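(* Let $\Gamma$ be a transitive Lie pseudogroup on a manifold $\mathbf{X}$ containing a Lie group $K$. For every $x_0\in\mathbf{X}$ there is a Lie groupoid isomorphism $$J^1\Gamma\cong(K\ltimes\mathbf{X})\times G,$$ where $G=(J^1\Gamma)_{x_0}$ is the isotropy group at $x_0$.
   Context: A pseudogroup $\Gamma$ on $\mathbf{X}$ is a set of smooth embeddings of open subsets of $\mathbf{X}$ into $\mathbf{X}$ containing $\mathrm{id}_{\mathbf{X}}$ and closed under composition (where defined), inversion, restriction to open subsets and gluing. It is transitive if for all $x,y$ there is $\varphi\in\Gamma$ with $\varphi(x)=y$. $J^k\Gamma$ is the set of $k$-jets $j^k_x\varphi$, $\varphi\in\Gamma$; $\Gamma$ is a Lie pseudogroup if each $J^k\Gamma\subset J^k(\mathbf{X},\mathbf{X})$ is an embedded submanifold and the projections $J^k\Gamma\to J^{k-1}\Gamma$ are surjective submersions. $J^k\Gamma\rightrightarrows\mathbf{X}$ is then a Lie groupoid with $s(j^k_x\varphi)=x$, $t(j^k_x\varphi)=\varphi(x)$ and multiplication induced by composition; its isotropy group at $x_0$ is $s^{-1}(x_0)\cap t^{-1}(x_0)$. For a Lie group $K$ acting (on the left) freely and transitively on $\mathbf{X}$, $\Gamma$ contains $K$ if for all $k\in K$ the diffeomorphism $T_k:\mathbf{X}\to\mathbf{X}$, $x\mapsto k\cdot x$ belongs to $\Gamma$. $(K\ltimes\mathbf{X})\times G\rightrightarrows\mathbf{X}$ denotes the Lie groupoid with arrow space $K\times\mathbf{X}\times G$, source $s(k,x,g)=x$,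 target $t(k,x,g)=k\cdot x$ and multiplication $(k_2,k_1\cdot x,g_2)\cdot(k_1,x,g_1)=(k_2k_1,x,g_2g_1)$. *)

theory Defs
  imports "HOL-Analysis.Analysis" "HOL-Algebra.Group" "HOL-Library.Multiset"
begin

section \<open>Smooth functions on coordinate spaces\<close>

text \<open>
  For a finite index set \<open>I\<close>, the coordinate space \<open>\<real>\<^sup>I\<close> consists of the real functions vanishing
  outside \<open>I\<close>, with the topology induced from the product topology on \<open>'i \<Rightarrow> real\<close>. Varying \<open>I\<close>
  inside one type allows the dimension to depend on terms, which is needed for jet spaces of all
  orders and for submanifolds.
\<close>

definition coord_space :: "'i set \<Rightarrow> ('i \<Rightarrow> real) set" where
  "coord_space I = {v. \<forall>i. i \<notin> I \<longrightarrow> v i = 0}"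

definition pd :: "'i \<Rightarrow> (('i \<Rightarrow> real) \<Rightarrow> real) \<Rightarrow> ('i \<Rightarrow> real) \<Rightarrow> real" where
  "pd i f = (\<lambda>x. deriv (\<lambda>t. f (x(i := t))) (x i))"

definition pds :: "'i list \<Rightarrow> (('i \<Rightarrow> real) \<Rightarrow> real) \<Rightarrow> ('i \<Rightarrow> real) \<Rightarrow> real" where
  "pds is f = foldr pd is f"

text \<open>
  \<open>C\<^sup>\<infinity>\<close> on \<open>U\<close>, meant for \<open>U\<close> open in \<open>\<real>\<^sup>I\<close>: all iterated partial derivatives in the directions
  from \<open>I\<close> exist and are continuous. The values of \<open>f\<close> off \<open>U\<close> are irrelevant, because
  \<open>x(i := t) \<in> U\<close> for \<open>t\<close> near \<open>x i\<close>.
\<close>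

definition C_infinity :: "'i set \<Rightarrow> ('i \<Rightarrow> real) set \<Rightarrow> (('i \<Rightarrow> real) \<Rightarrow> real) \<Rightarrow> bool" where
  "C_infinity I U f \<longleftrightarrow>
    (\<forall>is. set is \<subseteq> I \<longrightarrow>
      continuous_on U (pds is f) \<and>
      (\<forall>i\<in>I. \<forall>x\<in>U. (\<lambda>t. pds is f (x(i := t))) differentiable (at (x i))))"


section \<open>Smooth manifolds and smooth maps\<close>

text \<open>
  A manifold modelled on \<open>\<real>\<^sup>I\<close>, with \<open>I = idx M\<close>, is given by an atlas on its set of points; the
  topology is the one generated by the charts. A chart is a pair of its domain and a coordinate map.
\<close>

type_synonym ('a, 'i) chart = "'a set \<times> ('a \<Rightarrow> 'i \<Rightarrow> real)"

record ('a, 'i) mfd =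
  idx :: "'i set"
  atlas :: "('a, 'i) chart set"

definition pts :: "('a, 'i) mfd \<Rightarrow> 'a set" where
  "pts M = \<Union>(fst ` atlas M)"

definition mtop :: "('a, 'i) mfd \<Rightarrow> 'a topology" where
  "mtop M = topology_generated_by {{p \<in> C. \<phi> p \<in> W} |C \<phi> W. (C, \<phi>) \<in> atlas M \<and> open W}"

definition is_chart :: "'i set \<Rightarrow> ('a, 'i) chart \<Rightarrow> bool" where
  "is_chart I = (\<lambda>(C, \<phi>). inj_on \<phi> C \<and> openin (top_of_set (coord_space I)) (\<phi> ` C))"

definition smooth_transition :: "'i set \<Rightarrow> ('a, 'i) chart \<Rightarrow> ('a, 'i) chart \<Rightarrow> bool" where
  "smooth_transition I = (\<lambda>(C, \<phi>) (D, \<psi>).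
    openin (top_of_set (coord_space I)) (\<phi> ` (C \<inter> D)) \<and>
    (\<forall>j\<in>I. C_infinity I (\<phi> ` (C \<inter> D)) (\<lambda>u. \<psi> (inv_into C \<phi> u) j)))"

definition manifold :: "('a, 'i) mfd \<Rightarrow> bool" where
  "manifold M \<longleftrightarrow>
    finite (idx M) \<and>
    (\<forall>c\<in>atlas M. is_chart (idx M) c) \<and>
    (\<forall>c\<in>atlas M. \<forall>d\<in>atlas M. smooth_transition (idx M) c d) \<and>
    Hausdorff_space (mtop M) \<and> second_countable (mtop M)"

definition max_atlas :: "('a, 'i) mfd \<Rightarrow> ('a, 'i) chart set" where
  "max_atlas M = {c. fst c \<subseteq> pts M \<and> is_chart (idx M) c \<and>
    (\<forall>d\<in>atlas M. smooth_transition (idx M) c d \<and> smooth_transition (idx M) d c)}"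

definition smooth_map :: "('a, 'i) mfd \<Rightarrow> ('b, 'j) mfd \<Rightarrow> ('a \<Rightarrow> 'b) \<Rightarrow> bool" where
  "smooth_map M N f \<longleftrightarrow>
    continuous_map (mtop M) (mtop N) f \<and>
    (\<forall>(C, \<phi>)\<in>atlas M. \<forall>(D, \<psi>)\<in>atlas N. \<forall>j\<in>idx N.
      C_infinity (idx M) (\<phi> ` {p \<in> C. f p \<in> D}) (\<lambda>u. \<psi> (f (inv_into C \<phi> u)) j))"

definition diffeomorphism :: "('a, 'i) mfd \<Rightarrow> ('b, 'j) mfd \<Rightarrow> ('a \<Rightarrow> 'b) \<Rightarrow> bool" where
  "diffeomorphism M N f \<longleftrightarrow>
    bij_betw f (pts M) (pts N) \<and> smooth_map M N f \<and> smooth_map N M (inv_into (pts M) f)"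

text \<open>The differential at \<open>p\<close> in the given charts, as a map \<open>\<real>\<^sup>I \<rightarrow> \<real>\<^sup>J\<close>, with \<open>I = idx M\<close> and
  \<open>J = idx N\<close>.\<close>

definition dcoord ::
  "('a, 'i) mfd \<Rightarrow> ('b, 'j) mfd \<Rightarrow> ('a, 'i) chart \<Rightarrow> ('b, 'j) chart \<Rightarrow> ('a \<Rightarrow> 'b) \<Rightarrow> 'a
    \<Rightarrow> ('i \<Rightarrow> real) \<Rightarrow> 'j \<Rightarrow> real" where
  "dcoord M N = (\<lambda>(C, \<phi>) (D, \<psi>) f p v j.
    if j \<in> idx N
    then (\<Sum>i\<in>idx M. pd i (\<lambda>u. \<psi> (f (inv_into C \<phi> u)) j) (\<phi> p) * v i) else 0)"

definition immersion :: "('a, 'i) mfd \<Rightarrow> ('b, 'j) mfd \<Rightarrow> ('a \<Rightarrow> 'b) \<Rightarrow> bool" where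
  "immersion M N f \<longleftrightarrow> smooth_map M N f \<and>
    (\<forall>p\<in>pts M. \<forall>c\<in>atlas M. \<forall>d\<in>atlas N. p \<in> fst c \<and> f p \<in> fst d \<longrightarrow>
      inj_on (dcoord M N c d f p) (coord_space (idx M)))"

definition submersion :: "('a, 'i) mfd \<Rightarrow> ('b, 'j) mfd \<Rightarrow> ('a \<Rightarrow> 'b) \<Rightarrow> bool" where
  "submersion M N f \<longleftrightarrow> smooth_map M N f \<and>
    (\<forall>p\<in>pts M. \<forall>c\<in>atlas M. \<forall>d\<in>atlas N. p \<in> fst c \<and> f p \<in> fst d \<longrightarrow>
      dcoord M N c d f p ` coord_space (idx M) = coord_space (idx N))"

definition smooth_embedding :: "('a, 'i) mfd \<Rightarrow> ('b, 'j) mfd \<Rightarrow> ('a \<Rightarrow> 'b) \<Rightarrow> bool" where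
  "smooth_embedding M N f \<longleftrightarrow> immersion M N f \<and> embedding_map (mtop M) (mtop N) f"

definition open_submfd :: "('a, 'i) mfd \<Rightarrow> 'a set \<Rightarrow> ('a, 'i) mfd" where
  "open_submfd M U = \<lparr>idx = idx M, atlas = {(C \<inter> U, \<phi>) |C \<phi>. (C, \<phi>) \<in> atlas M}\<rparr>"

definition prod_mfd :: "('a, 'i) mfd \<Rightarrow> ('b, 'j) mfd \<Rightarrow> ('a \<times> 'b, 'i + 'j) mfd" where
  "prod_mfd M N = \<lparr>idx = idx M <+> idx N,
    atlas = {(C \<times> D, \<lambda>(p, q). case_sum (\<phi> p) (\<psi> q)) |C \<phi> D \<psi>.
      (C, \<phi>) \<in> atlas M \<and> (D, \<psi>) \<in> atlas N}\<rparr>"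

text \<open>
  Embedded submanifolds, by slice charts: near each of its points \<open>S\<close> is given by the vanishing of
  the coordinates outside \<open>J\<close>. As coordinates of charts in the maximal atlas may be permuted, one
  fixed \<open>J\<close>, whose cardinality is the dimension of \<open>S\<close>, serves all points.
\<close>

definition slice_chart :: "('a, 'i) mfd \<Rightarrow> 'a set \<Rightarrow> 'i set \<Rightarrow> ('a, 'i) chart \<Rightarrow> bool" where
  "slice_chart M S J = (\<lambda>(C, \<phi>). (C, \<phi>) \<in> max_atlas M \<and> \<phi> ` (C \<inter> S) = \<phi> ` C \<inter> coord_space J)"

definition has_slice_charts :: "('a, 'i) mfd \<Rightarrow> 'a set \<Rightarrow> 'i set \<Rightarrow> bool" where
  "has_slice_charts M S J \<longleftrightarrow> J \<subseteq> idx M \<and> (\<forall>p\<in>S. \<exists>c. slice_chart M S J c \<and> p \<in> fst c)"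

definition embedded_submanifold :: "('a, 'i) mfd \<Rightarrow> 'a set \<Rightarrow> bool" where
  "embedded_submanifold M S \<longleftrightarrow> S \<subseteq> pts M \<and> (\<exists>J. has_slice_charts M S J)"

text \<open>The manifold structure of an embedded submanifold \<open>S\<close>. Different choices of \<open>J\<close> yield the same
  manifold up to renaming of coordinates.\<close>

definition submfd :: "('a, 'i) mfd \<Rightarrow> 'a set \<Rightarrow> ('a, 'i) mfd" where
  "submfd M S = (let J = (SOME J. has_slice_charts M S J) in
    \<lparr>idx = J, atlas = {(C \<inter> S, \<phi>) |C \<phi>. slice_chart M S J (C, \<phi>)}\<rparr>)"


section \<open>Lie groups and actions\<close>

definition lie_group :: "('k, 'r) monoid_scheme \<Rightarrow> ('k, 'm) mfd \<Rightarrow> bool" where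
  "lie_group K KM \<longleftrightarrow>
    Group.group K \<and> manifold KM \<and> carrier K = pts KM \<and>
    smooth_map (prod_mfd KM KM) KM (\<lambda>(k, l). k \<otimes>\<^bsub>K\<^esub> l) \<and>
    smooth_map KM KM (\<lambda>k. inv\<^bsub>K\<^esub> k)"

definition smooth_action ::
  "('k, 'r) monoid_scheme \<Rightarrow> ('k, 'm) mfd \<Rightarrow> ('a, 'i) mfd \<Rightarrow> ('k \<Rightarrow> 'a \<Rightarrow> 'a) \<Rightarrow> bool" where
  "smooth_action K KM X act \<longleftrightarrow>
    smooth_map (prod_mfd KM X) X (\<lambda>(k, x). act k x) \<and>
    (\<forall>x\<in>pts X. act \<one>\<^bsub>K\<^esub> x = x) \<and>
    (\<forall>k\<in>carrier K. \<forall>l\<in>carrier K. \<forall>x\<in>pts X. act (k \<otimes>\<^bsub>K\<^esub> l) x = act k (act l x))"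

definition free_action ::
  "('k, 'r) monoid_scheme \<Rightarrow> ('a, 'i) mfd \<Rightarrow> ('k \<Rightarrow> 'a \<Rightarrow> 'a) \<Rightarrow> bool" where
  "free_action K X act \<longleftrightarrow> (\<forall>k\<in>carrier K. \<forall>x\<in>pts X. act k x = x \<longrightarrow> k = \<one>\<^bsub>K\<^esub>)"

definition transitive_action ::
  "('k, 'r) monoid_scheme \<Rightarrow> ('a, 'i) mfd \<Rightarrow> ('k \<Rightarrow> 'a \<Rightarrow> 'a) \<Rightarrow> bool" where
  "transitive_action K X act \<longleftrightarrow> (\<forall>x\<in>pts X. \<forall>y\<in>pts X. \<exists>k\<in>carrier K. act k x = y)"


section \<open>Jets\<close>

text \<open>Smooth maps from open subsets of \<open>X\<close> to \<open>X\<close>, as partial functions.\<close>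

definition local_smooth_maps :: "('a, 'i) mfd \<Rightarrow> ('a \<rightharpoonup> 'a) set" where
  "local_smooth_maps X =
    {f. openin (mtop X) (dom f) \<and> smooth_map (open_submfd X (dom f)) X (\<lambda>x. the (f x))}"

definition local_rep ::
  "('a, 'i) chart \<Rightarrow> ('a, 'i) chart \<Rightarrow> ('a \<rightharpoonup> 'a) \<Rightarrow> 'i \<Rightarrow> ('i \<Rightarrow> real) \<Rightarrow> real" where
  "local_rep c d f j = (\<lambda>u. snd d (the (f (inv_into (fst c) (snd c) u))) j)"

definition same_jet ::
  "('a, 'i) mfd \<Rightarrow> nat \<Rightarrow> 'a \<Rightarrow> ('a \<rightharpoonup> 'a) \<Rightarrow> ('a \<rightharpoonup> 'a) \<Rightarrow> bool" where
  "same_jet X k x f g \<longleftrightarrow> f x = g x \<and>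
    (\<forall>c\<in>atlas X. \<forall>d\<in>atlas X. x \<in> fst c \<and> the (f x) \<in> fst d \<longrightarrow>
      (\<forall>is. set is \<subseteq> idx X \<and> length is \<le> k \<longrightarrow>
        (\<forall>j\<in>idx X. pds is (local_rep c d f j) (snd c x) = pds is (local_rep c d g j) (snd c x))))"

text \<open>A jet is its source together with the class of all its representatives.\<close>

type_synonym 'a jet = "'a \<times> ('a \<rightharpoonup> 'a) set"

definition jet :: "('a, 'i) mfd \<Rightarrow> nat \<Rightarrow> 'a \<Rightarrow> ('a \<rightharpoonup> 'a) \<Rightarrow> 'a jet" where
  "jet X k x f = (x, {g \<in> local_smooth_maps X. x \<in> dom g \<and> same_jet X k x f g})"

definition jet_rep :: "'a jet \<Rightarrow> ('a \<rightharpoonup> 'a)" where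
  "jet_rep \<xi> = (SOME f. f \<in> snd \<xi>)"

definition jet_src :: "'a jet \<Rightarrow> 'a" where
  "jet_src \<xi> = fst \<xi>"

definition jet_tgt :: "'a jet \<Rightarrow> 'a" where
  "jet_tgt \<xi> = the (jet_rep \<xi> (jet_src \<xi>))"

definition jet_mult :: "('a, 'i) mfd \<Rightarrow> nat \<Rightarrow> 'a jet \<Rightarrow> 'a jet \<Rightarrow> 'a jet" where
  "jet_mult X k \<eta> \<xi> = jet X k (jet_src \<xi>) (jet_rep \<eta> \<circ>\<^sub>m jet_rep \<xi>)"

text \<open>The projection to \<open>k\<close>-jets from jets of higher order.\<close>

definition jet_proj :: "('a, 'i) mfd \<Rightarrow> nat \<Rightarrow> 'a jet \<Rightarrow> 'a jet" where
  "jet_proj X k \<xi> = jet X k (jet_src \<xi>) (jet_rep \<xi>)"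

text \<open>
  The manifold \<open>J\<^sup>k(X, X)\<close>. A jet of \<open>f\<close> at \<open>x\<close> has the coordinates \<open>x\<^sub>i\<close>, indexed by \<open>Inl i\<close>, and
  \<open>\<partial>\<^sup>\<alpha>f\<^sub>j(x)\<close>, indexed by \<open>Inr (\<alpha>, j)\<close>, for the multi-indices \<open>\<alpha>\<close> (multisets of coordinate indices)
  of size at most \<open>k\<close>; \<open>\<alpha> = {#}\<close> yields the coordinates of the target. By symmetry of
  iterated partial derivatives, the enumeration chosen for \<open>\<alpha>\<close> is immaterial.
\<close>

definition jet_fibre_idx :: "('a, 'i) mfd \<Rightarrow> nat \<Rightarrow> ('i multiset \<times> 'i) set" where
  "jet_fibre_idx X k = {\<alpha>. set_mset \<alpha> \<subseteq> idx X \<and> size \<alpha> \<le> k} \<times> idx X"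

definition jet_coord ::
  "('a, 'i) mfd \<Rightarrow> nat \<Rightarrow> ('a, 'i) chart \<Rightarrow> ('a, 'i) chart \<Rightarrow> 'a jet
    \<Rightarrow> 'i + ('i multiset \<times> 'i) \<Rightarrow> real" where
  "jet_coord X k c d \<xi> = case_sum
    (\<lambda>i. snd c (jet_src \<xi>) i)
    (\<lambda>(\<alpha>, j). if (\<alpha>, j) \<in> jet_fibre_idx X k
      then pds (SOME is. mset is = \<alpha>) (local_rep c d (jet_rep \<xi>) j) (snd c (jet_src \<xi>)) else 0)"

definition jets :: "('a, 'i) mfd \<Rightarrow> nat \<Rightarrow> ('a \<rightharpoonup> 'a) set \<Rightarrow> 'a jet set" where
  "jets X k \<Gamma> = {jet X k x f |x f. f \<in> \<Gamma> \<and> x \<in> dom f}"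

definition jet_mfd :: "('a, 'i) mfd \<Rightarrow> nat \<Rightarrow> ('a jet, 'i + ('i multiset \<times> 'i)) mfd" where
  "jet_mfd X k = \<lparr>idx = idx X <+> jet_fibre_idx X k,
    atlas = {({\<xi> \<in> jets X k (local_smooth_maps X). jet_src \<xi> \<in> fst c \<and> jet_tgt \<xi> \<in> fst d},
        jet_coord X k c d) |c d. c \<in> atlas X \<and> d \<in> atlas X}\<rparr>"


section \<open>Pseudogroups\<close>

definition map_inverse :: "('a \<rightharpoonup> 'b) \<Rightarrow> ('b \<rightharpoonup> 'a)" where
  "map_inverse f = (\<lambda>y. if y \<in> ran f then Some (SOME x. f x = Some y) else None)"

definition partial_id :: "('a, 'i) mfd \<Rightarrow> ('a \<rightharpoonup> 'a)" where
  "partial_id X = Some |` pts X"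

definition local_embeddings :: "('a, 'i) mfd \<Rightarrow> ('a \<rightharpoonup> 'a) set" where
  "local_embeddings X =
    {f. openin (mtop X) (dom f) \<and> smooth_embedding (open_submfd X (dom f)) X (\<lambda>x. the (f x))}"

definition pseudogroup :: "('a, 'i) mfd \<Rightarrow> ('a \<rightharpoonup> 'a) set \<Rightarrow> bool" where
  "pseudogroup X \<Gamma> \<longleftrightarrow>
    \<Gamma> \<subseteq> local_embeddings X \<and>
    partial_id X \<in> \<Gamma> \<and>
    (\<forall>f\<in>\<Gamma>. \<forall>g\<in>\<Gamma>. g \<circ>\<^sub>m f \<in> \<Gamma>) \<and>
    (\<forall>f\<in>\<Gamma>. map_inverse f \<in> \<Gamma>) \<and>
    (\<forall>f\<in>\<Gamma>. \<forall>U. openin (mtop X) U \<longrightarrow> f |` U \<in> \<Gamma>) \<and>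
    (\<forall>f\<in>local_embeddings X. \<forall>\<U>.
      (\<forall>U\<in>\<U>. openin (mtop X) U \<and> f |` U \<in> \<Gamma>) \<and> dom f = \<Union>\<U> \<longrightarrow> f \<in> \<Gamma>)"

definition transitive_pseudogroup :: "('a, 'i) mfd \<Rightarrow> ('a \<rightharpoonup> 'a) set \<Rightarrow> bool" where
  "transitive_pseudogroup X \<Gamma> \<longleftrightarrow> (\<forall>x\<in>pts X. \<forall>y\<in>pts X. \<exists>f\<in>\<Gamma>. f x = Some y)"

definition jets_mfd ::
  "('a, 'i) mfd \<Rightarrow> nat \<Rightarrow> ('a \<rightharpoonup> 'a) set \<Rightarrow> ('a jet, 'i + ('i multiset \<times> 'i)) mfd" where
  "jets_mfd X k \<Gamma> = submfd (jet_mfd X k) (jets X k \<Gamma>)"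

definition lie_pseudogroup :: "('a, 'i) mfd \<Rightarrow> ('a \<rightharpoonup> 'a) set \<Rightarrow> bool" where
  "lie_pseudogroup X \<Gamma> \<longleftrightarrow>
    pseudogroup X \<Gamma> \<and>
    (\<forall>k. embedded_submanifold (jet_mfd X k) (jets X k \<Gamma>)) \<and>
    (\<forall>k. jet_proj X k ` jets X (Suc k) \<Gamma> = jets X k \<Gamma> \<and>
         submersion (jets_mfd X (Suc k) \<Gamma>) (jets_mfd X k \<Gamma>) (jet_proj X k))"

definition contains_lie_group ::
  "('a, 'i) mfd \<Rightarrow> ('a \<rightharpoonup> 'a) set \<Rightarrow> ('k, 'r) monoid_scheme \<Rightarrow> ('k \<Rightarrow> 'a \<Rightarrow> 'a) \<Rightarrow> bool" where
  "contains_lie_group X \<Gamma> K act \<longleftrightarrow>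
    (\<forall>k\<in>carrier K. (\<lambda>x. if x \<in> pts X then Some (act k x) else None) \<in> \<Gamma>)"


section \<open>Lie groupoids\<close>

record ('o, 'i, 'a, 'j) gpd =
  objs :: "('o, 'i) mfd"
  arrows :: "('a, 'j) mfd"
  src :: "'a \<Rightarrow> 'o"
  tgt :: "'a \<Rightarrow> 'o"
  mul :: "'a \<Rightarrow> 'a \<Rightarrow> 'a"

definition composable :: "('o, 'i, 'a, 'j) gpd \<Rightarrow> ('a \<times> 'a) set" where
  "composable \<G> = {(b, a). b \<in> pts (arrows \<G>) \<and> a \<in> pts (arrows \<G>) \<and> src \<G> b = tgt \<G> a}"

text \<open>The set of composable pairs is a fibre product along submersions, hence automatically embedded;
  this is listed because it gives meaning to the smoothness of the multiplication.\<close>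

definition lie_groupoid :: "('o, 'i, 'a, 'j) gpd \<Rightarrow> bool" where
  "lie_groupoid \<G> \<longleftrightarrow>
    manifold (objs \<G>) \<and> manifold (arrows \<G>) \<and>
    submersion (arrows \<G>) (objs \<G>) (src \<G>) \<and>
    submersion (arrows \<G>) (objs \<G>) (tgt \<G>) \<and>
    embedded_submanifold (prod_mfd (arrows \<G>) (arrows \<G>)) (composable \<G>) \<and>
    smooth_map (submfd (prod_mfd (arrows \<G>) (arrows \<G>)) (composable \<G>)) (arrows \<G>)
      (\<lambda>(b, a). mul \<G> b a) \<and>
    (\<forall>(b, a)\<in>composable \<G>. src \<G> (mul \<G> b a) = src \<G> a \<and> tgt \<G> (mul \<G> b a) = tgt \<G> b) \<and>
    (\<forall>c b a. (c, b) \<in> composable \<G> \<and> (b, a) \<in> composable \<G> \<longrightarrow>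
      mul \<G> c (mul \<G> b a) = mul \<G> (mul \<G> c b) a) \<and>
    (\<exists>u i. smooth_map (objs \<G>) (arrows \<G>) u \<and> smooth_map (arrows \<G>) (arrows \<G>) i \<and>
      (\<forall>x\<in>pts (objs \<G>). src \<G> (u x) = x \<and> tgt \<G> (u x) = x) \<and>
      (\<forall>a\<in>pts (arrows \<G>).
        mul \<G> a (u (src \<G> a)) = a \<and> mul \<G> (u (tgt \<G> a)) a = a \<and>
        src \<G> (i a) = tgt \<G> a \<and> tgt \<G> (i a) = src \<G> a \<and>
        mul \<G> (i a) a = u (src \<G> a) \<and> mul \<G> a (i a) = u (tgt \<G> a)))"

definition lie_groupoid_iso ::
  "('o, 'i, 'a, 'j) gpd \<Rightarrow> ('p, 'k, 'b, 'l) gpd \<Rightarrow> ('a \<Rightarrow> 'b) \<Rightarrow> ('o \<Rightarrow> 'p) \<Rightarrow> bool" where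
  "lie_groupoid_iso \<G> \<H> F f \<longleftrightarrow>
    lie_groupoid \<G> \<and> lie_groupoid \<H> \<and>
    diffeomorphism (arrows \<G>) (arrows \<H>) F \<and>
    diffeomorphism (objs \<G>) (objs \<H>) f \<and>
    (\<forall>a\<in>pts (arrows \<G>). src \<H> (F a) = f (src \<G> a) \<and> tgt \<H> (F a) = f (tgt \<G> a)) \<and>
    (\<forall>(b, a)\<in>composable \<G>. F (mul \<G> b a) = mul \<H> (F b) (F a))"

definition isotropy :: "('o, 'i, 'a, 'j) gpd \<Rightarrow> 'o \<Rightarrow> 'a set" where
  "isotropy \<G> x = {a \<in> pts (arrows \<G>). src \<G> a = x \<and> tgt \<G> a = x}"

definition isotropy_group :: "('o, 'i, 'a, 'j) gpd \<Rightarrow> 'o \<Rightarrow> 'a monoid" where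
  "isotropy_group \<G> x = \<lparr>carrier = isotropy \<G> x, mult = mul \<G>,
    one = (THE e. e \<in> isotropy \<G> x \<and> (\<forall>a\<in>isotropy \<G> x. mul \<G> e a = a \<and> mul \<G> a e = a))\<rparr>"

definition isotropy_mfd :: "('o, 'i, 'a, 'j) gpd \<Rightarrow> 'o \<Rightarrow> ('a, 'j) mfd" where
  "isotropy_mfd \<G> x = submfd (arrows \<G>) (isotropy \<G> x)"

definition jet_groupoid ::
  "('a, 'i) mfd \<Rightarrow> nat \<Rightarrow> ('a \<rightharpoonup> 'a) set \<Rightarrow> ('a, 'i, 'a jet, 'i + ('i multiset \<times> 'i)) gpd" where
  "jet_groupoid X k \<Gamma> = \<lparr>objs = X, arrows = jets_mfd X k \<Gamma>,
    src = jet_src, tgt = jet_tgt, mul = jet_mult X k\<rparr>"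

text \<open>\<open>(K \<ltimes> X) \<times> G \<rightrightarrows> X\<close>, where \<open>KM\<close> and \<open>GM\<close> are the manifolds underlying the Lie groups \<open>K\<close> and \<open>G\<close>.\<close>

definition action_product_groupoid ::
  "('k, 'r) monoid_scheme \<Rightarrow> ('k, 'm) mfd \<Rightarrow> ('a, 'i) mfd \<Rightarrow> ('k \<Rightarrow> 'a \<Rightarrow> 'a)
    \<Rightarrow> ('g, 's) monoid_scheme \<Rightarrow> ('g, 'n) mfd
    \<Rightarrow> ('a, 'i, ('k \<times> 'a) \<times> 'g, ('m + 'i) + 'n) gpd" where
  "action_product_groupoid K KM X act G GM =
    \<lparr>objs = X, arrows = prod_mfd (prod_mfd KM X) GM,
     src = (\<lambda>((k, x), g). x), tgt = (\<lambda>((k, x), g). act k x),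
     mul = (\<lambda>((k2, x2), g2) ((k1, x1), g1). ((k2 \<otimes>\<^bsub>K\<^esub> k1, x1), g2 \<otimes>\<^bsub>G\<^esub> g1))\<rparr>"

end

theory Submission
  imports Defs
begin

text \<open>
  As \<open>K\<close> acts freely and transitively, the orbit map \<open>k \<mapsto> k \<cdot> x\<^sub>0\<close> is a smooth bijection; by
  homogeneity it has constant rank, so its inverse \<open>h : X \<rightarrow> K\<close> is smooth. The \<open>1\<close>-jets of the maps
  \<open>T\<^sub>k\<close> therefore trivialise \<open>J\<^sup>1\<Gamma>\<close>: a jet \<open>\<xi>\<close> from \<open>s\<close> to \<open>t\<close> corresponds to the element \<open>h(t) h(s)\<inverse>\<close>
  of \<open>K\<close>, the point \<open>s\<close>, and the element \<open>j(T\<^sub>h\<^sub>(\<^sub>t\<^sub>))\<inverse> \<xi> j(T\<^sub>h\<^sub>(\<^sub>s\<^sub>))\<close> of the isotropy group at \<open>x\<^sub>0\<close>.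
  The same sections \<open>j(T\<^sub>k)\<close> show that the source, the target and the composability condition are
  submersive, so that all the submanifolds involved are regular level sets.
\<close>

section \<open>Calculus on coordinate spaces\<close>

text \<open>The dimension of a manifold is the size of an index set given by a term, so calculus is
  done in coordinates, with partial derivatives and a chain rule along curves; a tangent vector
  appears only as a curve differentiable at one instant. The one inverse function theorem in use
  alters a single coordinate. It rests on the mean value and intermediate value theorems, and its
  iteration yields every chart that has to be constructed. Smoothness of \<open>h\<close> is the
  hard point. Equality of the dimensions of \<open>K\<close> and \<open>X\<close> is not assumed,
  and second countability is essential: the additive reals with the discrete topology act smoothly,
  freely and transitively on the line. Sections defined on the whole base replace tangent spaces: a
  smooth section through a point supplies a right inverse of the differential, which proves
  submersivity and produces the coordinates whose vanishing describes a level set. For jets of order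
  1, the derivatives of a product are bilinear in those of the factors, and inverses are governed by
  Cramer's rule.\<close>

abbreviation copen :: "'i set \<Rightarrow> ('i \<Rightarrow> real) set \<Rightarrow> bool" where
  "copen I U \<equiv> openin (top_of_set (coord_space I)) U"

lemma coord_space_upd: "x \<in> coord_space I \<Longrightarrow> i \<in> I \<Longrightarrow> x(i := t) \<in> coord_space I"
  by (auto simp: coord_space_def)

lemma coord_space_eqI:
  assumes "x \<in> coord_space I" "y \<in> coord_space I" "\<And>i. i \<in> I \<Longrightarrow> x i = y i"
  shows "x = y"
proof
  fix i show "x i = y i" using assms by (cases "i \<in> I") (auto simp: coord_space_def)
qed

lemma copen_subset: "copen I U \<Longrightarrow> U \<subseteq> coord_space I"
  using openin_subset by fastforce

text \<open>Coordinates outside \<open>I\<close> do not move at all, so of the factors of a basic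
  product neighbourhood only the finitely many indexed by \<open>I\<close> limit the radius.\<close>

lemma open_contains_box:
  fixes T :: "('i \<Rightarrow> real) set"
  assumes T: "open T" "x \<in> T" and I: "finite I"
  obtains e where "e > 0"
    "\<And>y. (\<And>i. i \<in> I \<Longrightarrow> \<bar>y i - x i\<bar> < e) \<Longrightarrow> (\<And>i. i \<notin> I \<Longrightarrow> y i = x i) \<Longrightarrow> y \<in> T"
proof -
  have "openin (product_topology (\<lambda>i. euclidean) UNIV) T"
    using T(1) by (simp add: open_fun_def)
  from product_topology_open_contains_basis[OF this T(2)]
  obtain X where X: "x \<in> (\<Pi>\<^sub>E i\<in>UNIV. X i)" "\<And>i. open (X i)" "(\<Pi>\<^sub>E i\<in>UNIV. X i) \<subseteq> T"
    by auto
  have "\<exists>e>0. \<forall>s. \<bar>s - x i\<bar> < e \<longrightarrow> s \<in> X i" for i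
    using X(1,2) by (metis PiE_mem UNIV_I open_real)
  then obtain e where e: "\<And>i. e i > 0" "\<And>i s. \<bar>s - x i\<bar> < e i \<Longrightarrow> s \<in> X i"
    by metis
  \<comment> \<open>The extra \<open>1\<close> keeps the minimum defined and positive when
    \<open>I\<close> is empty.\<close>
  define d where "d = Min (insert 1 (e ` I))"
  have d: "d > 0" "\<And>i. i \<in> I \<Longrightarrow> d \<le> e i"
    using I e(1) by (auto simp: d_def)
  show thesis
  proof (rule that[OF d(1)])
    fix y assume y: "\<And>i. i \<in> I \<Longrightarrow> \<bar>y i - x i\<bar> < d" "\<And>i. i \<notin> I \<Longrightarrow> y i = x i"
    have "y i \<in> X i" for i
      by (rule e(2), cases "i \<in> I") (use y d e(1) in \<open>auto intro: less_le_trans\<close>)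
    then show "y \<in> T" using X(3) by auto
  qed
qed

lemma copen_box:
  assumes "copen I U" "x \<in> U" "finite I"
  obtains e where "e > 0"
    "\<And>y. y \<in> coord_space I \<Longrightarrow> (\<And>i. i \<in> I \<Longrightarrow> \<bar>y i - x i\<bar> < e) \<Longrightarrow> y \<in> U"
proof -
  obtain T where T: "open T" "U = coord_space I \<inter> T"
    using assms(1) by (auto simp: openin_open)
  from T assms(2) have "x \<in> T" by auto
  from open_contains_box[OF T(1) this assms(3)] obtain e where e: "e > 0"
    "\<And>y. (\<And>i. i \<in> I \<Longrightarrow> \<bar>y i - x i\<bar> < e) \<Longrightarrow> (\<And>i. i \<notin> I \<Longrightarrow> y i = x i) \<Longrightarrow> y \<in> T"
    by blast
  show thesis
  proof (rule that[OF e(1)])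
    fix y assume y: "y \<in> coord_space I" "\<And>i. i \<in> I \<Longrightarrow> \<bar>y i - x i\<bar> < e"
    have "y \<in> T"
      by (rule e(2)) (use y assms(2) T(2) in \<open>auto simp: coord_space_def\<close>)
    then show "y \<in> U" using T(2) y by auto
  qed
qed

lemma open_box:
  assumes "finite I" shows "open {y :: 'i \<Rightarrow> real. \<forall>i\<in>I. \<bar>y i - x i\<bar> < e}"
proof -
  have "{y :: 'i \<Rightarrow> real. \<forall>i\<in>I. \<bar>y i - x i\<bar> < e} = (\<Inter>i\<in>I. {y. \<bar>y i - x i\<bar> < e})"
    by auto
  moreover have "open {y :: 'i \<Rightarrow> real. \<bar>y i - x i\<bar> < e}" for i
    by (intro open_Collect_less continuous_intros continuous_on_product_coordinates)
  ultimately show ?thesis using assms by auto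
qed

lemma copenI:
  assumes I: "finite I" and U: "U \<subseteq> coord_space I"
    and e: "\<And>x. x \<in> U \<Longrightarrow> \<exists>e>0. \<forall>y\<in>coord_space I. (\<forall>i\<in>I. \<bar>y i - x i\<bar> < e) \<longrightarrow> y \<in> U"
  shows "copen I U"
proof (subst openin_subopen, intro ballI)
  fix x assume x: "x \<in> U"
  from e[OF x] obtain e where e: "e > 0" "\<forall>y\<in>coord_space I. (\<forall>i\<in>I. \<bar>y i - x i\<bar> < e) \<longrightarrow> y \<in> U"
    by blast
  have "copen I (coord_space I \<inter> {y. \<forall>i\<in>I. \<bar>y i - x i\<bar> < e})"
    using open_box[OF I] by (rule openin_open_Int)
  then show "\<exists>T. copen I T \<and> x \<in> T \<and> T \<subseteq> U"
    using e x U by (intro exI[of _ "coord_space I \<inter> {y. \<forall>i\<in>I. \<bar>y i - x i\<bar> < e}"]) auto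
qed

lemma copen_upd_ev:
  assumes "copen I U" "x \<in> U" "i \<in> I" "finite I"
  shows "\<forall>\<^sub>F t in nhds (x i). x(i := t) \<in> U"
proof -
  obtain e where e: "e > 0"
    "\<And>y. y \<in> coord_space I \<Longrightarrow> (\<And>i. i \<in> I \<Longrightarrow> \<bar>y i - x i\<bar> < e) \<Longrightarrow> y \<in> U"
    using copen_box[OF assms(1,2,4)] by blast
  have "x \<in> coord_space I" using assms copen_subset by blast
  then have "\<bar>t - x i\<bar> < e \<Longrightarrow> x(i := t) \<in> U" for t
    using e assms(3) by (intro e(2)) (auto intro: coord_space_upd)
  then show ?thesis
    using e(1) by (auto simp: eventually_nhds_metric dist_real_def)
qed

lemma continuous_on_box:
  fixes f :: "('i \<Rightarrow> real) \<Rightarrow> real"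
  assumes f: "continuous_on U f" and U: "copen I U" "finite I" and x: "x \<in> U" and d: "d > 0"
  obtains e where "e > 0"
    "\<And>y. y \<in> coord_space I \<Longrightarrow> (\<And>i. i \<in> I \<Longrightarrow> \<bar>y i - x i\<bar> < e) \<Longrightarrow> y \<in> U \<and> \<bar>f y - f x\<bar> < d"
proof -
  have "openin (top_of_set U) (U \<inter> f -` {s. \<bar>s - f x\<bar> < d})"
    using f by (rule continuous_openin_preimage_gen) (intro open_Collect_less continuous_intros)
  then have "copen I (U \<inter> f -` {s. \<bar>s - f x\<bar> < d})"
    using U(1) openin_trans by blast
  from copen_box[OF this _ U(2), of x] show thesis using x d that by auto
qed

lemma continuous_on_boxI:
  fixes f :: "('i \<Rightarrow> real) \<Rightarrow> real"
  assumes I: "finite I" and U: "U \<subseteq> coord_space I"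
    and *: "\<And>x d. x \<in> U \<Longrightarrow> d > 0 \<Longrightarrow> \<exists>e>0. \<forall>y\<in>U. (\<forall>i\<in>I. \<bar>y i - x i\<bar> < e) \<longrightarrow> \<bar>f y - f x\<bar> < d"
  shows "continuous_on U f"
  unfolding continuous_on_topological
proof (intro ballI allI impI)
  fix x B assume x: "x \<in> U" and B: "open B" "f x \<in> B"
  obtain d where d: "d > 0" "\<And>s. \<bar>s - f x\<bar> < d \<Longrightarrow> s \<in> B"
    using B by (metis open_real)
  from *[OF x d(1)] obtain e where e: "e > 0" "\<forall>y\<in>U. (\<forall>i\<in>I. \<bar>y i - x i\<bar> < e) \<longrightarrow> \<bar>f y - f x\<bar> < d"
    by blast
  show "\<exists>A. open A \<and> x \<in> A \<and> (\<forall>y\<in>U. y \<in> A \<longrightarrow> f y \<in> B)"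
    by (rule exI[of _ "{y. \<forall>i\<in>I. \<bar>y i - x i\<bar> < e}"])
      (use e d open_box[OF I] in auto)
qed

text \<open>Components at indices outside \<open>I\<close> are constantly zero, so continuity into
  the product topology has to be checked on \<open>I\<close> only.\<close>

lemma continuous_on_coordI:
  fixes f :: "'x::topological_space \<Rightarrow> 'i \<Rightarrow> real"
  assumes "\<And>x. x \<in> S \<Longrightarrow> f x \<in> coord_space I" "\<And>i. i \<in> I \<Longrightarrow> continuous_on S (\<lambda>x. f x i)"
  shows "continuous_on S f"
proof (rule continuous_on_coordinatewise_then_product)
  fix i show "continuous_on S (\<lambda>x. f x i)"
  proof (cases "i \<in> I")
    case False
    then have "continuous_on S (\<lambda>x. f x i) = continuous_on S (\<lambda>x. 0::real)"
      using assms(1) by (intro continuous_on_cong) (auto simp: coord_space_def)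
    then show ?thesis by simp
  qed (use assms in auto)
qed

section \<open>Classes of finitely often differentiable functions\<close>

definition pdiff :: "'i \<Rightarrow> (('i \<Rightarrow> real) \<Rightarrow> real) \<Rightarrow> ('i \<Rightarrow> real) \<Rightarrow> bool" where
  "pdiff i f x \<longleftrightarrow> (\<lambda>t. f (x(i := t))) differentiable (at (x i))"

lemma pdiff_DERIV:
  "pdiff i f x \<Longrightarrow> ((\<lambda>t. f (x(i := t))) has_real_derivative pd i f x) (at (x i))"
  by (simp add: pdiff_def pd_def DERIV_deriv_iff_real_differentiable)

lemma pdiff_DERIV':
  "pdiff i f (x(i := s)) \<Longrightarrow> ((\<lambda>t. f (x(i := t))) has_real_derivative pd i f (x(i := s))) (at s)"
  using pdiff_DERIV[of i f "x(i := s)"] by simp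

lemma pdI:
  assumes "((\<lambda>t. f (x(i := t))) has_real_derivative D) (at (x i))"
  shows "pdiff i f x" "pd i f x = D"
  using assms by (auto simp: pdiff_def pd_def DERIV_imp_deriv real_differentiable_def)

text \<open>A partial derivative sees only the values on a short segment of a coordinate line, and
  this segment stays in \<open>U\<close> because \<open>U\<close> is relatively open and
  \<open>i\<close> belongs to \<open>I\<close>.\<close>

lemma pd_cong_open:
  assumes eq: "\<And>x. x \<in> U \<Longrightarrow> f x = g x" and U: "copen I U" "finite I" "i \<in> I" "x \<in> U"
  shows "pd i f x = pd i g x" "pdiff i f x \<longleftrightarrow> pdiff i g x"
proof -
  have ev: "\<forall>\<^sub>F t in nhds (x i). f (x(i := t)) = g (x(i := t))"
    using copen_upd_ev[OF U(1) U(4) U(3) U(2)] by eventually_elim (use eq in auto)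
  show "pd i f x = pd i g x"
    unfolding pd_def using ev by (rule deriv_cong_ev) simp
  show "pdiff i f x \<longleftrightarrow> pdiff i g x"
    unfolding pdiff_def real_differentiable_def
    using DERIV_cong_ev[OF refl ev refl] by simp
qed

text \<open>\<open>C_infinity\<close> speaks about all lists of directions at once and offers
  nothing to induct on. These classes peel off the innermost derivative, so that each rule of
  calculus becomes an induction on the order.\<close>

primrec Ck :: "nat \<Rightarrow> 'i set \<Rightarrow> ('i \<Rightarrow> real) set \<Rightarrow> (('i \<Rightarrow> real) \<Rightarrow> real) \<Rightarrow> bool" where
  "Ck 0 I U f \<longleftrightarrow> continuous_on U f"
| "Ck (Suc n) I U f \<longleftrightarrow> continuous_on U f \<and> (\<forall>i\<in>I. (\<forall>x\<in>U. pdiff i f x) \<and> Ck n I U (pd i f))"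

lemma pds_snoc: "pds (is @ [i]) f = pds is (pd i f)"
  by (simp add: pds_def)

text \<open>\<open>pds\<close> folds from the right: the last direction of a list differentiates
  first. Splitting a list at its end therefore follows the recursion of \<open>Ck\<close>.\<close>

lemma C_infinity_Ck: "C_infinity I U f \<longleftrightarrow> (\<forall>n. Ck n I U f)"
proof
  have "\<And>f. C_infinity I U f \<Longrightarrow> Ck n I U f" for n
  proof (induction n)
    case 0 then show ?case by (auto simp: C_infinity_def pds_def dest!: spec[of _ "[]"])
  next
    case (Suc n)
    have "continuous_on U f \<and> (\<forall>i\<in>I. \<forall>x\<in>U. pdiff i f x)"
      using Suc.prems by (auto simp: C_infinity_def pds_def pdiff_def dest!: spec[of _ "[]"])
    moreover have "C_infinity I U (pd i f)" if "i \<in> I" for i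
      unfolding C_infinity_def
    proof (intro allI impI)
      fix "is" assume "set is \<subseteq> I"
      then show "continuous_on U (pds is (pd i f)) \<and>
        (\<forall>j\<in>I. \<forall>x\<in>U. (\<lambda>t. pds is (pd i f) (x(j := t))) differentiable at (x j))"
        using Suc.prems that unfolding C_infinity_def pds_snoc[symmetric]
        by (metis Un_subset_iff empty_subsetI insert_subset list.set(1) list.simps(15) set_append)
    qed
    ultimately show ?case using Suc.IH by auto
  qed
  then show "C_infinity I U f \<Longrightarrow> \<forall>n. Ck n I U f" by blast
next
  assume Ck: "\<forall>n. Ck n I U f"
  \<comment> \<open>One order beyond the length, since the iterated derivative has to be
    differentiable once more.\<close>
  have "\<And>f. Ck (length is + 1) I U f \<Longrightarrow> set is \<subseteq> I \<Longrightarrow>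
    continuous_on U (pds is f) \<and> (\<forall>i\<in>I. \<forall>x\<in>U. pdiff i (pds is f) x)" for "is"
  proof (induction "is" rule: rev_induct)
    case Nil then show ?case by (simp add: pds_def)
  next
    case (snoc i "is") then show ?case by (simp add: pds_snoc)
  qed
  then show "C_infinity I U f"
    using Ck unfolding C_infinity_def pdiff_def by blast
qed

lemma Ck_Suc_D: "Ck (Suc n) I U f \<Longrightarrow> Ck n I U f"
proof (induction n arbitrary: f)
  case (Suc n) then show ?case by (metis Ck.simps(2))
qed simp

lemma Ck_continuous: "Ck n I U f \<Longrightarrow> continuous_on U f"
  by (cases n) auto

lemma Ck_subset: "Ck n I U f \<Longrightarrow> V \<subseteq> U \<Longrightarrow> J \<subseteq> I \<Longrightarrow> Ck n J V f"
proof (induction n arbitrary: f)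
  case 0 then show ?case by (auto intro: continuous_on_subset)
next
  case (Suc n) then show ?case by simp (metis continuous_on_subset subset_iff)
qed

lemma Ck_cong:
  assumes "Ck n I U f" "\<And>x. x \<in> U \<Longrightarrow> f x = g x" "copen I U" "finite I"
  shows "Ck n I U g"
  using assms(1,2)
proof (induction n arbitrary: f g)
  case 0 then show ?case by (simp cong: continuous_on_cong)
next
  case (Suc n)
  have "continuous_on U g" using Suc.prems by (simp cong: continuous_on_cong)
  moreover have "pdiff i g x" if "i \<in> I" "x \<in> U" for i x
    using pd_cong_open(2)[where f = f and g = g, OF Suc.prems(2) assms(3,4) that] Suc.prems(1) that by auto
  moreover have "Ck n I U (pd i g)" if "i \<in> I" for i
  proof (rule Suc.IH)
    show "Ck n I U (pd i f)" using Suc.prems(1) that by simp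
    show "pd i f x = pd i g x" if "x \<in> U" for x
      by (rule pd_cong_open(1)[OF Suc.prems(2) assms(3,4) \<open>i \<in> I\<close> that])
  qed
  ultimately show ?case by auto
qed

text \<open>The derivative is presented by a formula \<open>f'\<close>, on which induction
  hypotheses can act, rather than by \<open>pd\<close>.\<close>

lemma Ck_SucI:
  assumes "continuous_on U f" "copen I U" "finite I"
    and "\<And>i x. i \<in> I \<Longrightarrow> x \<in> U \<Longrightarrow> ((\<lambda>t. f (x(i := t))) has_real_derivative f' i x) (at (x i))"
    and "\<And>i. i \<in> I \<Longrightarrow> Ck n I U (f' i)"
  shows "Ck (Suc n) I U f"
proof -
  have "pdiff i f x" "pd i f x = f' i x" if "i \<in> I" "x \<in> U" for i x
    using pdI[OF assms(4)[OF that]] by auto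
  then show ?thesis
    using assms(1) Ck_cong[OF assms(5) _ assms(2,3)] by (metis (no_types, lifting) Ck.simps(2))
qed

lemma Ck_local:
  assumes "\<And>x. x \<in> U \<Longrightarrow> \<exists>V. copen I V \<and> x \<in> V \<and> Ck n I V f" "copen I U" "finite I"
  shows "Ck n I U f"
  using assms(1)
proof (induction n arbitrary: f)
  case 0
  show ?case unfolding Ck.simps
  proof (rule continuous_on_boxI[OF assms(3) copen_subset[OF assms(2)]])
    fix x and d::real assume x: "x \<in> U" "d > 0"
    with 0 obtain V where V: "copen I V" "x \<in> V" "continuous_on V f" by auto
    show "\<exists>e>0. \<forall>y\<in>U. (\<forall>i\<in>I. \<bar>y i - x i\<bar> < e) \<longrightarrow> \<bar>f y - f x\<bar> < d"
      by (rule continuous_on_box[OF V(3,1) assms(3) V(2) x(2)])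
        (use copen_subset[OF assms(2)] in blast)
  qed
next
  case (Suc n)
  have "continuous_on U f"
  proof (rule continuous_on_boxI[OF assms(3) copen_subset[OF assms(2)]])
    fix x and d::real assume x: "x \<in> U" "d > 0"
    obtain V where V: "copen I V" "x \<in> V" "continuous_on V f"
      using Suc.prems[OF x(1)] by auto
    show "\<exists>e>0. \<forall>y\<in>U. (\<forall>i\<in>I. \<bar>y i - x i\<bar> < e) \<longrightarrow> \<bar>f y - f x\<bar> < d"
      by (rule continuous_on_box[OF V(3,1) assms(3) V(2) x(2)])
        (use copen_subset[OF assms(2)] in blast)
  qed
  moreover have "Ck n I U (pd i f)" if "i \<in> I" for i
    using Suc.prems that by (intro Suc.IH) (meson Ck.simps(2))
  moreover have "pdiff i f x" if "i \<in> I" "x \<in> U" for i x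
    using Suc.prems[OF that(2)] that(1) by auto
  ultimately show ?case by simp
qed

lemma Ck_const: "finite I \<Longrightarrow> copen I U \<Longrightarrow> Ck n I U (\<lambda>x. c)"
proof (induction n arbitrary: c)
  case (Suc n)
  show ?case by (rule Ck_SucI[where f' = "\<lambda>_ _. 0"]) (use Suc in auto)
qed simp

lemma Ck_coord:
  assumes "finite I" "copen I U" shows "Ck n I U (\<lambda>x. x i)"
proof (cases n)
  case 0 then show ?thesis
    by (auto intro: continuous_on_subset[OF continuous_on_product_coordinates])
next
  case (Suc m)
  show ?thesis unfolding Suc
  proof (rule Ck_SucI[where f' = "\<lambda>j _. if i = j then 1 else 0"])
    show "continuous_on U (\<lambda>x. x i)"
      by (auto intro: continuous_on_subset[OF continuous_on_product_coordinates])
  qed (use assms in \<open>auto intro!: Ck_const\<close>)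
qed

lemma Ck_add:
  assumes "Ck n I U f" "Ck n I U g" "finite I" "copen I U"
  shows "Ck n I U (\<lambda>x. f x + g x)"
  using assms(1,2)
proof (induction n arbitrary: f g)
  case 0 then show ?case by (auto intro: continuous_intros)
next
  case (Suc n)
  show ?case
  proof (rule Ck_SucI[where f' = "\<lambda>i x. pd i f x + pd i g x"])
    show "((\<lambda>t. f (x(i := t)) + g (x(i := t))) has_real_derivative pd i f x + pd i g x) (at (x i))"
      if "i \<in> I" "x \<in> U" for i x
      using DERIV_add[OF pdiff_DERIV[of i f x] pdiff_DERIV[of i g x]] Suc.prems that by simp
  qed (use Suc assms in \<open>auto intro!: continuous_intros\<close>)
qed

lemma Ck_mult:
  assumes "Ck n I U f" "Ck n I U g" "finite I" "copen I U"
  shows "Ck n I U (\<lambda>x. f x * g x)"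
  using assms(1,2)
proof (induction n arbitrary: f g)
  case 0 then show ?case by (auto intro: continuous_intros)
next
  case (Suc n)
  show ?case
  proof (rule Ck_SucI[where f' = "\<lambda>i x. pd i f x * g x + pd i g x * f x"])
    show "continuous_on U (\<lambda>x. f x * g x)" using Suc.prems by (auto intro: continuous_intros)
    show "((\<lambda>t. f (x(i := t)) * g (x(i := t))) has_real_derivative
        pd i f x * g x + pd i g x * f x) (at (x i))" if "i \<in> I" "x \<in> U" for i x
      using DERIV_mult[OF pdiff_DERIV[of i f x] pdiff_DERIV[of i g x]] Suc.prems that by simp
    show "Ck n I U (\<lambda>x. pd i f x * g x + pd i g x * f x)" if "i \<in> I" for i
      using Suc.prems that Ck_Suc_D[OF Suc.prems(1)] Ck_Suc_D[OF Suc.prems(2)]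
      by (intro Ck_add assms(3,4) Suc.IH) auto
  qed (use assms in auto)
qed

lemma Ck_sum:
  assumes "\<And>j. j \<in> J \<Longrightarrow> Ck n I U (f j)" "finite I" "copen I U"
  shows "Ck n I U (\<lambda>x. \<Sum>j\<in>J. f j x)"
  using assms(1)
proof (induction J rule: infinite_finite_induct)
  case (insert j J)
  have "Ck n I U (\<lambda>x. f j x + (\<Sum>j\<in>J. f j x))"
    by (rule Ck_add) (use insert assms in auto)
  then show ?case using insert by simp
qed (use assms in \<open>auto intro: Ck_const\<close>)

lemma Ck_inverse:
  assumes "Ck n I U f" "finite I" "copen I U" "\<And>x. x \<in> U \<Longrightarrow> f x \<noteq> 0"
  shows "Ck n I U (\<lambda>x. inverse (f x))"
  using assms(1)
proof (induction n)
  case 0 then show ?case using assms(4) by (auto intro: continuous_intros)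
next
  case (Suc n)
  show ?case
  proof (rule Ck_SucI[where f' = "\<lambda>i x. (-1) * (pd i f x * (inverse (f x) * inverse (f x)))"])
    show "continuous_on U (\<lambda>x. inverse (f x))"
      using Suc.prems assms(4) by (auto intro: continuous_intros)
    show "((\<lambda>t. inverse (f (x(i := t)))) has_real_derivative
        (-1) * (pd i f x * (inverse (f x) * inverse (f x)))) (at (x i))" if "i \<in> I" "x \<in> U" for i x
      using DERIV_inverse_fun[OF pdiff_DERIV[of i f x]] Suc.prems that assms(4) by simp
    show "Ck n I U (\<lambda>x. (-1) * (pd i f x * (inverse (f x) * inverse (f x))))" if "i \<in> I" for i
      using Suc.prems that Ck_Suc_D[OF Suc.prems]
      by (intro Ck_mult Ck_const assms(2,3) Suc.IH) auto
  qed (use assms in auto)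
qed

section \<open>Chain rule and composition\<close>

lemma mvt_between:
  fixes f :: "real \<Rightarrow> real"
  assumes ne: "a \<noteq> b" and f: "\<And>s. min a b \<le> s \<Longrightarrow> s \<le> max a b \<Longrightarrow> (f has_real_derivative f' s) (at s)"
  obtains z where "min a b \<le> z" "z \<le> max a b" "f b - f a = (b - a) * f' z"
proof (cases "a < b")
  case True
  obtain z where "a < z" "z < b" "f b - f a = (b - a) * f' z"
    using MVT2[OF True, of f f'] f True by auto
  then show ?thesis using that[of z] by auto
next
  case False
  then have "b < a" using ne by auto
  obtain z where z: "b < z" "z < a" "f a - f b = (a - b) * f' z"
    using MVT2[OF \<open>b < a\<close>, of f f'] f \<open>b < a\<close> by auto
  then have "f b - f a = (b - a) * f' z" by (simp add: algebra_simps)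
  then show ?thesis using that[of z] z by auto
qed

text \<open>With continuous partial derivatives alone, the passage from \<open>\<gamma> t0\<close>
  to \<open>\<gamma> t\<close> is made one coordinate at a time: \<open>z A t\<close> has already
  moved the coordinates in \<open>A\<close>. A single move is evaluated by the mean value theorem,
  and continuity of \<open>pd j g\<close> at \<open>\<gamma> t0\<close> removes the intermediate
  point in the limit.\<close>

lemma chain_curve:
  fixes \<gamma> :: "real \<Rightarrow> 'j \<Rightarrow> real"
  assumes J: "finite J" and V: "copen J V"
    and g: "\<And>j x. j \<in> J \<Longrightarrow> x \<in> V \<Longrightarrow> pdiff j g x" "\<And>j. j \<in> J \<Longrightarrow> continuous_on V (pd j g)"
    and \<gamma>V: "\<gamma> t0 \<in> V" "\<forall>\<^sub>F t in nhds t0. \<gamma> t \<in> coord_space J"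
    and \<gamma>: "\<And>j. j \<in> J \<Longrightarrow> ((\<lambda>t. \<gamma> t j) has_real_derivative \<gamma>' j) (at t0)"
  shows "((\<lambda>t. g (\<gamma> t)) has_real_derivative (\<Sum>j\<in>J. pd j g (\<gamma> t0) * \<gamma>' j)) (at t0)"
proof -
  define z where "z = (\<lambda>A t j. if j \<in> A then \<gamma> t j else \<gamma> t0 j)"
  have p: "\<gamma> t0 \<in> coord_space J" using \<gamma>V(1) copen_subset[OF V] by auto
  have z0: "z A t0 = \<gamma> t0" for A by (auto simp: z_def)
  have "((\<lambda>t. g (z A t)) has_real_derivative (\<Sum>j\<in>A. pd j g (\<gamma> t0) * \<gamma>' j)) (at t0)" if "A \<subseteq> J" for A
    using finite_subset[OF that J] that
  proof (induction A)
    case empty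
    have "z {} t = \<gamma> t0" for t by (auto simp: z_def)
    then show ?case by simp
  next
    case (insert j A)
    then have j: "j \<in> J" and AJ: "A \<subseteq> J" by auto
    \<comment> \<open>A slope in the sense of Caratheodory: the value chosen when coordinate
      \<open>j\<close> stands still makes the increment equal to \<open>q t\<close> times the
      increment of that coordinate for every \<open>t\<close>, so no vanishing denominator has to be
      excluded.\<close>
    define q where "q = (\<lambda>t. if \<gamma> t j = \<gamma> t0 j then pd j g (\<gamma> t0)
      else (g (z (insert j A) t) - g (z A t)) / (\<gamma> t j - \<gamma> t0 j))"
    have zz: "z (insert j A) t = (z A t)(j := \<gamma> t j)" "z A t = (z A t)(j := \<gamma> t0 j)" for t
      using insert.hyps(2) by (auto simp: z_def)
    have D: "g (z (insert j A) t) - g (z A t) = q t * (\<gamma> t j - \<gamma> t0 j)" for t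
    proof (cases "\<gamma> t j = \<gamma> t0 j")
      case True
      then have "z (insert j A) t = z A t" using zz by metis
      then show ?thesis using True by simp
    qed (simp add: q_def)
    have q0: "q t0 = pd j g (\<gamma> t0)" by (simp add: q_def)
    have "q \<midarrow>t0\<rightarrow> q t0"
      unfolding q0 tendsto_iff
    proof (intro allI impI)
      fix \<epsilon> :: real assume \<epsilon>: "\<epsilon> > 0"
      obtain d where d: "d > 0" "\<And>y. y \<in> coord_space J \<Longrightarrow> (\<And>i. i \<in> J \<Longrightarrow> \<bar>y i - \<gamma> t0 i\<bar> < d)
          \<Longrightarrow> y \<in> V \<and> \<bar>pd j g y - pd j g (\<gamma> t0)\<bar> < \<epsilon>"
        using continuous_on_box[OF g(2)[OF j] V J \<gamma>V(1) \<epsilon>] by metis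
      have "\<forall>\<^sub>F t in at t0. \<forall>i\<in>J. \<bar>\<gamma> t i - \<gamma> t0 i\<bar> < d"
      proof (rule eventually_ball_finite[OF J], intro ballI)
        fix i assume "i \<in> J"
        then have "(\<lambda>t. \<gamma> t i) \<midarrow>t0\<rightarrow> \<gamma> t0 i" using \<gamma> DERIV_isCont isCont_def by blast
        then show "\<forall>\<^sub>F t in at t0. \<bar>\<gamma> t i - \<gamma> t0 i\<bar> < d"
          using d(1) by (auto simp: tendsto_iff dist_real_def)
      qed
      then show "\<forall>\<^sub>F t in at t0. dist (q t) (pd j g (\<gamma> t0)) < \<epsilon>"
      proof eventually_elim
        case (elim t)
        show ?case
        proof (cases "\<gamma> t j = \<gamma> t0 j")
          case True then show ?thesis using \<epsilon> by (simp add: q_def)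
        next
          case False
          have seg: "(z A t)(j := s) \<in> V \<and> \<bar>pd j g ((z A t)(j := s)) - pd j g (\<gamma> t0)\<bar> < \<epsilon>"
            if s: "min (\<gamma> t0 j) (\<gamma> t j) \<le> s" "s \<le> max (\<gamma> t0 j) (\<gamma> t j)" for s
          proof (rule d(2))
            show "(z A t)(j := s) \<in> coord_space J"
              using p AJ j by (auto simp: z_def coord_space_def)
            fix i assume i: "i \<in> J"
            have "\<bar>s - \<gamma> t0 j\<bar> \<le> \<bar>\<gamma> t j - \<gamma> t0 j\<bar>" using s by (auto simp: min_def max_def split: if_splits)
            then show "\<bar>((z A t)(j := s)) i - \<gamma> t0 i\<bar> < d"
              using elim i j d(1) by (auto simp: z_def intro: le_less_trans)
          qed
          obtain s where s: "min (\<gamma> t0 j) (\<gamma> t j) \<le> s" "s \<le> max (\<gamma> t0 j) (\<gamma> t j)"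
            "g ((z A t)(j := \<gamma> t j)) - g ((z A t)(j := \<gamma> t0 j)) = (\<gamma> t j - \<gamma> t0 j) * pd j g ((z A t)(j := s))"
          proof (rule mvt_between)
            show "\<gamma> t0 j \<noteq> \<gamma> t j" using False by simp
            show "((\<lambda>s. g ((z A t)(j := s))) has_real_derivative pd j g ((z A t)(j := s))) (at s)"
              if "min (\<gamma> t0 j) (\<gamma> t j) \<le> s" "s \<le> max (\<gamma> t0 j) (\<gamma> t j)" for s
              using seg[OF that] g(1)[OF j] by (intro pdiff_DERIV') auto
          qed
          have "q t = pd j g ((z A t)(j := s))"
            using False s(3) zz by (simp add: q_def)
          then show ?thesis using seg[OF s(1,2)] by (simp add: dist_real_def)
        qed
      qed
    qed
    then have qc: "isCont q t0" by (simp add: isCont_def)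
    obtain c where c: "\<And>t. \<gamma> t j - \<gamma> t0 j = c t * (t - t0)" "isCont c t0" "c t0 = \<gamma>' j"
      using \<gamma>[OF j] unfolding CARAT_DERIV by blast
    have "((\<lambda>t. g (z (insert j A) t) - g (z A t)) has_real_derivative pd j g (\<gamma> t0) * \<gamma>' j) (at t0)"
      unfolding CARAT_DERIV
      by (rule exI[of _ "\<lambda>t. q t * c t"]) (use D qc c q0 z0 in \<open>auto intro: continuous_intros\<close>)
    from DERIV_add[OF this insert.IH[OF AJ]] insert.hyps show ?case
      by simp
  qed
  from this[of J] have "((\<lambda>t. g (z J t)) has_real_derivative (\<Sum>j\<in>J. pd j g (\<gamma> t0) * \<gamma>' j)) (at t0)" by simp
  \<comment> \<open>Outside \<open>J\<close> the point \<open>z J t\<close> keeps the zeros of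
    \<open>\<gamma> t0\<close>; it equals \<open>\<gamma> t\<close> only while the curve lies in the
    coordinate space, which holds near \<open>t0\<close>.\<close>
  moreover have "\<forall>\<^sub>F t in nhds t0. g (z J t) = g (\<gamma> t)"
    using \<gamma>V(2)
  proof eventually_elim
    case (elim t)
    have "z J t = \<gamma> t" using elim p by (auto simp: z_def coord_space_def)
    then show ?case by simp
  qed
  ultimately show ?thesis by (simp cong: DERIV_cong_ev)
qed

text \<open>The inner map stays fixed while \<open>g\<close> varies: the chain rule produces
  \<open>pd j g\<close> composed with \<open>f\<close>, which is the induction hypothesis for
  another outer function, times first derivatives of the components of \<open>f\<close>.\<close>

lemma Ck_compose:
  assumes g: "Ck n J V g" and f: "\<And>j. j \<in> J \<Longrightarrow> Ck n I U (\<lambda>u. f u j)"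
    and fV: "\<And>u. u \<in> U \<Longrightarrow> f u \<in> V"
    and U: "copen I U" "finite I" and V: "copen J V" "finite J"
  shows "Ck n I U (\<lambda>u. g (f u))"
  using g f
proof (induction n arbitrary: g)
  case 0
  have "continuous_on U f"
    using 0(2) fV copen_subset[OF V(1)] by (intro continuous_on_coordI[of U f J]) auto
  then show ?case using 0(1) fV by (auto intro: continuous_on_compose2[of V g U f])
next
  case (Suc n)
  have Cn: "Ck n I U (\<lambda>u. f u j)" if "j \<in> J" for j using Suc.prems(2)[OF that] by (rule Ck_Suc_D)
  have cont: "continuous_on U f"
    using Suc.prems(2) fV copen_subset[OF V(1)] by (intro continuous_on_coordI[of U f J]) auto
  show ?case
  proof (rule Ck_SucI[where f' = "\<lambda>i u. \<Sum>j\<in>J. pd j g (f u) * pd i (\<lambda>u. f u j) u"])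
    show "continuous_on U (\<lambda>u. g (f u))"
      using cont Suc.prems(1) fV by (auto intro: continuous_on_compose2[of V g U f])
  next
    fix i u assume i: "i \<in> I" and u: "u \<in> U"
    have ev: "\<forall>\<^sub>F t in nhds (u i). f (u(i := t)) \<in> coord_space J"
      using copen_upd_ev[OF U(1) u i U(2)]
      by eventually_elim (use fV copen_subset[OF V(1)] in auto)
    have "((\<lambda>t. g (f (u(i := t)))) has_real_derivative
       (\<Sum>j\<in>J. pd j g (f (u(i := u i))) * pd i (\<lambda>u. f u j) u)) (at (u i))"
    proof (rule chain_curve[OF V(2,1) _ _ _ ev])
      show "((\<lambda>t. f (u(i := t)) j) has_real_derivative pd i (\<lambda>u. f u j) u) (at (u i))" if "j \<in> J" for j
        using pdiff_DERIV[of i "\<lambda>u. f u j" u] Suc.prems(2)[OF that] i u by simp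
      show "pdiff j g x" if "j \<in> J" "x \<in> V" for j x using Suc.prems(1) that by simp
      show "continuous_on V (pd j g)" if "j \<in> J" for j
        using Suc.prems(1) that Ck_continuous[of n J V "pd j g"] by simp
      show "f (u(i := u i)) \<in> V" using fV u by simp
    qed
    then show "((\<lambda>t. g (f (u(i := t)))) has_real_derivative
       (\<Sum>j\<in>J. pd j g (f u) * pd i (\<lambda>u. f u j) u)) (at (u i))" by simp
  next
    fix i assume i: "i \<in> I"
    show "Ck n I U (\<lambda>u. \<Sum>j\<in>J. pd j g (f u) * pd i (\<lambda>u. f u j) u)"
    proof (intro Ck_sum Ck_mult U)
      fix j assume j: "j \<in> J"
      have "Ck n J V (pd j g)" using Suc.prems(1) j by simp
      then show "Ck n I U (\<lambda>u. pd j g (f u))" using Cn by (rule Suc.IH)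
      show "Ck n I U (pd i (\<lambda>u. f u j))" using Suc.prems(2)[OF j] i by simp
    qed
  qed (use U in auto)
qed

lemma C_infinityD:
  assumes "C_infinity I U f"
  shows "continuous_on U f" "i \<in> I \<Longrightarrow> x \<in> U \<Longrightarrow> pdiff i f x" "i \<in> I \<Longrightarrow> C_infinity I U (pd i f)"
    "i \<in> I \<Longrightarrow> continuous_on U (pd i f)"
proof -
  have *: "Ck n I U f" for n using assms by (simp add: C_infinity_Ck)
  show "continuous_on U f" using *[of 0] by simp
  show "pdiff i f x" if "i \<in> I" "x \<in> U" using *[of 1] that by simp
  show "C_infinity I U (pd i f)" if "i \<in> I"
    unfolding C_infinity_Ck
  proof
    fix n show "Ck n I U (pd i f)" using *[of "Suc n"] that by simp
  qed
  then show "i \<in> I \<Longrightarrow> continuous_on U (pd i f)" by (metis C_infinity_Ck Ck.simps(1))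
qed

lemma C_infinity_chain:
  fixes \<gamma> :: "real \<Rightarrow> 'j \<Rightarrow> real"
  assumes "finite J" "copen J V" "C_infinity J V g" "\<gamma> t0 \<in> V" "\<forall>\<^sub>F t in nhds t0. \<gamma> t \<in> coord_space J"
    and "\<And>j. j \<in> J \<Longrightarrow> ((\<lambda>t. \<gamma> t j) has_real_derivative \<gamma>' j) (at t0)"
  shows "((\<lambda>t. g (\<gamma> t)) has_real_derivative (\<Sum>j\<in>J. pd j g (\<gamma> t0) * \<gamma>' j)) (at t0)"
  using assms by (intro chain_curve[of J V g]) (auto intro: C_infinityD)

lemma C_infinity_subset: "C_infinity I U f \<Longrightarrow> V \<subseteq> U \<Longrightarrow> J \<subseteq> I \<Longrightarrow> C_infinity J V f"
  unfolding C_infinity_Ck using Ck_subset by blast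

lemma C_infinity_cong:
  "C_infinity I U f \<Longrightarrow> (\<And>x. x \<in> U \<Longrightarrow> f x = g x) \<Longrightarrow> copen I U \<Longrightarrow> finite I \<Longrightarrow> C_infinity I U g"
  unfolding C_infinity_Ck using Ck_cong by blast

lemma C_infinity_local:
  assumes "\<And>x. x \<in> U \<Longrightarrow> \<exists>V. copen I V \<and> x \<in> V \<and> C_infinity I V f" "copen I U" "finite I"
  shows "C_infinity I U f"
  using assms unfolding C_infinity_Ck by (intro allI Ck_local) blast+

lemma C_infinity_intros:
  assumes "finite I" "copen I U"
  shows C_infinity_const: "C_infinity I U (\<lambda>x. c)"
    and C_infinity_coord: "C_infinity I U (\<lambda>x. x i)"
    and C_infinity_add: "C_infinity I U f \<Longrightarrow> C_infinity I U g \<Longrightarrow> C_infinity I U (\<lambda>x. f x + g x)"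
    and C_infinity_mult: "C_infinity I U f \<Longrightarrow> C_infinity I U g \<Longrightarrow> C_infinity I U (\<lambda>x. f x * g x)"
    and C_infinity_sum: "(\<And>j. j \<in> J \<Longrightarrow> C_infinity I U (h j)) \<Longrightarrow> C_infinity I U (\<lambda>x. \<Sum>j\<in>J. h j x)"
    and C_infinity_inverse: "C_infinity I U f \<Longrightarrow> (\<And>x. x \<in> U \<Longrightarrow> f x \<noteq> 0) \<Longrightarrow> C_infinity I U (\<lambda>x. inverse (f x))"
  using assms unfolding C_infinity_Ck
  by (auto intro: Ck_const Ck_coord Ck_add Ck_mult Ck_sum Ck_inverse)

lemma C_infinity_compose:
  assumes "C_infinity J V g" "\<And>j. j \<in> J \<Longrightarrow> C_infinity I U (\<lambda>u. f u j)" "\<And>u. u \<in> U \<Longrightarrow> f u \<in> V"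
    and "copen I U" "finite I" "copen J V" "finite J"
  shows "C_infinity I U (\<lambda>u. g (f u))"
  using assms unfolding C_infinity_Ck by (auto intro: Ck_compose)

text \<open>An inverse function theorem for a map altering one coordinate. On a small box
  \<open>pd i g\<close> keeps its sign, so \<open>g\<close> is strictly monotone along lines in
  direction \<open>i\<close>: the mean value theorem gives injectivity, the intermediate value
  theorem an open image and a continuous inverse. The derivatives of \<open>G\<close> come from
  differentiating \<open>g (w(i := G w)) = w i\<close>; they are smooth expressions in
  \<open>G\<close> itself, which raises the order of smoothness step by step.\<close>

lemma C_infinity_replace_coord:
  assumes I: "finite I" and U: "copen I U" and g: "C_infinity I U g"
    and p: "p \<in> U" and i: "i \<in> I" and nz: "pd i g p \<noteq> 0"
  obtains V W G where "copen I V" "p \<in> V" "V \<subseteq> U" "copen I W" "W = (\<lambda>u. u(i := g u)) ` V"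
    "inj_on (\<lambda>u. u(i := g u)) V" "C_infinity I W G"
    "\<forall>w\<in>W. w(i := G w) \<in> V \<and> g (w(i := G w)) = w i"
proof -
  define D where "D = pd i g"
  \<comment> \<open>The sign of the derivative; multiplying by it treats increasing and decreasing
    \<open>g\<close> together.\<close>
  define s where "s = sgn (D p)"
  have Dc: "continuous_on U D" using C_infinityD(4)[OF g i] by (simp add: D_def)
  obtain e where e: "e > 0" "\<And>y. y \<in> coord_space I \<Longrightarrow> (\<And>k. k \<in> I \<Longrightarrow> \<bar>y k - p k\<bar> < e)
      \<Longrightarrow> y \<in> U \<and> \<bar>D y - D p\<bar> < \<bar>D p\<bar>"
    using continuous_on_box[OF Dc U I p] nz by (metis D_def zero_less_abs_iff)
  define V where "V = coord_space I \<inter> {y. \<forall>k\<in>I. \<bar>y k - p k\<bar> < e}"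
  have Vo: "copen I V" unfolding V_def using open_box[OF I] by (rule openin_open_Int)
  have VU: "V \<subseteq> U" using e(2) by (auto simp: V_def)
  have pV: "p \<in> V" using p e(1) copen_subset[OF U] by (auto simp: V_def)
  have sD: "s * D y > 0" if "y \<in> V" for y
  proof -
    have "\<bar>D y - D p\<bar> < \<bar>D p\<bar>" using e(2) that by (auto simp: V_def)
    then show ?thesis by (auto simp: s_def sgn_if split: if_splits)
  qed
  have gi: "((\<lambda>t. g (y(i := t))) has_real_derivative D (y(i := t))) (at t)" if "y(i := t) \<in> V" for y t
    unfolding D_def using C_infinityD(2)[OF g i] VU that by (intro pdiff_DERIV') auto
  have Vconv: "y(i := t) \<in> V" if "y(i := a) \<in> V" "y(i := b) \<in> V" "min a b \<le> t" "t \<le> max a b" for y a b t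
  proof -
    have "\<bar>a - p i\<bar> < e" "\<bar>b - p i\<bar> < e" using that i by (force simp: V_def)+
    then have "\<bar>t - p i\<bar> < e" using that by (auto simp: min_def max_def split: if_splits)
    then show ?thesis using that(1) i by (auto simp: V_def coord_space_def)
  qed
  have mvt: "\<exists>z. min a b \<le> z \<and> z \<le> max a b \<and> y(i := z) \<in> V \<and>
      g (y(i := b)) - g (y(i := a)) = (b - a) * D (y(i := z))"
    if yab: "y(i := a) \<in> V" "y(i := b) \<in> V" "a \<noteq> b" for y a b
  proof -
    obtain z where "min a b \<le> z" "z \<le> max a b" "g (y(i := b)) - g (y(i := a)) = (b - a) * D (y(i := z))"
      by (rule mvt_between[OF yab(3), of "\<lambda>t. g (y(i := t))" "\<lambda>t. D (y(i := t))"])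
        (use Vconv yab gi in blast)+
    then show ?thesis using Vconv yab by blast
  qed
  define \<rho> where "\<rho> = (\<lambda>u :: 'a \<Rightarrow> real. u(i := g u))"
  have inj: "inj_on \<rho> V"
  proof
    fix u v assume uv: "u \<in> V" "v \<in> V" "\<rho> u = \<rho> v"
    have "u k = v k" if "k \<noteq> i" for k using fun_cong[OF uv(3), of k] that by (simp add: \<rho>_def)
    then have v: "v = u(i := v i)" by auto
    have "g u = g v" using fun_cong[OF uv(3), of i] by (simp add: \<rho>_def)
    have "u i = v i"
    proof (rule ccontr)
      assume "u i \<noteq> v i"
      then obtain z where "u(i := z) \<in> V" "g (u(i := v i)) - g (u(i := u i)) = (v i - u i) * D (u(i := z))"
        using mvt[of u "u i" "v i"] uv v by auto
      then show False using \<open>g u = g v\<close> v sD[of "u(i := z)"] \<open>u i \<noteq> v i\<close> by simp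
    qed
    then show "u = v" using v by (metis fun_upd_triv)
  qed
  define W where "W = \<rho> ` V"
  define G where "G = (\<lambda>w. inv_into V \<rho> w i)"
  have G: "w(i := G w) \<in> V" "g (w(i := G w)) = w i" if w: "w \<in> W" for w
  proof -
    obtain v where v: "v \<in> V" "w = \<rho> v" using w by (auto simp: W_def)
    then have "inv_into V \<rho> w = v" using inj by simp
    then have "w(i := G w) = v" using v(2) by (simp add: G_def \<rho>_def)
    then show "w(i := G w) \<in> V" "g (w(i := G w)) = w i" using v by (auto simp: \<rho>_def)
  qed
  have G_eq: "w \<in> W \<and> G w = t" if "w(i := t) \<in> V" "g (w(i := t)) = w i" for w t
  proof -
    have "\<rho> (w(i := t)) = w" using that by (simp add: \<rho>_def)
    then show ?thesis using that(1) inj by (metis G_def W_def fun_upd_same imageI inv_into_f_f)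
  qed
  have WI: "W \<subseteq> coord_space I" using i copen_subset[OF Vo] by (auto simp: W_def \<rho>_def intro!: coord_space_upd)
  \<comment> \<open>Openness of \<open>W\<close> and continuity of \<open>G\<close> in one
    statement. The values of \<open>g\<close> at the ends of a short segment through
    \<open>v0\<close> lie on either side of \<open>w0 i\<close>; for \<open>w\<close> near
    \<open>w0\<close> they still lie on either side of \<open>w i\<close>, so the intermediate value
    theorem finds the preimage inside the segment.\<close>
  have L: "\<exists>\<delta>>0. \<forall>w\<in>coord_space I. (\<forall>k\<in>I. \<bar>w k - w0 k\<bar> < \<delta>) \<longrightarrow> w \<in> W \<and> \<bar>G w - G w0\<bar> < \<epsilon>"
    if w0: "w0 \<in> W" and \<epsilon>: "\<epsilon> > 0" for w0 \<epsilon>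
  proof -
    define v0 where "v0 = w0(i := G w0)"
    have v0: "v0 \<in> V" "g v0 = w0 i" "v0 i = G w0" using G[OF w0] by (auto simp: v0_def)
    \<comment> \<open>At most half of \<open>\<epsilon>\<close>, and at most half of the room left
      in the box, so that both ends of the segment remain in \<open>V\<close>.\<close>
    define \<eta> where "\<eta> = min (\<epsilon> / 2) ((e - \<bar>v0 i - p i\<bar>) / 2)"
    have "\<bar>v0 i - p i\<bar> < e" using v0(1) i by (auto simp: V_def)
    then have \<eta>: "\<eta> > 0" "\<eta> < \<epsilon>" "\<bar>v0 i - \<eta> - p i\<bar> < e" "\<bar>v0 i + \<eta> - p i\<bar> < e"
      using \<epsilon> by (auto simp: \<eta>_def min_def abs_if field_simps split: if_splits)
    define a b where "a = v0 i - \<eta>" and "b = v0 i + \<eta>"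
    have ab: "v0(i := a) \<in> V" "v0(i := b) \<in> V"
      using v0(1) i \<eta> by (auto simp: V_def a_def b_def coord_space_def)
    obtain z1 where z1: "v0(i := z1) \<in> V" "g (v0(i := a)) - g v0 = (a - v0 i) * D (v0(i := z1))"
      using mvt[of v0 "v0 i" a] v0(1) ab \<eta>(1) by (auto simp: a_def)
    obtain z2 where z2: "v0(i := z2) \<in> V" "g (v0(i := b)) - g v0 = (b - v0 i) * D (v0(i := z2))"
      using mvt[of v0 "v0 i" b] v0(1) ab \<eta>(1) by (auto simp: b_def)
    have s2: "s * s = 1" using nz by (auto simp: s_def D_def sgn_if)
    have sa: "s * (g (v0(i := a)) - w0 i) < 0"
    proof -
      have "s * (g (v0(i := a)) - w0 i) = - \<eta> * (s * D (v0(i := z1)))"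
        using z1(2) v0 by (simp add: a_def)
      also have "\<dots> < 0" using mult_neg_pos[OF _ sD[OF z1(1)], of "- \<eta>"] \<eta>(1) by simp
      finally show ?thesis .
    qed
    have sb: "s * (g (v0(i := b)) - w0 i) > 0"
    proof -
      have "s * (g (v0(i := b)) - w0 i) = \<eta> * (s * D (v0(i := z2)))"
        using z2(2) v0 by (simp add: b_def)
      also have "\<dots> > 0" using mult_pos_pos[OF \<eta>(1) sD[OF z2(1)]] .
      finally show ?thesis .
    qed
    have gV: "continuous_on V g" using C_infinityD(1)[OF g] VU continuous_on_subset by blast
    \<comment> \<open>The point \<open>w\<close> enters through the argument of \<open>g\<close> and
      through \<open>w i\<close>; each of the two is allowed half of \<open>d\<close>.\<close>
    have near: "\<exists>\<delta>>0. \<forall>w\<in>coord_space I. (\<forall>k\<in>I. \<bar>w k - w0 k\<bar> < \<delta>) \<longrightarrow>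
        w(i := c) \<in> V \<and> \<bar>(g (w(i := c)) - w i) - (g (v0(i := c)) - w0 i)\<bar> < d"
      if c: "v0(i := c) \<in> V" and d: "d > 0" for c d
    proof -
      obtain \<delta> where \<delta>: "\<delta> > 0" "\<And>y. y \<in> coord_space I \<Longrightarrow> (\<And>k. k \<in> I \<Longrightarrow> \<bar>y k - (v0(i := c)) k\<bar> < \<delta>)
          \<Longrightarrow> y \<in> V \<and> \<bar>g y - g (v0(i := c))\<bar> < d / 2"
        using continuous_on_box[OF gV Vo I c, of "d/2"] d by (metis half_gt_zero)
      show ?thesis
      proof (intro exI[of _ "min \<delta> (d/2)"] conjI ballI impI)
        fix w assume w: "w \<in> coord_space I" "\<forall>k\<in>I. \<bar>w k - w0 k\<bar> < min \<delta> (d/2)"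
        have "w(i := c) \<in> V \<and> \<bar>g (w(i := c)) - g (v0(i := c))\<bar> < d / 2"
          using w i \<delta>(1) by (intro \<delta>(2)) (auto simp: v0_def coord_space_upd)
        moreover have "\<bar>w i - w0 i\<bar> < d / 2" using w(2) i by auto
        ultimately show "w(i := c) \<in> V" "\<bar>(g (w(i := c)) - w i) - (g (v0(i := c)) - w0 i)\<bar> < d"
          by (simp, linarith)
      qed (use d \<delta> in auto)
    qed
    obtain \<delta>1 where \<delta>1: "\<delta>1 > 0" "\<And>w. w\<in>coord_space I \<Longrightarrow> (\<forall>k\<in>I. \<bar>w k - w0 k\<bar> < \<delta>1) \<Longrightarrow>
        w(i := a) \<in> V \<and> \<bar>(g (w(i := a)) - w i) - (g (v0(i := a)) - w0 i)\<bar> < \<bar>g (v0(i := a)) - w0 i\<bar>"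
      using near[OF ab(1), of "\<bar>g (v0(i := a)) - w0 i\<bar>"] sa by fastforce
    obtain \<delta>2 where \<delta>2: "\<delta>2 > 0" "\<And>w. w\<in>coord_space I \<Longrightarrow> (\<forall>k\<in>I. \<bar>w k - w0 k\<bar> < \<delta>2) \<Longrightarrow>
        w(i := b) \<in> V \<and> \<bar>(g (w(i := b)) - w i) - (g (v0(i := b)) - w0 i)\<bar> < \<bar>g (v0(i := b)) - w0 i\<bar>"
      using near[OF ab(2), of "\<bar>g (v0(i := b)) - w0 i\<bar>"] sb by fastforce
    show ?thesis
    proof (intro exI[of _ "min \<delta>1 \<delta>2"] conjI ballI impI)
      fix w assume w: "w \<in> coord_space I" "\<forall>k\<in>I. \<bar>w k - w0 k\<bar> < min \<delta>1 \<delta>2"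
      have wab: "w(i := a) \<in> V" "w(i := b) \<in> V"
        and near_ab: "\<bar>(g (w(i := a)) - w i) - (g (v0(i := a)) - w0 i)\<bar> < \<bar>g (v0(i := a)) - w0 i\<bar>"
         "\<bar>(g (w(i := b)) - w i) - (g (v0(i := b)) - w0 i)\<bar> < \<bar>g (v0(i := b)) - w0 i\<bar>"
        using \<delta>1(2)[OF w(1)] \<delta>2(2)[OF w(1)] w(2) by auto
      have ale: "a \<le> b" using \<eta>(1) by (simp add: a_def b_def)
      have cont: "continuous_on {a..b} (\<lambda>t. s * (g (w(i := t)) - w i))"
      proof (intro continuous_intros continuous_at_imp_continuous_on ballI)
        fix t assume "t \<in> {a..b}"
        then show "isCont (\<lambda>t. g (w(i := t))) t"
          using Vconv[OF wab] ale by (intro DERIV_isCont[OF gi]) (auto simp: min_def max_def)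
      qed
      have scase: "s = 1 \<or> s = -1" using nz by (auto simp: s_def D_def sgn_if)
      have "s * (g (w(i := a)) - w i) \<le> 0" "0 \<le> s * (g (w(i := b)) - w i)"
        using near_ab sa sb scase by auto
      from IVT'[OF this ale cont] obtain t where t: "a \<le> t" "t \<le> b" "s * (g (w(i := t)) - w i) = 0"
        by blast
      have "w \<in> W \<and> G w = t"
        using t scase Vconv[OF wab] ale by (intro G_eq) (auto simp: min_def max_def)
      then show "w \<in> W" "\<bar>G w - G w0\<bar> < \<epsilon>"
        using t \<eta> v0(3) by (auto simp: a_def b_def)
    qed (use \<delta>1 \<delta>2 in auto)
  qed
  have Wo: "copen I W"
  proof (rule copenI[OF I WI])
    fix x assume "x \<in> W"
    from L[OF this zero_less_one] show "\<exists>e>0. \<forall>y\<in>coord_space I. (\<forall>i\<in>I. \<bar>y i - x i\<bar> < e) \<longrightarrow> y \<in> W"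
      by (metis (no_types, lifting))
  qed
  have Gc: "continuous_on W G"
  proof (rule continuous_on_boxI[OF I WI])
    fix x and d :: real assume "x \<in> W" "d > 0"
    from L[OF this] obtain e where e: "e > 0"
      "\<And>w. w \<in> coord_space I \<Longrightarrow> (\<forall>k\<in>I. \<bar>w k - x k\<bar> < e) \<Longrightarrow> \<bar>G w - G x\<bar> < d" by blast
    then show "\<exists>e>0. \<forall>y\<in>W. (\<forall>i\<in>I. \<bar>y i - x i\<bar> < e) \<longrightarrow> \<bar>G y - G x\<bar> < d"
      using WI by blast
  qed
  \<comment> \<open>Implicit differentiation. For \<open>j = i\<close> the value prescribed for
    \<open>g\<close> changes at rate 1; otherwise that value is kept, and the change of
    \<open>g\<close> caused by coordinate \<open>j\<close> has to be compensated by coordinate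
    \<open>i\<close>.\<close>
  have DG: "((\<lambda>t. G (w0(j := t))) has_real_derivative
      (if j = i then 1 else - pd j g (w0(i := G w0))) * inverse (D (w0(i := G w0)))) (at (w0 j))"
    if w0: "w0 \<in> W" and j: "j \<in> I" for w0 j
  proof -
    define v0 where "v0 = w0(i := G w0)"
    have v0: "v0 \<in> V" "g v0 = w0 i" "v0 i = G w0" using G[OF w0] by (auto simp: v0_def)
    \<comment> \<open>\<open>bs\<close> is the point with the shift in direction \<open>j\<close>
      already made, \<open>N\<close> is, up to a constant, the gain of \<open>g\<close> that
      coordinate \<open>i\<close> must supply, and \<open>Q\<close> is the mean slope of
      \<open>g\<close> in direction \<open>i\<close>. The fact \<open>key\<close> then says
      \<open>N t - N t0 = Q t * (a t - a t0)\<close>.\<close>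
    define bs where "bs = (\<lambda>t. if j = i then v0 else v0(j := t))"
    define N where "N = (\<lambda>t. if j = i then t else - g (v0(j := t)))"
    define a where "a = (\<lambda>t. G (w0(j := t)))"
    define t0 where "t0 = w0 j"
    define Q where "Q = (\<lambda>t. if a t = a t0 then D v0 else (N t - N t0) / (a t - a t0))"
    have at0: "a t0 = G w0" by (simp add: a_def t0_def)
    have bs0: "bs t0 = v0" by (auto simp: bs_def t0_def v0_def)
    have evW: "\<forall>\<^sub>F t in nhds t0. w0(j := t) \<in> W"
      unfolding t0_def by (rule copen_upd_ev[OF Wo w0 j I])
    have bsV: "\<forall>\<^sub>F t in nhds t0. bs t \<in> V"
    proof (cases "j = i")
      case True then show ?thesis using v0 by (simp add: bs_def)
    next
      case False
      then have "v0 j = t0" by (simp add: v0_def t0_def)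
      then show ?thesis using copen_upd_ev[OF Vo v0(1) j I] False by (simp add: bs_def)
    qed
    have key: "N t - N t0 = g ((bs t)(i := a t)) - g ((bs t)(i := a t0)) \<and> (bs t)(i := a t) \<in> V"
      if "w0(j := t) \<in> W" for t
    proof -
      have "j \<noteq> i \<Longrightarrow> v0(j := t0) = v0" by (auto simp: v0_def t0_def)
      then have N0: "j \<noteq> i \<Longrightarrow> N t0 = - g v0" by (simp add: N_def)
      have *: "w0(j := t, i := a t) \<in> V" "g (w0(j := t, i := a t)) = (w0(j := t)) i"
        using G[OF that] by (simp_all add: a_def)
      show ?thesis
      proof (cases "j = i")
        case True
        then show ?thesis using * v0 at0 by (simp add: N_def bs_def v0_def t0_def)
      next
        case False
        then have "(bs t)(i := a t) = w0(j := t, i := a t)" "(bs t)(i := a t0) = v0(j := t)"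
          by (auto simp: bs_def v0_def at0)
        then show ?thesis using * False N0 v0(2) by (simp add: N_def)
      qed
    qed
    have bsi: "(bs t)(i := a t0) = bs t" for t by (auto simp: bs_def at0 v0_def)
    have acont: "isCont a t0"
    proof -
      have "a \<midarrow>t0\<rightarrow> a t0"
        unfolding tendsto_iff
      proof (intro allI impI)
        fix \<epsilon> :: real assume "\<epsilon> > 0"
        from L[OF w0 this] obtain \<delta> where \<delta>: "\<delta> > 0" "\<And>w. w\<in>coord_space I \<Longrightarrow>
          (\<forall>k\<in>I. \<bar>w k - w0 k\<bar> < \<delta>) \<Longrightarrow> \<bar>G w - G w0\<bar> < \<epsilon>" by blast
        have "dist (a t) (a t0) < \<epsilon>" if "dist t t0 < \<delta>" for t
        proof -
          have "\<bar>G (w0(j := t)) - G w0\<bar> < \<epsilon>" using that \<delta>(1) w0 WI j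
            by (intro \<delta>(2)) (auto simp: dist_real_def t0_def intro: coord_space_upd)
          then show ?thesis by (simp add: at0 dist_real_def) (simp add: a_def)
        qed
        then show "\<forall>\<^sub>F t in at t0. dist (a t) (a t0) < \<epsilon>"
          using \<delta>(1) by (auto simp: eventually_at)
      qed
      then show ?thesis by (simp add: isCont_def)
    qed
    have Q: "Q \<midarrow>t0\<rightarrow> D v0"
      unfolding tendsto_iff
    proof (intro allI impI)
      fix \<epsilon> :: real assume \<epsilon>: "\<epsilon> > 0"
      have "continuous_on V D" using Dc VU continuous_on_subset by blast
      from continuous_on_box[OF this Vo I v0(1) \<epsilon>] obtain \<delta> where \<delta>: "\<delta> > 0"
        "\<And>y. y \<in> coord_space I \<Longrightarrow> (\<And>k. k \<in> I \<Longrightarrow> \<bar>y k - v0 k\<bar> < \<delta>) \<Longrightarrow> \<bar>D y - D v0\<bar> < \<epsilon>"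
        by metis
      have "\<forall>\<^sub>F t in at t0. \<bar>a t - a t0\<bar> < \<delta>"
        using acont \<delta>(1) by (auto simp: isCont_def tendsto_iff dist_real_def)
      moreover have "\<forall>\<^sub>F t in at t0. \<bar>t - t0\<bar> < \<delta>"
        using \<delta>(1) by (auto simp: eventually_at dist_real_def)
      moreover have "\<forall>\<^sub>F t in at t0. w0(j := t) \<in> W" using evW by (simp add: eventually_nhds_conv_at)
      moreover have "\<forall>\<^sub>F t in at t0. bs t \<in> V" using bsV by (simp add: eventually_nhds_conv_at)
      ultimately show "\<forall>\<^sub>F t in at t0. dist (Q t) (D v0) < \<epsilon>"
      proof eventually_elim
        case (elim t)
        show ?case
        proof (cases "a t = a t0")
          case True then show ?thesis using \<epsilon> by (simp add: Q_def)
        next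
          case False
          obtain z where z: "min (a t0) (a t) \<le> z" "z \<le> max (a t0) (a t)" "(bs t)(i := z) \<in> V"
            "N t - N t0 = (a t - a t0) * D ((bs t)(i := z))"
            using mvt[of "bs t" "a t0" "a t"] key[OF elim(3)] elim(4) False unfolding bsi by metis
          have "\<bar>D ((bs t)(i := z)) - D v0\<bar> < \<epsilon>"
          proof (rule \<delta>(2))
            show "(bs t)(i := z) \<in> coord_space I" using z(3) by (simp add: V_def)
            fix k assume "k \<in> I"
            have "\<bar>z - a t0\<bar> < \<delta>" using z(1,2) elim(1) by (auto simp: min_def max_def split: if_splits)
            then have "\<bar>z - G w0\<bar> < \<delta>" by (simp only: at0)
            then show "\<bar>((bs t)(i := z)) k - v0 k\<bar> < \<delta>"
              using elim(2) \<delta>(1) by (auto simp: bs_def t0_def v0_def)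
          qed
          then show ?thesis using False z(4) by (simp add: Q_def dist_real_def)
        qed
      qed
    qed
    define N' where "N' = (if j = i then 1 else - pd j g v0)"
    have "(N has_real_derivative N') (at t0)"
    proof (cases "j = i")
      case False
      then have "v0 j = t0" by (simp add: v0_def t0_def)
      moreover have "pdiff j g v0" using C_infinityD(2)[OF g j] v0(1) VU by auto
      ultimately show ?thesis using DERIV_minus[OF pdiff_DERIV[of j g v0]] False by (simp add: N_def N'_def)
    qed (simp add: N_def N'_def)
    then have "(\<lambda>t. (N t - N t0) / (t - t0)) \<midarrow>t0\<rightarrow> N'" by (simp add: has_field_derivative_iff)
    moreover have D0: "D v0 \<noteq> 0" using sD[OF v0(1)] by auto
    ultimately have "(\<lambda>t. (N t - N t0) / (t - t0) / Q t) \<midarrow>t0\<rightarrow> N' / D v0"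
      using Q by (intro tendsto_divide)
    \<comment> \<open>\<open>Q\<close> does not vanish near \<open>t0\<close>, so dividing the
      difference quotient of \<open>N\<close> by it recovers that of \<open>a\<close>.\<close>
    moreover have "\<forall>\<^sub>F t in at t0. (N t - N t0) / (t - t0) / Q t = (a t - a t0) / (t - t0)"
    proof -
      have "\<forall>\<^sub>F t in at t0. Q t \<noteq> 0"
        using Q D0 by (auto intro: tendsto_imp_eventually_ne)
      moreover have "\<forall>\<^sub>F t in at t0. w0(j := t) \<in> W" using evW by (simp add: eventually_nhds_conv_at)
      ultimately show ?thesis
      proof eventually_elim
        case (elim t)
        have "N t - N t0 = Q t * (a t - a t0)"
          using key[OF elim(2)] by (auto simp: Q_def)
        then show ?case using elim(1) by simp
      qed
    qed
    ultimately have "(\<lambda>t. (a t - a t0) / (t - t0)) \<midarrow>t0\<rightarrow> N' / D v0"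
      by (rule Lim_transform_eventually)
    then have "(a has_real_derivative N' / D v0) (at t0)" by (simp add: has_field_derivative_iff)
    then show ?thesis unfolding a_def t0_def N'_def v0_def divide_inverse .
  qed
  \<comment> \<open>Bootstrapping: the formulas for the derivatives contain \<open>G\<close> only
    inside smooth functions, so order \<open>n\<close> of \<open>G\<close> gives order
    \<open>n\<close> of its derivatives.\<close>
  have "Ck n I W G" for n
  proof (induction n)
    case 0 then show ?case using Gc by simp
  next
    case (Suc n)
    have comp: "Ck n I W (\<lambda>w. (w(i := G w)) k)" if "k \<in> I" for k
      using Suc Ck_coord[OF I Wo] by (cases "k = i") auto
    have cc: "Ck n I W (\<lambda>w. h (w(i := G w)))" if "C_infinity I U h" for h
      using that comp G VU by (intro Ck_compose[of n I U h I W] U Wo I) (auto simp: C_infinity_Ck)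
    show ?case
    proof (rule Ck_SucI[OF Gc Wo I DG])
      fix j assume j: "j \<in> I"
      have "Ck n I W (\<lambda>w. if j = i then 1 else - pd j g (w(i := G w)))"
        using Ck_mult[OF Ck_const[of I W n "-1"] cc[OF C_infinityD(3)[OF g j]]] I Wo
        by (cases "j = i") (auto intro: Ck_const)
      moreover have "D (w(i := G w)) \<noteq> 0" if "w \<in> W" for w using sD[OF G(1)[OF that]] by auto
      moreover have "Ck n I W (\<lambda>w. D (w(i := G w)))"
        unfolding D_def by (rule cc[OF C_infinityD(3)[OF g i]])
      ultimately show "Ck n I W (\<lambda>w. (if j = i then 1 else - pd j g (w(i := G w))) * inverse (D (w(i := G w))))"
        by (intro Ck_mult Ck_inverse I Wo) auto
    qed
  qed
  then have "C_infinity I W G" by (simp add: C_infinity_Ck)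
  from that[OF Vo pV VU Wo _ _ this] G inj show thesis
    by (simp add: W_def \<rho>_def)
qed

section \<open>Smooth functions and charts\<close>

lemma copen_preimage:
  assumes A: "copen I A" and B: "copen J B"
    and f: "\<And>j. j \<in> J \<Longrightarrow> continuous_on A (\<lambda>u. f u j)" "\<And>u. u \<in> A \<Longrightarrow> f u \<in> coord_space J"
  shows "copen I {u \<in> A. f u \<in> B}"
proof -
  have "continuous_on A f" using f by (intro continuous_on_coordI[of A f J]) auto
  then have "openin (top_of_set A) (A \<inter> f -` B)"
    using B f(2) by (intro continuous_openin_preimage[of A f "coord_space J"]) auto
  moreover have "A \<inter> f -` B = {u \<in> A. f u \<in> B}" by auto
  ultimately show ?thesis using A openin_trans by metis
qed

text \<open>\<open>manifold\<close> without the Hausdorff and countability axioms. Smoothness needs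
  no more, and for jet spaces, products and submanifolds this part has to be available before their
  topology is examined.\<close>

definition atlas_ok :: "('a, 'i) mfd \<Rightarrow> bool" where
  "atlas_ok M \<longleftrightarrow> finite (idx M) \<and> (\<forall>c\<in>atlas M. is_chart (idx M) c) \<and>
    (\<forall>c\<in>atlas M. \<forall>d\<in>atlas M. smooth_transition (idx M) c d)"

lemma manifold_atlas_ok: "manifold M \<Longrightarrow> atlas_ok M"
  by (simp add: manifold_def atlas_ok_def)

lemma atlas_ok_finite: "atlas_ok M \<Longrightarrow> finite (idx M)"
  by (simp add: atlas_ok_def)

lemma chartD:
  assumes "atlas_ok M" "(C, \<phi>) \<in> atlas M"
  shows "inj_on \<phi> C" "copen (idx M) (\<phi> ` C)" "C \<subseteq> pts M" "p \<in> C \<Longrightarrow> \<phi> p \<in> coord_space (idx M)"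
proof -
  show "inj_on \<phi> C" "copen (idx M) (\<phi> ` C)"
    using assms by (auto simp: atlas_ok_def is_chart_def)
  then show "p \<in> C \<Longrightarrow> \<phi> p \<in> coord_space (idx M)" using copen_subset by blast
  show "C \<subseteq> pts M" using assms by (force simp: pts_def)
qed

lemma transitionD:
  assumes "atlas_ok M" "(C, \<phi>) \<in> atlas M" "(D, \<psi>) \<in> atlas M"
  shows "copen (idx M) (\<phi> ` (C \<inter> D))"
    "j \<in> idx M \<Longrightarrow> C_infinity (idx M) (\<phi> ` (C \<inter> D)) (\<lambda>u. \<psi> (inv_into C \<phi> u) j)"
  using assms unfolding atlas_ok_def smooth_transition_def by fast+

lemma pts_chart:
  assumes "p \<in> pts M"
  obtains C \<phi> where "(C, \<phi>) \<in> atlas M" "p \<in> C"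
  using assms by (auto simp: pts_def)

lemma inv_into_filter:
  "inj_on \<phi> C \<Longrightarrow> {u \<in> \<phi> ` (C \<inter> D). P (inv_into C \<phi> u)} = \<phi> ` {p \<in> C \<inter> D. P p}"
  by (auto simp: inv_into_f_f)

lemma topspace_mtop: "topspace (mtop M) = pts M"
proof -
  have "\<Union>{{p \<in> C. \<phi> p \<in> W} |C \<phi> W. (C, \<phi>) \<in> atlas M \<and> open W} = pts M"
  proof (intro equalityI subsetI)
    fix p assume "p \<in> pts M"
    then obtain C \<phi> where "(C, \<phi>) \<in> atlas M" "p \<in> C" by (rule pts_chart)
    then show "p \<in> \<Union>{{p \<in> C. \<phi> p \<in> W} |C \<phi> W. (C, \<phi>) \<in> atlas M \<and> open W}"
      by (intro UnionI[of "{p \<in> C. \<phi> p \<in> UNIV}"]) blast+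
  qed (force simp: pts_def)
  then show ?thesis by (simp add: mtop_def)
qed

lemma openin_pts: "openin (mtop M) U \<Longrightarrow> U \<subseteq> pts M"
  using openin_subset topspace_mtop by metis

lemma openin_chart:
  assumes "openin (mtop M) U" "p \<in> U"
  obtains C \<phi> where "(C, \<phi>) \<in> atlas M" "p \<in> C"
  using pts_chart[of p M] openin_pts[OF assms(1)] assms(2) by blast

lemma openin_mtop_pts [simp]: "openin (mtop M) (pts M)"
  by (metis openin_topspace topspace_mtop)

lemma chart_openin:
  assumes "(C, \<phi>) \<in> atlas M" "open W"
  shows "openin (mtop M) {p \<in> C. \<phi> p \<in> W}"
  unfolding mtop_def by (rule topology_generated_by_Basis) (use assms in blast)

lemma chart_copenin:
  assumes "atlas_ok M" "(C, \<phi>) \<in> atlas M" "copen (idx M) W"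
  shows "openin (mtop M) {p \<in> C. \<phi> p \<in> W}"
proof -
  obtain T where T: "open T" "W = coord_space (idx M) \<inter> T" using assms(3) by (auto simp: openin_open)
  have "{p \<in> C. \<phi> p \<in> W} = {p \<in> C. \<phi> p \<in> T}" using chartD(4)[OF assms(1,2)] T by auto
  then show ?thesis using chart_openin[OF assms(2) T(1)] by simp
qed

text \<open>Induction over the generation of the topology. Intersections use injectivity of the
  chart; only a generating set, which is given in another chart, involves a transition map.\<close>

lemma openin_mtop_image:
  assumes M: "atlas_ok M" and U: "openin (mtop M) U" and c: "(C, \<phi>) \<in> atlas M"
  shows "copen (idx M) (\<phi> ` (C \<inter> U))"
proof -
  have "generate_topology_on {{p \<in> C. \<phi> p \<in> W} |C \<phi> W. (C, \<phi>) \<in> atlas M \<and> open W} U"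
    using U unfolding mtop_def openin_topology_generated_by_iff .
  then show ?thesis
  proof (induction U)
    case Empty then show ?case by simp
  next
    case (Int a b)
    have "\<phi> ` (C \<inter> (a \<inter> b)) = \<phi> ` (C \<inter> a) \<inter> \<phi> ` (C \<inter> b)"
      using chartD(1)[OF M c] by (auto simp: inj_on_def)
    then show ?case using Int by (simp add: openin_Int)
  next
    case (UN K)
    have "\<phi> ` (C \<inter> \<Union>K) = (\<Union>a\<in>K. \<phi> ` (C \<inter> a))" by auto
    then show ?case using UN by auto
  next
    case (Basis s)
    then obtain D \<psi> W where D: "(D, \<psi>) \<in> atlas M" "open W" "s = {p \<in> D. \<psi> p \<in> W}" by auto
    have "\<phi> ` (C \<inter> s) = {u \<in> \<phi> ` (C \<inter> D). \<psi> (inv_into C \<phi> u) \<in> coord_space (idx M) \<inter> W}"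
      using chartD(1)[OF M c] chartD(4)[OF M D(1)] D(3) by (auto simp: inv_into_f_f)
    moreover have "copen (idx M) \<dots>"
    proof (rule copen_preimage)
      show "copen (idx M) (coord_space (idx M) \<inter> W)" using D(2) by (rule openin_open_Int)
      show "continuous_on (\<phi> ` (C \<inter> D)) (\<lambda>u. \<psi> (inv_into C \<phi> u) j)" if "j \<in> idx M" for j
        using transitionD(2)[OF M c D(1) that] by (rule C_infinityD)
      show "\<psi> (inv_into C \<phi> u) \<in> coord_space (idx M)" if "u \<in> \<phi> ` (C \<inter> D)" for u
        using that chartD(1)[OF M c] chartD(4)[OF M D(1)] by (auto simp: inv_into_f_f)
    qed (rule transitionD(1)[OF M c D(1)])
    ultimately show ?case by simp
  qed
qed

lemma openin_mtop_iff:
  assumes M: "atlas_ok M"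
  shows "openin (mtop M) U \<longleftrightarrow> U \<subseteq> pts M \<and> (\<forall>(C, \<phi>)\<in>atlas M. copen (idx M) (\<phi> ` (C \<inter> U)))"
proof
  assume "openin (mtop M) U"
  then show "U \<subseteq> pts M \<and> (\<forall>(C, \<phi>)\<in>atlas M. copen (idx M) (\<phi> ` (C \<inter> U)))"
    using openin_mtop_image[OF M] openin_pts by blast
next
  assume U: "U \<subseteq> pts M \<and> (\<forall>(C, \<phi>)\<in>atlas M. copen (idx M) (\<phi> ` (C \<inter> U)))"
  show "openin (mtop M) U"
  proof (subst openin_subopen, intro ballI)
    fix p assume p: "p \<in> U"
    then obtain C \<phi> where c: "(C, \<phi>) \<in> atlas M" "p \<in> C" using U by (meson pts_chart subsetD)
    have "openin (mtop M) {q \<in> C. \<phi> q \<in> \<phi> ` (C \<inter> U)}"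
      using U c by (intro chart_copenin[OF M]) auto
    moreover have "{q \<in> C. \<phi> q \<in> \<phi> ` (C \<inter> U)} = C \<inter> U"
      using chartD(1)[OF M c(1)] by (auto simp: inj_on_def)
    ultimately show "\<exists>T. openin (mtop M) T \<and> p \<in> T \<and> T \<subseteq> U" using p c by auto
  qed
qed

text \<open>Real functions on open sets are the common language of what follows: coordinates are of
  this kind, and maps are handled through the functions they pull back. Openness is built in so that
  domains need no separate hypothesis.\<close>

definition smooth_on :: "('a, 'i) mfd \<Rightarrow> 'a set \<Rightarrow> ('a \<Rightarrow> real) \<Rightarrow> bool" where
  "smooth_on M U h \<longleftrightarrow> openin (mtop M) U \<and>
    (\<forall>(C, \<phi>)\<in>atlas M. C_infinity (idx M) (\<phi> ` (C \<inter> U)) (\<lambda>u. h (inv_into C \<phi> u)))"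

lemma smooth_on_openin: "smooth_on M U h \<Longrightarrow> openin (mtop M) U"
  by (simp add: smooth_on_def)

lemma smooth_on_subset:
  assumes "smooth_on M U h" "openin (mtop M) V" "V \<subseteq> U"
  shows "smooth_on M V h"
  using assms unfolding smooth_on_def by (force intro: C_infinity_subset)

lemma smooth_on_local:
  assumes M: "atlas_ok M" and U: "openin (mtop M) U"
    and *: "\<And>p. p \<in> U \<Longrightarrow> \<exists>V. p \<in> V \<and> smooth_on M V h"
  shows "smooth_on M U h"
  unfolding smooth_on_def
proof (intro conjI U ballI, clarify)
  fix C \<phi> assume c: "(C, \<phi>) \<in> atlas M"
  show "C_infinity (idx M) (\<phi> ` (C \<inter> U)) (\<lambda>u. h (inv_into C \<phi> u))"
  proof (rule C_infinity_local[OF _ openin_mtop_image[OF M U c] atlas_ok_finite[OF M]])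
    fix x assume "x \<in> \<phi> ` (C \<inter> U)"
    then obtain p where p: "p \<in> C" "p \<in> U" "x = \<phi> p" by auto
    obtain V where V: "p \<in> V" "smooth_on M V h" using *[OF p(2)] by blast
    show "\<exists>V. copen (idx M) V \<and> x \<in> V \<and> C_infinity (idx M) V (\<lambda>u. h (inv_into C \<phi> u))"
      using p V c openin_mtop_image[OF M smooth_on_openin[OF V(2)] c]
      by (intro exI[of _ "\<phi> ` (C \<inter> V)"]) (auto simp: smooth_on_def)
  qed
qed

lemma inv_into_image: "inj_on \<phi> C \<Longrightarrow> u \<in> \<phi> ` (C \<inter> U) \<Longrightarrow> inv_into C \<phi> u \<in> C \<inter> U \<and> \<phi> (inv_into C \<phi> u) = u"
  by (auto simp: inv_into_f_f)

lemma smooth_on_cong: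
  assumes M: "atlas_ok M" and h: "smooth_on M U h" and eq: "\<And>p. p \<in> U \<Longrightarrow> h p = k p"
  shows "smooth_on M U k"
  unfolding smooth_on_def
proof (intro conjI smooth_on_openin[OF h] ballI, clarify)
  fix C \<phi> assume c: "(C, \<phi>) \<in> atlas M"
  show "C_infinity (idx M) (\<phi> ` (C \<inter> U)) (\<lambda>u. k (inv_into C \<phi> u))"
  proof (rule C_infinity_cong[OF _ _ openin_mtop_image[OF M smooth_on_openin[OF h] c] atlas_ok_finite[OF M]])
    show "C_infinity (idx M) (\<phi> ` (C \<inter> U)) (\<lambda>u. h (inv_into C \<phi> u))"
      using h c by (auto simp: smooth_on_def)
    show "h (inv_into C \<phi> u) = k (inv_into C \<phi> u)" if "u \<in> \<phi> ` (C \<inter> U)" for u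
      using inv_into_image[OF chartD(1)[OF M c] that] eq by auto
  qed
qed

lemma smooth_on_const: "atlas_ok M \<Longrightarrow> openin (mtop M) U \<Longrightarrow> smooth_on M U (\<lambda>p. c)"
  unfolding smooth_on_def
  by (auto intro!: C_infinity_const openin_mtop_image dest: atlas_ok_finite)

lemma smooth_on_add:
  "atlas_ok M \<Longrightarrow> smooth_on M U f \<Longrightarrow> smooth_on M U g \<Longrightarrow> smooth_on M U (\<lambda>p. f p + g p)"
  unfolding smooth_on_def
  by (auto intro!: C_infinity_add openin_mtop_image dest: atlas_ok_finite)

lemma smooth_on_mult:
  "atlas_ok M \<Longrightarrow> smooth_on M U f \<Longrightarrow> smooth_on M U g \<Longrightarrow> smooth_on M U (\<lambda>p. f p * g p)"
  unfolding smooth_on_def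
  by (auto intro!: C_infinity_mult openin_mtop_image dest: atlas_ok_finite)

lemma smooth_on_sum:
  assumes "atlas_ok M" "openin (mtop M) U" "\<And>j. j \<in> J \<Longrightarrow> smooth_on M U (f j)"
  shows "smooth_on M U (\<lambda>p. \<Sum>j\<in>J. f j p)"
  using assms(3)
  by (induction J rule: infinite_finite_induct) (auto intro: smooth_on_const smooth_on_add assms(1,2))

lemma smooth_on_prod:
  assumes "atlas_ok M" "openin (mtop M) U" "\<And>j. j \<in> J \<Longrightarrow> smooth_on M U (f j)"
  shows "smooth_on M U (\<lambda>p. \<Prod>j\<in>J. f j p)"
  using assms(3)
  by (induction J rule: infinite_finite_induct) (auto intro: smooth_on_const smooth_on_mult assms(1,2))

lemma smooth_on_diff:
  assumes "atlas_ok M" "smooth_on M U f" "smooth_on M U g"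
  shows "smooth_on M U (\<lambda>p. f p - g p)"
  using smooth_on_add[OF assms(1,2) smooth_on_mult[OF assms(1) smooth_on_const[OF assms(1), of U "-1"] assms(3)]]
    smooth_on_openin[OF assms(2)] by simp

lemma smooth_on_inverse:
  assumes M: "atlas_ok M" and f: "smooth_on M U f" "\<And>p. p \<in> U \<Longrightarrow> f p \<noteq> 0"
  shows "smooth_on M U (\<lambda>p. inverse (f p))"
  unfolding smooth_on_def
proof (intro conjI smooth_on_openin[OF f(1)] ballI, clarify)
  fix C \<phi> assume c: "(C, \<phi>) \<in> atlas M"
  show "C_infinity (idx M) (\<phi> ` (C \<inter> U)) (\<lambda>u. inverse (f (inv_into C \<phi> u)))"
    using f c inv_into_image[OF chartD(1)[OF M c]]
      openin_mtop_image[OF M smooth_on_openin[OF f(1)] c] atlas_ok_finite[OF M]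
    by (intro C_infinity_inverse) (force simp: smooth_on_def)+
qed

lemma smooth_on_compose:
  assumes M: "atlas_ok M" and U: "openin (mtop M) U"
    and g: "C_infinity J V g" "copen J V" "finite J"
    and f: "\<And>j. j \<in> J \<Longrightarrow> smooth_on M U (\<lambda>p. f p j)" "\<And>p. p \<in> U \<Longrightarrow> f p \<in> V"
  shows "smooth_on M U (\<lambda>p. g (f p))"
  unfolding smooth_on_def
proof (intro conjI U ballI, clarify)
  fix C \<phi> assume c: "(C, \<phi>) \<in> atlas M"
  show "C_infinity (idx M) (\<phi> ` (C \<inter> U)) (\<lambda>u. g (f (inv_into C \<phi> u)))"
  proof (rule C_infinity_compose[OF g(1) _ _ openin_mtop_image[OF M U c] atlas_ok_finite[OF M] g(2,3)])
    show "C_infinity (idx M) (\<phi> ` (C \<inter> U)) (\<lambda>u. f (inv_into C \<phi> u) j)" if "j \<in> J" for j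
      using f(1)[OF that] c by (auto simp: smooth_on_def)
    show "f (inv_into C \<phi> u) \<in> V" if "u \<in> \<phi> ` (C \<inter> U)" for u
      using inv_into_image[OF chartD(1)[OF M c] that] f(2) by auto
  qed
qed

lemma smooth_on_preimage:
  assumes M: "atlas_ok M" and U: "openin (mtop M) U" and V: "copen J V"
    and f: "\<And>j. j \<in> J \<Longrightarrow> smooth_on M U (\<lambda>p. f p j)" "\<And>p. p \<in> U \<Longrightarrow> f p \<in> coord_space J"
  shows "openin (mtop M) {p \<in> U. f p \<in> V}"
  unfolding openin_mtop_iff[OF M]
proof (intro conjI ballI, use openin_pts[OF U] in blast, clarify)
  fix C \<phi> assume c: "(C, \<phi>) \<in> atlas M"
  have "copen (idx M) {u \<in> \<phi> ` (C \<inter> U). f (inv_into C \<phi> u) \<in> V}"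
  proof (rule copen_preimage[OF openin_mtop_image[OF M U c] V])
    show "continuous_on (\<phi> ` (C \<inter> U)) (\<lambda>u. f (inv_into C \<phi> u) j)" if "j \<in> J" for j
      using f(1)[OF that] c by (auto simp: smooth_on_def intro: C_infinityD)
    show "f (inv_into C \<phi> u) \<in> coord_space J" if "u \<in> \<phi> ` (C \<inter> U)" for u
      using inv_into_image[OF chartD(1)[OF M c] that] f(2) by auto
  qed
  moreover have "{u \<in> \<phi> ` (C \<inter> U). f (inv_into C \<phi> u) \<in> V} = \<phi> ` (C \<inter> {p \<in> U. f p \<in> V})"
    using chartD(1)[OF M c] by (auto simp: inv_into_f_f)
  ultimately show "copen (idx M) (\<phi> ` (C \<inter> {p \<in> U. f p \<in> V}))" by simp
qed

section \<open>Charts compatible with the atlas\<close>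

lemma max_chartD:
  assumes M: "atlas_ok M" and c: "(C, \<phi>) \<in> max_atlas M"
  shows "inj_on \<phi> C" "copen (idx M) (\<phi> ` C)" "C \<subseteq> pts M" "p \<in> C \<Longrightarrow> \<phi> p \<in> coord_space (idx M)"
    "openin (mtop M) C" "smooth_on M C (\<lambda>p. \<phi> p i)"
proof -
  show inj: "inj_on \<phi> C" and co: "copen (idx M) (\<phi> ` C)" and pts: "C \<subseteq> pts M"
    using c by (auto simp: max_atlas_def is_chart_def)
  show cs: "\<phi> p \<in> coord_space (idx M)" if "p \<in> C" for p using co copen_subset that by blast
  show op: "openin (mtop M) C"
    using c pts unfolding openin_mtop_iff[OF M] by (auto simp: max_atlas_def smooth_transition_def)
  show "smooth_on M C (\<lambda>p. \<phi> p i)"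
  proof (cases "i \<in> idx M")
    case True
    then show ?thesis using c op by (auto simp: smooth_on_def max_atlas_def smooth_transition_def)
  next
    case False
    show ?thesis
      by (rule smooth_on_cong[OF M smooth_on_const[OF M op, of 0]]) (use cs False in \<open>auto simp: coord_space_def\<close>)
  qed
qed

lemma max_chart_copen:
  assumes M: "atlas_ok M" and c: "(C, \<phi>) \<in> max_atlas M" and W: "copen (idx M) W"
  shows "openin (mtop M) {p \<in> C. \<phi> p \<in> W}"
  using max_chartD[OF M c] by (intro smooth_on_preimage[OF M _ W]) auto

lemma max_chart_transition:
  assumes M: "atlas_ok M" and c: "(C, \<phi>) \<in> max_atlas M" and d: "(D, \<psi>) \<in> atlas M"
    and U: "openin (mtop M) U"
  shows "copen (idx M) (\<phi> ` (C \<inter> (D \<inter> U)))"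
    "j \<in> idx M \<Longrightarrow> C_infinity (idx M) (\<phi> ` (C \<inter> (D \<inter> U))) (\<lambda>u. \<psi> (inv_into C \<phi> u) j)"
proof -
  have tr: "copen (idx M) (\<phi> ` (C \<inter> D))"
    "\<And>j. j \<in> idx M \<Longrightarrow> C_infinity (idx M) (\<phi> ` (C \<inter> D)) (\<lambda>u. \<psi> (inv_into C \<phi> u) j)"
    using c d by (auto simp: max_atlas_def smooth_transition_def)
  then show "j \<in> idx M \<Longrightarrow> C_infinity (idx M) (\<phi> ` (C \<inter> (D \<inter> U))) (\<lambda>u. \<psi> (inv_into C \<phi> u) j)"
    by (auto intro: C_infinity_subset)
  have "\<phi> ` (C \<inter> (D \<inter> U)) = {u \<in> \<phi> ` (C \<inter> D). \<psi> (inv_into C \<phi> u) \<in> \<psi> ` (D \<inter> U)}"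
    using inv_into_filter[OF max_chartD(1)[OF M c], of D "\<lambda>p. \<psi> p \<in> \<psi> ` (D \<inter> U)"]
      chartD(1)[OF M d] by (auto dest: inj_onD)
  moreover have "copen (idx M) \<dots>"
  proof (rule copen_preimage[OF tr(1) openin_mtop_image[OF M U d]])
    show "\<psi> (inv_into C \<phi> u) \<in> coord_space (idx M)" if "u \<in> \<phi> ` (C \<inter> D)" for u
      using inv_into_image[OF max_chartD(1)[OF M c] that] chartD(4)[OF M d] by auto
  qed (rule C_infinityD(1)[OF tr(2)])
  ultimately show "copen (idx M) (\<phi> ` (C \<inter> (D \<inter> U)))" by simp
qed

lemma max_chart_image:
  assumes M: "atlas_ok M" and c: "(C, \<phi>) \<in> max_atlas M" and U: "openin (mtop M) U"
  shows "copen (idx M) (\<phi> ` (C \<inter> U))"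
proof (subst openin_subopen, intro ballI)
  fix x assume "x \<in> \<phi> ` (C \<inter> U)"
  then obtain p where p: "p \<in> C" "p \<in> U" "x = \<phi> p" by auto
  obtain D \<psi> where d: "(D, \<psi>) \<in> atlas M" "p \<in> D" by (rule openin_chart[OF U p(2)])
  show "\<exists>T. copen (idx M) T \<and> x \<in> T \<and> T \<subseteq> \<phi> ` (C \<inter> U)"
    using max_chart_transition(1)[OF M c d(1) U] p d
    by (intro exI[of _ "\<phi> ` (C \<inter> (D \<inter> U))"]) auto
qed

text \<open>Near each point the function is read in an atlas chart and composed with the transition
  map; locality of smoothness glues the pieces.\<close>

lemma max_chart_smooth:
  assumes M: "atlas_ok M" and c: "(C, \<phi>) \<in> max_atlas M" and h: "smooth_on M U h"
  shows "C_infinity (idx M) (\<phi> ` (C \<inter> U)) (\<lambda>u. h (inv_into C \<phi> u))"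
proof (rule C_infinity_local[OF _ max_chart_image[OF M c smooth_on_openin[OF h]] atlas_ok_finite[OF M]])
  fix x assume "x \<in> \<phi> ` (C \<inter> U)"
  then obtain p where p: "p \<in> C" "p \<in> U" "x = \<phi> p" by auto
  have U: "openin (mtop M) U" using h by (rule smooth_on_openin)
  obtain D \<psi> where d: "(D, \<psi>) \<in> atlas M" "p \<in> D" by (rule openin_chart[OF U p(2)])
  have hd: "C_infinity (idx M) (\<psi> ` (D \<inter> U)) (\<lambda>u. h (inv_into D \<psi> u))"
    using h d by (auto simp: smooth_on_def)
  note fin = atlas_ok_finite[OF M]
  have "C_infinity (idx M) (\<phi> ` (C \<inter> (D \<inter> U))) (\<lambda>u. h (inv_into D \<psi> (\<psi> (inv_into C \<phi> u))))"
  proof (rule C_infinity_compose[OF hd max_chart_transition(2)[OF M c d(1) U] _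
        max_chart_transition(1)[OF M c d(1) U] fin openin_mtop_image[OF M U d(1)] fin])
    show "\<psi> (inv_into C \<phi> u) \<in> \<psi> ` (D \<inter> U)" if "u \<in> \<phi> ` (C \<inter> (D \<inter> U))" for u
      using inv_into_image[OF max_chartD(1)[OF M c] that] by auto
  qed
  then have "C_infinity (idx M) (\<phi> ` (C \<inter> (D \<inter> U))) (\<lambda>u. h (inv_into C \<phi> u))"
  proof (rule C_infinity_cong[OF _ _ max_chart_transition(1)[OF M c d(1) U] fin])
    show "h (inv_into D \<psi> (\<psi> (inv_into C \<phi> u))) = h (inv_into C \<phi> u)" if "u \<in> \<phi> ` (C \<inter> (D \<inter> U))" for u
      using inv_into_image[OF max_chartD(1)[OF M c] that] chartD(1)[OF M d(1)] by (simp add: inv_into_f_f)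
  qed
  then show "\<exists>V. copen (idx M) V \<and> x \<in> V \<and> C_infinity (idx M) V (\<lambda>u. h (inv_into C \<phi> u))"
    using max_chart_transition(1)[OF M c d(1) U] p d by (intro exI[of _ "\<phi> ` (C \<inter> (D \<inter> U))"]) auto
qed

lemma chart_open_domain:
  assumes M: "atlas_ok M" and c: "(C, \<phi>) \<in> atlas M"
  shows "openin (mtop M) C"
  using transitionD(1)[OF M _ c] chartD(3)[OF M c] by (auto simp: openin_mtop_iff[OF M])

lemma atlas_max_atlas: "atlas_ok M \<Longrightarrow> c \<in> atlas M \<Longrightarrow> c \<in> max_atlas M"
  using chartD(3)[of M "fst c" "snd c"] by (simp add: max_atlas_def atlas_ok_def)

text \<open>Transition maps out of the new chart are the case of \<open>s'\<close> in which
  \<open>h\<close> is a coordinate of an atlas chart; those into it are the smoothness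
  \<open>s\<close> of its own coordinates.\<close>

lemma max_atlasI:
  assumes M: "atlas_ok M" and C: "openin (mtop M) C" and inj: "inj_on \<phi> C"
    and s: "\<And>i. i \<in> idx M \<Longrightarrow> smooth_on M C (\<lambda>p. \<phi> p i)"
    and co: "\<And>U. openin (mtop M) U \<Longrightarrow> copen (idx M) (\<phi> ` (C \<inter> U))"
    and s': "\<And>U h. smooth_on M U h \<Longrightarrow> C_infinity (idx M) (\<phi> ` (C \<inter> U)) (\<lambda>u. h (inv_into C \<phi> u))"
  shows "(C, \<phi>) \<in> max_atlas M"
proof -
  have "smooth_transition (idx M) (C, \<phi>) d \<and> smooth_transition (idx M) d (C, \<phi>)"
    if d: "d \<in> atlas M" for d
  proof (cases d)
    case (Pair D \<psi>)
    have d': "(D, \<psi>) \<in> atlas M" using d Pair by simp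
    note dm = max_chartD[OF M atlas_max_atlas[OF M d']]
    have "C_infinity (idx M) (\<psi> ` (D \<inter> C)) (\<lambda>u. \<phi> (inv_into D \<psi> u) j)" if "j \<in> idx M" for j
      using s[OF that] d' by (auto simp: smooth_on_def)
    then show ?thesis
      using s'[OF dm(6)] co[OF dm(5)] openin_mtop_image[OF M C d']
      by (auto simp: smooth_transition_def Pair)
  qed
  moreover have "copen (idx M) (\<phi> ` C)" using co[OF C] by simp
  ultimately show ?thesis using inj openin_pts[OF C] by (auto simp: max_atlas_def is_chart_def)
qed

lemma max_atlas_restrict:
  assumes M: "atlas_ok M" and c: "(C, \<phi>) \<in> max_atlas M" and U: "openin (mtop M) U"
  shows "(C \<inter> U, \<phi>) \<in> max_atlas M"
proof (rule max_atlasI[OF M])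
  note cD = max_chartD[OF M c]
  show o: "openin (mtop M) (C \<inter> U)" using cD(5) U by (rule openin_Int)
  show inj: "inj_on \<phi> (C \<inter> U)" using cD(1) by (auto simp: inj_on_def)
  show "smooth_on M (C \<inter> U) (\<lambda>p. \<phi> p i)" for i
    using smooth_on_subset[OF cD(6) o] by simp
  show co: "copen (idx M) (\<phi> ` (C \<inter> U \<inter> V))" if "openin (mtop M) V" for V
    using max_chart_image[OF M c openin_Int[OF U that]] by (simp add: Int_assoc)
  fix V h assume h: "smooth_on M V h"
  have "C_infinity (idx M) (\<phi> ` (C \<inter> U \<inter> V)) (\<lambda>u. h (inv_into C \<phi> u))"
    using max_chart_smooth[OF M c h] by (rule C_infinity_subset) auto
  then show "C_infinity (idx M) (\<phi> ` (C \<inter> U \<inter> V)) (\<lambda>u. h (inv_into (C \<inter> U) \<phi> u))"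
    by (rule C_infinity_cong[OF _ _ co[OF smooth_on_openin[OF h]] atlas_ok_finite[OF M]])
      (use inj cD(1) in \<open>auto simp: inv_into_f_f\<close>)
qed

section \<open>Smooth maps\<close>

lemma smooth_mapD:
  assumes f: "smooth_map M N f"
  shows "p \<in> pts M \<Longrightarrow> f p \<in> pts N"
    "openin (mtop N) V \<Longrightarrow> openin (mtop M) {p \<in> pts M. f p \<in> V}"
proof -
  have c: "continuous_map (mtop M) (mtop N) f" using f by (simp add: smooth_map_def)
  show "f p \<in> pts N" if "p \<in> pts M"
    using continuous_map_image_subset_topspace[OF c] that by (auto simp: topspace_mtop)
  show "openin (mtop M) {p \<in> pts M. f p \<in> V}" if "openin (mtop N) V"
    using openin_continuous_map_preimage[OF c that] by (simp add: topspace_mtop)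
qed

lemma smooth_map_chart:
  assumes M: "atlas_ok M" and N: "atlas_ok N" and f: "smooth_map M N f" and d: "(D, \<psi>) \<in> atlas N"
    and j: "j \<in> idx N"
  shows "smooth_on M {p \<in> pts M. f p \<in> D} (\<lambda>p. \<psi> (f p) j)"
  unfolding smooth_on_def
proof (intro conjI smooth_mapD(2)[OF f] chart_open_domain[OF N d] ballI, clarify)
  fix C \<phi> assume c: "(C, \<phi>) \<in> atlas M"
  have "C \<inter> {p \<in> pts M. f p \<in> D} = {p \<in> C. f p \<in> D}" using chartD(3)[OF M c] by auto
  then show "C_infinity (idx M) (\<phi> ` (C \<inter> {p \<in> pts M. f p \<in> D})) (\<lambda>u. \<psi> (f (inv_into C \<phi> u)) j)"
    using f c d j unfolding smooth_map_def by fastforce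
qed

text \<open>Near \<open>p\<close> the function \<open>h\<close> is read in a chart around
  \<open>f p\<close>, in which the components of \<open>f\<close> are smooth by definition.\<close>

lemma smooth_on_pullback:
  assumes M: "atlas_ok M" and N: "atlas_ok N" and f: "smooth_map M N f" and h: "smooth_on N V h"
  shows "smooth_on M {p \<in> pts M. f p \<in> V} (\<lambda>p. h (f p))"
proof (rule smooth_on_local[OF M smooth_mapD(2)[OF f smooth_on_openin[OF h]]])
  note V = smooth_on_openin[OF h]
  fix p assume p: "p \<in> {p \<in> pts M. f p \<in> V}"
  then have "f p \<in> V" by simp
  then obtain D \<psi> where d: "(D, \<psi>) \<in> atlas N" "f p \<in> D" by (rule openin_chart[OF V])
  note dm = max_chartD[OF N atlas_max_atlas[OF N d(1)]]
  define U where "U = {p \<in> pts M. f p \<in> D \<inter> V}"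
  have U: "openin (mtop M) U" unfolding U_def
    by (rule smooth_mapD(2)[OF f openin_Int[OF dm(5) V]])
  have "smooth_on M U (\<lambda>p. h (inv_into D \<psi> (\<psi> (f p))))"
  proof (rule smooth_on_compose[OF M U, where J = "idx N" and V = "\<psi> ` (D \<inter> V)" and f = "\<lambda>p. \<psi> (f p)"])
    show "C_infinity (idx N) (\<psi> ` (D \<inter> V)) (\<lambda>u. h (inv_into D \<psi> u))"
      using h d by (auto simp: smooth_on_def)
    show "copen (idx N) (\<psi> ` (D \<inter> V))" by (rule openin_mtop_image[OF N V d(1)])
    show "smooth_on M U (\<lambda>p. \<psi> (f p) j)" if "j \<in> idx N" for j
      by (rule smooth_on_subset[OF smooth_map_chart[OF M N f d(1) that] U]) (auto simp: U_def)
  qed (auto simp: U_def atlas_ok_finite[OF N])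
  then have "smooth_on M U (\<lambda>p. h (f p))"
    by (rule smooth_on_cong[OF M]) (use dm(1) in \<open>auto simp: U_def inv_into_f_f\<close>)
  then show "\<exists>U. p \<in> U \<and> smooth_on M U (\<lambda>p. h (f p))" using p d by (intro exI[of _ U]) (auto simp: U_def)
qed

lemma smooth_map_max_chart:
  assumes M: "atlas_ok M" and N: "atlas_ok N" and f: "smooth_map M N f" and d: "(D, \<psi>) \<in> max_atlas N"
  shows "smooth_on M {p \<in> pts M. f p \<in> D} (\<lambda>p. \<psi> (f p) j)"
  using smooth_on_pullback[OF M N f max_chartD(6)[OF N d]] .

text \<open>The definition demands continuity and a condition for all pairs of atlas charts; here
  one compatible chart around each image point suffices. Continuity comes out as well, because chart
  images of open sets are open and have open preimages under the smooth components.\<close>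

lemma smooth_mapI:
  assumes M: "atlas_ok M" and N: "atlas_ok N"
    and *: "\<And>p. p \<in> pts M \<Longrightarrow> \<exists>U D \<psi>. openin (mtop M) U \<and> p \<in> U \<and> (D, \<psi>) \<in> max_atlas N \<and>
      (\<forall>q\<in>U. f q \<in> D) \<and> (\<forall>j\<in>idx N. smooth_on M U (\<lambda>q. \<psi> (f q) j))"
  shows "smooth_map M N f"
proof -
  have fp: "f p \<in> pts N" if p: "p \<in> pts M" for p
  proof -
    obtain U D \<psi> where "p \<in> U" "(D, \<psi>) \<in> max_atlas N" "\<forall>q\<in>U. f q \<in> D" using *[OF p] by blast
    then show ?thesis using max_chartD(3)[OF N] by blast
  qed
  have loc: "\<exists>U. openin (mtop M) U \<and> p \<in> U \<and> (\<forall>q\<in>U. f q \<in> V) \<and> (\<forall>h. smooth_on N V h \<longrightarrow> smooth_on M U (\<lambda>q. h (f q)))"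
    if p: "p \<in> pts M" "f p \<in> V" and V: "openin (mtop N) V" for p V
  proof -
    obtain U D \<psi> where U: "openin (mtop M) U" "p \<in> U" "(D, \<psi>) \<in> max_atlas N" "\<forall>q\<in>U. f q \<in> D"
      "\<forall>j\<in>idx N. smooth_on M U (\<lambda>q. \<psi> (f q) j)" using *[OF p(1)] by blast
    note dm = max_chartD[OF N U(3)]
    define U' where "U' = {q \<in> U. \<psi> (f q) \<in> \<psi> ` (D \<inter> V)}"
    have co: "copen (idx N) (\<psi> ` (D \<inter> V))" by (rule max_chart_image[OF N U(3) V])
    have U': "openin (mtop M) U'" unfolding U'_def
      by (rule smooth_on_preimage[OF M U(1) co]) (use U dm(4) in auto)
    have fV: "f q \<in> V" if "q \<in> U'" for q
      using that U(4) dm(1) by (auto simp: U'_def inj_on_def)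
    have "smooth_on M U' (\<lambda>q. h (f q))" if h: "smooth_on N V h" for h
    proof -
      have "smooth_on M U' (\<lambda>q. h (inv_into D \<psi> (\<psi> (f q))))"
      proof (rule smooth_on_compose[OF M U' max_chart_smooth[OF N U(3) h] co atlas_ok_finite[OF N]])
        show "smooth_on M U' (\<lambda>q. \<psi> (f q) j)" if "j \<in> idx N" for j
          using U(5) that by (intro smooth_on_subset[OF _ U']) (auto simp: U'_def)
      qed (auto simp: U'_def)
      then show ?thesis
        by (rule smooth_on_cong[OF M]) (use dm(1) U(4) in \<open>auto simp: U'_def inv_into_f_f\<close>)
    qed
    moreover have "p \<in> U'" using U(2,4) p by (simp add: U'_def)
    ultimately show ?thesis using U' fV by (intro exI[of _ U'] conjI ballI allI impI)
  qed
  have "continuous_map (mtop M) (mtop N) f"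
    unfolding continuous_map topspace_mtop
  proof (intro conjI allI impI)
    fix V assume V: "openin (mtop N) V"
    show "openin (mtop M) {p \<in> pts M. f p \<in> V}"
    proof (subst openin_subopen, intro ballI)
      fix p assume "p \<in> {p \<in> pts M. f p \<in> V}"
      then obtain U where "openin (mtop M) U" "p \<in> U" "\<forall>q\<in>U. f q \<in> V" using loc[OF _ _ V] by blast
      then show "\<exists>T. openin (mtop M) T \<and> p \<in> T \<and> T \<subseteq> {p \<in> pts M. f p \<in> V}"
        using openin_pts by blast
    qed
  qed (use fp in auto)
  moreover have "C_infinity (idx M) (\<phi> ` {p \<in> C. f p \<in> D}) (\<lambda>u. \<psi> (f (inv_into C \<phi> u)) j)"
    if c: "(C, \<phi>) \<in> atlas M" and d: "(D, \<psi>) \<in> atlas N" and j: "j \<in> idx N" for C \<phi> D \<psi> j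
  proof -
    note dm = max_chartD[OF N atlas_max_atlas[OF N d]]
    have "openin (mtop M) {p \<in> pts M. f p \<in> D}"
      using openin_continuous_map_preimage[OF calculation dm(5)] by (simp add: topspace_mtop)
    then have "smooth_on M {p \<in> pts M. f p \<in> D} (\<lambda>p. \<psi> (f p) j)"
    proof (rule smooth_on_local[OF M])
      fix p assume "p \<in> {p \<in> pts M. f p \<in> D}"
      then show "\<exists>V. p \<in> V \<and> smooth_on M V (\<lambda>p. \<psi> (f p) j)"
        using loc[OF _ _ dm(5), of p] dm(6) by blast
    qed
    moreover have "C \<inter> {p \<in> pts M. f p \<in> D} = {p \<in> C. f p \<in> D}" using chartD(3)[OF M c] by auto
    ultimately show ?thesis using c unfolding smooth_on_def by fastforce
  qed
  ultimately show ?thesis unfolding smooth_map_def by auto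
qed

lemma smooth_map_compose:
  assumes M: "atlas_ok M" and N: "atlas_ok N" and P: "atlas_ok P"
    and f: "smooth_map M N f" and g: "smooth_map N P g"
  shows "smooth_map M P (\<lambda>p. g (f p))"
proof (rule smooth_mapI[OF M P])
  fix p assume p: "p \<in> pts M"
  then have "g (f p) \<in> pts P" by (intro smooth_mapD(1)[OF g] smooth_mapD(1)[OF f])
  then obtain D \<psi> where d: "(D, \<psi>) \<in> atlas P" "g (f p) \<in> D" by (rule pts_chart)
  note sg = smooth_map_max_chart[OF N P g atlas_max_atlas[OF P d(1)]]
  show "\<exists>U D \<psi>. openin (mtop M) U \<and> p \<in> U \<and> (D, \<psi>) \<in> max_atlas P \<and> (\<forall>q\<in>U. g (f q) \<in> D) \<and>
      (\<forall>j\<in>idx P. smooth_on M U (\<lambda>q. \<psi> (g (f q)) j))"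
    using smooth_on_pullback[OF M N f sg] smooth_mapD(2)[OF f smooth_on_openin[OF sg]]
      atlas_max_atlas[OF P d(1)] d(2) p smooth_mapD(1)[OF f p]
    by (intro exI[of _ "{q \<in> pts M. f q \<in> {y \<in> pts N. g y \<in> D}}"] exI[of _ D] exI[of _ \<psi>]) auto
qed

lemma smooth_map_cong:
  assumes M: "atlas_ok M" and N: "atlas_ok N" and f: "smooth_map M N f" and eq: "\<And>p. p \<in> pts M \<Longrightarrow> f p = g p"
  shows "smooth_map M N g"
proof (rule smooth_mapI[OF M N])
  fix p assume p: "p \<in> pts M"
  then obtain D \<psi> where d: "(D, \<psi>) \<in> atlas N" "f p \<in> D" by (rule pts_chart[OF smooth_mapD(1)[OF f]])
  note sf = smooth_map_max_chart[OF M N f atlas_max_atlas[OF N d(1)]]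
  have "smooth_on M {q \<in> pts M. f q \<in> D} (\<lambda>q. \<psi> (g q) j)" for j
    by (rule smooth_on_cong[OF M sf]) (use eq in auto)
  then show "\<exists>U D \<psi>. openin (mtop M) U \<and> p \<in> U \<and> (D, \<psi>) \<in> max_atlas N \<and>
      (\<forall>q\<in>U. g q \<in> D) \<and> (\<forall>j\<in>idx N. smooth_on M U (\<lambda>q. \<psi> (g q) j))"
    using atlas_max_atlas[OF N d(1)] d(2) p eq smooth_on_openin[OF sf]
    by (intro exI[of _ "{q \<in> pts M. f q \<in> D}"] exI[of _ D] exI[of _ \<psi>]) auto
qed

lemma smooth_map_ident:
  assumes M: "atlas_ok M" shows "smooth_map M M (\<lambda>p. p)"
proof (rule smooth_mapI[OF M M])
  fix p assume "p \<in> pts M"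
  then obtain D \<psi> where d: "(D, \<psi>) \<in> atlas M" "p \<in> D" by (rule pts_chart)
  note dm = atlas_max_atlas[OF M d(1)]
  show "\<exists>U D \<psi>. openin (mtop M) U \<and> p \<in> U \<and> (D, \<psi>) \<in> max_atlas M \<and>
      (\<forall>q\<in>U. q \<in> D) \<and> (\<forall>j\<in>idx M. smooth_on M U (\<lambda>q. \<psi> q j))"
    using dm d(2) max_chartD(5,6)[OF M dm] by blast
qed

lemma smooth_map_const:
  assumes M: "atlas_ok M" and N: "atlas_ok N" and c: "c \<in> pts N"
  shows "smooth_map M N (\<lambda>p. c)"
proof (rule smooth_mapI[OF M N])
  fix p assume "p \<in> pts M"
  obtain D \<psi> where d: "(D, \<psi>) \<in> atlas N" "c \<in> D" using c by (rule pts_chart)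
  then show "\<exists>U D \<psi>. openin (mtop M) U \<and> p \<in> U \<and> (D, \<psi>) \<in> max_atlas N \<and>
      (\<forall>q\<in>U. c \<in> D) \<and> (\<forall>j\<in>idx N. smooth_on M U (\<lambda>q. \<psi> c j))"
    using atlas_max_atlas[OF N] \<open>p \<in> pts M\<close> smooth_on_const[OF M openin_mtop_pts]
    by (intro exI[of _ "pts M"] exI[of _ D] exI[of _ \<psi>]) auto
qed

section \<open>Partial derivatives in charts and curves\<close>

definition dpart :: "('a, 'i) chart \<Rightarrow> 'i \<Rightarrow> ('a \<Rightarrow> real) \<Rightarrow> 'a \<Rightarrow> real" where
  "dpart c i h p = pd i (\<lambda>u. h (inv_into (fst c) (snd c) u)) (snd c p)"

lemma smooth_on_dpart:
  assumes M: "atlas_ok M" and c: "(C, \<phi>) \<in> max_atlas M" and h: "smooth_on M U h" and i: "i \<in> idx M"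
  shows "smooth_on M (C \<inter> U) (dpart (C, \<phi>) i h)"
proof -
  note cm = max_chartD[OF M c]
  have o: "openin (mtop M) (C \<inter> U)" using cm(5) smooth_on_openin[OF h] by (rule openin_Int)
  have "smooth_on M (C \<inter> U) (\<lambda>p. pd i (\<lambda>u. h (inv_into C \<phi> u)) (\<phi> p))"
    by (rule smooth_on_compose[OF M o C_infinityD(3)[OF max_chart_smooth[OF M c h] i]
          max_chart_image[OF M c smooth_on_openin[OF h]] atlas_ok_finite[OF M]])
      (use smooth_on_subset[OF cm(6) o] in auto)
  then show ?thesis by (simp add: dpart_def[abs_def])
qed

text \<open>A tangent vector in disguise: continuity and differentiability are required at time 0
  only. This is stable under smooth maps and enough for the chain rule.\<close>

definition curve :: "('a, 'i) mfd \<Rightarrow> 'a \<Rightarrow> (real \<Rightarrow> 'a) \<Rightarrow> bool" where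
  "curve M p \<gamma> \<longleftrightarrow> \<gamma> 0 = p \<and> p \<in> pts M \<and>
    (\<forall>U. openin (mtop M) U \<and> p \<in> U \<longrightarrow> (\<forall>\<^sub>F t in nhds 0. \<gamma> t \<in> U)) \<and>
    (\<forall>U h. smooth_on M U h \<and> p \<in> U \<longrightarrow> (\<lambda>t. h (\<gamma> t)) differentiable (at 0))"

lemma curveD:
  assumes "curve M p \<gamma>"
  shows "\<gamma> 0 = p" "p \<in> pts M" "openin (mtop M) U \<Longrightarrow> p \<in> U \<Longrightarrow> \<forall>\<^sub>F t in nhds 0. \<gamma> t \<in> U"
    "smooth_on M U h \<Longrightarrow> p \<in> U \<Longrightarrow> ((\<lambda>t. h (\<gamma> t)) has_real_derivative deriv (\<lambda>t. h (\<gamma> t)) 0) (at 0)"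
  using assms unfolding curve_def by (blast intro: DERIV_deriv_iff_real_differentiable[THEN iffD2])+

lemma curve_map:
  assumes M: "atlas_ok M" and N: "atlas_ok N" and f: "smooth_map M N f" and g: "curve M p \<gamma>"
  shows "curve N (f p) (\<lambda>t. f (\<gamma> t))"
  unfolding curve_def
proof (intro conjI allI impI)
  show "f (\<gamma> 0) = f p" "f p \<in> pts N" using curveD(1,2)[OF g] smooth_mapD(1)[OF f] by auto
  fix U assume U: "openin (mtop N) U \<and> f p \<in> U"
  have "\<forall>\<^sub>F t in nhds 0. \<gamma> t \<in> {p \<in> pts M. f p \<in> U}"
    using U curveD(2)[OF g] by (intro curveD(3)[OF g] smooth_mapD(2)[OF f]) auto
  then show "\<forall>\<^sub>F t in nhds 0. f (\<gamma> t) \<in> U" by eventually_elim auto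
next
  fix U h assume U: "smooth_on N U h \<and> f p \<in> U"
  then show "(\<lambda>t. h (f (\<gamma> t))) differentiable (at 0)"
    using curveD(4)[OF g smooth_on_pullback[OF M N f, of U h]] curveD(2)[OF g]
    by (auto simp: real_differentiable_def)
qed

text \<open>The numbers \<open>deriv (\<lambda>t. \<phi> (\<gamma> t) i) 0\<close> are the
  components of the tangent vector in the chart; every directional derivative is linear in
  them.\<close>

lemma curve_chain:
  assumes M: "atlas_ok M" and g: "curve M p \<gamma>" and c: "(C, \<phi>) \<in> max_atlas M" "p \<in> C"
    and h: "smooth_on M U h" "p \<in> U"
  shows "((\<lambda>t. h (\<gamma> t)) has_real_derivative
    (\<Sum>i\<in>idx M. dpart (C, \<phi>) i h p * deriv (\<lambda>t. \<phi> (\<gamma> t) i) 0)) (at 0)"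
proof -
  note cm = max_chartD[OF M c(1)] and fin = atlas_ok_finite[OF M]
  have ev: "\<forall>\<^sub>F t in nhds 0. \<gamma> t \<in> C" using curveD(3)[OF g cm(5) c(2)] .
  have "((\<lambda>t. h (inv_into C \<phi> (\<phi> (\<gamma> t)))) has_real_derivative
    (\<Sum>i\<in>idx M. pd i (\<lambda>u. h (inv_into C \<phi> u)) (\<phi> (\<gamma> 0)) * deriv (\<lambda>t. \<phi> (\<gamma> t) i) 0)) (at 0)"
  proof (rule C_infinity_chain[OF fin max_chart_image[OF M c(1) smooth_on_openin[OF h(1)]]
        max_chart_smooth[OF M c(1) h(1)]])
    show "\<phi> (\<gamma> 0) \<in> \<phi> ` (C \<inter> U)" using curveD(1)[OF g] c h by auto
    show "\<forall>\<^sub>F t in nhds 0. \<phi> (\<gamma> t) \<in> coord_space (idx M)" using ev by eventually_elim (rule cm(4))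
    show "((\<lambda>t. \<phi> (\<gamma> t) i) has_real_derivative deriv (\<lambda>t. \<phi> (\<gamma> t) i) 0) (at 0)" for i
      by (rule curveD(4)[OF g cm(6) c(2)])
  qed
  moreover have "\<forall>\<^sub>F t in nhds 0. h (inv_into C \<phi> (\<phi> (\<gamma> t))) = h (\<gamma> t)"
    using ev by eventually_elim (simp add: cm(1) inv_into_f_f)
  ultimately show ?thesis
    unfolding dpart_def fst_conv snd_conv curveD(1)[OF g] by (rule DERIV_cong_ev[OF refl _ refl, THEN iffD1, rotated])
qed

text \<open>The coordinate line, its time shifted so that \<open>p\<close> is reached at 0. Once the
  line leaves the chart the values of \<open>inv_into\<close> are arbitrary, hence facts about it
  hold for small times only.\<close>

definition coord_curve :: "('a, 'i) chart \<Rightarrow> 'i \<Rightarrow> 'a \<Rightarrow> real \<Rightarrow> 'a" where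
  "coord_curve c i p t = inv_into (fst c) (snd c) ((snd c p)(i := t + snd c p i))"

lemma coord_curve_ev:
  assumes M: "atlas_ok M" and c: "(C, \<phi>) \<in> max_atlas M" "p \<in> C" and i: "i \<in> idx M"
    and U: "openin (mtop M) U" "p \<in> U"
  shows "\<forall>\<^sub>F t in nhds 0. (\<phi> p)(i := t + \<phi> p i) \<in> \<phi> ` (C \<inter> U)"
proof -
  have "\<forall>\<^sub>F t in nhds (\<phi> p i). (\<phi> p)(i := t) \<in> \<phi> ` (C \<inter> U)"
    by (rule copen_upd_ev[OF max_chart_image[OF M c(1) U(1)] _ i atlas_ok_finite[OF M]]) (use c U in auto)
  moreover have "filterlim (\<lambda>t. t + \<phi> p i) (nhds (\<phi> p i)) (nhds 0)"
    by (rule tendsto_eq_intros filterlim_ident | simp)+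
  ultimately show ?thesis by (rule eventually_compose_filterlim)
qed

lemma coord_curve_eq:
  assumes "inj_on \<phi> C" "(\<phi> p)(i := t + \<phi> p i) \<in> \<phi> ` (C \<inter> U)"
  shows "coord_curve (C, \<phi>) i p t \<in> C \<inter> U" "\<phi> (coord_curve (C, \<phi>) i p t) = (\<phi> p)(i := t + \<phi> p i)"
  using inv_into_image[OF assms] by (auto simp: coord_curve_def)

lemma coord_curve_deriv:
  assumes M: "atlas_ok M" and c: "(C, \<phi>) \<in> max_atlas M" "p \<in> C" and i: "i \<in> idx M"
    and h: "smooth_on M U h" "p \<in> U"
  shows "((\<lambda>t. h (coord_curve (C, \<phi>) i p t)) has_real_derivative dpart (C, \<phi>) i h p) (at 0)"
proof -
  have "pdiff i (\<lambda>u. h (inv_into C \<phi> u)) (\<phi> p)"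
    by (rule C_infinityD(2)[OF max_chart_smooth[OF M c(1) h(1)] i]) (use c h in auto)
  from pdiff_DERIV[OF this] show ?thesis
    unfolding coord_curve_def dpart_def
    using DERIV_shift[of "\<lambda>t. h (inv_into C \<phi> ((\<phi> p)(i := t)))" _ 0 "\<phi> p i"] by simp
qed

lemma coord_curve:
  assumes M: "atlas_ok M" and c: "(C, \<phi>) \<in> max_atlas M" "p \<in> C" and i: "i \<in> idx M"
  shows "curve M p (coord_curve (C, \<phi>) i p)"
  unfolding curve_def
proof (intro conjI allI impI)
  note cm = max_chartD[OF M c(1)]
  show "coord_curve (C, \<phi>) i p 0 = p" "p \<in> pts M"
    using c(2) cm(1,3) by (auto simp: coord_curve_def inv_into_f_f)
  fix U assume U: "openin (mtop M) U \<and> p \<in> U"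
  have "\<forall>\<^sub>F t in nhds 0. (\<phi> p)(i := t + \<phi> p i) \<in> \<phi> ` (C \<inter> U)"
    by (rule coord_curve_ev[OF M c i]) (use U in auto)
  then show "\<forall>\<^sub>F t in nhds 0. coord_curve (C, \<phi>) i p t \<in> U"
    by eventually_elim (use coord_curve_eq(1)[OF cm(1)] in blast)
next
  fix U h assume "smooth_on M U h \<and> p \<in> U"
  then show "(\<lambda>t. h (coord_curve (C, \<phi>) i p t)) differentiable (at 0)"
    using coord_curve_deriv[OF M c i] by (auto simp: real_differentiable_def)
qed

text \<open>\<open>\<tau>\<close> translates the new coordinates back into the old ones. The old
  chart mediates to the whole atlas, so smoothness of \<open>\<tau>\<close> and of the new
  coordinate functions is all that compatibility requires.\<close>

lemma max_atlas_change:
  assumes M: "atlas_ok M" and c: "(C, \<phi>) \<in> max_atlas M" and C': "openin (mtop M) C'" "C' \<subseteq> C"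
    and W: "copen (idx M) W" "\<phi>' ` C' = W"
    and t: "\<And>q. q \<in> C' \<Longrightarrow> \<tau> (\<phi>' q) = \<phi> q" "\<And>i. i \<in> idx M \<Longrightarrow> C_infinity (idx M) W (\<lambda>w. \<tau> w i)"
    and s: "\<And>i. i \<in> idx M \<Longrightarrow> smooth_on M C' (\<lambda>q. \<phi>' q i)"
  shows "(C', \<phi>') \<in> max_atlas M"
proof (rule max_atlasI[OF M C'(1) _ s])
  note cm = max_chartD[OF M c] and fin = atlas_ok_finite[OF M]
  show inj: "inj_on \<phi>' C'"
  proof
    fix p q assume pq: "p \<in> C'" "q \<in> C'" "\<phi>' p = \<phi>' q"
    then have "\<phi> p = \<phi> q" using t(1) by metis
    then show "p = q" using cm(1) pq C'(2) by (auto dest: inj_onD)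
  qed
  have img: "\<phi>' ` (C' \<inter> U) = {w \<in> W. \<tau> w \<in> \<phi> ` (C \<inter> U)}" for U
  proof (intro equalityI subsetI)
    fix w assume "w \<in> \<phi>' ` (C' \<inter> U)"
    then show "w \<in> {w \<in> W. \<tau> w \<in> \<phi> ` (C \<inter> U)}" using W(2) t(1) C'(2) by auto
  next
    fix w assume "w \<in> {w \<in> W. \<tau> w \<in> \<phi> ` (C \<inter> U)}"
    then obtain q where q: "q \<in> C'" "w = \<phi>' q" "\<phi> q \<in> \<phi> ` (C \<inter> U)" using W(2) t(1) by auto
    then have "q \<in> U" using cm(1) C'(2) by (auto dest: inj_onD)
    then show "w \<in> \<phi>' ` (C' \<inter> U)" using q by auto
  qed
  have tc: "\<tau> w \<in> coord_space (idx M)" if "w \<in> W" for w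
    using that W(2) t(1) cm(4) C'(2) by auto
  show co: "copen (idx M) (\<phi>' ` (C' \<inter> U))" if "openin (mtop M) U" for U
    unfolding img using C_infinityD(1)[OF t(2)] tc
    by (intro copen_preimage[OF W(1) max_chart_image[OF M c that]]) auto
  fix U h assume h: "smooth_on M U h"
  note U = smooth_on_openin[OF h]
  have "C_infinity (idx M) (\<phi>' ` (C' \<inter> U)) (\<lambda>w. h (inv_into C \<phi> (\<tau> w)))"
  proof (rule C_infinity_compose[OF max_chart_smooth[OF M c h] _ _ co[OF U] fin max_chart_image[OF M c U] fin])
    show "C_infinity (idx M) (\<phi>' ` (C' \<inter> U)) (\<lambda>w. \<tau> w i)" if "i \<in> idx M" for i
      by (rule C_infinity_subset[OF t(2)[OF that]]) (auto simp: img)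
  qed (auto simp: img)
  then show "C_infinity (idx M) (\<phi>' ` (C' \<inter> U)) (\<lambda>w. h (inv_into C' \<phi>' w))"
  proof (rule C_infinity_cong[OF _ _ co[OF U] fin])
    fix w assume "w \<in> \<phi>' ` (C' \<inter> U)"
    then obtain q where q: "q \<in> C'" "w = \<phi>' q" by auto
    moreover have "q \<in> C" using q C'(2) by auto
    ultimately show "h (inv_into C \<phi> (\<tau> w)) = h (inv_into C' \<phi>' w)"
      using inj cm(1) t(1) by (simp add: inv_into_f_f)
  qed
qed

text \<open>In the chart, \<open>f\<close> plays the part of \<open>g\<close> in
  \<open>C_infinity_replace_coord\<close>, and the function \<open>G\<close> found there restores
  the coordinate that was given up.\<close>

lemma max_atlas_replace_coord:
  assumes M: "atlas_ok M" and c: "(C, \<phi>) \<in> max_atlas M" "p \<in> C" and f: "smooth_on M U f" "p \<in> U"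
    and i: "i \<in> idx M" and nz: "dpart (C, \<phi>) i f p \<noteq> 0"
  obtains C' where "p \<in> C'" "C' \<subseteq> C \<inter> U" "(C', \<lambda>q. (\<phi> q)(i := f q)) \<in> max_atlas M"
proof -
  note cm = max_chartD[OF M c(1)] and fin = atlas_ok_finite[OF M] and U = smooth_on_openin[OF f(1)]
  define g where "g = (\<lambda>u. f (inv_into C \<phi> u))"
  define A where "A = \<phi> ` (C \<inter> U)"
  have A: "copen (idx M) A" unfolding A_def by (rule max_chart_image[OF M c(1) U])
  have gA: "C_infinity (idx M) A g" unfolding A_def g_def by (rule max_chart_smooth[OF M c(1) f(1)])
  have pA: "\<phi> p \<in> A" using c f by (auto simp: A_def)
  have "pd i g (\<phi> p) \<noteq> 0" using nz by (simp add: dpart_def g_def)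
  then obtain V W G where V: "copen (idx M) V" "\<phi> p \<in> V" "V \<subseteq> A" "copen (idx M) W" "W = (\<lambda>u. u(i := g u)) ` V"
    "inj_on (\<lambda>u. u(i := g u)) V" "C_infinity (idx M) W G"
    "\<forall>w\<in>W. w(i := G w) \<in> V \<and> g (w(i := G w)) = w i"
    by (rule C_infinity_replace_coord[OF fin A gA pA i])
  define C' where "C' = {q \<in> C. \<phi> q \<in> V}"
  have C': "openin (mtop M) C'" unfolding C'_def by (rule max_chart_copen[OF M c(1) V(1)])
  have C'U: "C' \<subseteq> C \<inter> U" using V(3) cm(1) by (auto simp: C'_def A_def inj_on_def)
  have gf: "g (\<phi> q) = f q" if "q \<in> C" for q using that cm(1) by (simp add: g_def inv_into_f_f)
  show thesis
  proof (rule that[OF _ C'U])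
    show "p \<in> C'" using c V(2) by (simp add: C'_def)
    show "(C', \<lambda>q. (\<phi> q)(i := f q)) \<in> max_atlas M"
    proof (rule max_atlas_change[OF M c(1) C' _ V(4)])
      have "\<phi> ` C' = V" using V(3) by (auto simp: C'_def A_def)
      moreover have "(\<lambda>q. (\<phi> q)(i := f q)) ` C' = (\<lambda>u. u(i := g u)) ` \<phi> ` C'"
        unfolding image_image using gf C'U by (intro image_cong) auto
      ultimately show "(\<lambda>q. (\<phi> q)(i := f q)) ` C' = W" using V(5) by simp
      show "(((\<phi> q)(i := f q))(i := G ((\<phi> q)(i := f q)))) = \<phi> q" if "q \<in> C'" for q
      proof -
        define w where "w = (\<phi> q)(i := g (\<phi> q))"
        have q: "\<phi> q \<in> V" "q \<in> C" using that by (auto simp: C'_def)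
        then have "w \<in> W" by (simp add: w_def V(5))
        then have "w(i := G w) \<in> V" "(w(i := G w))(i := g (w(i := G w))) = (\<phi> q)(i := g (\<phi> q))"
          using V(8)[rule_format, of w] by (auto simp: w_def)
        then have "w(i := G w) = \<phi> q" using inj_onD[OF V(6), of "w(i := G w)" "\<phi> q"] q(1) by simp
        then show ?thesis using gf[OF q(2)] by (simp add: w_def)
      qed
      show "C_infinity (idx M) W (\<lambda>w. (w(i := G w)) k)" for k
        using V(7) C_infinity_coord[OF fin V(4)] by (cases "k = i") auto
      show "smooth_on M C' (\<lambda>q. ((\<phi> q)(i := f q)) k)" for k
        using smooth_on_subset[OF cm(6) C'] smooth_on_subset[OF f(1) C'] C'U by (cases "k = i") auto
      show "C' \<subseteq> C" using C'U by auto
    qed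
  qed
qed

text \<open>The dual curves certify that the differentials of the \<open>f l\<close> are independent
  at \<open>p\<close>. The functions enter the chart one at a time, each in place of an old
  coordinate, and the curves guarantee that a coordinate not yet taken is available each
  time.\<close>

lemma straighten:
  assumes M: "atlas_ok M" and L: "finite L" and U: "openin (mtop M) U" "p \<in> U"
    and f: "\<And>l. l \<in> L \<Longrightarrow> smooth_on M U (f l)" and g: "\<And>l. l \<in> L \<Longrightarrow> curve M p (\<gamma> l)"
    and d: "\<And>l m. l \<in> L \<Longrightarrow> m \<in> L \<Longrightarrow>
      ((\<lambda>t. f l (\<gamma> m t)) has_real_derivative (if l = m then 1 else 0)) (at 0)"
  shows "\<exists>C \<phi> \<iota>. (C, \<phi>) \<in> max_atlas M \<and> p \<in> C \<and> C \<subseteq> U \<and> inj_on \<iota> L \<and> \<iota> ` L \<subseteq> idx M \<and>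
    (\<forall>l\<in>L. \<forall>q\<in>C. \<phi> q (\<iota> l) = f l q)"
  using L f g d
proof (induction L)
  case empty
  obtain C \<phi> where c: "(C, \<phi>) \<in> atlas M" "p \<in> C" using U by (rule openin_chart)
  show ?case
    by (intro exI[of _ "C \<inter> U"] exI[of _ \<phi>] exI[of _ undefined])
      (use max_atlas_restrict[OF M atlas_max_atlas[OF M c(1)] U(1)] c U in auto)
next
  case (insert l L)
  have "\<exists>C \<phi> \<iota>. (C, \<phi>) \<in> max_atlas M \<and> p \<in> C \<and> C \<subseteq> U \<and> inj_on \<iota> L \<and> \<iota> ` L \<subseteq> idx M \<and>
    (\<forall>l\<in>L. \<forall>q\<in>C. \<phi> q (\<iota> l) = f l q)"
    by (rule insert.IH) (use insert.prems in auto)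
  then obtain C \<phi> \<iota> where c: "(C, \<phi>) \<in> max_atlas M" "p \<in> C" "C \<subseteq> U" and \<iota>: "inj_on \<iota> L" "\<iota> ` L \<subseteq> idx M"
    and "\<forall>l\<in>L. \<forall>q\<in>C. \<phi> q (\<iota> l) = f l q" by (elim exE conjE)
  then have fl: "\<And>m q. m \<in> L \<Longrightarrow> q \<in> C \<Longrightarrow> \<phi> q (\<iota> m) = f m q" by simp
  note cm = max_chartD[OF M c(1)]
  have gl: "curve M p (\<gamma> l)" and sl: "smooth_on M U (f l)" using insert.prems by auto
  have "(\<Sum>i\<in>idx M. dpart (C, \<phi>) i (f l) p * deriv (\<lambda>t. \<phi> (\<gamma> l t) i) 0) = 1"
    using DERIV_unique[OF curve_chain[OF M gl c(1,2) sl U(2)]] insert.prems(3)[of l l] by simp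
  then obtain i where i: "i \<in> idx M" "dpart (C, \<phi>) i (f l) p * deriv (\<lambda>t. \<phi> (\<gamma> l t) i) 0 \<noteq> 0"
    by (metis (no_types, lifting) sum.neutral zero_neq_one)
  \<comment> \<open>A position already taken carries some \<open>f m\<close>, whose derivative along
    \<open>\<gamma> l\<close> vanishes, so it contributes nothing to the sum that equals 1.\<close>
  have iL: "i \<notin> \<iota> ` L"
  proof
    assume "i \<in> \<iota> ` L"
    then obtain m where m: "m \<in> L" "i = \<iota> m" by auto
    have "\<forall>\<^sub>F t in nhds 0. \<gamma> l t \<in> C" using curveD(3)[OF gl cm(5) c(2)] .
    then have ev: "\<forall>\<^sub>F t in nhds 0. \<phi> (\<gamma> l t) i = f m (\<gamma> l t)" by eventually_elim (use fl m in auto)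
    have "deriv (\<lambda>t. \<phi> (\<gamma> l t) i) 0 = deriv (\<lambda>t. f m (\<gamma> l t)) 0" using ev by (rule deriv_cong_ev) simp
    also have "\<dots> = 0" using insert.prems(3)[of m l, THEN DERIV_imp_deriv] m(1) insert.hyps(2) by auto
    finally show False using i(2) by simp
  qed
  have nz: "dpart (C, \<phi>) i (f l) p \<noteq> 0" using i(2) by auto
  obtain C' where C': "p \<in> C'" "C' \<subseteq> C \<inter> U" "(C', \<lambda>q. (\<phi> q)(i := f l q)) \<in> max_atlas M"
    by (rule max_atlas_replace_coord[OF M c(1,2) sl U(2) i(1) nz])
  show ?case
  proof (intro exI conjI)
    show "(C', \<lambda>q. (\<phi> q)(i := f l q)) \<in> max_atlas M" "p \<in> C'" "C' \<subseteq> U" using C' by auto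
    show "inj_on (\<iota>(l := i)) (insert l L)" using \<iota>(1) iL insert.hyps(2) by (auto simp: inj_on_def)
    show "\<iota>(l := i) ` insert l L \<subseteq> idx M" using \<iota>(2) i(1) by auto
    show "\<forall>m\<in>insert l L. \<forall>q\<in>C'. ((\<phi> q)(i := f l q)) ((\<iota>(l := i)) m) = f m q"
      using fl C'(2) iL by auto
  qed
qed

text \<open>The positions that \<open>straighten\<close> fills vary from point to point, whereas the
  slice charts of a submanifold share one index set; renumbering reconciles the two.\<close>

lemma max_atlas_permute:
  assumes M: "atlas_ok M" and c: "(C, \<phi>) \<in> max_atlas M" and b: "bij_betw \<pi> (idx M) (idx M)"
  shows "(C, \<lambda>q i. if i \<in> idx M then \<phi> q (\<pi> i) else 0) \<in> max_atlas M"
proof -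
  note cm = max_chartD[OF M c] and fin = atlas_ok_finite[OF M]
  define \<tau> where "\<tau> = (\<lambda>w :: 'b \<Rightarrow> real. \<lambda>i. if i \<in> idx M then w (inv_into (idx M) \<pi> i) else 0)"
  let ?\<phi> = "\<lambda>q i. if i \<in> idx M then \<phi> q (\<pi> i) else 0"
  have inv: "\<pi> i \<in> idx M" "inv_into (idx M) \<pi> (\<pi> i) = i" "inv_into (idx M) \<pi> i \<in> idx M" "\<pi> (inv_into (idx M) \<pi> i) = i"
    if "i \<in> idx M" for i
    using b that by (auto simp: bij_betw_def inv_into_into inv_into_f_f f_inv_into_f)
  have \<tau>\<phi>: "\<tau> (?\<phi> q) = \<phi> q" if "q \<in> C" for q
    using cm(4)[OF that] inv by (auto simp: \<tau>_def coord_space_def fun_eq_iff)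
  define W where "W = {w \<in> coord_space (idx M). \<tau> w \<in> \<phi> ` C}"
  have \<tau>C: "C_infinity (idx M) A (\<lambda>w. \<tau> w i)" if "copen (idx M) A" for A i
    using C_infinity_coord[OF fin that] C_infinity_const[OF fin that] unfolding \<tau>_def
    by (cases "i \<in> idx M") auto
  have W: "copen (idx M) W"
    unfolding W_def
  proof (rule copen_preimage[OF _ cm(2)])
    show "copen (idx M) (coord_space (idx M))" by simp
    then show "continuous_on (coord_space (idx M)) (\<lambda>w. \<tau> w j)" for j by (rule C_infinityD(1)[OF \<tau>C])
  qed (simp add: \<tau>_def coord_space_def)
  show ?thesis
  proof (rule max_atlas_change[OF M c cm(5) order_refl W _ \<tau>\<phi> \<tau>C[OF W]])
    show "?\<phi> ` C = W"
    proof (intro equalityI subsetI)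
      fix w assume "w \<in> ?\<phi> ` C"
      then show "w \<in> W" using \<tau>\<phi> by (auto simp: W_def coord_space_def)
    next
      fix w assume w: "w \<in> W"
      then obtain q where q: "q \<in> C" "\<tau> w = \<phi> q" by (auto simp: W_def)
      have "w = ?\<phi> q"
        using w inv unfolding q(2)[symmetric] by (auto simp: W_def \<tau>_def coord_space_def fun_eq_iff)
      then show "w \<in> ?\<phi> ` C" using q by auto
    qed
    show "smooth_on M C (\<lambda>q. if i \<in> idx M then \<phi> q (\<pi> i) else 0)" if "i \<in> idx M" for i
      using cm(6) that by simp
  qed auto
qed

section \<open>Embedded submanifolds\<close>

text \<open>\<open>submfd\<close> selects its index set by choice, so all that is known of this set
  is that it admits slice charts around the points of \<open>S\<close>. Later facts rest on that
  alone.\<close>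

lemma submfd_eq:
  assumes S: "embedded_submanifold M S"
  obtains J where "submfd M S = \<lparr>idx = J, atlas = {(C \<inter> S, \<phi>) |C \<phi>. slice_chart M S J (C, \<phi>)}\<rparr>"
    "J \<subseteq> idx M" "\<forall>p\<in>S. \<exists>C \<phi>. slice_chart M S J (C, \<phi>) \<and> p \<in> C"
proof -
  have "has_slice_charts M S (SOME J. has_slice_charts M S J)"
    using S unfolding embedded_submanifold_def by (metis someI_ex)
  then show thesis
    by (intro that[of "SOME J. has_slice_charts M S J"]) (auto simp: submfd_def has_slice_charts_def Let_def)
qed

lemma copen_slice: "copen I A \<Longrightarrow> J \<subseteq> I \<Longrightarrow> copen J (A \<inter> coord_space J)"
  by (auto simp: openin_open coord_space_def)

lemma slice_chartD:
  assumes "slice_chart M S J (C, \<phi>)"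
  shows "(C, \<phi>) \<in> max_atlas M" "\<phi> ` (C \<inter> S) = \<phi> ` C \<inter> coord_space J"
  using assms by (auto simp: slice_chart_def)

lemma slice_image:
  assumes M: "atlas_ok M" and c: "slice_chart M S J (C, \<phi>)"
  shows "\<phi> ` (C \<inter> S \<inter> (U \<inter> S)) = \<phi> ` (C \<inter> U) \<inter> coord_space J"
  using slice_chartD(2)[OF c] max_chartD(1)[OF M slice_chartD(1)[OF c]]
  by (auto simp: set_eq_iff inj_on_def image_iff Bex_def)

lemma submfd_facts:
  assumes M: "atlas_ok M" and S: "embedded_submanifold M S"
  shows pts_submfd: "pts (submfd M S) = S"
    and atlas_ok_submfd: "atlas_ok (submfd M S)"
    and mtop_submfd: "mtop (submfd M S) = subtopology (mtop M) S"
proof -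
  obtain J where J: "submfd M S = \<lparr>idx = J, atlas = {(C \<inter> S, \<phi>) |C \<phi>. slice_chart M S J (C, \<phi>)}\<rparr>"
    "J \<subseteq> idx M" "\<forall>p\<in>S. \<exists>C \<phi>. slice_chart M S J (C, \<phi>) \<and> p \<in> C"
    by (rule submfd_eq[OF S])
  note fin = atlas_ok_finite[OF M]
  have finJ: "finite J" using finite_subset[OF J(2) fin] .
  have SM: "S \<subseteq> pts M" using S by (simp add: embedded_submanifold_def)
  show pts: "pts (submfd M S) = S"
  proof (intro equalityI subsetI)
    fix p assume "p \<in> S"
    from J(3)[rule_format, OF this] obtain C \<phi> where "slice_chart M S J (C, \<phi>)" "p \<in> C" by (elim exE conjE)
    then have "(C \<inter> S, \<phi>) \<in> atlas (submfd M S)" "p \<in> C \<inter> S" using \<open>p \<in> S\<close> by (auto simp: J(1))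
    then show "p \<in> pts (submfd M S)" by (force simp: pts_def)
  qed (auto simp: J(1) pts_def)
  have img: "copen J (\<phi> ` (C \<inter> S \<inter> (U \<inter> S)))" if "slice_chart M S J (C, \<phi>)" "openin (mtop M) U" for C \<phi> U
    unfolding slice_image[OF M that(1)]
    by (rule copen_slice[OF max_chart_image[OF M slice_chartD(1)[OF that(1)] that(2)] J(2)])
  have chart: "is_chart J (C \<inter> S, \<phi>)" if c: "slice_chart M S J (C, \<phi>)" for C \<phi>
  proof -
    have "C \<inter> S \<inter> (pts M \<inter> S) = C \<inter> S" using SM by auto
    then have "copen J (\<phi> ` (C \<inter> S))" using img[OF c openin_mtop_pts] by simp
    then show ?thesis using max_chartD(1)[OF M slice_chartD(1)[OF c]] by (auto simp: is_chart_def inj_on_def)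
  qed
  have trans: "smooth_transition J (C \<inter> S, \<phi>) (D \<inter> S, \<psi>)"
    if c: "slice_chart M S J (C, \<phi>)" and d: "slice_chart M S J (D, \<psi>)" for C \<phi> D \<psi>
  proof -
    note cm = max_chartD[OF M slice_chartD(1)[OF c]] and dm = max_chartD[OF M slice_chartD(1)[OF d]]
    have "C_infinity J (\<phi> ` (C \<inter> S \<inter> (D \<inter> S))) (\<lambda>u. \<psi> (inv_into (C \<inter> S) \<phi> u) j)" for j
    proof (rule C_infinity_cong[OF _ _ img[OF c dm(5)] finJ])
      show "C_infinity J (\<phi> ` (C \<inter> S \<inter> (D \<inter> S))) (\<lambda>u. \<psi> (inv_into C \<phi> u) j)"
        by (rule C_infinity_subset[OF max_chart_smooth[OF M slice_chartD(1)[OF c] dm(6)] _ J(2)]) auto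
      fix u assume "u \<in> \<phi> ` (C \<inter> S \<inter> (D \<inter> S))"
      then show "\<psi> (inv_into C \<phi> u) j = \<psi> (inv_into (C \<inter> S) \<phi> u) j"
        using cm(1) inj_on_subset[OF cm(1), of "C \<inter> S"] by (auto simp: inv_into_f_f)
    qed
    then show ?thesis using img[OF c dm(5)] by (auto simp: smooth_transition_def)
  qed
  show ok: "atlas_ok (submfd M S)"
    using chart trans finJ by (auto simp: J(1) atlas_ok_def)
  show "mtop (submfd M S) = subtopology (mtop M) S"
    unfolding topology_eq
  proof (intro allI iffI)
    fix U assume "openin (subtopology (mtop M) S) U"
    then obtain T where T: "openin (mtop M) T" "U = T \<inter> S" by (auto simp: openin_subtopology)
    show "openin (mtop (submfd M S)) U"
      unfolding openin_mtop_iff[OF ok] pts using img[OF _ T(1)] by (auto simp: J(1) T(2))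
  next
    fix U assume U: "openin (mtop (submfd M S)) U"
    show "openin (subtopology (mtop M) S) U"
    proof (subst openin_subopen, intro ballI)
      fix p assume p: "p \<in> U"
      then have "p \<in> S" using openin_pts[OF U] pts by auto
      then obtain C \<phi> where c: "slice_chart M S J (C, \<phi>)" "p \<in> C" using J(3) by blast
      note cm = max_chartD[OF M slice_chartD(1)[OF c(1)]]
      have "copen J (\<phi> ` (C \<inter> S \<inter> U))"
        using openin_mtop_image[OF ok U, of "C \<inter> S" \<phi>] c(1) by (auto simp: J(1))
      \<comment> \<open>\<open>T\<close> is open in the full function space, so it cuts out an open
        set of the ambient chart as well as of the slice.\<close>
      then obtain T where T: "open T" "\<phi> ` (C \<inter> S \<inter> U) = coord_space J \<inter> T" by (auto simp: openin_open)
      define V where "V = {q \<in> C. \<phi> q \<in> coord_space (idx M) \<inter> T}"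
      have "openin (mtop M) V" unfolding V_def
        by (rule max_chart_copen[OF M slice_chartD(1)[OF c(1)] openin_open_Int[OF T(1)]])
      moreover have "p \<in> V" using T(2) p \<open>p \<in> S\<close> c(2) cm(4) by (auto simp: V_def)
      moreover have "V \<inter> S \<subseteq> U"
      proof
        fix q assume q: "q \<in> V \<inter> S"
        then have "\<phi> q \<in> \<phi> ` (C \<inter> S)" by (auto simp: V_def)
        then have "\<phi> q \<in> coord_space J \<inter> T" using slice_chartD(2)[OF c(1)] q by (auto simp: V_def)
        then have "\<phi> q \<in> \<phi> ` (C \<inter> S \<inter> U)" using T(2) by simp
        then show "q \<in> U" using cm(1) q by (auto simp: V_def dest: inj_onD)
      qed
      ultimately show "\<exists>T. openin (subtopology (mtop M) S) T \<and> p \<in> T \<and> T \<subseteq> U"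
        using \<open>p \<in> S\<close> by (intro exI[of _ "V \<inter> S"]) (auto simp: openin_subtopology)
    qed
  qed
qed

lemma manifold_submfd:
  assumes "manifold M" "embedded_submanifold M S"
  shows "manifold (submfd M S)"
  using submfd_facts[OF manifold_atlas_ok[OF assms(1)] assms(2)] assms(1)
  by (auto simp: manifold_def atlas_ok_def Hausdorff_space_subtopology second_countable_subtopology)

text \<open>The coordinates of a slice chart on \<open>S\<close> are some of the ambient ones, the
  others being zero there. A map into \<open>S\<close> is thus smooth as soon as it is smooth into
  \<open>M\<close>; this universal property spares all later computations in slice charts.\<close>

lemma smooth_map_submfd:
  assumes M: "atlas_ok M" and S: "embedded_submanifold M S"
  shows smooth_map_inclusion: "smooth_map (submfd M S) M (\<lambda>p. p)"
    and smooth_map_into_submfd: "\<And>N f. atlas_ok N \<Longrightarrow> smooth_map N M f \<Longrightarrow> (\<And>p. p \<in> pts N \<Longrightarrow> f p \<in> S)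
      \<Longrightarrow> smooth_map N (submfd M S) f"
proof -
  obtain J where J: "submfd M S = \<lparr>idx = J, atlas = {(C \<inter> S, \<phi>) |C \<phi>. slice_chart M S J (C, \<phi>)}\<rparr>"
    "J \<subseteq> idx M" "\<forall>p\<in>S. \<exists>C \<phi>. slice_chart M S J (C, \<phi>) \<and> p \<in> C"
    by (rule submfd_eq[OF S])
  note ok = atlas_ok_submfd[OF M S] and pts = pts_submfd[OF M S]
  have sub: "(C \<inter> S, \<phi>) \<in> max_atlas (submfd M S)" if "slice_chart M S J (C, \<phi>)" for C \<phi>
    by (rule atlas_max_atlas[OF ok]) (use that in \<open>auto simp: J(1)\<close>)
  show "smooth_map (submfd M S) M (\<lambda>p. p)"
  proof (rule smooth_mapI[OF ok M])
    fix p assume "p \<in> pts (submfd M S)"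
    then obtain C \<phi> where c: "slice_chart M S J (C, \<phi>)" "p \<in> C" "p \<in> S" using J(3) pts by blast
    show "\<exists>U D \<psi>. openin (mtop (submfd M S)) U \<and> p \<in> U \<and> (D, \<psi>) \<in> max_atlas M \<and>
      (\<forall>q\<in>U. q \<in> D) \<and> (\<forall>j\<in>idx M. smooth_on (submfd M S) U (\<lambda>q. \<psi> q j))"
      using slice_chartD(1)[OF c(1)] c max_chartD(5,6)[OF ok sub[OF c(1)]]
      by (intro exI[of _ "C \<inter> S"] exI[of _ C] exI[of _ \<phi>]) auto
  qed
  fix N :: "('c, 'd) mfd" and f
  assume N: "atlas_ok N" and f: "smooth_map N M f" and fS: "\<And>p. p \<in> pts N \<Longrightarrow> f p \<in> S"
  show "smooth_map N (submfd M S) f"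
  proof (rule smooth_mapI[OF N ok])
    fix p assume p: "p \<in> pts N"
    then obtain C \<phi> where c: "slice_chart M S J (C, \<phi>)" "f p \<in> C" using J(3) fS by blast
    note s = smooth_map_max_chart[OF N M f slice_chartD(1)[OF c(1)]]
    show "\<exists>U D \<psi>. openin (mtop N) U \<and> p \<in> U \<and> (D, \<psi>) \<in> max_atlas (submfd M S) \<and>
      (\<forall>q\<in>U. f q \<in> D) \<and> (\<forall>j\<in>idx (submfd M S). smooth_on N U (\<lambda>q. \<psi> (f q) j))"
      using sub[OF c(1)] s p c(2) fS smooth_on_openin[OF s]
      by (intro exI[of _ "{q \<in> pts N. f q \<in> C}"] exI[of _ "C \<inter> S"] exI[of _ \<phi>]) auto
  qed
qed

section \<open>Products\<close>

lemma copen_prod: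
  assumes A: "copen I A" and B: "copen J B"
  shows "copen (I <+> J) {w \<in> coord_space (I <+> J). (\<lambda>i. w (Inl i)) \<in> A \<and> (\<lambda>j. w (Inr j)) \<in> B}"
proof -
  have c: "copen (I <+> J) (coord_space (I <+> J))" by simp
  have cont: "continuous_on S (\<lambda>w :: 'a + 'b \<Rightarrow> real. w k)" for S k
    by (rule continuous_on_subset[OF continuous_on_product_coordinates]) simp
  have "copen (I <+> J) {w \<in> coord_space (I <+> J). (\<lambda>i. w (Inl i)) \<in> A}"
    by (rule copen_preimage[OF c A cont]) (auto simp: coord_space_def)
  moreover have "copen (I <+> J) {w \<in> coord_space (I <+> J). (\<lambda>j. w (Inr j)) \<in> B}"
    by (rule copen_preimage[OF c B cont]) (auto simp: coord_space_def)
  ultimately have "copen (I <+> J) ({w \<in> coord_space (I <+> J). (\<lambda>i. w (Inl i)) \<in> A} \<inter>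
    {w \<in> coord_space (I <+> J). (\<lambda>j. w (Inr j)) \<in> B})" by (rule openin_Int)
  then show ?thesis by (simp add: Collect_conj_eq[symmetric] Int_def conj_ac cong: conj_cong)
qed

lemma coord_space_case_sum:
  "u \<in> coord_space I \<Longrightarrow> v \<in> coord_space J \<Longrightarrow> case_sum u v \<in> coord_space (I <+> J)"
  by (auto simp: coord_space_def split: sum.split)

definition prod_chart :: "('a \<Rightarrow> 'i \<Rightarrow> real) \<Rightarrow> ('b \<Rightarrow> 'j \<Rightarrow> real) \<Rightarrow> 'a \<times> 'b \<Rightarrow> 'i + 'j \<Rightarrow> real" where
  "prod_chart \<phi> \<psi> = (\<lambda>(p, q). case_sum (\<phi> p) (\<psi> q))"

lemma prod_chart_Inl_Inr [simp]: "prod_chart \<phi> \<psi> (p, q) (Inl i) = \<phi> p i" "prod_chart \<phi> \<psi> (p, q) (Inr j) = \<psi> q j"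
  by (simp_all add: prod_chart_def)

lemma prod_mfd_sel: "idx (prod_mfd M N) = idx M <+> idx N"
  "atlas (prod_mfd M N) = {(C \<times> D, prod_chart \<phi> \<psi>) |C \<phi> D \<psi>. (C, \<phi>) \<in> atlas M \<and> (D, \<psi>) \<in> atlas N}"
  by (simp_all add: prod_mfd_def prod_chart_def)

lemma prod_atlasI: "(C, \<phi>) \<in> atlas M \<Longrightarrow> (D, \<psi>) \<in> atlas N \<Longrightarrow> (C \<times> D, prod_chart \<phi> \<psi>) \<in> atlas (prod_mfd M N)"
  by (auto simp: prod_mfd_sel)

lemma pts_prod_mfd [simp]: "pts (prod_mfd M N) = pts M \<times> pts N"
proof (intro equalityI subsetI)
  fix z assume "z \<in> pts M \<times> pts N"
  then obtain p q where z: "z = (p, q)" "p \<in> pts M" "q \<in> pts N" by auto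
  obtain C \<phi> where c: "(C, \<phi>) \<in> atlas M" "p \<in> C" using z(2) by (rule pts_chart)
  obtain D \<psi> where d: "(D, \<psi>) \<in> atlas N" "q \<in> D" using z(3) by (rule pts_chart)
  show "z \<in> pts (prod_mfd M N)"
    using prod_atlasI[OF c(1) d(1)] c(2) d(2) z(1) by (force simp: pts_def)
qed (force simp: pts_def prod_mfd_sel)

lemma prod_chart_image:
  assumes "\<phi> ` (C \<inter> A) \<subseteq> coord_space I" "\<psi> ` (D \<inter> B) \<subseteq> coord_space J"
  shows "prod_chart \<phi> \<psi> ` ((C \<times> D) \<inter> (A \<times> B)) =
    {w \<in> coord_space (I <+> J). (\<lambda>i. w (Inl i)) \<in> \<phi> ` (C \<inter> A) \<and> (\<lambda>j. w (Inr j)) \<in> \<psi> ` (D \<inter> B)}"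
proof (intro equalityI subsetI)
  fix w assume "w \<in> prod_chart \<phi> \<psi> ` ((C \<times> D) \<inter> (A \<times> B))"
  then obtain p q where pq: "w = prod_chart \<phi> \<psi> (p, q)" "p \<in> C \<inter> A" "q \<in> D \<inter> B" by auto
  have "w \<in> coord_space (I <+> J)"
    using assms pq(2,3) unfolding pq(1) prod_chart_def case_prod_conv by (intro coord_space_case_sum) auto
  then show "w \<in> {w \<in> coord_space (I <+> J). (\<lambda>i. w (Inl i)) \<in> \<phi> ` (C \<inter> A) \<and> (\<lambda>j. w (Inr j)) \<in> \<psi> ` (D \<inter> B)}"
    using pq by simp
next
  fix w assume "w \<in> {w \<in> coord_space (I <+> J). (\<lambda>i. w (Inl i)) \<in> \<phi> ` (C \<inter> A) \<and> (\<lambda>j. w (Inr j)) \<in> \<psi> ` (D \<inter> B)}"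
  then obtain p q where pq: "p \<in> C \<inter> A" "(\<lambda>i. w (Inl i)) = \<phi> p" "q \<in> D \<inter> B" "(\<lambda>j. w (Inr j)) = \<psi> q" by auto
  have "w k = prod_chart \<phi> \<psi> (p, q) k" for k
    using fun_cong[OF pq(2)] fun_cong[OF pq(4)] by (cases k) auto
  then show "w \<in> prod_chart \<phi> \<psi> ` ((C \<times> D) \<inter> (A \<times> B))" using pq(1,3) by blast
qed

lemma prod_chart_inj: "inj_on \<phi> C \<Longrightarrow> inj_on \<psi> D \<Longrightarrow> inj_on (prod_chart \<phi> \<psi>) (C \<times> D)"
proof (rule inj_onI, clarify)
  fix p q p' q' assume i: "inj_on \<phi> C" "inj_on \<psi> D" and m: "p \<in> C" "q \<in> D" "p' \<in> C" "q' \<in> D"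
    and e: "prod_chart \<phi> \<psi> (p, q) = prod_chart \<phi> \<psi> (p', q')"
  have "\<phi> p = \<phi> p'" "\<psi> q = \<psi> q'"
    using fun_cong[OF e, of "Inl _"] fun_cong[OF e, of "Inr _"] by (auto simp: fun_eq_iff)
  then show "p = p' \<and> q = q'" using i m by (auto dest: inj_onD)
qed

lemma prod_mfd_facts:
  assumes M: "atlas_ok M" and N: "atlas_ok N"
  shows atlas_ok_prod: "atlas_ok (prod_mfd M N)"
    and mtop_prod: "mtop (prod_mfd M N) = prod_topology (mtop M) (mtop N)"
proof -
  note fM = atlas_ok_finite[OF M] and fN = atlas_ok_finite[OF N]
  have img: "prod_chart \<phi> \<psi> ` ((C \<times> D) \<inter> (A \<times> B)) =
      {w \<in> coord_space (idx M <+> idx N). (\<lambda>i. w (Inl i)) \<in> \<phi> ` (C \<inter> A) \<and> (\<lambda>j. w (Inr j)) \<in> \<psi> ` (D \<inter> B)}"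
    if "(C, \<phi>) \<in> atlas M" "(D, \<psi>) \<in> atlas N" for C \<phi> D \<psi> A B
    using chartD(4)[OF M that(1)] chartD(4)[OF N that(2)] by (intro prod_chart_image) auto
  have co: "copen (idx M <+> idx N) (prod_chart \<phi> \<psi> ` ((C \<times> D) \<inter> (A \<times> B)))"
    if "(C, \<phi>) \<in> atlas M" "(D, \<psi>) \<in> atlas N" "openin (mtop M) A" "openin (mtop N) B" for C \<phi> D \<psi> A B
    unfolding img[OF that(1,2)]
    by (rule copen_prod[OF openin_mtop_image[OF M that(3,1)] openin_mtop_image[OF N that(4,2)]])
  have inj: "inj_on (prod_chart \<phi> \<psi>) (C \<times> D)" if "(C, \<phi>) \<in> atlas M" "(D, \<psi>) \<in> atlas N" for C \<phi> D \<psi>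
    by (rule prod_chart_inj[OF chartD(1)[OF M that(1)] chartD(1)[OF N that(2)]])
  have inv: "inv_into (C \<times> D) (prod_chart \<phi> \<psi>) w = (inv_into C \<phi> (\<lambda>i. w (Inl i)), inv_into D \<psi> (\<lambda>j. w (Inr j)))"
    if c: "(C, \<phi>) \<in> atlas M" and d: "(D, \<psi>) \<in> atlas N" and w: "w \<in> prod_chart \<phi> \<psi> ` (C \<times> D)" for C \<phi> D \<psi> w
  proof -
    obtain p q where "p \<in> C" "q \<in> D" "w = prod_chart \<phi> \<psi> (p, q)" using w by auto
    then show ?thesis using inj[OF c d] chartD(1)[OF M c] chartD(1)[OF N d] by (simp add: inv_into_f_f)
  qed
  have chart: "is_chart (idx M <+> idx N) (C \<times> D, prod_chart \<phi> \<psi>)"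
    if c: "(C, \<phi>) \<in> atlas M" and d: "(D, \<psi>) \<in> atlas N" for C \<phi> D \<psi>
    using inj[OF c d] co[OF c d chart_open_domain[OF M c] chart_open_domain[OF N d]] by (simp add: is_chart_def)
  have trans: "smooth_transition (idx M <+> idx N) (C \<times> D, prod_chart \<phi> \<psi>) (C' \<times> D', prod_chart \<phi>' \<psi>')"
    if c: "(C, \<phi>) \<in> atlas M" and d: "(D, \<psi>) \<in> atlas N" and c': "(C', \<phi>') \<in> atlas M" and d': "(D', \<psi>') \<in> atlas N"
    for C \<phi> D \<psi> C' \<phi>' D' \<psi>'
  proof -
    note o = co[OF c d chart_open_domain[OF M c'] chart_open_domain[OF N d']]
    have fin: "finite (idx M <+> idx N)" using fM fN by simp
    let ?A = "prod_chart \<phi> \<psi> ` ((C \<times> D) \<inter> (C' \<times> D'))"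
    have "C_infinity (idx M <+> idx N) ?A (\<lambda>u. prod_chart \<phi>' \<psi>' (inv_into (C \<times> D) (prod_chart \<phi> \<psi>) u) k)"
      if k: "k \<in> idx M <+> idx N" for k
    proof (cases k)
      case (Inl i)
      then have i: "i \<in> idx M" using k by auto
      have "C_infinity (idx M <+> idx N) ?A (\<lambda>u. \<phi>' (inv_into C \<phi> (\<lambda>i. u (Inl i))) i)"
        by (rule C_infinity_compose[OF transitionD(2)[OF M c c' i] C_infinity_coord[OF fin o] _ o fin transitionD(1)[OF M c c'] fM])
          (auto simp: img[OF c d])
      then show ?thesis
        by (rule C_infinity_cong[OF _ _ o fin]) (subst inv[OF c d], auto simp: Inl)
    next
      case (Inr j)
      then have j: "j \<in> idx N" using k by auto
      have "C_infinity (idx M <+> idx N) ?A (\<lambda>u. \<psi>' (inv_into D \<psi> (\<lambda>j. u (Inr j))) j)"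
        by (rule C_infinity_compose[OF transitionD(2)[OF N d d' j] C_infinity_coord[OF fin o] _ o fin transitionD(1)[OF N d d'] fN])
          (auto simp: img[OF c d])
      then show ?thesis
        by (rule C_infinity_cong[OF _ _ o fin]) (subst inv[OF c d], auto simp: Inr)
    qed
    then show ?thesis using o by (simp add: smooth_transition_def)
  qed
  show ok: "atlas_ok (prod_mfd M N)"
    using chart trans fM fN by (auto simp: atlas_ok_def prod_mfd_sel)
  have rect: "openin (mtop (prod_mfd M N)) (A \<times> B)" if A: "openin (mtop M) A" and B: "openin (mtop N) B" for A B
    unfolding openin_mtop_iff[OF ok] using openin_pts[OF A] openin_pts[OF B] co[OF _ _ A B]
    by (auto simp: prod_mfd_sel)
  show "mtop (prod_mfd M N) = prod_topology (mtop M) (mtop N)"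
    unfolding topology_eq
  proof (intro allI iffI)
    fix S assume S: "openin (prod_topology (mtop M) (mtop N)) S"
    show "openin (mtop (prod_mfd M N)) S"
    proof (subst openin_subopen, intro ballI)
      fix z assume z: "z \<in> S"
      then obtain A B where "openin (mtop M) A" "openin (mtop N) B" "fst z \<in> A" "snd z \<in> B" "A \<times> B \<subseteq> S"
        using S[unfolded openin_prod_topology_alt, rule_format, of "fst z" "snd z"] by auto
      then show "\<exists>T. openin (mtop (prod_mfd M N)) T \<and> z \<in> T \<and> T \<subseteq> S"
        using rect by (intro exI[of _ "A \<times> B"]) (auto simp: mem_Times_iff)
    qed
  next
    fix S assume S: "openin (mtop (prod_mfd M N)) S"
    show "openin (prod_topology (mtop M) (mtop N)) S"
      unfolding openin_prod_topology_alt
    proof (intro allI impI)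
      fix p q assume pq: "(p, q) \<in> S"
      then have "p \<in> pts M" "q \<in> pts N" using openin_pts[OF S] by auto
      obtain C \<phi> where c: "(C, \<phi>) \<in> atlas M" "p \<in> C" using \<open>p \<in> pts M\<close> by (rule pts_chart)
      obtain D \<psi> where d: "(D, \<psi>) \<in> atlas N" "q \<in> D" using \<open>q \<in> pts N\<close> by (rule pts_chart)
      have "copen (idx M <+> idx N) (prod_chart \<phi> \<psi> ` ((C \<times> D) \<inter> S))"
        using openin_mtop_image[OF ok S prod_atlasI[OF c(1) d(1)]] by (simp add: prod_mfd_sel)
      moreover have "prod_chart \<phi> \<psi> (p, q) \<in> prod_chart \<phi> \<psi> ` ((C \<times> D) \<inter> S)" using pq c d by auto
      moreover have "finite (idx M <+> idx N)" using fM fN by simp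
      ultimately obtain e where e: "e > 0" "\<And>y. y \<in> coord_space (idx M <+> idx N) \<Longrightarrow>
          (\<And>k. k \<in> idx M <+> idx N \<Longrightarrow> \<bar>y k - prod_chart \<phi> \<psi> (p, q) k\<bar> < e) \<Longrightarrow> y \<in> prod_chart \<phi> \<psi> ` ((C \<times> D) \<inter> S)"
        using copen_box by blast
      \<comment> \<open>A box for the joint coordinates is a product of boxes of the same radius,
        which yields the rectangle.\<close>
      define A where "A = {p' \<in> C. \<phi> p' \<in> {y. \<forall>i\<in>idx M. \<bar>y i - \<phi> p i\<bar> < e}}"
      define B where "B = {q' \<in> D. \<psi> q' \<in> {y. \<forall>i\<in>idx N. \<bar>y i - \<psi> q i\<bar> < e}}"
      have "openin (mtop M) A" unfolding A_def by (rule chart_openin[OF c(1) open_box[OF fM]])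
      moreover have "openin (mtop N) B" unfolding B_def by (rule chart_openin[OF d(1) open_box[OF fN]])
      moreover have "A \<times> B \<subseteq> S"
      proof clarify
        fix p' q' assume m: "p' \<in> A" "q' \<in> B"
        have "prod_chart \<phi> \<psi> (p', q') \<in> coord_space (idx M <+> idx N)"
          using m chartD(4)[OF M c(1)] chartD(4)[OF N d(1)]
          by (auto simp: A_def B_def prod_chart_def intro!: coord_space_case_sum)
        then have "prod_chart \<phi> \<psi> (p', q') \<in> prod_chart \<phi> \<psi> ` ((C \<times> D) \<inter> S)"
          by (rule e(2)) (use m in \<open>auto simp: A_def B_def\<close>)
        moreover have "(p', q') \<in> C \<times> D" using m by (auto simp: A_def B_def)
        ultimately show "(p', q') \<in> S" using inj[OF c(1) d(1)] by (auto dest: inj_onD)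
      qed
      moreover have "p \<in> A" "q \<in> B" using c d e(1) by (auto simp: A_def B_def)
      ultimately show "\<exists>U V. openin (mtop M) U \<and> openin (mtop N) V \<and> p \<in> U \<and> q \<in> V \<and> U \<times> V \<subseteq> S" by blast
    qed
  qed
qed

lemma second_countable_prod_topology:
  assumes "second_countable X" "second_countable Y"
  shows "second_countable (prod_topology X Y)"
proof -
  obtain A where A: "countable A" "\<forall>V\<in>A. openin X V" "\<forall>U x. openin X U \<and> x \<in> U \<longrightarrow> (\<exists>V\<in>A. x \<in> V \<and> V \<subseteq> U)"
    using assms(1) unfolding second_countable_def by blast
  obtain B where B: "countable B" "\<forall>V\<in>B. openin Y V" "\<forall>U x. openin Y U \<and> x \<in> U \<longrightarrow> (\<exists>V\<in>B. x \<in> V \<and> V \<subseteq> U)"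
    using assms(2) unfolding second_countable_def by blast
  show ?thesis unfolding second_countable_def
  proof (intro exI[of _ "(\<lambda>(U, V). U \<times> V) ` (A \<times> B)"] conjI allI impI ballI)
    show "countable ((\<lambda>(U, V). U \<times> V) ` (A \<times> B))" using A(1) B(1) by simp
    show "openin (prod_topology X Y) V" if "V \<in> (\<lambda>(U, V). U \<times> V) ` (A \<times> B)" for V
      using that A(2) B(2) by (auto simp: openin_prod_Times_iff)
    fix S z assume S: "openin (prod_topology X Y) S \<and> z \<in> S"
    then obtain U V where UV: "openin X U" "openin Y V" "fst z \<in> U" "snd z \<in> V" "U \<times> V \<subseteq> S"
      using openin_prod_topology_alt[of X Y S] by (metis prod.collapse)
    obtain U' where U': "U' \<in> A" "fst z \<in> U'" "U' \<subseteq> U" using A(3) UV(1,3) by blast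
    obtain V' where V': "V' \<in> B" "snd z \<in> V'" "V' \<subseteq> V" using B(3) UV(2,4) by blast
    show "\<exists>T\<in>(\<lambda>(U, V). U \<times> V) ` (A \<times> B). z \<in> T \<and> T \<subseteq> S"
      using U' V' UV(5) by (intro bexI[of _ "U' \<times> V'"]) (auto simp: mem_Times_iff)
  qed
qed

lemma manifold_prod: "manifold M \<Longrightarrow> manifold N \<Longrightarrow> manifold (prod_mfd M N)"
  using atlas_ok_prod[of M N] mtop_prod[of M N] manifold_atlas_ok[of M] manifold_atlas_ok[of N]
  by (auto simp: manifold_def atlas_ok_def Hausdorff_space_prod_topology second_countable_prod_topology)

lemma smooth_map_fst:
  assumes M: "atlas_ok M" and N: "atlas_ok N"
  shows "smooth_map (prod_mfd M N) M fst"
proof (rule smooth_mapI[OF atlas_ok_prod[OF M N] M])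
  fix z assume "z \<in> pts (prod_mfd M N)"
  then obtain p q where z: "z = (p, q)" "p \<in> pts M" "q \<in> pts N" by auto
  obtain C \<phi> where c: "(C, \<phi>) \<in> atlas M" "p \<in> C" using z(2) by (rule pts_chart)
  obtain D \<psi> where d: "(D, \<psi>) \<in> atlas N" "q \<in> D" using z(3) by (rule pts_chart)
  note ok = atlas_ok_prod[OF M N]
  note pm = max_chartD(5,6)[OF ok atlas_max_atlas[OF ok prod_atlasI[OF c(1) d(1)]]]
  have "smooth_on (prod_mfd M N) (C \<times> D) (\<lambda>z. \<phi> (fst z) j)" for j
    by (rule smooth_on_cong[OF ok pm(2)[of "Inl j"]]) auto
  then show "\<exists>U D \<psi>. openin (mtop (prod_mfd M N)) U \<and> z \<in> U \<and> (D, \<psi>) \<in> max_atlas M \<and>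
      (\<forall>q\<in>U. fst q \<in> D) \<and> (\<forall>j\<in>idx M. smooth_on (prod_mfd M N) U (\<lambda>q. \<psi> (fst q) j))"
    using pm(1) atlas_max_atlas[OF M c(1)] c d z(1)
    by (intro exI[of _ "C \<times> D"] exI[of _ C] exI[of _ \<phi>]) auto
qed

lemma smooth_map_snd:
  assumes M: "atlas_ok M" and N: "atlas_ok N"
  shows "smooth_map (prod_mfd M N) N snd"
proof (rule smooth_mapI[OF atlas_ok_prod[OF M N] N])
  fix z assume "z \<in> pts (prod_mfd M N)"
  then obtain p q where z: "z = (p, q)" "p \<in> pts M" "q \<in> pts N" by auto
  obtain C \<phi> where c: "(C, \<phi>) \<in> atlas M" "p \<in> C" using z(2) by (rule pts_chart)
  obtain D \<psi> where d: "(D, \<psi>) \<in> atlas N" "q \<in> D" using z(3) by (rule pts_chart)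
  note ok = atlas_ok_prod[OF M N]
  note pm = max_chartD(5,6)[OF ok atlas_max_atlas[OF ok prod_atlasI[OF c(1) d(1)]]]
  have "smooth_on (prod_mfd M N) (C \<times> D) (\<lambda>z. \<psi> (snd z) j)" for j
    by (rule smooth_on_cong[OF ok pm(2)[of "Inr j"]]) auto
  then show "\<exists>U D \<psi>. openin (mtop (prod_mfd M N)) U \<and> z \<in> U \<and> (D, \<psi>) \<in> max_atlas N \<and>
      (\<forall>q\<in>U. snd q \<in> D) \<and> (\<forall>j\<in>idx N. smooth_on (prod_mfd M N) U (\<lambda>q. \<psi> (snd q) j))"
    using pm(1) atlas_max_atlas[OF N d(1)] c d z(1)
    by (intro exI[of _ "C \<times> D"] exI[of _ D] exI[of _ \<psi>]) auto
qed

lemma smooth_map_pair: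
  assumes P: "atlas_ok P" and M: "atlas_ok M" and N: "atlas_ok N"
    and f: "smooth_map P M f" and g: "smooth_map P N g"
  shows "smooth_map P (prod_mfd M N) (\<lambda>x. (f x, g x))"
proof (rule smooth_mapI[OF P atlas_ok_prod[OF M N]])
  fix x assume x: "x \<in> pts P"
  obtain C \<phi> where c: "(C, \<phi>) \<in> atlas M" "f x \<in> C" using smooth_mapD(1)[OF f x] by (rule pts_chart)
  obtain D \<psi> where d: "(D, \<psi>) \<in> atlas N" "g x \<in> D" using smooth_mapD(1)[OF g x] by (rule pts_chart)
  note sf = smooth_map_max_chart[OF P M f atlas_max_atlas[OF M c(1)]]
  note sg = smooth_map_max_chart[OF P N g atlas_max_atlas[OF N d(1)]]
  define U where "U = {x \<in> pts P. f x \<in> C} \<inter> {x \<in> pts P. g x \<in> D}"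
  have U: "openin (mtop P) U" unfolding U_def
    using smooth_on_openin[OF sf] smooth_on_openin[OF sg] by (rule openin_Int)
  have "smooth_on P U (\<lambda>x. prod_chart \<phi> \<psi> (f x, g x) k)" for k
  proof (cases k)
    case (Inl i)
    have "smooth_on P U (\<lambda>x. \<phi> (f x) i)" by (rule smooth_on_subset[OF sf U]) (simp add: U_def)
    then show ?thesis by (simp add: Inl)
  next
    case (Inr j)
    have "smooth_on P U (\<lambda>x. \<psi> (g x) j)" by (rule smooth_on_subset[OF sg U]) (simp add: U_def)
    then show ?thesis by (simp add: Inr)
  qed
  then show "\<exists>U D \<psi>. openin (mtop P) U \<and> x \<in> U \<and> (D, \<psi>) \<in> max_atlas (prod_mfd M N) \<and>
      (\<forall>x\<in>U. (f x, g x) \<in> D) \<and> (\<forall>k\<in>idx (prod_mfd M N). smooth_on P U (\<lambda>x. \<psi> (f x, g x) k))"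
    using U x c d atlas_max_atlas[OF atlas_ok_prod[OF M N] prod_atlasI[OF c(1) d(1)]]
    by (intro exI[of _ U] exI[of _ "C \<times> D"] exI[of _ "prod_chart \<phi> \<psi>"]) (auto simp: U_def)
qed

section \<open>Level sets and submersions\<close>

text \<open>Coordinate lines of \<open>N\<close>, pushed through a section, are dual to the
  coordinates of \<open>\<Phi>\<close>: they are the curves that \<open>straighten\<close> asks
  for.\<close>

lemma section_curve:
  assumes M: "atlas_ok M" and N: "atlas_ok N" and s: "smooth_map N M \<sigma>"
    and sec: "\<And>y. y \<in> pts N \<Longrightarrow> \<Phi> (\<sigma> y) = y" and d: "(D, \<psi>) \<in> atlas N" "y \<in> D" and l: "l \<in> idx N"
  shows "curve M (\<sigma> y) (\<lambda>t. \<sigma> (coord_curve (D, \<psi>) l y t))"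
    "((\<lambda>t. \<psi> (\<Phi> (\<sigma> (coord_curve (D, \<psi>) l y t))) j) has_real_derivative (if j = l then 1 else 0)) (at 0)"
proof -
  note dm = atlas_max_atlas[OF N d(1)]
  note dD = max_chartD[OF N dm]
  show "curve M (\<sigma> y) (\<lambda>t. \<sigma> (coord_curve (D, \<psi>) l y t))"
    by (rule curve_map[OF N M s coord_curve[OF N dm d(2) l]])
  have "\<forall>\<^sub>F t in nhds 0. (\<psi> y)(l := t + \<psi> y l) \<in> \<psi> ` (D \<inter> D)"
    by (rule coord_curve_ev[OF N dm d(2) l dD(5) d(2)])
  then have ev: "\<forall>\<^sub>F t in nhds 0. \<psi> (\<Phi> (\<sigma> (coord_curve (D, \<psi>) l y t))) j = ((\<psi> y)(l := t + \<psi> y l)) j"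
  proof eventually_elim
    case (elim t)
    have "coord_curve (D, \<psi>) l y t \<in> pts N" using coord_curve_eq(1)[OF dD(1) elim] dD(3) by auto
    then show ?case using coord_curve_eq(2)[OF dD(1) elim] sec by simp
  qed
  have "((\<lambda>t. ((\<psi> y)(l := t + \<psi> y l)) j) has_real_derivative (if j = l then 1 else 0)) (at 0)"
    by (cases "j = l") (auto intro!: derivative_eq_intros)
  then show "((\<lambda>t. \<psi> (\<Phi> (\<sigma> (coord_curve (D, \<psi>) l y t))) j) has_real_derivative (if j = l then 1 else 0)) (at 0)"
    using DERIV_cong_ev[OF refl ev refl] by simp
qed

text \<open>The velocities of the curves obtained from the section form a matrix \<open>a\<close>
  that is a right inverse of the Jacobian matrix \<open>A\<close> of \<open>\<Phi>\<close>, and a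
  matrix with a right inverse is surjective.\<close>

lemma submersionI:
  assumes M: "atlas_ok M" and N: "atlas_ok N" and \<Phi>: "smooth_map M N \<Phi>"
    and sec: "\<And>p. p \<in> pts M \<Longrightarrow> \<exists>\<sigma>. smooth_map N M \<sigma> \<and> \<sigma> (\<Phi> p) = p \<and> (\<forall>y\<in>pts N. \<Phi> (\<sigma> y) = y)"
  shows "submersion M N \<Phi>"
  unfolding submersion_def
proof (intro conjI \<Phi> ballI impI, clarify)
  fix p C \<phi> D \<psi>
  assume p: "p \<in> pts M" and c: "(C, \<phi>) \<in> atlas M" and d: "(D, \<psi>) \<in> atlas N"
    and pc: "p \<in> fst (C, \<phi>)" and pd: "\<Phi> p \<in> fst (D, \<psi>)"
  note cm = atlas_max_atlas[OF M c] and dm = atlas_max_atlas[OF N d]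
  obtain \<sigma> where \<sigma>: "smooth_map N M \<sigma>" "\<sigma> (\<Phi> p) = p" "\<And>y. y \<in> pts N \<Longrightarrow> \<Phi> (\<sigma> y) = y"
    using sec[OF p] by blast
  have pC: "p \<in> C" and pD: "\<Phi> p \<in> D" using pc pd by auto
  define \<gamma> where "\<gamma> = (\<lambda>l t. \<sigma> (coord_curve (D, \<psi>) l (\<Phi> p) t))"
  have \<gamma>: "curve M p (\<gamma> l)" if "l \<in> idx N" for l
    using section_curve(1)[OF M N \<sigma>(1,3) d pD that] \<sigma>(2) by (simp add: \<gamma>_def)
  define a where "a = (\<lambda>i l. deriv (\<lambda>t. \<phi> (\<gamma> l t) i) 0)"
  define A where "A = (\<lambda>j i. dpart (C, \<phi>) i (\<lambda>q. \<psi> (\<Phi> q) j) p)"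
  have Aa: "(\<Sum>i\<in>idx M. A j i * a i l) = (if j = l then 1 else 0)" if l: "l \<in> idx N" for j l
  proof -
    have "((\<lambda>t. \<psi> (\<Phi> (\<gamma> l t)) j) has_real_derivative (\<Sum>i\<in>idx M. A j i * a i l)) (at 0)"
      unfolding A_def a_def
      by (rule curve_chain[OF M \<gamma>[OF l] cm pC smooth_map_max_chart[OF M N \<Phi> dm]]) (use p pD in auto)
    moreover have "((\<lambda>t. \<psi> (\<Phi> (\<gamma> l t)) j) has_real_derivative (if j = l then 1 else 0)) (at 0)"
      unfolding \<gamma>_def by (rule section_curve(2)[OF M N \<sigma>(1,3) d pD l])
    ultimately show ?thesis by (rule DERIV_unique)
  qed
  have dc: "dcoord M N (C, \<phi>) (D, \<psi>) \<Phi> p v = (\<lambda>j. if j \<in> idx N then \<Sum>i\<in>idx M. A j i * v i else 0)" for v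
    by (auto simp: dcoord_def A_def dpart_def fun_eq_iff)
  show "dcoord M N (C, \<phi>) (D, \<psi>) \<Phi> p ` coord_space (idx M) = coord_space (idx N)"
  proof (intro equalityI subsetI)
    fix w assume "w \<in> dcoord M N (C, \<phi>) (D, \<psi>) \<Phi> p ` coord_space (idx M)"
    then show "w \<in> coord_space (idx N)" by (auto simp: dc coord_space_def)
  next
    fix w assume w: "w \<in> coord_space (idx N)"
    \<comment> \<open>The image of \<open>w\<close> under the differential of the section.\<close>
    define v where "v = (\<lambda>i. if i \<in> idx M then \<Sum>l\<in>idx N. a i l * w l else 0)"
    have "dcoord M N (C, \<phi>) (D, \<psi>) \<Phi> p v j = w j" for j
    proof (cases "j \<in> idx N")
      case True
      have "(\<Sum>i\<in>idx M. A j i * v i) = (\<Sum>i\<in>idx M. \<Sum>l\<in>idx N. A j i * a i l * w l)"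
        by (simp add: v_def sum_distrib_left mult.assoc)
      also have "\<dots> = (\<Sum>l\<in>idx N. (\<Sum>i\<in>idx M. A j i * a i l) * w l)"
        by (subst sum.swap) (simp add: sum_distrib_right)
      also have "\<dots> = (\<Sum>l\<in>idx N. if j = l then w l else 0)"
        using Aa by (intro sum.cong) auto
      also have "\<dots> = w j" using True atlas_ok_finite[OF N] by simp
      finally show ?thesis using True by (simp add: dc)
    qed (use w in \<open>auto simp: dc coord_space_def\<close>)
    then have "w = dcoord M N (C, \<phi>) (D, \<psi>) \<Phi> p v" by auto
    moreover have "v \<in> coord_space (idx M)" by (simp add: v_def coord_space_def)
    ultimately show "w \<in> dcoord M N (C, \<phi>) (D, \<psi>) \<Phi> p ` coord_space (idx M)" by blast
  qed
qed

text \<open>The coordinates of \<open>\<Phi>\<close>, diminished by their values at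
  \<open>p\<close>, are straightened to coordinates of \<open>M\<close>; the subtraction turns the
  level set into a set of zeros.\<close>

lemma level_set_chart:
  assumes M: "atlas_ok M" and N: "atlas_ok N" and \<Phi>: "smooth_map M N \<Phi>" and p: "p \<in> pts M"
    and \<sigma>: "smooth_map N M \<sigma>" "\<sigma> (\<Phi> p) = p" "\<And>y. y \<in> pts N \<Longrightarrow> \<Phi> (\<sigma> y) = y"
  shows "\<exists>C \<phi> \<iota>. (C, \<phi>) \<in> max_atlas M \<and> p \<in> C \<and> inj_on \<iota> (idx N) \<and> \<iota> ` idx N \<subseteq> idx M \<and>
    (\<forall>q\<in>C. \<Phi> q = \<Phi> p \<longleftrightarrow> (\<forall>i\<in>\<iota> ` idx N. \<phi> q i = 0))"
proof -
  obtain D \<psi> where d: "(D, \<psi>) \<in> atlas N" "\<Phi> p \<in> D" using smooth_mapD(1)[OF \<Phi> p] by (rule pts_chart)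
  note dm = atlas_max_atlas[OF N d(1)]
  note sm = smooth_map_max_chart[OF M N \<Phi> dm] and dD = max_chartD[OF N dm]
  define U where "U = {q \<in> pts M. \<Phi> q \<in> D}"
  have U: "openin (mtop M) U" "p \<in> U" using smooth_on_openin[OF sm] p d by (auto simp: U_def)
  define f where "f = (\<lambda>l q. \<psi> (\<Phi> q) l - \<psi> (\<Phi> p) l)"
  define \<gamma> where "\<gamma> = (\<lambda>l t. \<sigma> (coord_curve (D, \<psi>) l (\<Phi> p) t))"
  have "\<exists>C \<phi> \<iota>. (C, \<phi>) \<in> max_atlas M \<and> p \<in> C \<and> C \<subseteq> U \<and> inj_on \<iota> (idx N) \<and> \<iota> ` idx N \<subseteq> idx M \<and>
    (\<forall>l\<in>idx N. \<forall>q\<in>C. \<phi> q (\<iota> l) = f l q)"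
  proof (rule straighten[OF M atlas_ok_finite[OF N] U])
    show "smooth_on M U (f l)" for l
      unfolding f_def by (rule smooth_on_diff[OF M _ smooth_on_const[OF M U(1)]]) (use sm in \<open>simp add: U_def\<close>)
    show "curve M p (\<gamma> l)" if "l \<in> idx N" for l
      using section_curve(1)[OF M N \<sigma>(1,3) d that] \<sigma>(2) by (simp add: \<gamma>_def)
    show "((\<lambda>t. f l (\<gamma> m t)) has_real_derivative (if l = m then 1 else 0)) (at 0)" if "m \<in> idx N" for l m
      using DERIV_diff[OF section_curve(2)[OF M N \<sigma>(1,3) d that, of l] DERIV_const[of "\<psi> (\<Phi> p) l"]]
      by (simp add: f_def \<gamma>_def)
  qed
  then obtain C \<phi> \<iota> where c: "(C, \<phi>) \<in> max_atlas M" "p \<in> C" "C \<subseteq> U" "inj_on \<iota> (idx N)" "\<iota> ` idx N \<subseteq> idx M"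
    "\<forall>l\<in>idx N. \<forall>q\<in>C. \<phi> q (\<iota> l) = f l q" by (elim exE conjE)
  have "\<Phi> q = \<Phi> p \<longleftrightarrow> (\<forall>i\<in>\<iota> ` idx N. \<phi> q i = 0)" if q: "q \<in> C" for q
  proof -
    have qD: "\<Phi> q \<in> D" using q c(3) by (auto simp: U_def)
    have "\<Phi> q = \<Phi> p \<longleftrightarrow> \<psi> (\<Phi> q) = \<psi> (\<Phi> p)" using dD(1) qD d(2) by (auto dest: inj_onD)
    also have "\<dots> \<longleftrightarrow> (\<forall>l\<in>idx N. \<psi> (\<Phi> q) l = \<psi> (\<Phi> p) l)"
      using coord_space_eqI[OF dD(4)[OF qD] dD(4)[OF d(2)]] by auto
    also have "\<dots> \<longleftrightarrow> (\<forall>i\<in>\<iota> ` idx N. \<phi> q i = 0)" using c(6) q by (auto simp: f_def)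
    finally show ?thesis .
  qed
  then show ?thesis using c(1,2,4,5) by blast
qed

text \<open>The index set must not depend on the point. The positions \<open>B\<close> are therefore
  taken from an arbitrary \<open>p0\<close>, and at every other point a permutation of the
  coordinates moves the vanishing ones to \<open>B\<close>.\<close>

lemma embedded_level_set:
  assumes M: "atlas_ok M" and N: "atlas_ok N" and \<Phi>: "smooth_map M N \<Phi>"
    and sec: "\<And>p. p \<in> pts M \<Longrightarrow> \<Phi> p = c \<Longrightarrow> \<exists>\<sigma>. smooth_map N M \<sigma> \<and> \<sigma> c = p \<and> (\<forall>y\<in>pts N. \<Phi> (\<sigma> y) = y)"
  shows "embedded_submanifold M {p \<in> pts M. \<Phi> p = c}"
proof (cases "{p \<in> pts M. \<Phi> p = c} = {}")
  case True
  then show ?thesis by (auto simp: embedded_submanifold_def has_slice_charts_def)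
next
  case False
  note fin = atlas_ok_finite[OF M]
  let ?S = "{p \<in> pts M. \<Phi> p = c}"
  have ch: "\<exists>C \<phi> \<iota>. (C, \<phi>) \<in> max_atlas M \<and> p \<in> C \<and> inj_on \<iota> (idx N) \<and> \<iota> ` idx N \<subseteq> idx M \<and>
    (\<forall>q\<in>C. \<Phi> q = c \<longleftrightarrow> (\<forall>i\<in>\<iota> ` idx N. \<phi> q i = 0))" if p: "p \<in> ?S" for p
  proof -
    have "p \<in> pts M" "\<Phi> p = c" using p by auto
    then obtain \<sigma> where \<sigma>: "smooth_map N M \<sigma>" "\<sigma> (\<Phi> p) = p" "\<And>y. y \<in> pts N \<Longrightarrow> \<Phi> (\<sigma> y) = y"
      using sec by blast
    from level_set_chart[OF M N \<Phi> \<open>p \<in> pts M\<close> \<sigma>] show ?thesis unfolding \<open>\<Phi> p = c\<close> .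
  qed
  obtain p0 where p0: "p0 \<in> ?S" using False by blast
  obtain \<iota>0 where \<iota>0: "inj_on \<iota>0 (idx N)" "\<iota>0 ` idx N \<subseteq> idx M" using ch[OF p0] by blast
  define B where "B = \<iota>0 ` idx N"
  define J where "J = idx M - B"
  have "\<exists>ch. slice_chart M ?S J ch \<and> p \<in> fst ch" if p: "p \<in> ?S" for p
  proof -
    obtain C \<phi> \<iota> where C: "(C, \<phi>) \<in> max_atlas M" "p \<in> C" "inj_on \<iota> (idx N)" "\<iota> ` idx N \<subseteq> idx M"
      "\<forall>q\<in>C. \<Phi> q = c \<longleftrightarrow> (\<forall>i\<in>\<iota> ` idx N. \<phi> q i = 0)" using ch[OF p] by (elim exE conjE)
    note cm = max_chartD[OF M C(1)]
    define B' where "B' = \<iota> ` idx N"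
    have BM: "B \<subseteq> idx M" "B' \<subseteq> idx M" using \<iota>0 C(4) by (auto simp: B_def B'_def)
    have fB: "finite B" "finite B'" using finite_subset[OF _ fin] BM by auto
    have card: "card B = card B'" using card_image[OF \<iota>0(1)] card_image[OF C(3)] by (simp add: B_def B'_def)
    \<comment> \<open>Both sets of positions have the size of \<open>idx N\<close>, hence equally
      large complements, and the bijection between them extends to all coordinates.\<close>
    then have card': "card (idx M - B) = card (idx M - B')" using BM fB by (simp add: card_Diff_subset)
    obtain f where f: "bij_betw f B B'" using finite_same_card_bij[OF fB card] by blast
    obtain g where g: "bij_betw g (idx M - B) (idx M - B')"
      using finite_same_card_bij[OF _ _ card'] fin by blast
    define \<pi> where "\<pi> = (\<lambda>i. if i \<in> B then f i else g i)"
    have \<pi>B: "bij_betw \<pi> B B'" using f by (rule bij_betw_cong[THEN iffD1, rotated]) (simp add: \<pi>_def)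
    have "bij_betw \<pi> (idx M - B) (idx M - B')"
      using g by (rule bij_betw_cong[THEN iffD1, rotated]) (simp add: \<pi>_def)
    then have \<pi>: "bij_betw \<pi> (idx M) (idx M)"
      using bij_betw_combine[OF \<pi>B, of "idx M - B" "idx M - B'"] BM by (simp add: Un_absorb1)
    let ?\<phi> = "\<lambda>q i. if i \<in> idx M then \<phi> q (\<pi> i) else 0"
    have S: "q \<in> ?S \<longleftrightarrow> ?\<phi> q \<in> coord_space J" if q: "q \<in> C" for q
    proof -
      have "q \<in> ?S \<longleftrightarrow> (\<forall>i\<in>B'. \<phi> q i = 0)" using C(5) q cm(3) by (auto simp: B'_def)
      also have "\<dots> \<longleftrightarrow> (\<forall>i\<in>B. \<phi> q (\<pi> i) = 0)" using \<pi>B by (auto simp: bij_betw_def)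
      also have "\<dots> \<longleftrightarrow> ?\<phi> q \<in> coord_space J" using BM by (auto simp: coord_space_def J_def)
      finally show ?thesis .
    qed
    have "slice_chart M ?S J (C, ?\<phi>)"
      unfolding slice_chart_def case_prod_conv
    proof
      show "(C, ?\<phi>) \<in> max_atlas M" by (rule max_atlas_permute[OF M C(1) \<pi>])
      show "?\<phi> ` (C \<inter> ?S) = ?\<phi> ` C \<inter> coord_space J" using S by blast
    qed
    then show ?thesis using C(2) by (intro exI[of _ "(C, ?\<phi>)"]) auto
  qed
  then show ?thesis
    unfolding embedded_submanifold_def has_slice_charts_def
    by (intro conjI exI[of _ J] ballI) (auto simp: J_def)
qed

section \<open>Homogeneous smooth bijections\<close>

lemma coord_curve_coord:
  assumes M: "atlas_ok M" and c: "(C, \<phi>) \<in> max_atlas M" "p \<in> C" and i: "i \<in> idx M"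
  shows "((\<lambda>t. \<phi> (coord_curve (C, \<phi>) i p t) k) has_real_derivative (if k = i then 1 else 0)) (at 0)"
proof -
  note cm = max_chartD[OF M c(1)]
  have "\<forall>\<^sub>F t in nhds 0. (\<phi> p)(i := t + \<phi> p i) \<in> \<phi> ` (C \<inter> C)"
    by (rule coord_curve_ev[OF M c i cm(5) c(2)])
  then have ev: "\<forall>\<^sub>F t in nhds 0. \<phi> (coord_curve (C, \<phi>) i p t) k = ((\<phi> p)(i := t + \<phi> p i)) k"
    by eventually_elim (use coord_curve_eq(2)[OF cm(1)] in metis)
  have "((\<lambda>t. ((\<phi> p)(i := t + \<phi> p i)) k) has_real_derivative (if k = i then 1 else 0)) (at 0)"
    by (cases "k = i") (auto intro!: derivative_eq_intros)
  then show ?thesis using DERIV_cong_ev[OF refl ev refl] by simp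
qed

text \<open>The differential of \<open>\<theta>\<close> at \<open>p\<close> has rank at least \<open>s\<close>: some functions on the target and
  curves in the source have the identity as their matrix of derivatives.\<close>

definition rank_ge :: "('a, 'i) mfd \<Rightarrow> ('b, 'j) mfd \<Rightarrow> ('a \<Rightarrow> 'b) \<Rightarrow> 'a \<Rightarrow> nat \<Rightarrow> bool" where
  "rank_ge M N \<theta> p s \<longleftrightarrow> (\<exists>V l \<gamma>. openin (mtop N) V \<and> \<theta> p \<in> V \<and> (\<forall>a<s. smooth_on N V (l a)) \<and>
    (\<forall>b<s. curve M p (\<gamma> b)) \<and>
    (\<forall>a<s. \<forall>b<s. ((\<lambda>t. l a (\<theta> (\<gamma> b t))) has_real_derivative (if a = b then 1 else 0)) (at 0)))"

text \<open>Curves are pushed forward by \<open>a\<close> and functions pulled back by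
  \<open>b\<close>; as \<open>b (\<theta> (a q)) = \<theta> q\<close>, the matrix of derivatives
  remains the identity.\<close>

lemma rank_ge_transport:
  assumes M: "atlas_ok M" and N: "atlas_ok N" and r: "rank_ge M N \<theta> p s" and \<theta>: "smooth_map M N \<theta>"
    and p: "p \<in> pts M" and a: "smooth_map M M a" and b: "smooth_map N N b"
    and ab: "\<And>q. q \<in> pts M \<Longrightarrow> b (\<theta> (a q)) = \<theta> q"
  shows "rank_ge M N \<theta> (a p) s"
proof -
  obtain V l \<gamma> where V: "openin (mtop N) V" "\<theta> p \<in> V" "\<forall>a<s. smooth_on N V (l a)" "\<forall>b<s. curve M p (\<gamma> b)"
    "\<forall>a<s. \<forall>b<s. ((\<lambda>t. l a (\<theta> (\<gamma> b t))) has_real_derivative (if a = b then 1 else 0)) (at 0)"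
    using r unfolding rank_ge_def by (elim exE conjE)
  show ?thesis
    unfolding rank_ge_def
  proof (intro exI conjI allI impI)
    show "openin (mtop N) {y \<in> pts N. b y \<in> V}" by (rule smooth_mapD(2)[OF b V(1)])
    show "\<theta> (a p) \<in> {y \<in> pts N. b y \<in> V}"
      using ab[OF p] V(2) smooth_mapD(1)[OF \<theta> smooth_mapD(1)[OF a p]] by simp
    show "smooth_on N {y \<in> pts N. b y \<in> V} (\<lambda>y. l k (b y))" if "k < s" for k
      using smooth_on_pullback[OF N N b V(3)[rule_format, OF that]] .
    show "curve M (a p) (\<lambda>t. a (\<gamma> k t))" if "k < s" for k
      using curve_map[OF M M a V(4)[rule_format, OF that]] .
    fix k m assume km: "k < s" "m < s"
    have "\<forall>\<^sub>F t in nhds 0. \<gamma> m t \<in> pts M"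
      by (rule curveD(3)[OF V(4)[rule_format, OF km(2)] openin_mtop_pts p])
    then have ev: "\<forall>\<^sub>F t in nhds 0. l k (b (\<theta> (a (\<gamma> m t)))) = l k (\<theta> (\<gamma> m t))"
      by eventually_elim (simp add: ab)
    show "((\<lambda>t. l k (b (\<theta> (a (\<gamma> m t))))) has_real_derivative (if k = m then 1 else 0)) (at 0)"
      using V(5) km DERIV_cong_ev[OF refl ev refl] by simp
  qed
qed

text \<open>The functions \<open>l\<close> become coordinates of the target and their pullbacks
  coordinates of the source. Independence is certified by the given curves in the source and by
  their images in the target.\<close>

lemma rank_ge_straighten:
  fixes s :: nat
  assumes M: "atlas_ok M" and N: "atlas_ok N" and \<theta>: "smooth_map M N \<theta>" and p: "p \<in> pts M"
    and V: "openin (mtop N) V" "\<theta> p \<in> V" "\<forall>a<s. smooth_on N V (l a)" "\<forall>b<s. curve M p (\<gamma> b)"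
    "\<forall>a<s. \<forall>b<s. ((\<lambda>t. l a (\<theta> (\<gamma> b t))) has_real_derivative (if a = b then 1 else 0)) (at 0)"
  shows "\<exists>C \<phi> \<iota>. (C, \<phi>) \<in> max_atlas M \<and> p \<in> C \<and> C \<subseteq> {q \<in> pts M. \<theta> q \<in> V} \<and> inj_on \<iota> {..<s} \<and> \<iota> ` {..<s} \<subseteq> idx M \<and>
      (\<forall>a\<in>{..<s}. \<forall>q\<in>C. \<phi> q (\<iota> a) = l a (\<theta> q))"
    "\<exists>D \<psi> \<iota>. (D, \<psi>) \<in> max_atlas N \<and> \<theta> p \<in> D \<and> D \<subseteq> V \<and> inj_on \<iota> {..<s} \<and> \<iota> ` {..<s} \<subseteq> idx N \<and>
      (\<forall>a\<in>{..<s}. \<forall>y\<in>D. \<psi> y (\<iota> a) = l a y)"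
proof -
  have "\<exists>C \<phi> \<iota>. (C, \<phi>) \<in> max_atlas M \<and> p \<in> C \<and> C \<subseteq> {q \<in> pts M. \<theta> q \<in> V} \<and> inj_on \<iota> {..<s} \<and> \<iota> ` {..<s} \<subseteq> idx M \<and>
      (\<forall>a\<in>{..<s}. \<forall>q\<in>C. \<phi> q (\<iota> a) = (\<lambda>a q. l a (\<theta> q)) a q)"
    by (rule straighten[OF M _ smooth_mapD(2)[OF \<theta> V(1)], where \<gamma> = \<gamma>])
      (use V p smooth_on_pullback[OF M N \<theta>] in auto)
  then show "\<exists>C \<phi> \<iota>. (C, \<phi>) \<in> max_atlas M \<and> p \<in> C \<and> C \<subseteq> {q \<in> pts M. \<theta> q \<in> V} \<and> inj_on \<iota> {..<s} \<and> \<iota> ` {..<s} \<subseteq> idx M \<and>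
      (\<forall>a\<in>{..<s}. \<forall>q\<in>C. \<phi> q (\<iota> a) = l a (\<theta> q))" by simp
  show "\<exists>D \<psi> \<iota>. (D, \<psi>) \<in> max_atlas N \<and> \<theta> p \<in> D \<and> D \<subseteq> V \<and> inj_on \<iota> {..<s} \<and> \<iota> ` {..<s} \<subseteq> idx N \<and>
      (\<forall>a\<in>{..<s}. \<forall>y\<in>D. \<psi> y (\<iota> a) = l a y)"
    by (rule straighten[OF N _ V(1,2), where \<gamma> = "\<lambda>b t. \<theta> (\<gamma> b t)"])
      (use V curve_map[OF M N \<theta>] in auto)
qed

text \<open>Straightened functions occupy distinct coordinates of the source.\<close>

lemma rank_ge_bound:
  assumes M: "atlas_ok M" and N: "atlas_ok N" and \<theta>: "smooth_map M N \<theta>" and p: "p \<in> pts M"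
    and r: "rank_ge M N \<theta> p s"
  shows "s \<le> card (idx M)"
proof -
  obtain V l \<gamma> where V: "openin (mtop N) V" "\<theta> p \<in> V" "\<forall>a<s. smooth_on N V (l a)" "\<forall>b<s. curve M p (\<gamma> b)"
    "\<forall>a<s. \<forall>b<s. ((\<lambda>t. l a (\<theta> (\<gamma> b t))) has_real_derivative (if a = b then 1 else 0)) (at 0)"
    using r unfolding rank_ge_def by (elim exE conjE)
  from rank_ge_straighten(1)[OF M N \<theta> p V] obtain \<iota> :: "nat \<Rightarrow> 'b" where "inj_on \<iota> {..<s}" "\<iota> ` {..<s} \<subseteq> idx M"
    by (elim exE conjE)
  from card_inj_on_le[OF this atlas_ok_finite[OF M]] show ?thesis by simp
qed

text \<open>A function on the target whose pullback varied in a direction \<open>i\<close> outside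
  the \<open>r\<close> distinguished ones would enlarge the identity matrix by one row, with the
  coordinate line in direction \<open>i\<close> as the new column.\<close>

lemma max_rank_dpart_zero:
  assumes M: "atlas_ok M" and N: "atlas_ok N" and \<theta>: "smooth_map M N \<theta>"
    and c: "(C, \<phi>) \<in> max_atlas M" "q \<in> C" "C \<subseteq> {q \<in> pts M. \<theta> q \<in> V}"
    and \<iota>: "inj_on \<iota> {..<r}" "\<iota> ` {..<r} \<subseteq> idx M" "\<And>a q. a < r \<Longrightarrow> q \<in> C \<Longrightarrow> \<phi> q (\<iota> a) = l a (\<theta> q)"
    and V: "openin (mtop N) V" "\<And>a. a < r \<Longrightarrow> smooth_on N V (l a)"
    and max: "\<not> rank_ge M N \<theta> q (Suc r)"
    and i: "i \<in> idx M" "i \<notin> \<iota> ` {..<r}" and \<mu>: "smooth_on N V' \<mu>" "\<theta> q \<in> V'"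
  shows "dpart (C, \<phi>) i (\<lambda>q. \<mu> (\<theta> q)) q = 0"
proof (rule ccontr)
  note cm = max_chartD[OF M c(1)]
  define d where "d = (\<lambda>j. dpart (C, \<phi>) j (\<lambda>q. \<mu> (\<theta> q)) q)"
  assume "dpart (C, \<phi>) i (\<lambda>q. \<mu> (\<theta> q)) q \<noteq> 0"
  then have di: "d i \<noteq> 0" by (simp add: d_def)
  have qM: "q \<in> pts M" "\<theta> q \<in> V" using c(2,3) by auto
  \<comment> \<open>Subtracting this combination of the \<open>l b\<close> kills the derivatives
    along the \<open>r\<close> directions of \<open>\<iota>\<close>; division by \<open>d i\<close>
    makes the derivative in direction \<open>i\<close> equal to 1.\<close>
  define l' where "l' = (\<lambda>y. (\<mu> y - (\<Sum>b<r. d (\<iota> b) * l b y)) * inverse (d i))"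
  have dl: "((\<lambda>t. l a (\<theta> (coord_curve (C, \<phi>) j q t))) has_real_derivative (if \<iota> a = j then 1 else 0)) (at 0)"
    if a: "a < r" and j: "j \<in> idx M" for a j
  proof -
    have "\<forall>\<^sub>F t in nhds 0. coord_curve (C, \<phi>) j q t \<in> C"
      by (rule curveD(3)[OF coord_curve[OF M c(1,2) j] cm(5) c(2)])
    then have ev: "\<forall>\<^sub>F t in nhds 0. l a (\<theta> (coord_curve (C, \<phi>) j q t)) = \<phi> (coord_curve (C, \<phi>) j q t) (\<iota> a)"
      by eventually_elim (simp add: \<iota>(3)[OF a])
    show ?thesis using coord_curve_coord[OF M c(1,2) j, of "\<iota> a"] DERIV_cong_ev[OF refl ev refl] by simp
  qed
  have d\<mu>: "((\<lambda>t. \<mu> (\<theta> (coord_curve (C, \<phi>) j q t))) has_real_derivative d j) (at 0)" if j: "j \<in> idx M" for j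
    unfolding d_def
    by (rule coord_curve_deriv[OF M c(1,2) j smooth_on_pullback[OF M N \<theta> \<mu>(1)]]) (use qM \<mu> in auto)
  have dl': "((\<lambda>t. l' (\<theta> (coord_curve (C, \<phi>) j q t))) has_real_derivative
      (d j - (\<Sum>b<r. d (\<iota> b) * (if \<iota> b = j then 1 else 0))) * inverse (d i)) (at 0)" if j: "j \<in> idx M" for j
    unfolding l'_def by (intro DERIV_cmult_right DERIV_diff d\<mu> j DERIV_sum DERIV_cmult dl) auto
  have sum1: "(\<Sum>b<r. d (\<iota> b) * (if \<iota> b = i then 1 else 0)) = 0"
    using i(2) by (intro sum.neutral) auto
  have sum2: "(\<Sum>b<r. d (\<iota> b) * (if \<iota> b = \<iota> m then 1 else 0)) = d (\<iota> m)" if "m < r" for m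
  proof -
    have "(\<Sum>b<r. d (\<iota> b) * (if \<iota> b = \<iota> m then 1 else 0)) = (\<Sum>b<r. if b = m then d (\<iota> m) else 0)"
      using \<iota>(1) that by (intro sum.cong) (auto dest: inj_onD)
    then show ?thesis using that by simp
  qed
  have "rank_ge M N \<theta> q (Suc r)"
    unfolding rank_ge_def
  proof (intro exI conjI allI impI)
    show o: "openin (mtop N) (V \<inter> V')" using V(1) smooth_on_openin[OF \<mu>(1)] by (rule openin_Int)
    show "\<theta> q \<in> V \<inter> V'" using qM \<mu>(2) by simp
    show "smooth_on N (V \<inter> V') ((\<lambda>a. if a < r then l a else l') a)" if "a < Suc r" for a
    proof (cases "a < r")
      case True
      then show ?thesis using smooth_on_subset[OF V(2) o] by simp
    next
      case False
      have "smooth_on N (V \<inter> V') l'"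
        unfolding l'_def
        by (intro smooth_on_mult[OF N] smooth_on_diff[OF N] smooth_on_sum[OF N] o smooth_on_const[OF N]
            smooth_on_subset[OF V(2) o] smooth_on_subset[OF \<mu>(1) o]) auto
      then show ?thesis using False by simp
    qed
    show "curve M q ((\<lambda>b. coord_curve (C, \<phi>) (if b < r then \<iota> b else i) q) b)" if "b < Suc r" for b
      using \<iota>(2) i(1) by (intro coord_curve[OF M c(1,2)]) auto
    fix a b assume ab: "a < Suc r" "b < Suc r"
    show "((\<lambda>t. (\<lambda>a. if a < r then l a else l') a (\<theta> ((\<lambda>b. coord_curve (C, \<phi>) (if b < r then \<iota> b else i) q) b t)))
      has_real_derivative (if a = b then 1 else 0)) (at 0)"
    proof (cases "a < r")
      case True
      have "(if b < r then \<iota> b else i) \<in> idx M" using \<iota>(2) i(1) by auto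
      moreover have "\<iota> a = (if b < r then \<iota> b else i) \<longleftrightarrow> a = b"
        using True i(2) \<iota>(1) ab by (auto dest: inj_onD)
      ultimately show ?thesis using dl[OF True, of "if b < r then \<iota> b else i"] True by simp
    next
      case a: False
      show ?thesis
      proof (cases "b < r")
        case True
        then have "\<iota> b \<in> idx M" using \<iota>(2) by auto
        then show ?thesis using dl'[of "\<iota> b"] sum2[OF True] a True by simp
      next
        case False
        then show ?thesis using dl'[OF i(1)] sum1 a ab di by simp
      qed
    qed
  qed
  then show False using max by simp
qed

text \<open>If a direction \<open>i\<close> were left over, all coordinates of
  \<open>\<theta>\<close> would have derivative zero along a segment of the coordinate line in that
  direction, and \<open>\<theta>\<close> would be constant on it, against injectivity. The bound on
  the rank has to hold at every point of the segment.\<close>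

lemma max_rank_immersion:
  assumes M: "atlas_ok M" and N: "atlas_ok N" and \<theta>: "smooth_map M N \<theta>" and inj: "inj_on \<theta> (pts M)"
    and c: "(C, \<phi>) \<in> max_atlas M" "p \<in> C" "C \<subseteq> {q \<in> pts M. \<theta> q \<in> V}"
    and \<iota>: "inj_on \<iota> {..<r}" "\<iota> ` {..<r} \<subseteq> idx M" "\<And>a q. a < r \<Longrightarrow> q \<in> C \<Longrightarrow> \<phi> q (\<iota> a) = l a (\<theta> q)"
    and V: "openin (mtop N) V" "\<And>a. a < r \<Longrightarrow> smooth_on N V (l a)"
    and max: "\<And>q. q \<in> pts M \<Longrightarrow> \<not> rank_ge M N \<theta> q (Suc r)"
  shows "\<iota> ` {..<r} = idx M"
proof (rule ccontr)
  note cm = max_chartD[OF M c(1)]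
  assume "\<iota> ` {..<r} \<noteq> idx M"
  then obtain i where i: "i \<in> idx M" "i \<notin> \<iota> ` {..<r}" using \<iota>(2) by auto
  have pM: "p \<in> pts M" using c by auto
  obtain D \<psi> where d: "(D, \<psi>) \<in> atlas N" "\<theta> p \<in> D" using smooth_mapD(1)[OF \<theta> pM] by (rule pts_chart)
  note dm = atlas_max_atlas[OF N d(1)]
  note dD = max_chartD[OF N dm] and sm = smooth_map_max_chart[OF M N \<theta> dm]
  define U where "U = {q \<in> pts M. \<theta> q \<in> D}"
  have U: "openin (mtop M) U" "p \<in> U" using smooth_on_openin[OF sm] pM d(2) by (auto simp: U_def)
  let ?F = "coord_curve (C, \<phi>) i p"
  have "\<forall>\<^sub>F t in nhds 0. (\<phi> p)(i := t + \<phi> p i) \<in> \<phi> ` (C \<inter> U)"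
    by (rule coord_curve_ev[OF M c(1,2) i(1) U])
  then obtain e where e: "e > 0" "\<And>t. \<bar>t\<bar> < e \<Longrightarrow> (\<phi> p)(i := t + \<phi> p i) \<in> \<phi> ` (C \<inter> U)"
    by (auto simp: eventually_nhds_metric dist_real_def)
  have F: "?F t \<in> C \<inter> U" "\<phi> (?F t) = (\<phi> p)(i := t + \<phi> p i)" if "\<bar>t\<bar> < e" for t
    using coord_curve_eq[OF cm(1) e(2)[OF that]] by auto
  \<comment> \<open>Starting the coordinate line at another of its points only shifts time; this
    turns derivatives at time 0 into derivatives at time \<open>t\<close>.\<close>
  have shift: "coord_curve (C, \<phi>) i (?F t) s = ?F (s + t)" if "\<bar>t\<bar> < e" for s t
    using F(2)[OF that] by (simp add: coord_curve_def add.assoc)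
  have D0: "((\<lambda>t. \<psi> (\<theta> (?F t)) j) has_real_derivative 0) (at t)" if t: "\<bar>t\<bar> < e" for t j
  proof -
    have FC: "?F t \<in> C" and FU: "?F t \<in> U" using F(1)[OF t] by auto
    have "((\<lambda>s. \<psi> (\<theta> (coord_curve (C, \<phi>) i (?F t) s)) j) has_real_derivative
        dpart (C, \<phi>) i (\<lambda>q. \<psi> (\<theta> q) j) (?F t)) (at 0)"
      by (rule coord_curve_deriv[OF M c(1) FC i(1) sm]) (use FU in \<open>simp add: U_def\<close>)
    moreover have "dpart (C, \<phi>) i (\<lambda>q. \<psi> (\<theta> q) j) (?F t) = 0"
      by (rule max_rank_dpart_zero[OF M N \<theta> c(1) FC c(3) \<iota> V _ i dD(6)])
        (use FU max in \<open>auto simp: U_def\<close>)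
    ultimately show ?thesis
      using DERIV_shift[of "\<lambda>t. \<psi> (\<theta> (?F t)) j" 0 0 t] shift[OF t] by simp
  qed
  have "\<psi> (\<theta> (?F (e/2))) j = \<psi> (\<theta> (?F 0)) j" for j
    by (rule DERIV_isconst3[of "-e" e]) (use e(1) D0 in auto)
  then have "\<psi> (\<theta> (?F (e/2))) = \<psi> (\<theta> (?F 0))" by auto
  moreover have h: "\<bar>e/2\<bar> < e" "\<bar>0::real\<bar> < e" using e(1) by auto
  ultimately have "\<theta> (?F (e/2)) = \<theta> (?F 0)"
    using F(1)[OF h(1)] F(1)[OF h(2)] dD(1) by (auto simp: U_def dest: inj_onD)
  then have "?F (e/2) = ?F 0"
    using F(1)[OF h(1)] F(1)[OF h(2)] inj by (auto simp: U_def dest: inj_onD)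
  then have "(\<phi> p)(i := e/2 + \<phi> p i) = (\<phi> p)(i := 0 + \<phi> p i)" using F(2)[OF h(1)] F(2)[OF h(2)] by simp
  from fun_cong[OF this, of i] show False using e(1) by simp
qed

text \<open>A rank theorem for injective maps: in these charts all coordinates of \<open>M\<close>
  reappear as \<open>r\<close> of the coordinates of the image, so the image of \<open>C\<close> is
  a graph over these.\<close>

lemma constant_rank_charts:
  assumes M: "atlas_ok M" and N: "atlas_ok N" and \<theta>: "smooth_map M N \<theta>" and inj: "inj_on \<theta> (pts M)"
    and p: "p \<in> pts M" and r: "rank_ge M N \<theta> p r"
    and max: "\<And>q. q \<in> pts M \<Longrightarrow> \<not> rank_ge M N \<theta> q (Suc r)"
  shows "\<exists>C \<phi> \<iota> D \<psi> \<kappa>. (C, \<phi>) \<in> max_atlas M \<and> p \<in> C \<and> bij_betw \<iota> {..<r} (idx M) \<and>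
    (D, \<psi>) \<in> max_atlas N \<and> \<theta> ` C \<subseteq> D \<and> inj_on \<kappa> {..<r} \<and> \<kappa> ` {..<r} \<subseteq> idx N \<and>
    (\<forall>a<r. \<forall>q\<in>C. \<phi> q (\<iota> a) = \<psi> (\<theta> q) (\<kappa> a))"
proof -
  obtain V l \<gamma> where V: "openin (mtop N) V" "\<theta> p \<in> V" "\<forall>a<r. smooth_on N V (l a)" "\<forall>b<r. curve M p (\<gamma> b)"
    "\<forall>a<r. \<forall>b<r. ((\<lambda>t. l a (\<theta> (\<gamma> b t))) has_real_derivative (if a = b then 1 else 0)) (at 0)"
    using r unfolding rank_ge_def by (elim exE conjE)
  obtain C \<phi> \<iota> where c: "(C, \<phi>) \<in> max_atlas M" "p \<in> C" "C \<subseteq> {q \<in> pts M. \<theta> q \<in> V}" "inj_on \<iota> {..<r}" "\<iota> ` {..<r} \<subseteq> idx M"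
      "\<forall>a\<in>{..<r}. \<forall>q\<in>C. \<phi> q (\<iota> a) = l a (\<theta> q)"
    using rank_ge_straighten(1)[OF M N \<theta> p V] by (elim exE conjE)
  obtain D \<psi> \<kappa> where d: "(D, \<psi>) \<in> max_atlas N" "\<theta> p \<in> D" "D \<subseteq> V" "inj_on \<kappa> {..<r}" "\<kappa> ` {..<r} \<subseteq> idx N"
      "\<forall>a\<in>{..<r}. \<forall>y\<in>D. \<psi> y (\<kappa> a) = l a y"
    using rank_ge_straighten(2)[OF M N \<theta> p V] by (elim exE conjE)
  have "\<iota> ` {..<r} = idx M"
    by (rule max_rank_immersion[OF M N \<theta> inj c(1-5) _ V(1) _ max]) (use c(6) V(3) in auto)
  then have bij: "bij_betw \<iota> {..<r} (idx M)" using c(4) by (simp add: bij_betw_def)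
  define U where "U = {q \<in> pts M. \<theta> q \<in> D}"
  have U: "openin (mtop M) U" unfolding U_def by (rule smooth_mapD(2)[OF \<theta> max_chartD(5)[OF N d(1)]])
  show ?thesis
  proof (intro exI conjI allI impI ballI)
    show "(C \<inter> U, \<phi>) \<in> max_atlas M" by (rule max_atlas_restrict[OF M c(1) U])
    show "p \<in> C \<inter> U" using c(2) p d(2) by (simp add: U_def)
    show "\<theta> ` (C \<inter> U) \<subseteq> D" by (auto simp: U_def)
    show "\<phi> q (\<iota> a) = \<psi> (\<theta> q) (\<kappa> a)" if "a < r" "q \<in> C \<inter> U" for a q
      using c(6) d(6) that by (auto simp: U_def)
  qed (use bij d in auto)
qed

text \<open>A closed cube in a chart is a product of compact intervals, with the factor
  \<open>{0}\<close> at the indices outside \<open>idx M\<close>, and Tychonoff's theorem makes it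
  compact. Half the radius keeps it inside the open set.\<close>

lemma compact_neighbourhood:
  assumes M: "atlas_ok M" and U: "openin (mtop M) U" "p \<in> U"
  shows "\<exists>V K. openin (mtop M) V \<and> compactin (mtop M) K \<and> p \<in> V \<and> V \<subseteq> K \<and> K \<subseteq> U"
proof -
  note fin = atlas_ok_finite[OF M]
  obtain C \<phi> where c: "(C, \<phi>) \<in> atlas M" "p \<in> C" using U by (rule openin_chart)
  note cm = chartD[OF M c(1)]
  define A where "A = \<phi> ` (C \<inter> U)"
  have A: "copen (idx M) A" unfolding A_def by (rule openin_mtop_image[OF M U(1) c(1)])
  have "\<phi> p \<in> A" using c U by (simp add: A_def)
  with A fin obtain e where e: "e > 0"
    "\<And>y. y \<in> coord_space (idx M) \<Longrightarrow> (\<And>i. i \<in> idx M \<Longrightarrow> \<bar>y i - \<phi> p i\<bar> < e) \<Longrightarrow> y \<in> A" using copen_box by blast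
  define B where "B = {y \<in> coord_space (idx M). \<forall>i\<in>idx M. \<bar>y i - \<phi> p i\<bar> \<le> e/2}"
  have BA: "B \<subseteq> A" using e by (fastforce simp: B_def)
  have "B = (\<Pi>\<^sub>E i\<in>UNIV. if i \<in> idx M then {\<phi> p i - e/2 .. \<phi> p i + e/2} else {0})"
  proof (intro equalityI subsetI)
    fix y assume y: "y \<in> B"
    have "y i \<in> (if i \<in> idx M then {\<phi> p i - e/2 .. \<phi> p i + e/2} else {0})" for i
    proof (cases "i \<in> idx M")
      case True
      then have "\<bar>y i - \<phi> p i\<bar> \<le> e/2" using y by (auto simp: B_def)
      then have "\<phi> p i - e/2 \<le> y i" "y i \<le> \<phi> p i + e/2" by linarith+
      then show ?thesis using True by simp
    qed (use y in \<open>auto simp: B_def coord_space_def\<close>)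
    then show "y \<in> (\<Pi>\<^sub>E i\<in>UNIV. if i \<in> idx M then {\<phi> p i - e/2 .. \<phi> p i + e/2} else {0})"
      unfolding PiE_UNIV_domain Pi_iff by blast
  next
    fix y assume "y \<in> (\<Pi>\<^sub>E i\<in>UNIV. if i \<in> idx M then {\<phi> p i - e/2 .. \<phi> p i + e/2} else {0})"
    from PiE_mem[OF this UNIV_I]
    have y: "y i \<in> (if i \<in> idx M then {\<phi> p i - e/2 .. \<phi> p i + e/2} else {0})" for i .
    have "\<bar>y i - \<phi> p i\<bar> \<le> e/2" if "i \<in> idx M" for i
    proof -
      have "\<phi> p i - e/2 \<le> y i" "y i \<le> \<phi> p i + e/2" using y[of i] that by auto
      then show ?thesis by linarith
    qed
    moreover have "y i = 0" if "i \<notin> idx M" for i using y[of i] that by simp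
    ultimately show "y \<in> B" unfolding B_def coord_space_def by blast
  qed
  then have "compactin (product_topology (\<lambda>i. euclidean) UNIV) B"
    by (auto simp: compactin_PiE)
  then have "compact B" by (simp add: euclidean_product_topology)
  then have "compactin (top_of_set A) B" using BA by (simp add: compactin_subtopology)
  moreover have "continuous_map (top_of_set A) (mtop M) (inv_into C \<phi>)"
    unfolding continuous_map topspace_mtop
  proof (intro conjI allI impI)
    show "inv_into C \<phi> ` topspace (top_of_set A) \<subseteq> pts M"
      using cm(1,3) by (auto simp: A_def inv_into_f_f)
    fix T assume T: "openin (mtop M) T"
    have "\<phi> ` (C \<inter> (U \<inter> T)) = {x \<in> topspace (top_of_set A). inv_into C \<phi> x \<in> T}"
      using cm(1) by (auto simp: A_def inv_into_f_f)
    moreover have "copen (idx M) (\<phi> ` (C \<inter> (U \<inter> T)))"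
      by (rule openin_mtop_image[OF M openin_Int[OF U(1) T] c(1)])
    moreover have "\<phi> ` (C \<inter> (U \<inter> T)) \<subseteq> A" by (auto simp: A_def)
    ultimately show "openin (top_of_set A) {x \<in> topspace (top_of_set A). inv_into C \<phi> x \<in> T}"
      using openin_subset_trans[OF _ _ copen_subset[OF A]] by metis
  qed
  ultimately have K: "compactin (mtop M) (inv_into C \<phi> ` B)" by (rule image_compactin)
  define V where "V = {q \<in> C. \<phi> q \<in> {y. \<forall>i\<in>idx M. \<bar>y i - \<phi> p i\<bar> < e/2}}"
  have "openin (mtop M) V" unfolding V_def by (rule chart_openin[OF c(1) open_box[OF fin]])
  moreover have "p \<in> V" using c e by (simp add: V_def)
  moreover have "V \<subseteq> inv_into C \<phi> ` B"
  proof
    fix q assume q: "q \<in> V"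
    then have "\<phi> q \<in> B" using cm(4) by (force simp: V_def B_def)
    moreover have "q = inv_into C \<phi> (\<phi> q)" using q cm(1) by (simp add: V_def inv_into_f_f)
    ultimately show "q \<in> inv_into C \<phi> ` B" by blast
  qed
  moreover have "inv_into C \<phi> ` B \<subseteq> U" using BA cm(1) by (auto simp: A_def inv_into_f_f)
  ultimately show ?thesis using K by blast
qed

text \<open>Points of the image of \<open>C\<close> are determined by their coordinates at the
  positions \<open>\<kappa>\<close>, while a nonempty open set contains points that differ only in a
  coordinate \<open>j\<close> missed by \<open>\<kappa>\<close>.\<close>

lemma lower_rank_thin:
  assumes M: "atlas_ok M" and N: "atlas_ok N"
    and c: "(C, \<phi>) \<in> max_atlas M" "bij_betw \<iota> {..<r} (idx M)"
    and d: "(D, \<psi>) \<in> max_atlas N" "\<theta> ` C \<subseteq> D" "\<kappa> ` {..<r} \<subseteq> idx N"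
    and eq: "\<forall>a<r. \<forall>q\<in>C. \<phi> q (\<iota> a) = \<psi> (\<theta> q) (\<kappa> a)"
    and r: "r < card (idx N)" and W: "openin (mtop N) W" "W \<subseteq> \<theta> ` C"
  shows "W = {}"
proof (rule ccontr)
  assume "W \<noteq> {}"
  then obtain y where y: "y \<in> W" by auto
  note cm = max_chartD[OF M c(1)] and dD = max_chartD[OF N d(1)]
  have "\<kappa> ` {..<r} \<noteq> idx N"
  proof
    assume "\<kappa> ` {..<r} = idx N"
    then have "card (idx N) \<le> r" using card_image_le[of "{..<r}" \<kappa>] by simp
    then show False using r by simp
  qed
  then obtain j where j: "j \<in> idx N" "j \<notin> \<kappa> ` {..<r}" using d(3) by auto
  have yD: "y \<in> D" using y W(2) d(2) by auto
  have "\<forall>\<^sub>F t in nhds 0. (\<psi> y)(j := t + \<psi> y j) \<in> \<psi> ` (D \<inter> W)"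
    by (rule coord_curve_ev[OF N d(1) yD j(1) W(1) y])
  then obtain e where e: "e > 0" "\<And>t. \<bar>t\<bar> < e \<Longrightarrow> (\<psi> y)(j := t + \<psi> y j) \<in> \<psi> ` (D \<inter> W)"
    by (auto simp: eventually_nhds_metric dist_real_def)
  obtain y' where y': "y' \<in> W" "\<psi> y' = (\<psi> y)(j := e/2 + \<psi> y j)" using e(2)[of "e/2"] e(1) by auto
  obtain q where q: "q \<in> C" "y = \<theta> q" using y W(2) by auto
  obtain q' where q': "q' \<in> C" "y' = \<theta> q'" using y'(1) W(2) by auto
  have "\<phi> q i = \<phi> q' i" if i: "i \<in> idx M" for i
  proof -
    obtain a where a: "a < r" "i = \<iota> a" using c(2) i by (auto simp: bij_betw_def)
    have "\<psi> y' (\<kappa> a) = \<psi> y (\<kappa> a)" using y'(2) j(2) a(1) by auto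
    then show ?thesis using eq a q q' by simp
  qed
  then have "\<phi> q = \<phi> q'" using coord_space_eqI[OF cm(4)[OF q(1)] cm(4)[OF q'(1)]] by blast
  then have "q = q'" using cm(1) q(1) q'(1) by (auto dest: inj_onD)
  then have "\<psi> y' = \<psi> y" using q q' by simp
  then have "((\<psi> y)(j := e/2 + \<psi> y j)) j = \<psi> y j" using y'(2) by metis
  then show False using e(1) by simp
qed

text \<open>When \<open>\<kappa>\<close> exhausts the coordinates of \<open>N\<close>, the map
  merely renumbers coordinates, and so does its inverse.\<close>

lemma full_rank_inverse_smooth:
  assumes M: "atlas_ok M" and N: "atlas_ok N" and \<theta>: "smooth_map M N \<theta>" and inj: "inj_on \<theta> (pts M)"
    and c: "(C, \<phi>) \<in> max_atlas M" "p \<in> C" "bij_betw \<iota> {..<r} (idx M)"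
    and d: "(D, \<psi>) \<in> max_atlas N" "\<theta> ` C \<subseteq> D" "inj_on \<kappa> {..<r}" "\<kappa> ` {..<r} \<subseteq> idx N"
    and eq: "\<forall>a<r. \<forall>q\<in>C. \<phi> q (\<iota> a) = \<psi> (\<theta> q) (\<kappa> a)"
    and r: "r = card (idx N)"
  shows "\<exists>U. openin (mtop N) U \<and> \<theta> p \<in> U \<and> (\<forall>y\<in>U. inv_into (pts M) \<theta> y \<in> C) \<and>
    (\<forall>i\<in>idx M. smooth_on N U (\<lambda>y. \<phi> (inv_into (pts M) \<theta> y) i))"
proof -
  note cm = max_chartD[OF M c(1)] and dD = max_chartD[OF N d(1)]
  have \<kappa>: "\<kappa> ` {..<r} = idx N"
    using card_subset_eq[OF atlas_ok_finite[OF N] d(4)] card_image[OF d(3)] r by simp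
  \<comment> \<open>The inverse in coordinates: coordinate \<open>i\<close> of the source is read
    off at the target position with the same number below \<open>r\<close>.\<close>
  define w where "w = (\<lambda>y i. if i \<in> idx M then \<psi> y (\<kappa> (inv_into {..<r} \<iota> i)) else 0)"
  have ws: "smooth_on N D (\<lambda>y. w y i)" for i
    unfolding w_def using dD(6) smooth_on_const[OF N dD(5)] by (cases "i \<in> idx M") auto
  define U where "U = {y \<in> D. w y \<in> \<phi> ` C}"
  have U: "openin (mtop N) U" unfolding U_def
    by (rule smooth_on_preimage[OF N dD(5) cm(2) ws]) (simp add: w_def coord_space_def)
  have w\<theta>: "w (\<theta> q) = \<phi> q" if q: "q \<in> C" for q
  proof (rule coord_space_eqI[OF _ cm(4)[OF q]])
    show "w (\<theta> q) \<in> coord_space (idx M)" by (simp add: w_def coord_space_def)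
    fix i assume i: "i \<in> idx M"
    have "inv_into {..<r} \<iota> i < r" "\<iota> (inv_into {..<r} \<iota> i) = i"
      using c(3) i inv_into_into[of i \<iota> "{..<r}"] f_inv_into_f[of i \<iota> "{..<r}"] by (auto simp: bij_betw_def)
    then show "w (\<theta> q) i = \<phi> q i" using eq q i by (simp add: w_def) metis
  qed
  have inv: "inv_into (pts M) \<theta> y \<in> C \<and> \<phi> (inv_into (pts M) \<theta> y) = w y" if y: "y \<in> U" for y
  proof -
    obtain q where q: "q \<in> C" "w y = \<phi> q" using y by (auto simp: U_def)
    have yD: "y \<in> D" and qD: "\<theta> q \<in> D" using y q(1) d(2) by (auto simp: U_def)
    have "\<psi> (\<theta> q) j = \<psi> y j" if j: "j \<in> idx N" for j
    proof -
      obtain a where a: "a < r" "j = \<kappa> a" using j \<kappa> by auto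
      have i: "\<iota> a \<in> idx M" "inv_into {..<r} \<iota> (\<iota> a) = a" using c(3) a by (auto simp: bij_betw_def inv_into_f_f)
      have "\<psi> (\<theta> q) (\<kappa> a) = w y (\<iota> a)" using eq a(1) q by simp
      then show ?thesis using a i by (simp add: w_def)
    qed
    then have "\<psi> (\<theta> q) = \<psi> y" using coord_space_eqI[OF dD(4)[OF qD] dD(4)[OF yD]] by blast
    then have "\<theta> q = y" using dD(1) qD yD by (auto dest: inj_onD)
    then have "inv_into (pts M) \<theta> y = q" using inj cm(3) q(1) by (auto simp: inv_into_f_f)
    then show ?thesis using q by simp
  qed
  have "smooth_on N U (\<lambda>y. \<phi> (inv_into (pts M) \<theta> y) i)" for i
    by (rule smooth_on_cong[OF N smooth_on_subset[OF ws U]]) (use inv in \<open>auto simp: U_def\<close>)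
  moreover have "\<theta> p \<in> U" using w\<theta>[OF c(2)] c(2) d(2) by (auto simp: U_def)
  ultimately show ?thesis using U inv by blast
qed

text \<open>The rank is constant, so the map is an immersion; were its rank too small, its image would be
  a countable union of thin compact sets, contradicting Baire's theorem.\<close>

theorem homogeneous_bijection_inverse_smooth:
  assumes mM: "manifold M" and mN: "manifold N" and \<theta>: "smooth_map M N \<theta>"
    and bij: "bij_betw \<theta> (pts M) (pts N)"
    and hom: "\<And>p q. p \<in> pts M \<Longrightarrow> q \<in> pts M \<Longrightarrow> \<exists>a b. smooth_map M M a \<and> smooth_map N N b \<and> a p = q \<and>
      (\<forall>x\<in>pts M. b (\<theta> (a x)) = \<theta> x)"
  shows "smooth_map N M (inv_into (pts M) \<theta>)"
proof (cases "pts M = {}")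
  case True
  then have "pts N = {}" using bij by (simp add: bij_betw_def)
  then show ?thesis by (intro smooth_mapI manifold_atlas_ok[OF mM] manifold_atlas_ok[OF mN]) auto
next
  case False
  note M = manifold_atlas_ok[OF mM] and N = manifold_atlas_ok[OF mN]
  have inj: "inj_on \<theta> (pts M)" using bij by (simp add: bij_betw_def)
  obtain p1 where p1: "p1 \<in> pts M" using False by auto
  have transport: "rank_ge M N \<theta> q s" if r: "rank_ge M N \<theta> p s" and p: "p \<in> pts M" and q: "q \<in> pts M" for p q s
  proof -
    obtain a b where ab: "smooth_map M M a" "smooth_map N N b" "a p = q" "\<And>x. x \<in> pts M \<Longrightarrow> b (\<theta> (a x)) = \<theta> x"
      using hom[OF p q] by blast
    show ?thesis using rank_ge_transport[OF M N r \<theta> p ab(1,2,4)] ab(3) by simp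
  qed
  \<comment> \<open>The maximum is attained: rank at least 0 is trivial, and the dimension of
    \<open>M\<close> bounds the rank.\<close>
  define r where "r = Max {s. rank_ge M N \<theta> p1 s}"
  have bd: "s \<le> card (idx M)" if "rank_ge M N \<theta> p1 s" for s by (rule rank_ge_bound[OF M N \<theta> p1 that])
  have fin: "finite {s. rank_ge M N \<theta> p1 s}" by (rule finite_subset[of _ "{..card (idx M)}"]) (use bd in auto)
  have "rank_ge M N \<theta> p1 0"
    using openin_mtop_pts smooth_mapD(1)[OF \<theta> p1] unfolding rank_ge_def by blast
  then have rr: "rank_ge M N \<theta> p1 r" using Max_in[OF fin] by (auto simp: r_def)
  have max1: "\<not> rank_ge M N \<theta> p1 (Suc r)" using Max_ge[OF fin, of "Suc r"] by (auto simp: r_def)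
  have rank: "rank_ge M N \<theta> q r" "\<not> rank_ge M N \<theta> q (Suc r)" if "q \<in> pts M" for q
    using transport[OF rr p1 that] transport[OF _ that p1] max1 by auto
  have charts: "\<exists>C \<phi> \<iota> D \<psi> \<kappa>. (C, \<phi>) \<in> max_atlas M \<and> p \<in> C \<and> bij_betw \<iota> {..<r} (idx M) \<and>
    (D, \<psi>) \<in> max_atlas N \<and> \<theta> ` C \<subseteq> D \<and> inj_on \<kappa> {..<r} \<and> \<kappa> ` {..<r} \<subseteq> idx N \<and>
    (\<forall>a<r. \<forall>q\<in>C. \<phi> q (\<iota> a) = \<psi> (\<theta> q) (\<kappa> a))" if "p \<in> pts M" for p
    by (rule constant_rank_charts[OF M N \<theta> inj that rank(1)[OF that] rank(2)])
  have "r \<le> card (idx N)"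
  proof -
    from charts[OF p1] obtain \<kappa> :: "nat \<Rightarrow> 'd" where "inj_on \<kappa> {..<r}" "\<kappa> ` {..<r} \<subseteq> idx N" by (elim exE conjE)
    from card_inj_on_le[OF this atlas_ok_finite[OF N]] show ?thesis by simp
  qed
  moreover have "\<not> r < card (idx N)"
  proof
    assume small: "r < card (idx N)"
    have thin: "\<exists>V K. openin (mtop M) V \<and> compactin (mtop M) K \<and> p \<in> V \<and> V \<subseteq> K \<and>
      mtop N interior_of (\<theta> ` K) = {}" if p: "p \<in> pts M" for p
    proof -
      obtain C \<phi> \<iota> D \<psi> \<kappa> where c: "(C, \<phi>) \<in> max_atlas M" "p \<in> C" "bij_betw \<iota> {..<r} (idx M)"
        "(D, \<psi>) \<in> max_atlas N" "\<theta> ` C \<subseteq> D" "inj_on \<kappa> {..<r}" "\<kappa> ` {..<r} \<subseteq> idx N"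
        "\<forall>a<r. \<forall>q\<in>C. \<phi> q (\<iota> a) = \<psi> (\<theta> q) (\<kappa> a)" using charts[OF p] by (elim exE conjE)
      obtain V K where VK: "openin (mtop M) V" "compactin (mtop M) K" "p \<in> V" "V \<subseteq> K" "K \<subseteq> C"
        using compact_neighbourhood[OF M max_chartD(5)[OF M c(1)] c(2)] by blast
      have "mtop N interior_of (\<theta> ` K) \<subseteq> \<theta> ` C"
        using image_mono[OF VK(5)] interior_of_subset[of "mtop N" "\<theta> ` K"] by (rule order_trans[rotated])
      then have "mtop N interior_of (\<theta> ` K) = {}"
        by (rule lower_rank_thin[OF M N c(1,3,4,5,7,8) small openin_interior_of])
      then show ?thesis using VK by blast
    qed
    then obtain V K where VK: "\<forall>p\<in>pts M. openin (mtop M) (V p) \<and> compactin (mtop M) (K p) \<and> p \<in> V p \<and> V p \<subseteq> K p \<and>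
      mtop N interior_of (\<theta> ` K p) = {}" by metis
    \<comment> \<open>Second countability of the source reduces the cover to a countable one, as
      Baire's theorem requires.\<close>
    have "Lindelof_space (mtop M)" using mM by (auto simp: manifold_def intro: second_countable_imp_Lindelof_space)
    moreover have "\<forall>U\<in>V ` pts M. openin (mtop M) U" using VK by auto
    moreover have "\<Union>(V ` pts M) = topspace (mtop M)"
      using VK openin_pts by (auto simp: topspace_mtop) blast
    ultimately obtain \<V> where \<V>: "countable \<V>" "\<V> \<subseteq> V ` pts M" "\<Union>\<V> = topspace (mtop M)"
      unfolding Lindelof_space_def by metis
    obtain P where P: "countable P" "P \<subseteq> pts M" "\<V> = V ` P" using countable_subset_image[THEN iffD1, OF conjI[OF \<V>(1,2)]] by blast
    define \<G> where "\<G> = (\<lambda>p. \<theta> ` K p) ` P"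
    have "mtop N interior_of \<Union>\<G> = {}"
    proof (rule Baire_category_alt)
      have "locally_compact_space (mtop N)"
        unfolding locally_compact_space_def topspace_mtop
        using compact_neighbourhood[OF N openin_mtop_pts] by blast
      then show "completely_metrizable_space (mtop N) \<or> locally_compact_space (mtop N) \<and> regular_space (mtop N)"
        using mN locally_compact_Hausdorff_imp_regular_space by (auto simp: manifold_def)
      show "countable \<G>" using P(1) by (simp add: \<G>_def)
      have cont: "continuous_map (mtop M) (mtop N) \<theta>" using \<theta> by (simp add: smooth_map_def)
      show "closedin (mtop N) T \<and> mtop N interior_of T = {}" if "T \<in> \<G>" for T
      proof -
        from that obtain p where p: "p \<in> pts M" "T = \<theta> ` K p" using P(2) by (auto simp: \<G>_def)
        have "compactin (mtop N) T" unfolding p(2) using VK p(1) by (intro image_compactin[OF _ cont]) auto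
        then have "closedin (mtop N) T" using mN by (auto simp: manifold_def intro: compactin_imp_closedin)
        then show ?thesis using VK p by auto
      qed
    qed
    \<comment> \<open>Surjectivity of \<open>\<theta>\<close> enters: the thin sets fill
      \<open>N\<close>, and a nonempty space does not have empty interior in itself.\<close>
    moreover have "\<Union>\<G> = topspace (mtop N)"
    proof (intro equalityI subsetI)
      fix y assume "y \<in> topspace (mtop N)"
      then obtain x where x: "x \<in> pts M" "y = \<theta> x" using bij by (auto simp: topspace_mtop bij_betw_def)
      then obtain p where "p \<in> P" "x \<in> V p" using \<V>(3) P(3) by (auto simp: topspace_mtop)
      then show "y \<in> \<Union>\<G>" using VK P(2) x(2) by (auto simp: \<G>_def)
    next
      fix y assume "y \<in> \<Union>\<G>"
      then obtain p x where "p \<in> pts M" "x \<in> K p" "y = \<theta> x" using P(2) by (auto simp: \<G>_def)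
      then show "y \<in> topspace (mtop N)"
        using VK compactin_subset_topspace[of "mtop M" "K p"] smooth_mapD(1)[OF \<theta>] by (auto simp: topspace_mtop)
    qed
    ultimately have "topspace (mtop N) = {}" by (simp add: interior_of_topspace)
    then show False using smooth_mapD(1)[OF \<theta> p1] by (simp add: topspace_mtop)
  qed
  ultimately have r: "r = card (idx N)" by simp
  show ?thesis
  proof (rule smooth_mapI[OF N M])
    fix y assume "y \<in> pts N"
    then obtain p where p: "p \<in> pts M" "y = \<theta> p" using bij by (auto simp: bij_betw_def)
    obtain C \<phi> \<iota> D \<psi> \<kappa> where c: "(C, \<phi>) \<in> max_atlas M" "p \<in> C" "bij_betw \<iota> {..<r} (idx M)"
      "(D, \<psi>) \<in> max_atlas N" "\<theta> ` C \<subseteq> D" "inj_on \<kappa> {..<r}" "\<kappa> ` {..<r} \<subseteq> idx N"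
      "\<forall>a<r. \<forall>q\<in>C. \<phi> q (\<iota> a) = \<psi> (\<theta> q) (\<kappa> a)" using charts[OF p(1)] by (elim exE conjE)
    from full_rank_inverse_smooth[OF M N \<theta> inj c r] c(1) p(2)
    show "\<exists>U D \<psi>. openin (mtop N) U \<and> y \<in> U \<and> (D, \<psi>) \<in> max_atlas M \<and>
      (\<forall>q\<in>U. inv_into (pts M) \<theta> q \<in> D) \<and> (\<forall>j\<in>idx M. smooth_on N U (\<lambda>q. \<psi> (inv_into (pts M) \<theta> q) j))"
      by blast
  qed
qed

section \<open>Local smooth maps\<close>

text \<open>The restricted charts differ from the old ones only in the domain of
  \<open>inv_into\<close>; on the images of subsets of \<open>U\<close> both inverses agree.\<close>

lemma open_submfd_facts:
  assumes M: "atlas_ok M" and U: "openin (mtop M) U"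
  shows pts_open_submfd: "pts (open_submfd M U) = U"
    and atlas_ok_open_submfd: "atlas_ok (open_submfd M U)"
    and openin_open_submfd: "openin (mtop (open_submfd M U)) V \<longleftrightarrow> openin (mtop M) V \<and> V \<subseteq> U"
    and smooth_on_open_submfd: "smooth_on (open_submfd M U) V h \<longleftrightarrow> smooth_on M V h \<and> V \<subseteq> U"
proof -
  note fin = atlas_ok_finite[OF M]
  have at: "atlas (open_submfd M U) = {(C \<inter> U, \<phi>) |C \<phi>. (C, \<phi>) \<in> atlas M}" "idx (open_submfd M U) = idx M"
    by (simp_all add: open_submfd_def)
  show pts: "pts (open_submfd M U) = U"
  proof (intro equalityI subsetI)
    fix p assume p: "p \<in> U"
    obtain C \<phi> where c: "(C, \<phi>) \<in> atlas M" "p \<in> C" using U p by (rule openin_chart)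
    then have "(C \<inter> U, \<phi>) \<in> atlas (open_submfd M U)" by (auto simp: at)
    then show "p \<in> pts (open_submfd M U)" using c p by (force simp: pts_def)
  qed (auto simp: pts_def at)
  have img: "copen (idx M) (\<phi> ` (C \<inter> U \<inter> V))" if "(C, \<phi>) \<in> atlas M" "openin (mtop M) V" for C \<phi> V
    using openin_mtop_image[OF M openin_Int[OF U that(2)] that(1)] by (simp add: Int_assoc)
  have cong: "C_infinity (idx M) (\<phi> ` (C \<inter> U \<inter> V)) (\<lambda>u. h (inv_into (C \<inter> U) \<phi> u)) \<longleftrightarrow>
      C_infinity (idx M) (\<phi> ` (C \<inter> U \<inter> V)) (\<lambda>u. h (inv_into C \<phi> u))"
    if c: "(C, \<phi>) \<in> atlas M" and V: "openin (mtop M) V" for C \<phi> V and h :: "'a \<Rightarrow> real"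
  proof -
    have "inv_into (C \<inter> U) \<phi> u = inv_into C \<phi> u" if "u \<in> \<phi> ` (C \<inter> U \<inter> V)" for u
      using that chartD(1)[OF M c] inj_on_subset[OF chartD(1)[OF M c], of "C \<inter> U"] by (auto simp: inv_into_f_f)
    then show ?thesis using C_infinity_cong[OF _ _ img[OF c V] fin] by metis
  qed
  have ok: "is_chart (idx M) (C \<inter> U, \<phi>)" if c: "(C, \<phi>) \<in> atlas M" for C \<phi>
    using img[OF c U] inj_on_subset[OF chartD(1)[OF M c], of "C \<inter> U"] by (simp add: is_chart_def Int_assoc)
  have tr: "smooth_transition (idx M) (C \<inter> U, \<phi>) (D \<inter> U, \<psi>)"
    if c: "(C, \<phi>) \<in> atlas M" and d: "(D, \<psi>) \<in> atlas M" for C \<phi> D \<psi>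
  proof -
    have "openin (mtop M) (D \<inter> U)" using chart_open_domain[OF M d] U by (rule openin_Int)
    moreover have "C_infinity (idx M) (\<phi> ` (C \<inter> U \<inter> (D \<inter> U))) (\<lambda>u. \<psi> (inv_into C \<phi> u) j)" if "j \<in> idx M" for j
      by (rule C_infinity_subset[OF transitionD(2)[OF M c d that]]) auto
    ultimately show ?thesis using img[OF c] cong[OF c, of "D \<inter> U" "\<lambda>p. \<psi> p _"] by (simp add: smooth_transition_def)
  qed
  show ao: "atlas_ok (open_submfd M U)" using ok tr fin by (auto simp: atlas_ok_def at)
  have 1: "openin (mtop M) V" if "openin (mtop (open_submfd M U)) V" for V
  proof -
    have VU: "V \<subseteq> U" using openin_pts[OF that] pts by simp
    have "copen (idx M) (\<phi> ` (C \<inter> V))" if c: "(C, \<phi>) \<in> atlas M" for C \<phi>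
    proof -
      have "(C \<inter> U, \<phi>) \<in> atlas (open_submfd M U)" using c by (auto simp: at)
      from openin_mtop_image[OF ao \<open>openin (mtop (open_submfd M U)) V\<close> this]
      have "copen (idx M) (\<phi> ` (C \<inter> U \<inter> V))" by (simp add: at)
      moreover have "C \<inter> U \<inter> V = C \<inter> V" using VU by auto
      ultimately show ?thesis by simp
    qed
    then show ?thesis unfolding openin_mtop_iff[OF M] using VU openin_pts[OF U] by auto
  qed
  show 2: "openin (mtop (open_submfd M U)) V \<longleftrightarrow> openin (mtop M) V \<and> V \<subseteq> U" for V
  proof
    assume "openin (mtop (open_submfd M U)) V"
    then show "openin (mtop M) V \<and> V \<subseteq> U" using 1 openin_pts pts by metis
  next
    assume V: "openin (mtop M) V \<and> V \<subseteq> U"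
    then show "openin (mtop (open_submfd M U)) V"
      unfolding openin_mtop_iff[OF ao] pts using img by (auto simp: at)
  qed
  show "smooth_on (open_submfd M U) V h \<longleftrightarrow> smooth_on M V h \<and> V \<subseteq> U"
  proof (cases "openin (mtop M) V \<and> V \<subseteq> U")
    case True
    then have e: "C \<inter> U \<inter> V = C \<inter> V" for C by auto
    have "(\<forall>(C, \<phi>)\<in>atlas (open_submfd M U). C_infinity (idx M) (\<phi> ` (C \<inter> V)) (\<lambda>u. h (inv_into C \<phi> u))) \<longleftrightarrow>
      (\<forall>(C, \<phi>)\<in>atlas M. C_infinity (idx M) (\<phi> ` (C \<inter> U \<inter> V)) (\<lambda>u. h (inv_into (C \<inter> U) \<phi> u)))"
      by (auto simp: at)
    also have "\<dots> \<longleftrightarrow> (\<forall>(C, \<phi>)\<in>atlas M. C_infinity (idx M) (\<phi> ` (C \<inter> V)) (\<lambda>u. h (inv_into C \<phi> u)))"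
    proof (intro ball_cong refl, clarify)
      fix C \<phi> assume c: "(C, \<phi>) \<in> atlas M"
      show "C_infinity (idx M) (\<phi> ` (C \<inter> U \<inter> V)) (\<lambda>u. h (inv_into (C \<inter> U) \<phi> u)) \<longleftrightarrow>
          C_infinity (idx M) (\<phi> ` (C \<inter> V)) (\<lambda>u. h (inv_into C \<phi> u))"
        using cong[OF c, of V h] True unfolding e by simp
    qed
    finally show ?thesis using True 2 by (simp add: smooth_on_def at)
  next
    case False
    then show ?thesis using 2 by (auto simp: smooth_on_def)
  qed
qed

lemma local_smoothD:
  assumes X: "atlas_ok X" and f: "f \<in> local_smooth_maps X"
  shows "openin (mtop X) (dom f)" "x \<in> dom f \<Longrightarrow> x \<in> pts X" "x \<in> dom f \<Longrightarrow> the (f x) \<in> pts X"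
    "openin (mtop X) V \<Longrightarrow> openin (mtop X) {x \<in> dom f. the (f x) \<in> V}"
    "smooth_on X V h \<Longrightarrow> smooth_on X {x \<in> dom f. the (f x) \<in> V} (\<lambda>x. h (the (f x)))"
proof -
  show U: "openin (mtop X) (dom f)" using f by (simp add: local_smooth_maps_def)
  have s: "smooth_map (open_submfd X (dom f)) X (\<lambda>x. the (f x))" using f by (simp add: local_smooth_maps_def)
  note of = open_submfd_facts[OF X U]
  show "x \<in> dom f \<Longrightarrow> x \<in> pts X" using openin_pts[OF U] by blast
  show "x \<in> dom f \<Longrightarrow> the (f x) \<in> pts X" using smooth_mapD(1)[OF s] of(1) by simp
  show "openin (mtop X) {x \<in> dom f. the (f x) \<in> V}" if "openin (mtop X) V"
    using smooth_mapD(2)[OF s that] unfolding of(1) of(3) by simp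
  show "smooth_on X {x \<in> dom f. the (f x) \<in> V} (\<lambda>x. h (the (f x)))" if "smooth_on X V h"
    using smooth_on_pullback[OF of(2) X s that] unfolding of(1) of(4) by simp
qed

lemma local_smoothI:
  assumes X: "atlas_ok X" and U: "openin (mtop X) (dom f)"
    and *: "\<And>x. x \<in> dom f \<Longrightarrow> \<exists>V D \<psi>. openin (mtop X) V \<and> x \<in> V \<and> V \<subseteq> dom f \<and> (D, \<psi>) \<in> max_atlas X \<and>
      (\<forall>q\<in>V. the (f q) \<in> D) \<and> (\<forall>j\<in>idx X. smooth_on X V (\<lambda>q. \<psi> (the (f q)) j))"
  shows "f \<in> local_smooth_maps X"
proof -
  note of = open_submfd_facts[OF X U]
  have "smooth_map (open_submfd X (dom f)) X (\<lambda>x. the (f x))"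
  proof (rule smooth_mapI[OF of(2) X])
    fix x assume "x \<in> pts (open_submfd X (dom f))"
    then have "x \<in> dom f" by (simp add: of(1))
    from *[OF this] obtain V D \<psi> where V: "openin (mtop X) V" "x \<in> V" "V \<subseteq> dom f" "(D, \<psi>) \<in> max_atlas X"
      "\<forall>q\<in>V. the (f q) \<in> D" "\<forall>j\<in>idx X. smooth_on X V (\<lambda>q. \<psi> (the (f q)) j)" by (elim exE conjE)
    then show "\<exists>V D \<psi>. openin (mtop (open_submfd X (dom f))) V \<and> x \<in> V \<and> (D, \<psi>) \<in> max_atlas X \<and>
      (\<forall>q\<in>V. the (f q) \<in> D) \<and> (\<forall>j\<in>idx X. smooth_on (open_submfd X (dom f)) V (\<lambda>q. \<psi> (the (f q)) j))"
      unfolding of(3) of(4) by blast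
  qed
  then show ?thesis using U by (simp add: local_smooth_maps_def)
qed

lemma local_smooth_of_map:
  assumes X: "atlas_ok X" and g: "smooth_map X X g"
  shows "(\<lambda>x. if x \<in> pts X then Some (g x) else None) \<in> local_smooth_maps X" (is "?f \<in> _")
proof (rule local_smoothI[OF X])
  have dom: "dom ?f = pts X" by (auto split: if_splits)
  show "openin (mtop X) (dom ?f)" by (simp add: dom)
  fix x assume "x \<in> dom ?f"
  then have x: "x \<in> pts X" by (simp add: dom)
  obtain D \<psi> where d: "(D, \<psi>) \<in> atlas X" "g x \<in> D" using smooth_mapD(1)[OF g x] by (rule pts_chart)
  note dm = atlas_max_atlas[OF X d(1)]
  have sm: "smooth_on X {q \<in> pts X. g q \<in> D} (\<lambda>q. \<psi> (the (?f q)) j)" for j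
    by (rule smooth_on_cong[OF X smooth_map_max_chart[OF X X g dm]]) simp
  show "\<exists>V D \<psi>. openin (mtop X) V \<and> x \<in> V \<and> V \<subseteq> dom ?f \<and> (D, \<psi>) \<in> max_atlas X \<and>
      (\<forall>q\<in>V. the (?f q) \<in> D) \<and> (\<forall>j\<in>idx X. smooth_on X V (\<lambda>q. \<psi> (the (?f q)) j))"
  proof (intro exI conjI ballI)
    show "openin (mtop X) {q \<in> pts X. g q \<in> D}" using sm by (rule smooth_on_openin)
    show "(D, \<psi>) \<in> max_atlas X" by (rule dm)
    show "smooth_on X {q \<in> pts X. g q \<in> D} (\<lambda>q. \<psi> (the (?f q)) j)" for j by (rule sm)
  qed (use x d(2) in \<open>auto simp: dom\<close>)
qed

lemma local_smooth_compose:
  assumes X: "atlas_ok X" and f: "f \<in> local_smooth_maps X" and g: "g \<in> local_smooth_maps X"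
  shows "g \<circ>\<^sub>m f \<in> local_smooth_maps X"
proof (rule local_smoothI[OF X])
  have dom: "dom (g \<circ>\<^sub>m f) = {x \<in> dom f. the (f x) \<in> dom g}"
    by (auto simp: map_comp_def split: option.splits)
  have val: "the ((g \<circ>\<^sub>m f) x) = the (g (the (f x)))" if "x \<in> dom f" for x using that by auto
  show op: "openin (mtop X) (dom (g \<circ>\<^sub>m f))"
    unfolding dom by (rule local_smoothD(4)[OF X f local_smoothD(1)[OF X g]])
  fix x assume x: "x \<in> dom (g \<circ>\<^sub>m f)"
  then have x': "x \<in> dom f" "the (f x) \<in> dom g" by (auto simp: dom)
  obtain D \<psi> where d: "(D, \<psi>) \<in> atlas X" "the (g (the (f x))) \<in> D"
    using local_smoothD(3)[OF X g x'(2)] by (rule pts_chart)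
  note dm = atlas_max_atlas[OF X d(1)]
  define V where "V = {x \<in> dom f. the (f x) \<in> {y \<in> dom g. the (g y) \<in> D}}"
  have s: "smooth_on X V (\<lambda>x. \<psi> (the (g (the (f x)))) j)" for j
    unfolding V_def by (rule local_smoothD(5)[OF X f local_smoothD(5)[OF X g max_chartD(6)[OF X dm]]])
  have sm: "smooth_on X V (\<lambda>q. \<psi> (the ((g \<circ>\<^sub>m f) q)) j)" for j
    by (rule smooth_on_cong[OF X s]) (auto simp: V_def val)
  show "\<exists>V D \<psi>. openin (mtop X) V \<and> x \<in> V \<and> V \<subseteq> dom (g \<circ>\<^sub>m f) \<and> (D, \<psi>) \<in> max_atlas X \<and>
      (\<forall>q\<in>V. the ((g \<circ>\<^sub>m f) q) \<in> D) \<and> (\<forall>j\<in>idx X. smooth_on X V (\<lambda>q. \<psi> (the ((g \<circ>\<^sub>m f) q)) j))"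
    using smooth_on_openin[OF s] dm sm x' d(2)
    by (intro exI[of _ V] exI[of _ D] exI[of _ \<psi>]) (auto simp: V_def dom val)
qed

lemma local_smooth_curve:
  assumes X: "atlas_ok X" and f: "f \<in> local_smooth_maps X" and x: "x \<in> dom f" and g: "curve X x \<gamma>"
  shows "curve X (the (f x)) (\<lambda>t. the (f (\<gamma> t)))"
  unfolding curve_def
proof (intro conjI allI impI)
  show "the (f (\<gamma> 0)) = the (f x)" "the (f x) \<in> pts X" using curveD(1)[OF g] local_smoothD(3)[OF X f x] by auto
  fix U assume U: "openin (mtop X) U \<and> the (f x) \<in> U"
  have "\<forall>\<^sub>F t in nhds 0. \<gamma> t \<in> {x \<in> dom f. the (f x) \<in> U}"
    using U x by (intro curveD(3)[OF g] local_smoothD(4)[OF X f]) auto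
  then show "\<forall>\<^sub>F t in nhds 0. the (f (\<gamma> t)) \<in> U" by eventually_elim auto
next
  fix U h assume "smooth_on X U h \<and> the (f x) \<in> U"
  then show "(\<lambda>t. h (the (f (\<gamma> t)))) differentiable (at 0)"
    using curveD(4)[OF g local_smoothD(5)[OF X f, of U h]] x
    by (auto simp: real_differentiable_def)
qed

section \<open>First order jets\<close>

text \<open>An entry of the Jacobian matrix of \<open>f\<close> in the charts \<open>c\<close> and
  \<open>d\<close>, the direction before the component. Together with the value of \<open>f\<close>
  this matrix is all that a jet of order 1 contains.\<close>

definition jder :: "('a, 'i) chart \<Rightarrow> ('a, 'i) chart \<Rightarrow> ('a \<rightharpoonup> 'a) \<Rightarrow> 'a \<Rightarrow> 'i \<Rightarrow> 'i \<Rightarrow> real" where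
  "jder c d f x i j = dpart c i (\<lambda>q. snd d (the (f q)) j) x"

lemma local_rep_pds:
  shows "pds [i] (local_rep c d f j) (snd c x) = jder c d f x i j"
    "pds [] (local_rep (C, \<phi>) d f j) u = snd d (the (f (inv_into C \<phi> u))) j"
  by (simp_all add: pds_def local_rep_def jder_def dpart_def)

lemma local_smooth_chain:
  assumes X: "atlas_ok X" and f: "f \<in> local_smooth_maps X" and x: "x \<in> dom f"
    and c: "(C, \<phi>) \<in> atlas X" "x \<in> C" and d: "(D, \<psi>) \<in> atlas X" "the (f x) \<in> D"
    and h: "smooth_on X V h" "the (f x) \<in> V" and g: "curve X x \<gamma>"
  shows "((\<lambda>t. h (the (f (\<gamma> t)))) has_real_derivative
    (\<Sum>j\<in>idx X. dpart (D, \<psi>) j h (the (f x)) * (\<Sum>i\<in>idx X. jder (C, \<phi>) (D, \<psi>) f x i j * deriv (\<lambda>t. \<phi> (\<gamma> t) i) 0))) (at 0)"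
proof -
  note cm = atlas_max_atlas[OF X c(1)] and dm = atlas_max_atlas[OF X d(1)]
  have "deriv (\<lambda>t. \<psi> (the (f (\<gamma> t))) j) 0 = (\<Sum>i\<in>idx X. jder (C, \<phi>) (D, \<psi>) f x i j * deriv (\<lambda>t. \<phi> (\<gamma> t) i) 0)" for j
    unfolding jder_def snd_conv
    by (rule DERIV_imp_deriv, rule curve_chain[OF X g cm c(2) local_smoothD(5)[OF X f max_chartD(6)[OF X dm]]])
      (use x d in auto)
  then show ?thesis
    using curve_chain[OF X local_smooth_curve[OF X f x g] dm d(2) h] by simp
qed

lemma coord_deriv:
  assumes "atlas_ok X" "(C, \<phi>) \<in> atlas X" "x \<in> C" "i \<in> idx X" "smooth_on X U h" "x \<in> U"
  shows "deriv (\<lambda>t. h (coord_curve (C, \<phi>) i x t)) 0 = dpart (C, \<phi>) i h x"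
  using coord_curve_deriv[OF assms(1) atlas_max_atlas[OF assms(1,2)] assms(3-6)] by (rule DERIV_imp_deriv)

text \<open>The chain rule along a coordinate line of the new source chart, with the Jacobian in the
  old charts as the middle factor.\<close>

lemma jder_change:
  assumes X: "atlas_ok X" and f: "f \<in> local_smooth_maps X" and x: "x \<in> dom f"
    and c: "(C, \<phi>) \<in> atlas X" "x \<in> C" and d: "(D, \<psi>) \<in> atlas X" "the (f x) \<in> D"
    and c': "(C', \<phi>') \<in> atlas X" "x \<in> C'" and d': "(D', \<psi>') \<in> atlas X" "the (f x) \<in> D'" and i: "i' \<in> idx X"
  shows "jder (C', \<phi>') (D', \<psi>') f x i' l = (\<Sum>j\<in>idx X. dpart (D, \<psi>) j (\<lambda>y. \<psi>' y l) (the (f x)) *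
    (\<Sum>i\<in>idx X. jder (C, \<phi>) (D, \<psi>) f x i j * dpart (C', \<phi>') i' (\<lambda>x. \<phi> x i) x))"
proof -
  note cm = atlas_max_atlas[OF X c(1)] and dm' = atlas_max_atlas[OF X d'(1)] and cm' = atlas_max_atlas[OF X c'(1)]
  have "jder (C', \<phi>') (D', \<psi>') f x i' l = deriv (\<lambda>t. \<psi>' (the (f (coord_curve (C', \<phi>') i' x t))) l) 0"
    unfolding jder_def snd_conv
    by (rule coord_deriv[OF X c' i local_smoothD(5)[OF X f max_chartD(6)[OF X dm']], symmetric])
      (use x d' in auto)
  also have "\<dots> = (\<Sum>j\<in>idx X. dpart (D, \<psi>) j (\<lambda>y. \<psi>' y l) (the (f x)) *
      (\<Sum>i\<in>idx X. jder (C, \<phi>) (D, \<psi>) f x i j * deriv (\<lambda>t. \<phi> (coord_curve (C', \<phi>') i' x t) i) 0))"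
    by (rule DERIV_imp_deriv, rule local_smooth_chain[OF X f x c d max_chartD(6)[OF X dm'] d'(2) coord_curve[OF X cm' c'(2) i]])
  finally show ?thesis
    using coord_deriv[OF X c' i max_chartD(6)[OF X cm] c(2)] by simp
qed

lemma jder_compose:
  assumes X: "atlas_ok X" and f: "f \<in> local_smooth_maps X" and x: "x \<in> dom f"
    and g: "g \<in> local_smooth_maps X" and y: "the (f x) \<in> dom g"
    and c: "(C, \<phi>) \<in> atlas X" "x \<in> C" and d: "(D, \<psi>) \<in> atlas X" "the (f x) \<in> D"
    and e: "(E, \<rho>) \<in> atlas X" "the (g (the (f x))) \<in> E" and i: "i \<in> idx X"
  shows "jder (C, \<phi>) (E, \<rho>) (g \<circ>\<^sub>m f) x i l =
    (\<Sum>j\<in>idx X. jder (D, \<psi>) (E, \<rho>) g (the (f x)) j l * jder (C, \<phi>) (D, \<psi>) f x i j)"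
proof -
  note cm = atlas_max_atlas[OF X c(1)] and em = atlas_max_atlas[OF X e(1)]
  note gf = local_smooth_compose[OF X f g]
  have xd: "x \<in> dom (g \<circ>\<^sub>m f)" using x y by (auto simp: map_comp_def)
  have val: "the ((g \<circ>\<^sub>m f) q) = the (g (the (f q)))" if "q \<in> dom f" for q using that by auto
  have cv: "curve X x (coord_curve (C, \<phi>) i x)" by (rule coord_curve[OF X cm c(2) i])
  have "\<forall>\<^sub>F t in nhds 0. coord_curve (C, \<phi>) i x t \<in> dom f"
    by (rule curveD(3)[OF cv local_smoothD(1)[OF X f] x])
  then have ev: "\<forall>\<^sub>F t in nhds 0. \<rho> (the ((g \<circ>\<^sub>m f) (coord_curve (C, \<phi>) i x t))) l =
      \<rho> (the (g (the (f (coord_curve (C, \<phi>) i x t))))) l"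
    by eventually_elim (simp add: val)
  have "jder (C, \<phi>) (E, \<rho>) (g \<circ>\<^sub>m f) x i l = deriv (\<lambda>t. \<rho> (the ((g \<circ>\<^sub>m f) (coord_curve (C, \<phi>) i x t))) l) 0"
    unfolding jder_def snd_conv
    by (rule coord_deriv[OF X c i local_smoothD(5)[OF X gf max_chartD(6)[OF X em]], symmetric])
      (use xd e val[OF x] in auto)
  also have "\<dots> = deriv (\<lambda>t. \<rho> (the (g (the (f (coord_curve (C, \<phi>) i x t))))) l) 0"
    using ev by (rule deriv_cong_ev) simp
  also have "\<dots> = (\<Sum>j\<in>idx X. dpart (D, \<psi>) j (\<lambda>y. \<rho> (the (g y)) l) (the (f x)) *
      (\<Sum>k\<in>idx X. jder (C, \<phi>) (D, \<psi>) f x k j * deriv (\<lambda>t. \<phi> (coord_curve (C, \<phi>) i x t) k) 0))"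
    by (rule DERIV_imp_deriv, rule local_smooth_chain[OF X f x c d local_smoothD(5)[OF X g max_chartD(6)[OF X em]] _ cv])
      (use y e in auto)
  also have "\<dots> = (\<Sum>j\<in>idx X. jder (D, \<psi>) (E, \<rho>) g (the (f x)) j l * jder (C, \<phi>) (D, \<psi>) f x i j)"
  proof (intro sum.cong refl arg_cong2[where f = "(*)"])
    fix j
    have "(\<Sum>k\<in>idx X. jder (C, \<phi>) (D, \<psi>) f x k j * deriv (\<lambda>t. \<phi> (coord_curve (C, \<phi>) i x t) k) 0) =
      (\<Sum>k\<in>idx X. if k = i then jder (C, \<phi>) (D, \<psi>) f x k j else 0)"
      using DERIV_imp_deriv[OF coord_curve_coord[OF X cm c(2) i]] by (intro sum.cong) auto
    then show "(\<Sum>k\<in>idx X. jder (C, \<phi>) (D, \<psi>) f x k j * deriv (\<lambda>t. \<phi> (coord_curve (C, \<phi>) i x t) k) 0) =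
      jder (C, \<phi>) (D, \<psi>) f x i j" using i atlas_ok_finite[OF X] by simp
  qed (simp add: jder_def)
  finally show ?thesis .
qed

lemma same_jet_1_iff:
  assumes X: "atlas_ok X"
  shows "same_jet X 1 x f g \<longleftrightarrow> f x = g x \<and> (\<forall>c\<in>atlas X. \<forall>d\<in>atlas X. x \<in> fst c \<and> the (f x) \<in> fst d \<longrightarrow>
    (\<forall>i\<in>idx X. \<forall>j\<in>idx X. jder c d f x i j = jder c d g x i j))" (is "_ \<longleftrightarrow> ?R")
proof
  assume s: "same_jet X 1 x f g"
  have "jder c d f x i j = jder c d g x i j"
    if "c \<in> atlas X" "d \<in> atlas X" "x \<in> fst c" "the (f x) \<in> fst d" "i \<in> idx X" "j \<in> idx X" for c d i j
  proof -
    have "set [i] \<subseteq> idx X \<and> length [i] \<le> 1" using that by simp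
    then have "pds [i] (local_rep c d f j) (snd c x) = pds [i] (local_rep c d g j) (snd c x)"
      using s that unfolding same_jet_def by blast
    then show ?thesis by (simp only: local_rep_pds)
  qed
  then show ?R using s by (auto simp: same_jet_def)
next
  assume R: ?R
  have "pds is (local_rep c d f j) (snd c x) = pds is (local_rep c d g j) (snd c x)"
    if m: "c \<in> atlas X" "d \<in> atlas X" "x \<in> fst c" "the (f x) \<in> fst d" "set is \<subseteq> idx X" "length is \<le> 1" "j \<in> idx X"
    for c d "is" j
  proof (cases "is")
    case Nil
    obtain C \<phi> where c: "c = (C, \<phi>)" by (cases c)
    have "inv_into C \<phi> (\<phi> x) = x" using chartD(1)[OF X, of C \<phi>] m c by (simp add: inv_into_f_f)
    then show ?thesis using R by (simp add: Nil c local_rep_pds)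
  next
    case (Cons i js)
    then have "is = [i]" "i \<in> idx X" using m by auto
    then show ?thesis using R m by (simp add: local_rep_pds)
  qed
  then show "same_jet X 1 x f g" using R unfolding same_jet_def by blast
qed

text \<open>\<open>same_jet\<close> speaks about all pairs of charts, but a change of charts acts on
  both Jacobians in the same way, so one pair decides.\<close>

lemma same_jetI:
  assumes X: "atlas_ok X" and f: "f \<in> local_smooth_maps X" "x \<in> dom f" and g: "g \<in> local_smooth_maps X"
    and eq: "f x = g x" and c: "(C, \<phi>) \<in> atlas X" "x \<in> C" and d: "(D, \<psi>) \<in> atlas X" "the (f x) \<in> D"
    and jd: "\<And>i j. i \<in> idx X \<Longrightarrow> j \<in> idx X \<Longrightarrow> jder (C, \<phi>) (D, \<psi>) f x i j = jder (C, \<phi>) (D, \<psi>) g x i j"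
  shows "same_jet X 1 x f g"
  unfolding same_jet_1_iff[OF X]
proof (intro conjI eq ballI impI)
  fix c' d' i l assume c': "c' \<in> atlas X" and d': "d' \<in> atlas X" and m: "x \<in> fst c' \<and> the (f x) \<in> fst d'"
    and i: "i \<in> idx X" and "l \<in> idx X"
  obtain C' \<phi>' where C': "c' = (C', \<phi>')" by (cases c')
  obtain D' \<psi>' where D': "d' = (D', \<psi>')" by (cases d')
  have gx: "x \<in> dom g" "the (g x) = the (f x)" using eq f(2) by (auto simp: dom_def)
  have cc: "(C', \<phi>') \<in> atlas X" "x \<in> C'" "(D', \<psi>') \<in> atlas X" "the (f x) \<in> D'" "the (g x) \<in> D'" "the (g x) \<in> D"
    using c' d' m C' D' gx d by auto
  show "jder c' d' f x i l = jder c' d' g x i l"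
    unfolding C' D' jder_change[OF X f c d cc(1-4) i] jder_change[OF X g gx(1) c d(1) cc(6) cc(1,2,3,5) i] gx(2)
    using jd by simp
qed

lemma same_jet_equiv:
  assumes X: "atlas_ok X"
  shows "same_jet X 1 x f f" "same_jet X 1 x f g \<Longrightarrow> same_jet X 1 x g f"
    "same_jet X 1 x f g \<Longrightarrow> same_jet X 1 x g h \<Longrightarrow> same_jet X 1 x f h"
  unfolding same_jet_1_iff[OF X] by auto

abbreviation jets1 :: "('a, 'i) mfd \<Rightarrow> 'a jet set" where
  "jets1 X \<equiv> jets X 1 (local_smooth_maps X)"

lemma jet_eqI: "atlas_ok X \<Longrightarrow> same_jet X 1 x f g \<Longrightarrow> jet X 1 x f = jet X 1 x g"
proof -
  assume X: "atlas_ok X" and fg: "same_jet X 1 x f g"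
  have "same_jet X 1 x f h \<longleftrightarrow> same_jet X 1 x g h" for h
    using same_jet_equiv(2)[OF X fg] same_jet_equiv(3)[OF X] fg by metis
  then show ?thesis by (simp only: jet_def)
qed

text \<open>\<open>jet_rep\<close> selects an arbitrary member of the class: its value and first
  derivatives at the source are determined, its domain and its values elsewhere are not.\<close>

lemma jet_facts:
  assumes X: "atlas_ok X" and f: "f \<in> local_smooth_maps X" "x \<in> dom f"
  shows jet_src: "jet_src (jet X 1 x f) = x"
    and jet_rep: "jet_rep (jet X 1 x f) \<in> local_smooth_maps X" "x \<in> dom (jet_rep (jet X 1 x f))"
      "same_jet X 1 x f (jet_rep (jet X 1 x f))"
    and jet_tgt: "jet_tgt (jet X 1 x f) = the (f x)"
    and jet_in: "jet X 1 x f \<in> jets1 X"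
proof -
  show 1: "jet_src (jet X 1 x f) = x" by (simp add: jet_src_def jet_def)
  have "f \<in> snd (jet X 1 x f)" using f same_jet_equiv(1)[OF X] by (simp add: jet_def)
  then have "jet_rep (jet X 1 x f) \<in> snd (jet X 1 x f)" unfolding jet_rep_def by (rule someI[where P = "\<lambda>g. g \<in> snd (jet X 1 x f)"])
  then show 2: "jet_rep (jet X 1 x f) \<in> local_smooth_maps X" "x \<in> dom (jet_rep (jet X 1 x f))"
      "same_jet X 1 x f (jet_rep (jet X 1 x f))" by (auto simp: jet_def)
  then show "jet_tgt (jet X 1 x f) = the (f x)" using 1 by (simp add: jet_tgt_def same_jet_def)
  show "jet X 1 x f \<in> jets1 X" using f by (auto simp: jets_def)
qed

lemma jets1D:
  assumes X: "atlas_ok X" and \<xi>: "\<xi> \<in> jets1 X"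
  shows "jet_rep \<xi> \<in> local_smooth_maps X" "jet_src \<xi> \<in> dom (jet_rep \<xi>)" "jet X 1 (jet_src \<xi>) (jet_rep \<xi>) = \<xi>"
    "jet_src \<xi> \<in> pts X" "jet_tgt \<xi> \<in> pts X" "jet_tgt \<xi> = the (jet_rep \<xi> (jet_src \<xi>))"
proof -
  obtain x f where f: "\<xi> = jet X 1 x f" "f \<in> local_smooth_maps X" "x \<in> dom f" using \<xi> by (auto simp: jets_def)
  note jf = jet_facts[OF X f(2,3)]
  show 1: "jet_rep \<xi> \<in> local_smooth_maps X" "jet_src \<xi> \<in> dom (jet_rep \<xi>)" using jf f(1) by auto
  show "jet X 1 (jet_src \<xi>) (jet_rep \<xi>) = \<xi>" using jet_eqI[OF X jf(4)] jf(1) f(1) by simp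
  show "jet_tgt \<xi> = the (jet_rep \<xi> (jet_src \<xi>))" by (simp add: jet_tgt_def)
  then show "jet_src \<xi> \<in> pts X" "jet_tgt \<xi> \<in> pts X"
    using local_smoothD(2,3)[OF X 1(1) 1(2)] by auto
qed

definition jd :: "('a, 'i) chart \<Rightarrow> ('a, 'i) chart \<Rightarrow> 'a jet \<Rightarrow> 'i \<Rightarrow> 'i \<Rightarrow> real" where
  "jd c d \<xi> i j = jder c d (jet_rep \<xi>) (jet_src \<xi>) i j"

lemma jd_jet:
  assumes X: "atlas_ok X" and f: "f \<in> local_smooth_maps X" "x \<in> dom f"
    and c: "c \<in> atlas X" "x \<in> fst c" and d: "d \<in> atlas X" "the (f x) \<in> fst d" and ij: "i \<in> idx X" "j \<in> idx X"
  shows "jd c d (jet X 1 x f) i j = jder c d f x i j"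
proof -
  have "jder c d f x i j = jder c d (jet_rep (jet X 1 x f)) x i j"
    using jet_rep(3)[OF X f] c d ij unfolding same_jet_1_iff[OF X] by blast
  then show ?thesis by (simp only: jd_def jet_src[OF X f])
qed

lemma jets1_eqI:
  assumes X: "atlas_ok X" and \<xi>: "\<xi> \<in> jets1 X" and \<eta>: "\<eta> \<in> jets1 X"
    and st: "jet_src \<xi> = jet_src \<eta>" "jet_tgt \<xi> = jet_tgt \<eta>"
    and c: "(C, \<phi>) \<in> atlas X" "jet_src \<xi> \<in> C" and d: "(D, \<psi>) \<in> atlas X" "jet_tgt \<xi> \<in> D"
    and eq: "\<And>i j. i \<in> idx X \<Longrightarrow> j \<in> idx X \<Longrightarrow> jd (C, \<phi>) (D, \<psi>) \<xi> i j = jd (C, \<phi>) (D, \<psi>) \<eta> i j"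
  shows "\<xi> = \<eta>"
proof -
  note x = jets1D[OF X \<xi>] and e = jets1D[OF X \<eta>]
  have "jet_rep \<xi> (jet_src \<xi>) = jet_rep \<eta> (jet_src \<xi>)"
    using x(2,6) e(2,6) st by (metis domD option.sel)
  then have "same_jet X 1 (jet_src \<xi>) (jet_rep \<xi>) (jet_rep \<eta>)"
    using eq st c d x(6) by (intro same_jetI[OF X x(1,2) e(1) _ c d(1)]) (auto simp: jd_def)
  then show ?thesis using jet_eqI[OF X] x(3) e(3) st by metis
qed

lemma jets1_realize:
  assumes X: "atlas_ok X" and c: "(C, \<phi>) \<in> atlas X" "x \<in> C" and d: "(D, \<psi>) \<in> atlas X" "y \<in> D"
  shows "\<exists>\<xi>\<in>jets1 X. jet_src \<xi> = x \<and> jet_tgt \<xi> = y \<and> (\<forall>i\<in>idx X. \<forall>j\<in>idx X. jd (C, \<phi>) (D, \<psi>) \<xi> i j = A i j)"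
proof -
  note cm = atlas_max_atlas[OF X c(1)] and dm = atlas_max_atlas[OF X d(1)] and fin = atlas_ok_finite[OF X]
  note cD = max_chartD[OF X cm] and dD = max_chartD[OF X dm]
  define v where "v = (\<lambda>q j. if j \<in> idx X then \<psi> y j + (\<Sum>i\<in>idx X. A i j * (\<phi> q i - \<phi> x i)) else 0)"
  have vs: "smooth_on X C (\<lambda>q. v q j)" for j
  proof (cases "j \<in> idx X")
    case True
    have "smooth_on X C (\<lambda>q. \<psi> y j + (\<Sum>i\<in>idx X. A i j * (\<phi> q i - \<phi> x i)))"
      by (intro smooth_on_add[OF X] smooth_on_sum[OF X] smooth_on_mult[OF X] smooth_on_diff[OF X]
          smooth_on_const[OF X cD(5)] cD(5,6))
    then show ?thesis using True by (simp add: v_def)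
  qed (simp add: v_def smooth_on_const[OF X cD(5)])
  define U where "U = {q \<in> C. v q \<in> \<psi> ` D}"
  have U: "openin (mtop X) U" unfolding U_def
    by (rule smooth_on_preimage[OF X cD(5) dD(2) vs]) (simp add: v_def coord_space_def)
  have "v x = \<psi> y"
    using dD(4)[OF d(2)] by (auto simp: v_def coord_space_def fun_eq_iff)
  then have xU: "x \<in> U" using c d by (simp add: U_def)
  define f where "f = (\<lambda>q. if q \<in> U then Some (inv_into D \<psi> (v q)) else None)"
  have dom: "dom f = U" by (auto simp: f_def split: if_splits)
  have fD: "the (f q) \<in> D" "\<psi> (the (f q)) = v q" if q: "q \<in> U" for q
  proof -
    obtain y' where "y' \<in> D" "v q = \<psi> y'" using q by (auto simp: U_def)
    then show "the (f q) \<in> D" "\<psi> (the (f q)) = v q" using q dD(1) by (auto simp: f_def inv_into_f_f)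
  qed
  have sm: "smooth_on X U (\<lambda>q. \<psi> (the (f q)) j)" for j
    by (rule smooth_on_cong[OF X smooth_on_subset[OF vs U]]) (use fD in \<open>auto simp: U_def\<close>)
  have f: "f \<in> local_smooth_maps X"
  proof (rule local_smoothI[OF X])
    fix q assume "q \<in> dom f"
    then show "\<exists>V D \<psi>. openin (mtop X) V \<and> q \<in> V \<and> V \<subseteq> dom f \<and> (D, \<psi>) \<in> max_atlas X \<and>
      (\<forall>q\<in>V. the (f q) \<in> D) \<and> (\<forall>j\<in>idx X. smooth_on X V (\<lambda>q. \<psi> (the (f q)) j))"
      using U dm sm fD dom by (intro exI[of _ U] exI[of _ D] exI[of _ \<psi>]) auto
  qed (simp add: dom U)
  have xd: "x \<in> dom f" using xU by (simp add: dom)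
  have fx: "the (f x) = y" using fD[OF xU] \<open>v x = \<psi> y\<close> d(2) dD(1) by (metis inj_onD)
  have "jder (C, \<phi>) (D, \<psi>) f x i j = A i j" if i: "i \<in> idx X" and j: "j \<in> idx X" for i j
  proof -
    let ?g = "coord_curve (C, \<phi>) i x"
    have "\<forall>\<^sub>F t in nhds 0. ?g t \<in> U" by (rule curveD(3)[OF coord_curve[OF X cm c(2) i] U xU])
    then have ev: "\<forall>\<^sub>F t in nhds 0. \<psi> (the (f (?g t))) j = \<psi> y j + (\<Sum>i\<in>idx X. A i j * (\<phi> (?g t) i - \<phi> x i))"
      by eventually_elim (simp add: fD v_def j)
    have "((\<lambda>t. \<psi> y j + (\<Sum>k\<in>idx X. A k j * (\<phi> (?g t) k - \<phi> x k))) has_real_derivative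
      (0 + (\<Sum>k\<in>idx X. A k j * ((if k = i then 1 else 0) - 0)))) (at 0)"
      by (intro DERIV_add DERIV_const DERIV_sum DERIV_cmult DERIV_diff coord_curve_coord[OF X cm c(2) i])
    moreover have "(\<Sum>k\<in>idx X. A k j * ((if k = i then 1 else 0) - 0)) = (\<Sum>k\<in>idx X. if k = i then A i j else 0)"
      by (intro sum.cong) auto
    ultimately have "((\<lambda>t. \<psi> y j + (\<Sum>k\<in>idx X. A k j * (\<phi> (?g t) k - \<phi> x k))) has_real_derivative A i j) (at 0)"
      using i fin by simp
    then have "((\<lambda>t. \<psi> (the (f (?g t))) j) has_real_derivative A i j) (at 0)"
      using DERIV_cong_ev[OF refl ev refl] by simp
    moreover have "((\<lambda>t. \<psi> (the (f (?g t))) j) has_real_derivative jder (C, \<phi>) (D, \<psi>) f x i j) (at 0)"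
      unfolding jder_def snd_conv by (rule coord_curve_deriv[OF X cm c(2) i sm xU])
    ultimately show ?thesis using DERIV_unique by blast
  qed
  then show ?thesis
    using jet_facts[OF X f xd] fx c d jd_jet[OF X f xd, of "(C, \<phi>)" "(D, \<psi>)"]
    by (intro bexI[of _ "jet X 1 x f"]) auto
qed

section \<open>The manifold of first order jets\<close>

declare One_nat_def [simp del]

lemma jet_fibre_idx_1: "jet_fibre_idx X 1 = ({{#}} \<union> (\<lambda>i. {#i#}) ` idx X) \<times> idx X"
proof -
  have "{\<alpha>. set_mset \<alpha> \<subseteq> idx X \<and> size \<alpha> \<le> 1} = {{#}} \<union> (\<lambda>i. {#i#}) ` idx X"
  proof (intro equalityI subsetI)
    fix \<alpha> assume a: "\<alpha> \<in> {\<alpha>. set_mset \<alpha> \<subseteq> idx X \<and> size \<alpha> \<le> 1}"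
    show "\<alpha> \<in> {{#}} \<union> (\<lambda>i. {#i#}) ` idx X"
    proof (cases "\<alpha> = {#}")
      case False
      then have "size \<alpha> \<noteq> 0" by simp
      then have "size \<alpha> = 1" using a by (simp add: le_Suc_eq One_nat_def)
      then obtain i where "\<alpha> = {#i#}" using size_1_singleton_mset by blast
      then show ?thesis using a by auto
    qed simp
  qed auto
  then show ?thesis by (simp add: jet_fibre_idx_def)
qed

definition jdom :: "('a, 'i) mfd \<Rightarrow> ('a, 'i) chart \<Rightarrow> ('a, 'i) chart \<Rightarrow> 'a jet set" where
  "jdom X c d = {\<xi> \<in> jets1 X. jet_src \<xi> \<in> fst c \<and> jet_tgt \<xi> \<in> fst d}"

lemma jet_mfd_sel: "idx (jet_mfd X 1) = idx X <+> jet_fibre_idx X 1"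
  "atlas (jet_mfd X 1) = {(jdom X c d, jet_coord X 1 c d) |c d. c \<in> atlas X \<and> d \<in> atlas X}"
  by (simp_all add: jet_mfd_def jdom_def)

lemma jet_mfd_idx_cases:
  assumes "k \<in> idx (jet_mfd X 1)"
  obtains i where "i \<in> idx X" "k = Inl i" | j where "j \<in> idx X" "k = Inr ({#}, j)"
    | i j where "i \<in> idx X" "j \<in> idx X" "k = Inr ({#i#}, j)"
  using assms unfolding jet_mfd_sel jet_fibre_idx_1 by auto

lemma finite_jet_idx: "atlas_ok X \<Longrightarrow> finite (idx (jet_mfd X 1))"
  unfolding jet_mfd_sel jet_fibre_idx_1 by (simp add: atlas_ok_finite)

lemma jet_coord_simps:
  assumes X: "atlas_ok X" and \<xi>: "\<xi> \<in> jets1 X" and c: "(C, \<phi>) \<in> atlas X" "jet_src \<xi> \<in> C"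
  shows "jet_coord X 1 (C, \<phi>) (D, \<psi>) \<xi> (Inl i) = \<phi> (jet_src \<xi>) i"
    "j \<in> idx X \<Longrightarrow> jet_coord X 1 (C, \<phi>) (D, \<psi>) \<xi> (Inr ({#}, j)) = \<psi> (jet_tgt \<xi>) j"
    "j \<notin> idx X \<Longrightarrow> jet_coord X 1 (C, \<phi>) (D, \<psi>) \<xi> (Inr ({#}, j)) = 0"
    "i \<in> idx X \<Longrightarrow> j \<in> idx X \<Longrightarrow> jet_coord X 1 (C, \<phi>) (D, \<psi>) \<xi> (Inr ({#i#}, j)) = jd (C, \<phi>) (D, \<psi>) \<xi> i j"
    "jet_coord X 1 (C, \<phi>) (D, \<psi>) \<xi> \<in> coord_space (idx (jet_mfd X 1))"
proof -
  show "jet_coord X 1 (C, \<phi>) (D, \<psi>) \<xi> (Inl i) = \<phi> (jet_src \<xi>) i" for i by (simp add: jet_coord_def)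
  \<comment> \<open>A multiset with at most one element has a single enumeration, so in order 1 the
    choice in \<open>jet_coord\<close> is determined and symmetry of derivatives is no
    issue.\<close>
  have e: "(SOME is. mset is = ({#} :: 'b multiset)) = []" by simp
  have s: "(SOME is. mset is = {#i#}) = [i]" for i :: 'b by (simp add: mset_single_iff)
  have "inv_into C \<phi> (\<phi> (jet_src \<xi>)) = jet_src \<xi>" using chartD(1)[OF X c(1)] c(2) by (simp add: inv_into_f_f)
  then show "j \<in> idx X \<Longrightarrow> jet_coord X 1 (C, \<phi>) (D, \<psi>) \<xi> (Inr ({#}, j)) = \<psi> (jet_tgt \<xi>) j"
    unfolding jet_coord_def jet_fibre_idx_1 by (simp add: e local_rep_pds jets1D(6)[OF X \<xi>])
  show "j \<notin> idx X \<Longrightarrow> jet_coord X 1 (C, \<phi>) (D, \<psi>) \<xi> (Inr ({#}, j)) = 0"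
    unfolding jet_coord_def jet_fibre_idx_1 by simp
  have "pds [i] (local_rep (C, \<phi>) (D, \<psi>) f j) (\<phi> x) = jder (C, \<phi>) (D, \<psi>) f x i j" for i j f x
    using local_rep_pds(1)[of i "(C, \<phi>)" "(D, \<psi>)" f j x] by simp
  then show "i \<in> idx X \<Longrightarrow> j \<in> idx X \<Longrightarrow> jet_coord X 1 (C, \<phi>) (D, \<psi>) \<xi> (Inr ({#i#}, j)) = jd (C, \<phi>) (D, \<psi>) \<xi> i j"
    unfolding jet_coord_def jet_fibre_idx_1 by (simp add: s jd_def)
  show "jet_coord X 1 (C, \<phi>) (D, \<psi>) \<xi> \<in> coord_space (idx (jet_mfd X 1))"
    unfolding coord_space_def jet_mfd_sel
  proof (intro CollectI allI impI)
    fix k assume k: "k \<notin> idx X <+> jet_fibre_idx X 1"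
    show "jet_coord X 1 (C, \<phi>) (D, \<psi>) \<xi> k = 0"
    proof (cases k)
      case (Inl i)
      then have "i \<notin> idx X" using k by auto
      then show ?thesis using chartD(4)[OF X c] by (simp add: Inl jet_coord_def coord_space_def)
    next
      case (Inr a)
      then have "a \<notin> jet_fibre_idx X 1" using k by auto
      then show ?thesis by (cases a) (simp add: Inr jet_coord_def)
    qed
  qed
qed

text \<open>As every matrix is realised, the derivative coordinates are entirely free; only source
  and target are confined to open sets, which makes the image open.\<close>

lemma jet_coord_image:
  assumes X: "atlas_ok X" and c: "(C, \<phi>) \<in> atlas X" and d: "(D, \<psi>) \<in> atlas X"
  shows "jet_coord X 1 (C, \<phi>) (D, \<psi>) ` {\<xi> \<in> jets1 X. jet_src \<xi> \<in> C \<inter> A \<and> jet_tgt \<xi> \<in> D \<inter> B} =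
    {w \<in> coord_space (idx (jet_mfd X 1)). (\<lambda>i. w (Inl i)) \<in> \<phi> ` (C \<inter> A) \<and> (\<lambda>j. w (Inr ({#}, j))) \<in> \<psi> ` (D \<inter> B)}"
    (is "?f ` ?S = ?R")
proof (intro equalityI subsetI)
  fix w assume "w \<in> ?f ` ?S"
  then obtain \<xi> where \<xi>: "\<xi> \<in> jets1 X" "jet_src \<xi> \<in> C" "jet_src \<xi> \<in> A" "jet_tgt \<xi> \<in> D" "jet_tgt \<xi> \<in> B" "w = ?f \<xi>" by auto
  note jc = jet_coord_simps[OF X \<xi>(1) c \<xi>(2), where D = D and \<psi> = \<psi>]
  have "(\<lambda>i. w (Inl i)) = \<phi> (jet_src \<xi>)" by (simp add: \<xi>(6) jc(1))
  moreover have "(\<lambda>j. w (Inr ({#}, j))) = \<psi> (jet_tgt \<xi>)"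
  proof
    fix j show "w (Inr ({#}, j)) = \<psi> (jet_tgt \<xi>) j"
      using jc(2,3)[of j] chartD(4)[OF X d \<xi>(4)] by (cases "j \<in> idx X") (auto simp: \<xi>(6) coord_space_def)
  qed
  ultimately show "w \<in> ?R" using \<xi> jc(5) by auto
next
  fix w assume w: "w \<in> ?R"
  then obtain x y where xy: "x \<in> C" "x \<in> A" "(\<lambda>i. w (Inl i)) = \<phi> x" "y \<in> D" "y \<in> B" "(\<lambda>j. w (Inr ({#}, j))) = \<psi> y" by auto
  obtain \<xi> where \<xi>: "\<xi> \<in> jets1 X" "jet_src \<xi> = x" "jet_tgt \<xi> = y"
    "\<forall>i\<in>idx X. \<forall>j\<in>idx X. jd (C, \<phi>) (D, \<psi>) \<xi> i j = w (Inr ({#i#}, j))"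
    using jets1_realize[OF X c xy(1) d xy(4), of "\<lambda>i j. w (Inr ({#i#}, j))"] by blast
  have sC: "jet_src \<xi> \<in> C" using \<xi> xy by simp
  note jc = jet_coord_simps[OF X \<xi>(1) c sC, where D = D and \<psi> = \<psi>]
  have "?f \<xi> = w"
  proof (rule coord_space_eqI[OF jc(5)])
    show "w \<in> coord_space (idx (jet_mfd X 1))" using w by simp
    fix k assume "k \<in> idx (jet_mfd X 1)"
    then show "?f \<xi> k = w k"
    proof (cases rule: jet_mfd_idx_cases)
      case (1 i) then show ?thesis using fun_cong[OF xy(3), of i] by (simp add: jc(1) \<xi>(2))
    next
      case (2 j) then show ?thesis using fun_cong[OF xy(6), of j] by (simp add: jc(2) \<xi>(3))
    next
      case (3 i j) then show ?thesis using \<xi>(4) by (simp add: jc(4))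
    qed
  qed
  then show "w \<in> ?f ` ?S" using \<xi> xy by auto
qed

lemma jet_coord_inj:
  assumes X: "atlas_ok X" and c: "(C, \<phi>) \<in> atlas X" and d: "(D, \<psi>) \<in> atlas X"
  shows "inj_on (jet_coord X 1 (C, \<phi>) (D, \<psi>)) (jdom X (C, \<phi>) (D, \<psi>))"
proof
  fix \<xi> \<eta> assume m: "\<xi> \<in> jdom X (C, \<phi>) (D, \<psi>)" "\<eta> \<in> jdom X (C, \<phi>) (D, \<psi>)"
    and eq: "jet_coord X 1 (C, \<phi>) (D, \<psi>) \<xi> = jet_coord X 1 (C, \<phi>) (D, \<psi>) \<eta>"
  have x: "\<xi> \<in> jets1 X" "jet_src \<xi> \<in> C" "jet_tgt \<xi> \<in> D" and e: "\<eta> \<in> jets1 X" "jet_src \<eta> \<in> C" "jet_tgt \<eta> \<in> D"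
    using m by (auto simp: jdom_def)
  note xc = jet_coord_simps[OF X x(1) c x(2), where D = D and \<psi> = \<psi>] and ec = jet_coord_simps[OF X e(1) c e(2), where D = D and \<psi> = \<psi>]
  show "\<xi> = \<eta>"
  proof (rule jets1_eqI[OF X x(1) e(1) _ _ c x(2) d x(3)])
    have "\<phi> (jet_src \<xi>) = \<phi> (jet_src \<eta>)" using fun_cong[OF eq, of "Inl _"] by (auto simp: xc(1) ec(1))
    then show "jet_src \<xi> = jet_src \<eta>" using chartD(1)[OF X c] x(2) e(2) by (auto dest: inj_onD)
    have "\<psi> (jet_tgt \<xi>) = \<psi> (jet_tgt \<eta>)"
    proof (rule coord_space_eqI[OF chartD(4)[OF X d x(3)] chartD(4)[OF X d e(3)]])
      show "\<psi> (jet_tgt \<xi>) j = \<psi> (jet_tgt \<eta>) j" if "j \<in> idx X" for j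
        using fun_cong[OF eq, of "Inr ({#}, j)"] xc(2)[OF that] ec(2)[OF that] by simp
    qed
    then show "jet_tgt \<xi> = jet_tgt \<eta>" using chartD(1)[OF X d] x(3) e(3) by (auto dest: inj_onD)
    show "jd (C, \<phi>) (D, \<psi>) \<xi> i j = jd (C, \<phi>) (D, \<psi>) \<eta> i j" if "i \<in> idx X" "j \<in> idx X" for i j
      using fun_cong[OF eq, of "Inr ({#i#}, j)"] xc(4)[OF that] ec(4)[OF that] by simp
  qed
qed

lemma jet_coord_copen:
  assumes X: "atlas_ok X" and c: "(C, \<phi>) \<in> atlas X" and d: "(D, \<psi>) \<in> atlas X"
    and A: "openin (mtop X) A" and B: "openin (mtop X) B"
  shows "copen (idx (jet_mfd X 1)) (jet_coord X 1 (C, \<phi>) (D, \<psi>) ` {\<xi> \<in> jets1 X. jet_src \<xi> \<in> C \<inter> A \<and> jet_tgt \<xi> \<in> D \<inter> B})"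
proof -
  let ?K = "idx (jet_mfd X 1)"
  have cont: "continuous_on S (\<lambda>w :: 'b + 'b multiset \<times> 'b \<Rightarrow> real. w k)" for S k
    by (rule continuous_on_subset[OF continuous_on_product_coordinates]) simp
  have c0: "copen ?K (coord_space ?K)" by simp
  have nI: "i \<notin> idx X \<Longrightarrow> Inl i \<notin> ?K" "j \<notin> idx X \<Longrightarrow> Inr (\<alpha>, j) \<notin> ?K" for i j \<alpha>
    unfolding jet_mfd_sel jet_fibre_idx_1 by auto
  have "copen ?K {w \<in> coord_space ?K. (\<lambda>i. w (Inl i)) \<in> \<phi> ` (C \<inter> A)}"
    by (rule copen_preimage[OF c0 openin_mtop_image[OF X A c] cont]) (use nI in \<open>simp add: coord_space_def\<close>)
  moreover have "copen ?K {w \<in> coord_space ?K. (\<lambda>j. w (Inr ({#}, j))) \<in> \<psi> ` (D \<inter> B)}"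
    by (rule copen_preimage[OF c0 openin_mtop_image[OF X B d] cont]) (use nI in \<open>simp add: coord_space_def\<close>)
  ultimately have "copen ?K ({w \<in> coord_space ?K. (\<lambda>i. w (Inl i)) \<in> \<phi> ` (C \<inter> A)} \<inter>
    {w \<in> coord_space ?K. (\<lambda>j. w (Inr ({#}, j))) \<in> \<psi> ` (D \<inter> B)})" by (rule openin_Int)
  moreover have "{w \<in> coord_space ?K. (\<lambda>i. w (Inl i)) \<in> \<phi> ` (C \<inter> A)} \<inter>
      {w \<in> coord_space ?K. (\<lambda>j. w (Inr ({#}, j))) \<in> \<psi> ` (D \<inter> B)} =
    {w \<in> coord_space ?K. (\<lambda>i. w (Inl i)) \<in> \<phi> ` (C \<inter> A) \<and> (\<lambda>j. w (Inr ({#}, j))) \<in> \<psi> ` (D \<inter> B)}" by auto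
  ultimately show ?thesis unfolding jet_coord_image[OF X c d] by simp
qed

text \<open>\<open>\<sigma>\<close> locates the coordinates of the source, or of the target, among
  those of a jet.\<close>

lemma C_infinity_select:
  assumes X: "atlas_ok X" and c: "(C, \<phi>) \<in> atlas X" and h: "smooth_on X U h" and A: "copen K A" "finite K"
    and sel: "\<And>w. w \<in> A \<Longrightarrow> (\<lambda>i. w (\<sigma> i)) \<in> \<phi> ` (C \<inter> U)"
  shows "C_infinity K A (\<lambda>w. h (inv_into C \<phi> (\<lambda>i. w (\<sigma> i))))"
proof (rule C_infinity_compose[OF _ C_infinity_coord[OF A(2,1)] sel A openin_mtop_image[OF X smooth_on_openin[OF h] c] atlas_ok_finite[OF X]])
  show "C_infinity (idx X) (\<phi> ` (C \<inter> U)) (\<lambda>u. h (inv_into C \<phi> u))"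
    using h c by (auto simp: smooth_on_def)
qed

lemma jd_change:
  assumes X: "atlas_ok X" and \<xi>: "\<xi> \<in> jets1 X"
    and c: "(C, \<phi>) \<in> atlas X" "jet_src \<xi> \<in> C" and d: "(D, \<psi>) \<in> atlas X" "jet_tgt \<xi> \<in> D"
    and c': "(C', \<phi>') \<in> atlas X" "jet_src \<xi> \<in> C'" and d': "(D', \<psi>') \<in> atlas X" "jet_tgt \<xi> \<in> D'" and i: "i' \<in> idx X"
  shows "jd (C', \<phi>') (D', \<psi>') \<xi> i' l = (\<Sum>j\<in>idx X. dpart (D, \<psi>) j (\<lambda>y. \<psi>' y l) (jet_tgt \<xi>) *
    (\<Sum>i\<in>idx X. jd (C, \<phi>) (D, \<psi>) \<xi> i j * dpart (C', \<phi>') i' (\<lambda>x. \<phi> x i) (jet_src \<xi>)))"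
proof -
  note x = jets1D[OF X \<xi>]
  show ?thesis unfolding jd_def x(6)
    by (rule jder_change[OF X x(1,2) c d(1) _ c' d'(1) _ i]) (use d d' x(6) in auto)
qed

text \<open>Source and target coordinates change by transition maps of \<open>X\<close>. Derivative
  coordinates change linearly, the coefficients being first derivatives of transition maps and hence
  smooth in source and target.\<close>

lemma atlas_ok_jet:
  assumes X: "atlas_ok X" shows "atlas_ok (jet_mfd X 1)"
proof -
  let ?K = "idx (jet_mfd X 1)"
  note fin = finite_jet_idx[OF X]
  have chart: "is_chart ?K (jdom X c d, jet_coord X 1 c d)" if c: "c \<in> atlas X" and d: "d \<in> atlas X" for c d
  proof -
    obtain C \<phi> where C: "c = (C, \<phi>)" by (cases c)
    obtain D \<psi> where D: "d = (D, \<psi>)" by (cases d)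
    have cd: "(C, \<phi>) \<in> atlas X" "(D, \<psi>) \<in> atlas X" using c d C D by auto
    have "jdom X c d = {\<xi> \<in> jets1 X. jet_src \<xi> \<in> C \<inter> C \<and> jet_tgt \<xi> \<in> D \<inter> D}" by (simp add: jdom_def C D)
    then show ?thesis
      using jet_coord_inj[OF X cd] jet_coord_copen[OF X cd chart_open_domain[OF X cd(1)] chart_open_domain[OF X cd(2)]]
      by (simp add: is_chart_def C D)
  qed
  have trans: "smooth_transition ?K (jdom X c d, jet_coord X 1 c d) (jdom X c' d', jet_coord X 1 c' d')"
    if "c \<in> atlas X" "d \<in> atlas X" "c' \<in> atlas X" "d' \<in> atlas X" for c d c' d'
  proof -
    obtain C \<phi> where C: "c = (C, \<phi>)" by (cases c)
    obtain D \<psi> where D: "d = (D, \<psi>)" by (cases d)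
    obtain C' \<phi>' where C': "c' = (C', \<phi>')" by (cases c')
    obtain D' \<psi>' where D': "d' = (D', \<psi>')" by (cases d')
    have c: "(C, \<phi>) \<in> atlas X" and d: "(D, \<psi>) \<in> atlas X" and c': "(C', \<phi>') \<in> atlas X" and d': "(D', \<psi>') \<in> atlas X"
      using that C D C' D' by auto
    note cm = atlas_max_atlas[OF X c] and dm = atlas_max_atlas[OF X d] and cm' = atlas_max_atlas[OF X c'] and dm' = atlas_max_atlas[OF X d']
    define S where "S = {\<xi> \<in> jets1 X. jet_src \<xi> \<in> C \<inter> C' \<and> jet_tgt \<xi> \<in> D \<inter> D'}"
    have S: "jdom X c d \<inter> jdom X c' d' = S" by (auto simp: jdom_def S_def C D C' D')
    define A where "A = jet_coord X 1 c d ` S"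
    have A: "copen ?K A" unfolding A_def S_def C D
      by (rule jet_coord_copen[OF X c d chart_open_domain[OF X c'] chart_open_domain[OF X d']])
    have Aw: "(\<lambda>i. w (Inl i)) \<in> \<phi> ` (C \<inter> C')" "(\<lambda>j. w (Inr ({#}, j))) \<in> \<psi> ` (D \<inter> D')" if "w \<in> A" for w
      using that unfolding A_def S_def C D jet_coord_image[OF X c d] by auto
    have Aw': "(\<lambda>i. w (Inl i)) \<in> \<phi> ` (C \<inter> (C' \<inter> C))" if "w \<in> A" for w using Aw(1)[OF that] by auto
    have Aw'': "(\<lambda>j. w (Inr ({#}, j))) \<in> \<psi> ` (D \<inter> (D \<inter> D'))" if "w \<in> A" for w using Aw(2)[OF that] by auto
    define x where "x = (\<lambda>w :: 'b + 'b multiset \<times> 'b \<Rightarrow> real. inv_into C \<phi> (\<lambda>i. w (Inl i)))"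
    define y where "y = (\<lambda>w :: 'b + 'b multiset \<times> 'b \<Rightarrow> real. inv_into D \<psi> (\<lambda>j. w (Inr ({#}, j))))"
    have bck: "inv_into (jdom X c d) (jet_coord X 1 c d) w = \<xi>" "x w = jet_src \<xi>" "y w = jet_tgt \<xi>"
      "\<And>i j. i \<in> idx X \<Longrightarrow> j \<in> idx X \<Longrightarrow> w (Inr ({#i#}, j)) = jd c d \<xi> i j"
      if \<xi>: "\<xi> \<in> S" "w = jet_coord X 1 c d \<xi>" for w \<xi>
    proof -
      have m: "\<xi> \<in> jets1 X" "jet_src \<xi> \<in> C" "jet_tgt \<xi> \<in> D" using \<xi>(1) by (auto simp: S_def)
      note jc = jet_coord_simps[OF X m(1) c m(2), where D = D and \<psi> = \<psi>]
      have "\<xi> \<in> jdom X c d" using \<xi>(1) S by blast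
      then show "inv_into (jdom X c d) (jet_coord X 1 c d) w = \<xi>"
        using jet_coord_inj[OF X c d] by (simp add: \<xi>(2) C D inv_into_f_f)
      show "x w = jet_src \<xi>" using chartD(1)[OF X c] m(2) by (simp add: x_def \<xi>(2) C D jc(1) inv_into_f_f)
      have "(\<lambda>j. w (Inr ({#}, j))) = \<psi> (jet_tgt \<xi>)"
      proof
        fix j show "w (Inr ({#}, j)) = \<psi> (jet_tgt \<xi>) j"
          using jc(2,3)[of j] chartD(4)[OF X d m(3)] by (cases "j \<in> idx X") (auto simp: \<xi>(2) C D coord_space_def)
      qed
      then show "y w = jet_tgt \<xi>" using chartD(1)[OF X d] m(3) by (simp add: y_def inv_into_f_f)
      show "w (Inr ({#i#}, j)) = jd c d \<xi> i j" if "i \<in> idx X" "j \<in> idx X" for i j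
        using jc(4)[OF that] by (simp add: \<xi>(2) C D)
    qed
    have "C_infinity ?K A (\<lambda>w. jet_coord X 1 c' d' (inv_into (jdom X c d) (jet_coord X 1 c d) w) k)" if k: "k \<in> ?K" for k
      using k
    proof (cases rule: jet_mfd_idx_cases)
      case (1 i)
      have "C_infinity ?K A (\<lambda>w. \<phi>' (x w) i)"
        unfolding x_def by (rule C_infinity_select[OF X c max_chartD(6)[OF X cm'] A fin Aw(1)])
      then show ?thesis
      proof (rule C_infinity_cong[OF _ _ A fin])
        fix w assume "w \<in> A"
        then obtain \<xi> where \<xi>: "\<xi> \<in> S" "w = jet_coord X 1 c d \<xi>" by (auto simp: A_def)
        show "\<phi>' (x w) i = jet_coord X 1 c' d' (inv_into (jdom X c d) (jet_coord X 1 c d) w) k"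
          unfolding bck[OF \<xi>] 1(2) C' D'
          by (rule jet_coord_simps(1)[OF X _ c', symmetric]) (use \<xi>(1) in \<open>auto simp: S_def\<close>)
      qed
    next
      case (2 j)
      have "C_infinity ?K A (\<lambda>w. \<psi>' (y w) j)"
        unfolding y_def by (rule C_infinity_select[OF X d max_chartD(6)[OF X dm'] A fin Aw(2)])
      then show ?thesis
      proof (rule C_infinity_cong[OF _ _ A fin])
        fix w assume "w \<in> A"
        then obtain \<xi> where \<xi>: "\<xi> \<in> S" "w = jet_coord X 1 c d \<xi>" by (auto simp: A_def)
        show "\<psi>' (y w) j = jet_coord X 1 c' d' (inv_into (jdom X c d) (jet_coord X 1 c d) w) k"
          unfolding bck[OF \<xi>] 2(2) C' D'
          by (rule jet_coord_simps(2)[OF X _ c' _ 2(1), symmetric]) (use \<xi>(1) in \<open>auto simp: S_def\<close>)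
      qed
    next
      case (3 i' l)
      have dx: "C_infinity ?K A (\<lambda>w. dpart (C', \<phi>') i' (\<lambda>x. \<phi> x i) (x w))" for i
        unfolding x_def
        by (rule C_infinity_select[OF X c smooth_on_dpart[OF X cm' max_chartD(6)[OF X cm] 3(1)] A fin Aw'])
      have dy: "C_infinity ?K A (\<lambda>w. dpart (D, \<psi>) j (\<lambda>y. \<psi>' y l) (y w))" if "j \<in> idx X" for j
        unfolding y_def
        by (rule C_infinity_select[OF X d smooth_on_dpart[OF X dm max_chartD(6)[OF X dm'] that] A fin Aw''])
      have "C_infinity ?K A (\<lambda>w. \<Sum>j\<in>idx X. dpart (D, \<psi>) j (\<lambda>y. \<psi>' y l) (y w) *
          (\<Sum>i\<in>idx X. w (Inr ({#i#}, j)) * dpart (C', \<phi>') i' (\<lambda>x. \<phi> x i) (x w)))"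
        by (intro C_infinity_sum C_infinity_mult C_infinity_coord fin A dx dy)
      then show ?thesis
      proof (rule C_infinity_cong[OF _ _ A fin])
        fix w assume "w \<in> A"
        then obtain \<xi> where \<xi>: "\<xi> \<in> S" "w = jet_coord X 1 c d \<xi>" by (auto simp: A_def)
        have m: "\<xi> \<in> jets1 X" "jet_src \<xi> \<in> C" "jet_tgt \<xi> \<in> D" "jet_src \<xi> \<in> C'" "jet_tgt \<xi> \<in> D'"
          using \<xi>(1) by (auto simp: S_def)
        have "jet_coord X 1 c' d' (inv_into (jdom X c d) (jet_coord X 1 c d) w) k = jd (C', \<phi>') (D', \<psi>') \<xi> i' l"
          unfolding bck(1)[OF \<xi>] 3(3) C' D' by (rule jet_coord_simps(4)[OF X m(1) c' m(4) 3(1,2)])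
        also have "\<dots> = (\<Sum>j\<in>idx X. dpart (D, \<psi>) j (\<lambda>y. \<psi>' y l) (jet_tgt \<xi>) *
          (\<Sum>i\<in>idx X. jd (C, \<phi>) (D, \<psi>) \<xi> i j * dpart (C', \<phi>') i' (\<lambda>x. \<phi> x i) (jet_src \<xi>)))"
          by (rule jd_change[OF X m(1) c m(2) d m(3) c' m(4) d' m(5) 3(1)])
        also have "\<dots> = (\<Sum>j\<in>idx X. dpart (D, \<psi>) j (\<lambda>y. \<psi>' y l) (y w) *
          (\<Sum>i\<in>idx X. w (Inr ({#i#}, j)) * dpart (C', \<phi>') i' (\<lambda>x. \<phi> x i) (x w)))"
          unfolding bck(2,3)[OF \<xi>]
          by (intro sum.cong refl arg_cong2[where f = "(*)"]) (use bck(4)[OF \<xi>] C D in auto)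
        finally show "(\<Sum>j\<in>idx X. dpart (D, \<psi>) j (\<lambda>y. \<psi>' y l) (y w) *
          (\<Sum>i\<in>idx X. w (Inr ({#i#}, j)) * dpart (C', \<phi>') i' (\<lambda>x. \<phi> x i) (x w))) =
          jet_coord X 1 c' d' (inv_into (jdom X c d) (jet_coord X 1 c d) w) k" by simp
      qed
    qed
    then show ?thesis using A unfolding smooth_transition_def by (simp add: S A_def)
  qed
  show ?thesis using chart trans fin unfolding atlas_ok_def jet_mfd_sel by blast
qed

lemma pts_jet_mfd: assumes X: "atlas_ok X" shows "pts (jet_mfd X 1) = jets1 X"
proof (intro equalityI subsetI)
  fix \<xi> assume \<xi>: "\<xi> \<in> jets1 X"
  obtain C \<phi> where c: "(C, \<phi>) \<in> atlas X" "jet_src \<xi> \<in> C" using jets1D(4)[OF X \<xi>] by (rule pts_chart)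
  obtain D \<psi> where d: "(D, \<psi>) \<in> atlas X" "jet_tgt \<xi> \<in> D" using jets1D(5)[OF X \<xi>] by (rule pts_chart)
  have "(jdom X (C, \<phi>) (D, \<psi>), jet_coord X 1 (C, \<phi>) (D, \<psi>)) \<in> atlas (jet_mfd X 1)"
    unfolding jet_mfd_sel using c d by blast
  moreover have "\<xi> \<in> jdom X (C, \<phi>) (D, \<psi>)" using \<xi> c d by (simp add: jdom_def)
  ultimately show "\<xi> \<in> pts (jet_mfd X 1)" unfolding pts_def by force
next
  fix \<xi> assume "\<xi> \<in> pts (jet_mfd X 1)"
  then obtain C \<phi> where "(C, \<phi>) \<in> atlas (jet_mfd X 1)" "\<xi> \<in> C" by (rule pts_chart)
  then show "\<xi> \<in> jets1 X" unfolding jet_mfd_sel by (auto simp: jdom_def)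
qed

lemma jet_chart:
  assumes X: "atlas_ok X" and c: "(C, \<phi>) \<in> atlas X" and d: "(D, \<psi>) \<in> atlas X"
  shows "(jdom X (C, \<phi>) (D, \<psi>), jet_coord X 1 (C, \<phi>) (D, \<psi>)) \<in> max_atlas (jet_mfd X 1)"
    "openin (mtop (jet_mfd X 1)) (jdom X (C, \<phi>) (D, \<psi>))"
    "smooth_on (jet_mfd X 1) (jdom X (C, \<phi>) (D, \<psi>)) (\<lambda>\<xi>. \<phi> (jet_src \<xi>) i)"
    "smooth_on (jet_mfd X 1) (jdom X (C, \<phi>) (D, \<psi>)) (\<lambda>\<xi>. \<psi> (jet_tgt \<xi>) i)"
    "i \<in> idx X \<Longrightarrow> j \<in> idx X \<Longrightarrow> smooth_on (jet_mfd X 1) (jdom X (C, \<phi>) (D, \<psi>)) (\<lambda>\<xi>. jd (C, \<phi>) (D, \<psi>) \<xi> i j)"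
proof -
  note ok = atlas_ok_jet[OF X]
  have "(jdom X (C, \<phi>) (D, \<psi>), jet_coord X 1 (C, \<phi>) (D, \<psi>)) \<in> atlas (jet_mfd X 1)"
    unfolding jet_mfd_sel using c d by blast
  from atlas_max_atlas[OF ok this]
  show m: "(jdom X (C, \<phi>) (D, \<psi>), jet_coord X 1 (C, \<phi>) (D, \<psi>)) \<in> max_atlas (jet_mfd X 1)" .
  note mD = max_chartD[OF ok m]
  show "openin (mtop (jet_mfd X 1)) (jdom X (C, \<phi>) (D, \<psi>))" by (rule mD(5))
  have J: "\<xi> \<in> jets1 X" "jet_src \<xi> \<in> C" "jet_tgt \<xi> \<in> D" if "\<xi> \<in> jdom X (C, \<phi>) (D, \<psi>)" for \<xi>
    using that by (auto simp: jdom_def)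
  show "smooth_on (jet_mfd X 1) (jdom X (C, \<phi>) (D, \<psi>)) (\<lambda>\<xi>. \<phi> (jet_src \<xi>) i)" for i
    by (rule smooth_on_cong[OF ok mD(6)[of "Inl i"]]) (simp add: jet_coord_simps(1)[OF X J(1) c J(2)])
  show "smooth_on (jet_mfd X 1) (jdom X (C, \<phi>) (D, \<psi>)) (\<lambda>\<xi>. \<psi> (jet_tgt \<xi>) i)" for i
  proof (cases "i \<in> idx X")
    case True
    show ?thesis
      by (rule smooth_on_cong[OF ok mD(6)[of "Inr ({#}, i)"]]) (simp add: jet_coord_simps(2)[OF X J(1) c J(2) True])
  next
    case False
    show ?thesis
      by (rule smooth_on_cong[OF ok smooth_on_const[OF ok mD(5), of 0]])
        (use chartD(4)[OF X d] J(3) False in \<open>auto simp: coord_space_def\<close>)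
  qed
  show "smooth_on (jet_mfd X 1) (jdom X (C, \<phi>) (D, \<psi>)) (\<lambda>\<xi>. jd (C, \<phi>) (D, \<psi>) \<xi> i j)" if "i \<in> idx X" "j \<in> idx X" for i j
    by (rule smooth_on_cong[OF ok mD(6)[of "Inr ({#i#}, j)"]]) (simp add: jet_coord_simps(4)[OF X J(1) c J(2) that])
qed

lemma jet_point_chart:
  assumes X: "atlas_ok X" and \<xi>: "\<xi> \<in> jets1 X"
  obtains C \<phi> D \<psi> where "(C, \<phi>) \<in> atlas X" "jet_src \<xi> \<in> C" "(D, \<psi>) \<in> atlas X" "jet_tgt \<xi> \<in> D"
    "\<xi> \<in> jdom X (C, \<phi>) (D, \<psi>)"
proof -
  obtain C \<phi> where c: "(C, \<phi>) \<in> atlas X" "jet_src \<xi> \<in> C" using jets1D(4)[OF X \<xi>] by (rule pts_chart)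
  obtain D \<psi> where d: "(D, \<psi>) \<in> atlas X" "jet_tgt \<xi> \<in> D" using jets1D(5)[OF X \<xi>] by (rule pts_chart)
  show thesis using that[OF c d] \<xi> c d by (simp add: jdom_def)
qed

lemma smooth_jet_src: assumes X: "atlas_ok X" shows "smooth_map (jet_mfd X 1) X jet_src"
proof (rule smooth_mapI[OF atlas_ok_jet[OF X] X])
  fix \<xi> assume "\<xi> \<in> pts (jet_mfd X 1)"
  then have "\<xi> \<in> jets1 X" by (simp add: pts_jet_mfd[OF X])
  then obtain C \<phi> D \<psi> where c: "(C, \<phi>) \<in> atlas X" "(D, \<psi>) \<in> atlas X" "\<xi> \<in> jdom X (C, \<phi>) (D, \<psi>)"
    using jet_point_chart[OF X] by metis
  then show "\<exists>U D \<psi>. openin (mtop (jet_mfd X 1)) U \<and> \<xi> \<in> U \<and> (D, \<psi>) \<in> max_atlas X \<and>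
      (\<forall>q\<in>U. jet_src q \<in> D) \<and> (\<forall>j\<in>idx X. smooth_on (jet_mfd X 1) U (\<lambda>q. \<psi> (jet_src q) j))"
    using jet_chart(2,3)[OF X c(1,2)] atlas_max_atlas[OF X c(1)]
    by (intro exI[of _ "jdom X (C, \<phi>) (D, \<psi>)"] exI[of _ C] exI[of _ \<phi>]) (auto simp: jdom_def)
qed

lemma smooth_jet_tgt: assumes X: "atlas_ok X" shows "smooth_map (jet_mfd X 1) X jet_tgt"
proof (rule smooth_mapI[OF atlas_ok_jet[OF X] X])
  fix \<xi> assume "\<xi> \<in> pts (jet_mfd X 1)"
  then have "\<xi> \<in> jets1 X" by (simp add: pts_jet_mfd[OF X])
  then obtain C \<phi> D \<psi> where c: "(C, \<phi>) \<in> atlas X" "(D, \<psi>) \<in> atlas X" "\<xi> \<in> jdom X (C, \<phi>) (D, \<psi>)"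
    using jet_point_chart[OF X] by metis
  then show "\<exists>U D \<psi>. openin (mtop (jet_mfd X 1)) U \<and> \<xi> \<in> U \<and> (D, \<psi>) \<in> max_atlas X \<and>
      (\<forall>q\<in>U. jet_tgt q \<in> D) \<and> (\<forall>j\<in>idx X. smooth_on (jet_mfd X 1) U (\<lambda>q. \<psi> (jet_tgt q) j))"
    using jet_chart(2,4)[OF X c(1,2)] atlas_max_atlas[OF X c(2)]
    by (intro exI[of _ "jdom X (C, \<phi>) (D, \<psi>)"] exI[of _ D] exI[of _ \<psi>]) (auto simp: jdom_def)
qed

text \<open>Boxes with rational corners in countably many charts form a base. For jets, the
  countable atlas will consist of the pairs from a countable subatlas of \<open>X\<close>.\<close>

lemma second_countable_atlas:
  assumes M: "atlas_ok M" and A: "countable A" "A \<subseteq> atlas M" "pts M \<subseteq> \<Union>(fst ` A)"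
  shows "second_countable (mtop M)"
proof -
  note fin = atlas_ok_finite[OF M]
  define R where "R = (\<Pi>\<^sub>E i\<in>idx M. (UNIV :: (rat \<times> rat) set))"
  define W :: "('b \<Rightarrow> rat \<times> rat) \<Rightarrow> ('b \<Rightarrow> real) set" where
    "W = (\<lambda>g. {w. \<forall>i\<in>idx M. of_rat (fst (g i)) < w i \<and> w i < of_rat (snd (g i))})"
  have "W g = (\<Inter>i\<in>idx M. {w. of_rat (fst (g i)) < w i} \<inter> {w. w i < of_rat (snd (g i))})" for g
    by (auto simp: W_def)
  moreover have "open ({w :: 'b \<Rightarrow> real. a < w i} \<inter> {w. w i < b})" for i a b
    by (intro open_Int open_Collect_less continuous_on_const continuous_on_product_coordinates)
  ultimately have Wo: "open (W g)" for g using fin by auto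
  define G where "G = (\<lambda>((C, \<phi>), g). {p \<in> C. \<phi> p \<in> W g}) ` (A \<times> R)"
  show ?thesis unfolding second_countable_def
  proof (intro exI[of _ G] conjI allI impI ballI)
    have "countable R" unfolding R_def by (rule countable_PiE[OF fin]) simp
    then show "countable G" using A(1) by (simp add: G_def)
    show "openin (mtop M) V" if "V \<in> G" for V
      using that A(2) Wo by (auto simp: G_def intro!: chart_openin)
    fix U p assume U: "openin (mtop M) U \<and> p \<in> U"
    then have "p \<in> \<Union>(fst ` A)" using openin_pts A(3) by blast
    then obtain C \<phi> where c: "(C, \<phi>) \<in> A" "p \<in> C" by auto
    have ca: "(C, \<phi>) \<in> atlas M" using c A(2) by auto
    have "copen (idx M) (\<phi> ` (C \<inter> U))" "\<phi> p \<in> \<phi> ` (C \<inter> U)"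
      using openin_mtop_image[OF M _ ca, of U] U c by auto
    then obtain e where e: "e > 0" "\<And>y. y \<in> coord_space (idx M) \<Longrightarrow>
        (\<And>i. i \<in> idx M \<Longrightarrow> \<bar>y i - \<phi> p i\<bar> < e) \<Longrightarrow> y \<in> \<phi> ` (C \<inter> U)" using copen_box[OF _ _ fin] by blast
    have "\<exists>a b. \<phi> p i - e < of_rat a \<and> of_rat a < \<phi> p i \<and> \<phi> p i < of_rat b \<and> of_rat b < \<phi> p i + e" for i
      using of_rat_dense[of "\<phi> p i - e" "\<phi> p i"] of_rat_dense[of "\<phi> p i" "\<phi> p i + e"] e(1) by auto
    then obtain a b where ab: "\<And>i. \<phi> p i - e < of_rat (a i)" "\<And>i. of_rat (a i) < \<phi> p i"
      "\<And>i. \<phi> p i < of_rat (b i)" "\<And>i. of_rat (b i) < \<phi> p i + e" by metis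
    define g where "g = restrict (\<lambda>i. (a i, b i)) (idx M)"
    have "g \<in> R" by (simp add: g_def R_def)
    moreover have "\<phi> p \<in> W g" using ab by (simp add: W_def g_def)
    moreover have "{q \<in> C. \<phi> q \<in> W g} \<subseteq> U"
    proof
      fix q assume q: "q \<in> {q \<in> C. \<phi> q \<in> W g}"
      have "\<bar>\<phi> q i - \<phi> p i\<bar> < e" if "i \<in> idx M" for i
      proof -
        have "of_rat (a i) < \<phi> q i" "\<phi> q i < of_rat (b i)" using q that by (auto simp: W_def g_def)
        then show ?thesis using ab(1)[of i] ab(4)[of i] by linarith
      qed
      then have "\<phi> q \<in> \<phi> ` (C \<inter> U)" using chartD(4)[OF M ca] q by (intro e(2)) auto
      then show "q \<in> U" using chartD(1)[OF M ca] q by (auto dest: inj_onD)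
    qed
    ultimately show "\<exists>V\<in>G. p \<in> V \<and> V \<subseteq> U"
      using c by (intro bexI[of _ "{q \<in> C. \<phi> q \<in> W g}"]) (auto simp: G_def intro!: image_eqI[of _ _ "((C, \<phi>), g)"])
  qed
qed

lemma countable_subatlas:
  assumes M: "manifold M"
  obtains A where "countable A" "A \<subseteq> atlas M" "pts M \<subseteq> \<Union>(fst ` A)"
proof -
  have ok: "atlas_ok M" using M by (rule manifold_atlas_ok)
  have "Lindelof_space (mtop M)" using M by (auto simp: manifold_def intro: second_countable_imp_Lindelof_space)
  moreover have "\<forall>U\<in>fst ` atlas M. openin (mtop M) U" using chart_open_domain[OF ok] by auto
  moreover have "\<Union>(fst ` atlas M) = topspace (mtop M)" by (simp add: topspace_mtop pts_def)
  ultimately obtain \<V> where \<V>: "countable \<V>" "\<V> \<subseteq> fst ` atlas M" "\<Union>\<V> = topspace (mtop M)"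
    unfolding Lindelof_space_def by metis
  obtain A where "countable A" "A \<subseteq> atlas M" "\<V> = fst ` A"
    using countable_subset_image[THEN iffD1, OF conjI[OF \<V>(1,2)]] by blast
  then show thesis using that \<V>(3) by (simp add: topspace_mtop)
qed

lemma manifold_jet:
  assumes mX: "manifold X" shows "manifold (jet_mfd X 1)"
proof -
  note X = manifold_atlas_ok[OF mX]
  note ok = atlas_ok_jet[OF X]
  have hX: "\<exists>U V. openin (mtop X) U \<and> openin (mtop X) V \<and> x \<in> U \<and> y \<in> V \<and> disjnt U V"
    if "x \<in> pts X" "y \<in> pts X" "x \<noteq> y" for x y
    using mX that unfolding manifold_def Hausdorff_space_def topspace_mtop by blast
  have sep: "\<exists>U V. openin (mtop (jet_mfd X 1)) U \<and> openin (mtop (jet_mfd X 1)) V \<and> \<xi> \<in> U \<and> \<eta> \<in> V \<and> disjnt U V"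
    if f: "smooth_map (jet_mfd X 1) X f" and m: "\<xi> \<in> pts (jet_mfd X 1)" "\<eta> \<in> pts (jet_mfd X 1)" "f \<xi> \<noteq> f \<eta>" for f \<xi> \<eta>
  proof -
    obtain U V where "openin (mtop X) U" "openin (mtop X) V" "f \<xi> \<in> U" "f \<eta> \<in> V" "disjnt U V"
      using hX[OF smooth_mapD(1)[OF f m(1)] smooth_mapD(1)[OF f m(2)] m(3)] by blast
    then show ?thesis
      using smooth_mapD(2)[OF f] m
      by (intro exI[of _ "{p \<in> pts (jet_mfd X 1). f p \<in> U}"] exI[of _ "{p \<in> pts (jet_mfd X 1). f p \<in> V}"])
        (auto simp: disjnt_iff)
  qed
  have "Hausdorff_space (mtop (jet_mfd X 1))"
    unfolding Hausdorff_space_def topspace_mtop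
  proof (intro allI impI, elim conjE)
    fix \<xi> \<eta> assume m: "\<xi> \<in> pts (jet_mfd X 1)" "\<eta> \<in> pts (jet_mfd X 1)" "\<xi> \<noteq> \<eta>"
    show "\<exists>U V. openin (mtop (jet_mfd X 1)) U \<and> openin (mtop (jet_mfd X 1)) V \<and> \<xi> \<in> U \<and> \<eta> \<in> V \<and> disjnt U V"
    \<comment> \<open>Jets with different sources or targets are separated by open sets pulled back
      from \<open>X\<close>; otherwise both lie in one chart and a coordinate separates
      them.\<close>
    proof (cases "jet_src \<xi> = jet_src \<eta> \<and> jet_tgt \<xi> = jet_tgt \<eta>")
      case False
      then show ?thesis using sep[OF smooth_jet_src[OF X] m(1,2)] sep[OF smooth_jet_tgt[OF X] m(1,2)] by blast
    next
      case True
      have J: "\<xi> \<in> jets1 X" "\<eta> \<in> jets1 X" using m by (auto simp: pts_jet_mfd[OF X])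
      obtain C \<phi> D \<psi> where c: "(C, \<phi>) \<in> atlas X" "(D, \<psi>) \<in> atlas X" "\<xi> \<in> jdom X (C, \<phi>) (D, \<psi>)"
        using jet_point_chart[OF X J(1)] by metis
      have e: "\<eta> \<in> jdom X (C, \<phi>) (D, \<psi>)" using c(3) True J by (simp add: jdom_def)
      let ?f = "jet_coord X 1 (C, \<phi>) (D, \<psi>)" and ?Q = "jdom X (C, \<phi>) (D, \<psi>)"
      have at: "(?Q, ?f) \<in> atlas (jet_mfd X 1)" unfolding jet_mfd_sel using c by blast
      have "?f \<xi> \<noteq> ?f \<eta>" using jet_coord_inj[OF X c(1,2)] c(3) e m(3) by (auto dest: inj_onD)
      then obtain k where "?f \<xi> k \<noteq> ?f \<eta> k" by auto
      then obtain U' V' where U': "open U'" "open V'" "?f \<xi> k \<in> U'" "?f \<eta> k \<in> V'" "U' \<inter> V' = {}"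
        using hausdorff[of "?f \<xi> k" "?f \<eta> k"] by blast
      define U V where "U = (\<lambda>w. w k) -` U'" and "V = (\<lambda>w. w k) -` V'"
      have UV: "open U" "open V" "?f \<xi> \<in> U" "?f \<eta> \<in> V" "U \<inter> V = {}"
        using U' open_vimage[OF _ continuous_on_product_coordinates] by (auto simp: U_def V_def)
      show ?thesis
        using chart_openin[OF at UV(1)] chart_openin[OF at UV(2)] c(3) e UV(3-5)
        by (intro exI[of _ "{p \<in> ?Q. ?f p \<in> U}"] exI[of _ "{p \<in> ?Q. ?f p \<in> V}"]) (auto simp: disjnt_iff)
    qed
  qed
  moreover have "second_countable (mtop (jet_mfd X 1))"
  proof -
    obtain A where A: "countable A" "A \<subseteq> atlas X" "pts X \<subseteq> \<Union>(fst ` A)" by (rule countable_subatlas[OF mX])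
    show ?thesis
    proof (rule second_countable_atlas[OF ok, of "(\<lambda>(c, d). (jdom X c d, jet_coord X 1 c d)) ` (A \<times> A)"])
      show "(\<lambda>(c, d). (jdom X c d, jet_coord X 1 c d)) ` (A \<times> A) \<subseteq> atlas (jet_mfd X 1)"
      proof (rule image_subsetI)
        fix z assume "z \<in> A \<times> A"
        then obtain c d where "c \<in> A" "d \<in> A" and z: "z = (c, d)" by (elim SigmaE)
        then have "c \<in> atlas X" "d \<in> atlas X" using A(2) by auto
        then show "(case z of (c, d) \<Rightarrow> (jdom X c d, jet_coord X 1 c d)) \<in> atlas (jet_mfd X 1)"
          unfolding jet_mfd_sel z case_prod_conv by blast
      qed
      show "pts (jet_mfd X 1) \<subseteq> \<Union> (fst ` (\<lambda>(c, d). (jdom X c d, jet_coord X 1 c d)) ` (A \<times> A))"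
      proof
        fix \<xi> assume "\<xi> \<in> pts (jet_mfd X 1)"
        then have \<xi>: "\<xi> \<in> jets1 X" by (simp add: pts_jet_mfd[OF X])
        obtain c where c: "c \<in> A" "jet_src \<xi> \<in> fst c" using jets1D(4)[OF X \<xi>] A(3) by auto
        obtain d where d: "d \<in> A" "jet_tgt \<xi> \<in> fst d" using jets1D(5)[OF X \<xi>] A(3) by auto
        have "\<xi> \<in> jdom X c d" using \<xi> c d by (simp add: jdom_def)
        then show "\<xi> \<in> \<Union> (fst ` (\<lambda>(c, d). (jdom X c d, jet_coord X 1 c d)) ` (A \<times> A))"
          using c(1) d(1) by force
      qed
    qed (use A(1) in simp)
  qed
  ultimately show ?thesis using ok by (simp add: manifold_def atlas_ok_def)
qed

section \<open>Smoothness of operations on jets\<close>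

lemma jet_mapD:
  assumes N: "atlas_ok N" and X: "atlas_ok X" and a: "smooth_map N (jet_mfd X 1) a"
  shows "q \<in> pts N \<Longrightarrow> a q \<in> jets1 X" "smooth_map N X (\<lambda>q. jet_src (a q))" "smooth_map N X (\<lambda>q. jet_tgt (a q))"
    "(C, \<phi>) \<in> atlas X \<Longrightarrow> (D, \<psi>) \<in> atlas X \<Longrightarrow> i \<in> idx X \<Longrightarrow> j \<in> idx X \<Longrightarrow>
      smooth_on N {q \<in> pts N. jet_src (a q) \<in> C \<and> jet_tgt (a q) \<in> D} (\<lambda>q. jd (C, \<phi>) (D, \<psi>) (a q) i j)"
proof -
  note ok = atlas_ok_jet[OF X]
  show J: "q \<in> pts N \<Longrightarrow> a q \<in> jets1 X" for q using smooth_mapD(1)[OF a] pts_jet_mfd[OF X] by simp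
  show "smooth_map N X (\<lambda>q. jet_src (a q))" by (rule smooth_map_compose[OF N ok X a smooth_jet_src[OF X]])
  show "smooth_map N X (\<lambda>q. jet_tgt (a q))" by (rule smooth_map_compose[OF N ok X a smooth_jet_tgt[OF X]])
  assume c: "(C, \<phi>) \<in> atlas X" "(D, \<psi>) \<in> atlas X" and ij: "i \<in> idx X" "j \<in> idx X"
  have "{q \<in> pts N. jet_src (a q) \<in> C \<and> jet_tgt (a q) \<in> D} = {q \<in> pts N. a q \<in> jdom X (C, \<phi>) (D, \<psi>)}"
    using J by (auto simp: jdom_def)
  then show "smooth_on N {q \<in> pts N. jet_src (a q) \<in> C \<and> jet_tgt (a q) \<in> D} (\<lambda>q. jd (C, \<phi>) (D, \<psi>) (a q) i j)"
    using smooth_on_pullback[OF N ok a jet_chart(5)[OF X c ij]] by simp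
qed

text \<open>Splits smoothness of a map into jets into that of source, target and derivatives; for
  products and inverses only the derivatives require an argument.\<close>

lemma jet_mapI:
  assumes N: "atlas_ok N" and X: "atlas_ok X" and a: "\<And>q. q \<in> pts N \<Longrightarrow> a q \<in> jets1 X"
    and s: "smooth_map N X (\<lambda>q. jet_src (a q))" and t: "smooth_map N X (\<lambda>q. jet_tgt (a q))"
    and *: "\<And>q C \<phi> D \<psi>. q \<in> pts N \<Longrightarrow> (C, \<phi>) \<in> atlas X \<Longrightarrow> jet_src (a q) \<in> C \<Longrightarrow> (D, \<psi>) \<in> atlas X \<Longrightarrow>
      jet_tgt (a q) \<in> D \<Longrightarrow> \<exists>U. openin (mtop N) U \<and> q \<in> U \<and>
      (\<forall>i\<in>idx X. \<forall>j\<in>idx X. smooth_on N U (\<lambda>q. jd (C, \<phi>) (D, \<psi>) (a q) i j))"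
  shows "smooth_map N (jet_mfd X 1) a"
proof (rule smooth_mapI[OF N atlas_ok_jet[OF X]])
  fix q assume q: "q \<in> pts N"
  obtain C \<phi> D \<psi> where c: "(C, \<phi>) \<in> atlas X" "jet_src (a q) \<in> C" and d: "(D, \<psi>) \<in> atlas X" "jet_tgt (a q) \<in> D"
    and "a q \<in> jdom X (C, \<phi>) (D, \<psi>)" by (rule jet_point_chart[OF X a[OF q]])
  obtain U where U: "openin (mtop N) U" "q \<in> U"
    "\<forall>i\<in>idx X. \<forall>j\<in>idx X. smooth_on N U (\<lambda>q. jd (C, \<phi>) (D, \<psi>) (a q) i j)" using *[OF q c d] by blast
  note sm = smooth_map_max_chart[OF N X s atlas_max_atlas[OF X c(1)]]
    and tm = smooth_map_max_chart[OF N X t atlas_max_atlas[OF X d(1)]]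
  define V where "V = U \<inter> {q \<in> pts N. jet_src (a q) \<in> C} \<inter> {q \<in> pts N. jet_tgt (a q) \<in> D}"
  have V: "openin (mtop N) V" unfolding V_def
    by (intro openin_Int U(1) smooth_on_openin[OF sm] smooth_on_openin[OF tm])
  have J: "a x \<in> jets1 X" "jet_src (a x) \<in> C" if "x \<in> V" for x using that a by (auto simp: V_def)
  note jc = jet_coord_simps[OF X J(1) c(1) J(2)]
  show "\<exists>U D \<psi>. openin (mtop N) U \<and> q \<in> U \<and> (D, \<psi>) \<in> max_atlas (jet_mfd X 1) \<and> (\<forall>q\<in>U. a q \<in> D) \<and>
      (\<forall>k\<in>idx (jet_mfd X 1). smooth_on N U (\<lambda>q. \<psi> (a q) k))"
  proof (intro exI conjI ballI)
    show "openin (mtop N) V" by (rule V)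
    show "q \<in> V" using U q c d by (simp add: V_def)
    show "(jdom X (C, \<phi>) (D, \<psi>), jet_coord X 1 (C, \<phi>) (D, \<psi>)) \<in> max_atlas (jet_mfd X 1)"
      by (rule jet_chart(1)[OF X c(1) d(1)])
    show "a x \<in> jdom X (C, \<phi>) (D, \<psi>)" if "x \<in> V" for x using that a by (auto simp: V_def jdom_def)
    fix k assume "k \<in> idx (jet_mfd X 1)"
    then show "smooth_on N V (\<lambda>q. jet_coord X 1 (C, \<phi>) (D, \<psi>) (a q) k)"
    proof (cases rule: jet_mfd_idx_cases)
      case (1 i)
      have "smooth_on N V (\<lambda>q. \<phi> (jet_src (a q)) i)" by (rule smooth_on_subset[OF sm V]) (auto simp: V_def)
      then show ?thesis by (rule smooth_on_cong[OF N]) (simp add: 1 jc(1))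
    next
      case (2 j)
      have "smooth_on N V (\<lambda>q. \<psi> (jet_tgt (a q)) j)" by (rule smooth_on_subset[OF tm V]) (auto simp: V_def)
      then show ?thesis by (rule smooth_on_cong[OF N]) (simp add: 2 jc(2))
    next
      case (3 i j)
      have "smooth_on N V (\<lambda>q. jd (C, \<phi>) (D, \<psi>) (a q) i j)"
        by (rule smooth_on_subset[OF _ V]) (use U(3) 3 in \<open>auto simp: V_def\<close>)
      then show ?thesis by (rule smooth_on_cong[OF N]) (simp add: 3 jc(4))
    qed
  qed
qed

lemma jet_mult_facts:
  assumes X: "atlas_ok X" and \<eta>: "\<eta> \<in> jets1 X" and \<xi>: "\<xi> \<in> jets1 X" and st: "jet_src \<eta> = jet_tgt \<xi>"
  shows jet_mult_in: "jet_mult X 1 \<eta> \<xi> \<in> jets1 X"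
    and jet_mult_src: "jet_src (jet_mult X 1 \<eta> \<xi>) = jet_src \<xi>"
    and jet_mult_tgt: "jet_tgt (jet_mult X 1 \<eta> \<xi>) = jet_tgt \<eta>"
    and jet_mult_jd: "(C, \<phi>) \<in> atlas X \<Longrightarrow> jet_src \<xi> \<in> C \<Longrightarrow> (D, \<psi>) \<in> atlas X \<Longrightarrow> jet_tgt \<xi> \<in> D \<Longrightarrow>
      (E, \<rho>) \<in> atlas X \<Longrightarrow> jet_tgt \<eta> \<in> E \<Longrightarrow> i \<in> idx X \<Longrightarrow> l \<in> idx X \<Longrightarrow>
      jd (C, \<phi>) (E, \<rho>) (jet_mult X 1 \<eta> \<xi>) i l = (\<Sum>j\<in>idx X. jd (D, \<psi>) (E, \<rho>) \<eta> j l * jd (C, \<phi>) (D, \<psi>) \<xi> i j)"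
proof -
  note x = jets1D[OF X \<xi>] and e = jets1D[OF X \<eta>]
  let ?h = "jet_rep \<eta> \<circ>\<^sub>m jet_rep \<xi>"
  have h: "?h \<in> local_smooth_maps X" by (rule local_smooth_compose[OF X x(1) e(1)])
  have y: "the (jet_rep \<xi> (jet_src \<xi>)) \<in> dom (jet_rep \<eta>)" using e(2) st x(6) by simp
  have xd: "jet_src \<xi> \<in> dom ?h" and val: "the (?h (jet_src \<xi>)) = the (jet_rep \<eta> (jet_tgt \<xi>))"
    using x(2,6) y by (auto simp: map_comp_def)
  show "jet_mult X 1 \<eta> \<xi> \<in> jets1 X" "jet_src (jet_mult X 1 \<eta> \<xi>) = jet_src \<xi>"
    unfolding jet_mult_def using jet_facts[OF X h xd] by auto
  show "jet_tgt (jet_mult X 1 \<eta> \<xi>) = jet_tgt \<eta>"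
    unfolding jet_mult_def jet_tgt[OF X h xd] val e(6) st ..
  assume c: "(C, \<phi>) \<in> atlas X" "jet_src \<xi> \<in> C" and d: "(D, \<psi>) \<in> atlas X" "jet_tgt \<xi> \<in> D"
    and E: "(E, \<rho>) \<in> atlas X" "jet_tgt \<eta> \<in> E" and il: "i \<in> idx X" "l \<in> idx X"
  have E': "the (jet_rep \<eta> (the (jet_rep \<xi> (jet_src \<xi>)))) \<in> E" using E(2) e(6) st x(6) by simp
  have "jd (C, \<phi>) (E, \<rho>) (jet_mult X 1 \<eta> \<xi>) i l = jder (C, \<phi>) (E, \<rho>) ?h (jet_src \<xi>) i l"
    unfolding jet_mult_def by (rule jd_jet[OF X h xd c(1) _ E(1) _ il]) (use c E E' val x(6) in auto)
  also have "\<dots> = (\<Sum>j\<in>idx X. jder (D, \<psi>) (E, \<rho>) (jet_rep \<eta>) (the (jet_rep \<xi> (jet_src \<xi>))) j l *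
      jder (C, \<phi>) (D, \<psi>) (jet_rep \<xi>) (jet_src \<xi>) i j)"
    by (rule jder_compose[OF X x(1,2) e(1) y c d(1) _ E(1) E' il(1)]) (use d x(6) in simp)
  finally show "jd (C, \<phi>) (E, \<rho>) (jet_mult X 1 \<eta> \<xi>) i l =
      (\<Sum>j\<in>idx X. jd (D, \<psi>) (E, \<rho>) \<eta> j l * jd (C, \<phi>) (D, \<psi>) \<xi> i j)"
    using st x(6) by (simp add: jd_def)
qed

text \<open>\<open>jet_mult\<close> composes arbitrarily chosen representatives. By the chain rule
  the Jacobian of the composite depends on the two Jacobians only, so any convenient representatives
  give the same product.\<close>

lemma jet_mult_jet:
  assumes X: "atlas_ok X" and f: "f \<in> local_smooth_maps X" "x \<in> dom f"
    and g: "g \<in> local_smooth_maps X" "the (f x) \<in> dom g"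
  shows "jet_mult X 1 (jet X 1 (the (f x)) g) (jet X 1 x f) = jet X 1 x (g \<circ>\<^sub>m f)"
proof -
  note jf = jet_facts[OF X f] and jg = jet_facts[OF X g]
  have h: "g \<circ>\<^sub>m f \<in> local_smooth_maps X" by (rule local_smooth_compose[OF X f(1) g(1)])
  have xd: "x \<in> dom (g \<circ>\<^sub>m f)" and val: "the ((g \<circ>\<^sub>m f) x) = the (g (the (f x)))"
    using f g by (auto simp: map_comp_def)
  note jh = jet_facts[OF X h xd]
  have st: "jet_src (jet X 1 (the (f x)) g) = jet_tgt (jet X 1 x f)" using jf jg by simp
  note jm = jet_mult_facts[OF X jg(6) jf(6) st]
  have p: "x \<in> pts X" "the (f x) \<in> pts X" "the (g (the (f x))) \<in> pts X"
    using local_smoothD(2,3)[OF X f(1) f(2)] local_smoothD(3)[OF X g(1) g(2)] by auto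
  obtain C \<phi> where c: "(C, \<phi>) \<in> atlas X" "x \<in> C" using p(1) by (rule pts_chart)
  obtain D \<psi> where d: "(D, \<psi>) \<in> atlas X" "the (f x) \<in> D" using p(2) by (rule pts_chart)
  obtain E \<rho> where e: "(E, \<rho>) \<in> atlas X" "the (g (the (f x))) \<in> E" using p(3) by (rule pts_chart)
  show ?thesis
  proof (rule jets1_eqI[OF X jm(1) jh(6) _ _ c(1) _ e(1)])
    fix i l assume il: "i \<in> idx X" "l \<in> idx X"
    have "jd (C, \<phi>) (E, \<rho>) (jet_mult X 1 (jet X 1 (the (f x)) g) (jet X 1 x f)) i l =
      (\<Sum>j\<in>idx X. jd (D, \<psi>) (E, \<rho>) (jet X 1 (the (f x)) g) j l * jd (C, \<phi>) (D, \<psi>) (jet X 1 x f) i j)"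
      by (rule jm(4)[OF c(1) _ d(1) _ e(1) _ il]) (use jf jg c d e in auto)
    also have "\<dots> = (\<Sum>j\<in>idx X. jder (D, \<psi>) (E, \<rho>) g (the (f x)) j l * jder (C, \<phi>) (D, \<psi>) f x i j)"
      using jd_jet[OF X g d(1) _ e(1)] jd_jet[OF X f c(1) _ d(1)] c d e il by (intro sum.cong) auto
    also have "\<dots> = jder (C, \<phi>) (E, \<rho>) (g \<circ>\<^sub>m f) x i l"
      by (rule jder_compose[OF X f g c d e il(1), symmetric])
    also have "\<dots> = jd (C, \<phi>) (E, \<rho>) (jet X 1 x (g \<circ>\<^sub>m f)) i l"
      by (rule jd_jet[OF X h xd c(1) _ e(1) _ il, symmetric]) (use c e val in auto)
    finally show "jd (C, \<phi>) (E, \<rho>) (jet_mult X 1 (jet X 1 (the (f x)) g) (jet X 1 x f)) i l =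
      jd (C, \<phi>) (E, \<rho>) (jet X 1 x (g \<circ>\<^sub>m f)) i l" .
  qed (use jm jf jg jh c e val in auto)
qed

lemma map_comp_assoc: "h \<circ>\<^sub>m (g \<circ>\<^sub>m f) = (h \<circ>\<^sub>m g) \<circ>\<^sub>m f"
  by (auto simp: map_comp_def split: option.splits)

text \<open>Associativity of partial composition carries over once \<open>jet_mult_jet\<close>
  allows composites to represent the inner products.\<close>

lemma jet_mult_assoc:
  assumes X: "atlas_ok X" and J: "\<zeta> \<in> jets1 X" "\<eta> \<in> jets1 X" "\<xi> \<in> jets1 X"
    and st: "jet_src \<zeta> = jet_tgt \<eta>" "jet_src \<eta> = jet_tgt \<xi>"
  shows "jet_mult X 1 \<zeta> (jet_mult X 1 \<eta> \<xi>) = jet_mult X 1 (jet_mult X 1 \<zeta> \<eta>) \<xi>"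
proof -
  note z = jets1D[OF X J(1)] and e = jets1D[OF X J(2)] and x = jets1D[OF X J(3)]
  let ?f = "jet_rep \<xi>" and ?g = "jet_rep \<eta>" and ?h = "jet_rep \<zeta>" and ?x = "jet_src \<xi>"
  have gf: "?g \<circ>\<^sub>m ?f \<in> local_smooth_maps X" "?x \<in> dom (?g \<circ>\<^sub>m ?f)" "the ((?g \<circ>\<^sub>m ?f) ?x) = jet_tgt \<eta>"
    using local_smooth_compose[OF X x(1) e(1)] x(2,6) e(2,6) st by (auto simp: map_comp_def)
  have hg: "?h \<circ>\<^sub>m ?g \<in> local_smooth_maps X" "jet_src \<eta> \<in> dom (?h \<circ>\<^sub>m ?g)"
    using local_smooth_compose[OF X e(1) z(1)] e(2,6) z(2) st by (auto simp: map_comp_def)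
  have "jet_mult X 1 \<eta> \<xi> = jet X 1 ?x (?g \<circ>\<^sub>m ?f)" "jet_mult X 1 \<zeta> \<eta> = jet X 1 (jet_src \<eta>) (?h \<circ>\<^sub>m ?g)"
    by (simp_all add: jet_mult_def)
  moreover have "jet_mult X 1 (jet X 1 (the ((?g \<circ>\<^sub>m ?f) ?x)) ?h) (jet X 1 ?x (?g \<circ>\<^sub>m ?f)) = jet X 1 ?x (?h \<circ>\<^sub>m (?g \<circ>\<^sub>m ?f))"
    by (rule jet_mult_jet[OF X gf(1,2) z(1)]) (use gf(3) st z(2) in simp)
  moreover have "jet_mult X 1 (jet X 1 (the (?f ?x)) (?h \<circ>\<^sub>m ?g)) (jet X 1 ?x ?f) = jet X 1 ?x ((?h \<circ>\<^sub>m ?g) \<circ>\<^sub>m ?f)"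
    by (rule jet_mult_jet[OF X x(1,2) hg(1)]) (use hg(2) st x(6) in simp)
  ultimately show ?thesis using gf(3) st x(3,6) z(3) by (simp add: map_comp_assoc)
qed

lemma dpart_cong:
  assumes X: "atlas_ok X" and c: "(C, \<phi>) \<in> max_atlas X" "x \<in> C" and i: "i \<in> idx X"
    and h: "smooth_on X U h" "x \<in> U" and eq: "\<And>q. q \<in> U \<Longrightarrow> h q = k q"
  shows "dpart (C, \<phi>) i k x = dpart (C, \<phi>) i h x"
proof -
  have k: "smooth_on X U k" by (rule smooth_on_cong[OF X h(1) eq])
  have "\<forall>\<^sub>F t in nhds 0. coord_curve (C, \<phi>) i x t \<in> U"
    by (rule curveD(3)[OF coord_curve[OF X c i] smooth_on_openin[OF h(1)] h(2)])
  then have "\<forall>\<^sub>F t in nhds 0. h (coord_curve (C, \<phi>) i x t) = k (coord_curve (C, \<phi>) i x t)"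
    by eventually_elim (rule eq)
  from DERIV_cong_ev[OF refl this refl, THEN iffD1, OF coord_curve_deriv[OF X c i h]]
  show ?thesis using coord_curve_deriv[OF X c i k h(2)] DERIV_unique by blast
qed

lemma jet_cong_open:
  assumes X: "atlas_ok X" and f: "f \<in> local_smooth_maps X" and g: "g \<in> local_smooth_maps X"
    and U: "openin (mtop X) U" "x \<in> U" "U \<subseteq> dom f" and eq: "\<And>q. q \<in> U \<Longrightarrow> f q = g q"
  shows "jet X 1 x f = jet X 1 x g"
proof (rule jet_eqI[OF X])
  have x: "x \<in> dom f" using U by auto
  obtain C \<phi> where c: "(C, \<phi>) \<in> atlas X" "x \<in> C" using U(1,2) by (rule openin_chart)
  obtain D \<psi> where d: "(D, \<psi>) \<in> atlas X" "the (f x) \<in> D" using local_smoothD(3)[OF X f x] by (rule pts_chart)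
  show "same_jet X 1 x f g"
  proof (rule same_jetI[OF X f x g eq[OF U(2)] c d])
    fix i j assume i: "i \<in> idx X"
    define V where "V = U \<inter> {q \<in> dom f. the (f q) \<in> D}"
    note sm = local_smoothD(5)[OF X f max_chartD(6)[OF X atlas_max_atlas[OF X d(1)]]]
    have V: "openin (mtop X) V" unfolding V_def by (intro openin_Int U(1) smooth_on_openin[OF sm])
    have "smooth_on X V (\<lambda>q. \<psi> (the (f q)) j)" by (rule smooth_on_subset[OF sm V]) (auto simp: V_def)
    then show "jder (C, \<phi>) (D, \<psi>) f x i j = jder (C, \<phi>) (D, \<psi>) g x i j"
      unfolding jder_def snd_conv
      by (rule dpart_cong[OF X atlas_max_atlas[OF X c(1)] c(2) i, symmetric]) (use U x d eq in \<open>auto simp: V_def\<close>)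
  qed
qed

definition jet_unit :: "('a, 'i) mfd \<Rightarrow> 'a \<Rightarrow> 'a jet" where
  "jet_unit X x = jet X 1 x (partial_id X)"

lemma partial_id_eq: "partial_id X = (\<lambda>x. if x \<in> pts X then Some x else None)"
  by (auto simp: partial_id_def restrict_map_def)

lemma partial_id_smooth: "atlas_ok X \<Longrightarrow> partial_id X \<in> local_smooth_maps X"
  unfolding partial_id_eq by (rule local_smooth_of_map[OF _ smooth_map_ident])

lemma jet_unit_facts:
  assumes X: "atlas_ok X" and x: "x \<in> pts X"
  shows "jet_unit X x \<in> jets1 X" "jet_src (jet_unit X x) = x" "jet_tgt (jet_unit X x) = x"
proof -
  have "x \<in> dom (partial_id X)" using x by (simp add: partial_id_eq dom_def)
  from jet_facts[OF X partial_id_smooth[OF X] this]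
  show "jet_unit X x \<in> jets1 X" "jet_src (jet_unit X x) = x" "jet_tgt (jet_unit X x) = x"
    using x by (auto simp: jet_unit_def partial_id_eq)
qed

lemma jet_mult_unit:
  assumes X: "atlas_ok X" and \<xi>: "\<xi> \<in> jets1 X"
  shows "jet_mult X 1 \<xi> (jet_unit X (jet_src \<xi>)) = \<xi>" "jet_mult X 1 (jet_unit X (jet_tgt \<xi>)) \<xi> = \<xi>"
proof -
  note x = jets1D[OF X \<xi>]
  let ?f = "jet_rep \<xi>"
  have "(?f \<circ>\<^sub>m partial_id X) y = ?f y" for y
    using local_smoothD(2)[OF X x(1), of y] by (cases "y \<in> pts X"; cases "?f y") (auto simp: partial_id_eq)
  moreover have "(partial_id X \<circ>\<^sub>m ?f) y = ?f y" for y
    using local_smoothD(3)[OF X x(1), of y] by (cases "?f y") (auto simp: partial_id_eq domIff)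
  ultimately have "?f \<circ>\<^sub>m partial_id X = ?f" "partial_id X \<circ>\<^sub>m ?f = ?f" by (auto simp: fun_eq_iff)
  moreover have "the (partial_id X (jet_src \<xi>)) = jet_src \<xi>" "jet_src \<xi> \<in> dom (partial_id X)"
      "the (?f (jet_src \<xi>)) \<in> dom (partial_id X)"
    using x(4,5,6) by (auto simp: partial_id_eq dom_def)
  ultimately show "jet_mult X 1 \<xi> (jet_unit X (jet_src \<xi>)) = \<xi>" "jet_mult X 1 (jet_unit X (jet_tgt \<xi>)) \<xi> = \<xi>"
    using jet_mult_jet[OF X partial_id_smooth[OF X], of "jet_src \<xi>" ?f] x
      jet_mult_jet[OF X x(1,2) partial_id_smooth[OF X]] by (simp_all add: jet_unit_def)
qed

lemma jd_unit:
  assumes X: "atlas_ok X" and c: "(C, \<phi>) \<in> atlas X" "x \<in> C" and il: "i \<in> idx X" "l \<in> idx X"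
  shows "jd (C, \<phi>) (C, \<phi>) (jet_unit X x) i l = (if i = l then 1 else 0)"
proof -
  note cm = atlas_max_atlas[OF X c(1)]
  have x: "x \<in> pts X" using c max_chartD(3)[OF X cm] by auto
  have "jd (C, \<phi>) (C, \<phi>) (jet_unit X x) i l = jder (C, \<phi>) (C, \<phi>) (partial_id X) x i l"
    unfolding jet_unit_def
    by (rule jd_jet[OF X partial_id_smooth[OF X] _ c(1) _ c(1) _ il]) (use c x in \<open>auto simp: partial_id_eq\<close>)
  also have "\<dots> = dpart (C, \<phi>) i (\<lambda>q. \<phi> q l) x"
    unfolding jder_def snd_conv
    by (rule dpart_cong[OF X cm c(2) il(1) max_chartD(6)[OF X cm] c(2)])
      (use max_chartD(3)[OF X cm] in \<open>auto simp: partial_id_eq\<close>)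
  also have "\<dots> = (if l = i then 1 else 0)"
    using DERIV_unique[OF coord_curve_deriv[OF X cm c(2) il(1) max_chartD(6)[OF X cm] c(2)] coord_curve_coord[OF X cm c(2) il(1)]] .
  finally show ?thesis by auto
qed

text \<open>Formulated for families over a parameter manifold \<open>N\<close> rather than on
  composable pairs, so that it applies before those pairs are known to form a submanifold.\<close>

lemma smooth_jet_mult:
  assumes N: "atlas_ok N" and X: "atlas_ok X" and b: "smooth_map N (jet_mfd X 1) b" and a: "smooth_map N (jet_mfd X 1) a"
    and st: "\<And>q. q \<in> pts N \<Longrightarrow> jet_src (b q) = jet_tgt (a q)"
  shows "smooth_map N (jet_mfd X 1) (\<lambda>q. jet_mult X 1 (b q) (a q))"
proof -
  note aD = jet_mapD[OF N X a] and bD = jet_mapD[OF N X b]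
  have jm: "jet_mult X 1 (b q) (a q) \<in> jets1 X" "jet_src (jet_mult X 1 (b q) (a q)) = jet_src (a q)"
    "jet_tgt (jet_mult X 1 (b q) (a q)) = jet_tgt (b q)" if "q \<in> pts N" for q
    using jet_mult_facts[OF X bD(1)[OF that] aD(1)[OF that] st[OF that]] by auto
  show ?thesis
  proof (rule jet_mapI[OF N X jm(1)])
    show "smooth_map N X (\<lambda>q. jet_src (jet_mult X 1 (b q) (a q)))"
      by (rule smooth_map_cong[OF N X aD(2)]) (simp add: jm)
    show "smooth_map N X (\<lambda>q. jet_tgt (jet_mult X 1 (b q) (a q)))"
      by (rule smooth_map_cong[OF N X bD(3)]) (simp add: jm)
    fix q C \<phi> E \<rho>
    assume q: "q \<in> pts N" and c: "(C, \<phi>) \<in> atlas X" "jet_src (jet_mult X 1 (b q) (a q)) \<in> C"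
      and e: "(E, \<rho>) \<in> atlas X" "jet_tgt (jet_mult X 1 (b q) (a q)) \<in> E"
    \<comment> \<open>The intermediate chart, through which the product of the two Jacobians
      passes.\<close>
    obtain D \<psi> where d: "(D, \<psi>) \<in> atlas X" "jet_tgt (a q) \<in> D" using jets1D(5)[OF X aD(1)[OF q]] by (rule pts_chart)
    define U where "U = {q \<in> pts N. jet_src (a q) \<in> C \<and> jet_tgt (a q) \<in> D} \<inter> {q \<in> pts N. jet_src (b q) \<in> D \<and> jet_tgt (b q) \<in> E}"
    have "openin (mtop N) {q \<in> pts N. jet_src (a q) \<in> C \<and> jet_tgt (a q) \<in> D}"
      using openin_Int[OF smooth_mapD(2)[OF aD(2) chart_open_domain[OF X c(1)]] smooth_mapD(2)[OF aD(3) chart_open_domain[OF X d(1)]]]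
      by (simp add: Int_def conj_ac cong: conj_cong)
    moreover have "openin (mtop N) {q \<in> pts N. jet_src (b q) \<in> D \<and> jet_tgt (b q) \<in> E}"
      using openin_Int[OF smooth_mapD(2)[OF bD(2) chart_open_domain[OF X d(1)]] smooth_mapD(2)[OF bD(3) chart_open_domain[OF X e(1)]]]
      by (simp add: Int_def conj_ac cong: conj_cong)
    ultimately have U: "openin (mtop N) U" unfolding U_def by (rule openin_Int)
    have "smooth_on N U (\<lambda>q. jd (C, \<phi>) (E, \<rho>) (jet_mult X 1 (b q) (a q)) i l)"
      if il: "i \<in> idx X" "l \<in> idx X" for i l
    proof (rule smooth_on_cong[OF N])
      show "smooth_on N U (\<lambda>q. \<Sum>j\<in>idx X. jd (D, \<psi>) (E, \<rho>) (b q) j l * jd (C, \<phi>) (D, \<psi>) (a q) i j)"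
        by (intro smooth_on_sum[OF N U] smooth_on_mult[OF N] smooth_on_subset[OF aD(4)[OF c(1) d(1)] U]
            smooth_on_subset[OF bD(4)[OF d(1) e(1)] U] il) (auto simp: U_def)
      show "(\<Sum>j\<in>idx X. jd (D, \<psi>) (E, \<rho>) (b x) j l * jd (C, \<phi>) (D, \<psi>) (a x) i j) =
          jd (C, \<phi>) (E, \<rho>) (jet_mult X 1 (b x) (a x)) i l" if "x \<in> U" for x
        by (rule jet_mult_jd[OF X bD(1) aD(1) st c(1) _ d(1) _ e(1) _ il, symmetric])
          (use that in \<open>auto simp: U_def\<close>)
    qed
    moreover have "q \<in> U" using q c e d jm st by (simp add: U_def)
    ultimately show "\<exists>U. openin (mtop N) U \<and> q \<in> U \<and>
        (\<forall>i\<in>idx X. \<forall>j\<in>idx X. smooth_on N U (\<lambda>q. jd (C, \<phi>) (E, \<rho>) (jet_mult X 1 (b q) (a q)) i j))"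
      using U by blast
  qed
qed

text \<open>Cramer's rule: entries of the inverse are quotients of determinants formed from
  \<open>P\<close> alone, with a denominator that never vanishes, hence smooth wherever the entries
  of \<open>P\<close> are.\<close>

lemma inverse_entry:
  fixes P Q :: "'n::finite \<Rightarrow> 'n \<Rightarrow> real"
  assumes PQ: "\<And>i l. (\<Sum>j\<in>UNIV. P i j * Q j l) = (if i = l then 1 else 0)"
  shows "det (\<chi> i j. P i j) \<noteq> 0"
    "Q k l = det (\<chi> i j. if j = k then (if i = l then 1 else 0) else P i j) * inverse (det (\<chi> i j. P i j))"
proof -
  have "(\<chi> i j. P i j) ** (\<chi> i j. Q i j) = mat 1"
    using PQ by (simp add: matrix_matrix_mult_def mat_def vec_eq_iff)
  then have "det (\<chi> i j. P i j) * det (\<chi> i j. Q i j) = 1" by (metis det_I det_mul)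
  then show nz: "det (\<chi> i j. P i j) \<noteq> 0" by auto
  have "(\<chi> i j. P i j) *v (\<chi> j. Q j l) = (\<chi> i. if i = l then 1 else 0)"
    using PQ by (simp add: matrix_vector_mult_def vec_eq_iff)
  then have "(\<chi> j. Q j l) = (\<chi> k. det (\<chi> i j. if j = k then (\<chi> i. if i = l then 1 else 0) $ i else (\<chi> i j. P i j) $ i $ j) / det (\<chi> i j. P i j))"
    by (rule cramer[OF nz, THEN iffD1])
  moreover have "(\<chi> i j. if j = k then (\<chi> i. if i = l then 1 else 0) $ i else (\<chi> i j. P i j) $ i $ j) =
      (\<chi> i j. if j = k then (if i = l then 1 else 0) else P i j)" for k
    by (simp add: vec_eq_iff)
  ultimately have "(\<chi> j. Q j l) = (\<chi> k. det (\<chi> i j. if j = k then (if i = l then 1 else 0) else P i j) / det (\<chi> i j. P i j))"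
    by (simp only:)
  from arg_cong[OF this, of "\<lambda>v. v $ k"]
  show "Q k l = det (\<chi> i j. if j = k then (if i = l then 1 else 0) else P i j) * inverse (det (\<chi> i j. P i j))"
    by (simp add: divide_inverse)
qed

lemma smooth_on_det:
  fixes P :: "'a \<Rightarrow> 'n::finite \<Rightarrow> 'n \<Rightarrow> real"
  assumes N: "atlas_ok N" and U: "openin (mtop N) U" and P: "\<And>i j. smooth_on N U (\<lambda>q. P q i j)"
  shows "smooth_on N U (\<lambda>q. det (\<chi> i j. P q i j))"
  unfolding det_def by (simp, intro smooth_on_sum[OF N U] smooth_on_mult[OF N] smooth_on_const[OF N U] smooth_on_prod[OF N U] P)

text \<open>Nothing is known about smoothness of \<open>b\<close> in advance; the equation for the
  product identifies the Jacobian of \<open>b q\<close> as the inverse matrix of that of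
  \<open>a q\<close>.\<close>

lemma smooth_jet_inverse:
  fixes X :: "('a, 'i::finite) mfd"
  assumes N: "atlas_ok N" and X: "atlas_ok X" and a: "smooth_map N (jet_mfd X 1) a"
    and b: "\<And>q. q \<in> pts N \<Longrightarrow> b q \<in> jets1 X \<and> jet_src (b q) = jet_tgt (a q) \<and> jet_tgt (b q) = jet_src (a q) \<and>
      jet_mult X 1 (b q) (a q) = jet_unit X (jet_src (a q))"
  shows "smooth_map N (jet_mfd X 1) b"
proof -
  note aD = jet_mapD[OF N X a]
  show ?thesis
  proof (rule jet_mapI[OF N X])
    show "b q \<in> jets1 X" if "q \<in> pts N" for q using b[OF that] by simp
    show "smooth_map N X (\<lambda>q. jet_src (b q))" by (rule smooth_map_cong[OF N X aD(3)]) (simp add: b)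
    show "smooth_map N X (\<lambda>q. jet_tgt (b q))" by (rule smooth_map_cong[OF N X aD(2)]) (simp add: b)
    fix q D \<psi> C \<phi>
    assume q: "q \<in> pts N" and d: "(D, \<psi>) \<in> atlas X" "jet_src (b q) \<in> D"
      and c: "(C, \<phi>) \<in> atlas X" "jet_tgt (b q) \<in> C"
    define U where "U = {q \<in> pts N. jet_src (a q) \<in> C \<and> jet_tgt (a q) \<in> D}"
    have U: "openin (mtop N) U"
      using openin_Int[OF smooth_mapD(2)[OF aD(2) chart_open_domain[OF X c(1)]] smooth_mapD(2)[OF aD(3) chart_open_domain[OF X d(1)]]]
      by (simp add: U_def Int_def conj_ac cong: conj_cong)
    \<comment> \<open>The set \<open>idx X\<close> may be smaller than its type. An identity block
      on the remaining indices gives square matrices over the whole finite type, to which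
      determinants apply, and leaves the inverse on \<open>idx X\<close> unaffected.\<close>
    define P where "P = (\<lambda>q i j. if i \<in> idx X \<and> j \<in> idx X then jd (C, \<phi>) (D, \<psi>) (a q) i j else if i = j then 1 else 0)"
    define Q where "Q = (\<lambda>q i j. if i \<in> idx X \<and> j \<in> idx X then jd (D, \<psi>) (C, \<phi>) (b q) i j else if i = j then 1 else 0)"
    have PQ: "(\<Sum>j\<in>UNIV. P x i j * Q x j l) = (if i = l then 1 else 0)" if x: "x \<in> U" for x i l
    proof (cases "i \<in> idx X")
      case i: True
      have "(\<Sum>j\<in>UNIV. P x i j * Q x j l) = (\<Sum>j\<in>idx X. P x i j * Q x j l)"
        by (rule sum.mono_neutral_right) (use i in \<open>auto simp: P_def\<close>)
      also have "\<dots> = (if i = l then 1 else 0)"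
      proof (cases "l \<in> idx X")
        case l: True
        have xN: "x \<in> pts N" using x by (simp add: U_def)
        have "(\<Sum>j\<in>idx X. P x i j * Q x j l) = (\<Sum>j\<in>idx X. jd (D, \<psi>) (C, \<phi>) (b x) j l * jd (C, \<phi>) (D, \<psi>) (a x) i j)"
          using i l by (intro sum.cong) (auto simp: P_def Q_def)
        also have "\<dots> = jd (C, \<phi>) (C, \<phi>) (jet_mult X 1 (b x) (a x)) i l"
          by (rule jet_mult_jd[OF X _ aD(1)[OF xN] _ c(1) _ d(1) _ c(1) _ i l, symmetric])
            (use b[OF xN] x in \<open>auto simp: U_def\<close>)
        also have "\<dots> = (if i = l then 1 else 0)"
          using b[OF xN] jd_unit[OF X c(1) _ i l] x by (simp add: U_def)
        finally show ?thesis .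
      next
        case False
        then show ?thesis using i by (auto simp: Q_def intro!: sum.neutral)
      qed
      finally show ?thesis .
    next
      case False
      then have "(\<Sum>j\<in>UNIV. P x i j * Q x j l) = (\<Sum>j\<in>UNIV. if j = i then Q x j l else 0)"
        by (intro sum.cong) (auto simp: P_def)
      then show ?thesis using False by (simp add: Q_def)
    qed
    have Ps: "smooth_on N U (\<lambda>q. P q i j)" for i j
    proof (cases "i \<in> idx X \<and> j \<in> idx X")
      case True
      then show ?thesis using aD(4)[OF c(1) d(1), of i j] by (simp add: P_def U_def)
    next
      case False
      then have "(\<lambda>q. P q i j) = (\<lambda>q. if i = j then 1 else 0)" by (auto simp: P_def)
      then show ?thesis using smooth_on_const[OF N U, of "if i = j then 1 else 0"] by (simp only:)
    qed
    have Ps': "smooth_on N U (\<lambda>q. if j = k then (if i = l then 1 else 0) else P q i j)" for i j k l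
      using Ps smooth_on_const[OF N U] by (cases "j = k") auto
    have "smooth_on N U (\<lambda>q. det (\<chi> i j. if j = k then (if i = l then 1 else 0) else P q i j) *
        inverse (det (\<chi> i j. P q i j)))" for k l
      by (intro smooth_on_mult[OF N] smooth_on_inverse[OF N] smooth_on_det[OF N U] Ps Ps' inverse_entry(1)[OF PQ])
    then have Qs: "smooth_on N U (\<lambda>q. Q q k l)" for k l
      by (rule smooth_on_cong[OF N]) (rule inverse_entry(2)[OF PQ, symmetric])
    have "smooth_on N U (\<lambda>q. jd (D, \<psi>) (C, \<phi>) (b q) k l)" if "k \<in> idx X" "l \<in> idx X" for k l
      using Qs[of k l] that by (simp add: Q_def)
    moreover have "q \<in> U" using q c d b[OF q] by (simp add: U_def)
    ultimately show "\<exists>U. openin (mtop N) U \<and> q \<in> U \<and>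
        (\<forall>i\<in>idx X. \<forall>j\<in>idx X. smooth_on N U (\<lambda>q. jd (D, \<psi>) (C, \<phi>) (b q) i j))"
      using U by blast
  qed
qed

text \<open>With the parameter fixed, a coordinate line of the second factor is a coordinate line of
  the product. Derivatives of a slice thus become derivatives on the product, where smoothness in
  the parameter is visible.\<close>

lemma dpart_prod_right:
  assumes N: "atlas_ok N" and X: "atlas_ok X" and e: "(E, \<epsilon>) \<in> atlas N" "p \<in> E" and c: "(C, \<phi>) \<in> atlas X" "x \<in> C"
    and i: "i \<in> idx X" and h: "smooth_on (prod_mfd N X) U h" "(p, x) \<in> U"
    and h': "smooth_on X V (\<lambda>x. h (p, x))" "x \<in> V"
  shows "dpart (C, \<phi>) i (\<lambda>x. h (p, x)) x = dpart (E \<times> C, prod_chart \<epsilon> \<phi>) (Inr i) h (p, x)"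
proof -
  note ok = atlas_ok_prod[OF N X] and cm = atlas_max_atlas[OF X c(1)]
  note pm = atlas_max_atlas[OF ok prod_atlasI[OF e(1) c(1)]]
  note pD = max_chartD[OF ok pm] and cD = max_chartD[OF X cm]
  have px: "(p, x) \<in> E \<times> C" using e c by simp
  have ii: "Inr i \<in> idx (prod_mfd N X)" using i by (auto simp: prod_mfd_sel)
  have "\<forall>\<^sub>F t in nhds 0. (\<phi> x)(i := t + \<phi> x i) \<in> \<phi> ` (C \<inter> C)" by (rule coord_curve_ev[OF X cm c(2) i cD(5) c(2)])
  then have ev: "\<forall>\<^sub>F t in nhds 0. h (p, coord_curve (C, \<phi>) i x t) = h (coord_curve (E \<times> C, prod_chart \<epsilon> \<phi>) (Inr i) (p, x) t)"
  proof eventually_elim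
    case (elim t)
    let ?y = "coord_curve (C, \<phi>) i x t"
    have y: "?y \<in> C" "\<phi> ?y = (\<phi> x)(i := t + \<phi> x i)" using coord_curve_eq[OF cD(1) elim] by auto
    have "(prod_chart \<epsilon> \<phi> (p, x))(Inr i := t + prod_chart \<epsilon> \<phi> (p, x) (Inr i)) = prod_chart \<epsilon> \<phi> (p, ?y)"
    proof
      fix k show "((prod_chart \<epsilon> \<phi> (p, x))(Inr i := t + prod_chart \<epsilon> \<phi> (p, x) (Inr i))) k = prod_chart \<epsilon> \<phi> (p, ?y) k"
        by (cases k) (auto simp: y(2))
    qed
    then have "coord_curve (E \<times> C, prod_chart \<epsilon> \<phi>) (Inr i) (p, x) t = inv_into (E \<times> C) (prod_chart \<epsilon> \<phi>) (prod_chart \<epsilon> \<phi> (p, ?y))"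
      by (simp add: coord_curve_def)
    also have "\<dots> = (p, ?y)" using pD(1) e(2) y(1) by (simp add: inv_into_f_f)
    finally show ?case by simp
  qed
  have "((\<lambda>t. h (p, coord_curve (C, \<phi>) i x t)) has_real_derivative dpart (E \<times> C, prod_chart \<epsilon> \<phi>) (Inr i) h (p, x)) (at 0)"
    using coord_curve_deriv[OF ok pm px ii h] DERIV_cong_ev[OF refl ev refl] by simp
  then show ?thesis using coord_curve_deriv[OF X cm c(2) i h'] DERIV_unique by blast
qed

text \<open>The derivative coordinates of these jets are partial derivatives, in the second
  variable, of a function smooth in both variables. Applied to the action, this makes the jets of
  the maps \<open>x \<mapsto> act k x\<close> smooth in \<open>k\<close> and \<open>x\<close>
  jointly.\<close>

lemma smooth_jet_family:
  assumes N: "atlas_ok N" and X: "atlas_ok X" and \<Psi>: "smooth_map (prod_mfd N X) X (\<lambda>(p, x). \<Psi> p x)"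
  defines "T \<equiv> \<lambda>p x. if x \<in> pts X then Some (\<Psi> p x) else None"
  shows "p \<in> pts N \<Longrightarrow> T p \<in> local_smooth_maps X"
    "smooth_map (prod_mfd N X) (jet_mfd X 1) (\<lambda>(p, x). jet X 1 x (T p))"
proof -
  note ok = atlas_ok_prod[OF N X]
  have slice: "smooth_map X X (\<Psi> p)" if "p \<in> pts N" for p
    using smooth_map_compose[OF X ok X smooth_map_pair[OF X N X smooth_map_const[OF X N that] smooth_map_ident[OF X]] \<Psi>]
    by simp
  show T: "T p \<in> local_smooth_maps X" if "p \<in> pts N" for p
    unfolding T_def by (rule local_smooth_of_map[OF X slice[OF that]])
  have jf: "jet X 1 x (T p) \<in> jets1 X" "jet_src (jet X 1 x (T p)) = x" "jet_tgt (jet X 1 x (T p)) = \<Psi> p x"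
    if "p \<in> pts N" "x \<in> pts X" for p x
    using jet_facts[OF X T[OF that(1)], of x] that(2) by (auto simp: T_def dom_def)
  show "smooth_map (prod_mfd N X) (jet_mfd X 1) (\<lambda>(p, x). jet X 1 x (T p))"
  proof (rule jet_mapI[OF ok X])
    show "(case z of (p, x) \<Rightarrow> jet X 1 x (T p)) \<in> jets1 X" if "z \<in> pts (prod_mfd N X)" for z
      using that jf by auto
    show "smooth_map (prod_mfd N X) X (\<lambda>z. jet_src (case z of (p, x) \<Rightarrow> jet X 1 x (T p)))"
      by (rule smooth_map_cong[OF ok X smooth_map_snd[OF N X]]) (auto simp: jf)
    show "smooth_map (prod_mfd N X) X (\<lambda>z. jet_tgt (case z of (p, x) \<Rightarrow> jet X 1 x (T p)))"
      by (rule smooth_map_cong[OF ok X \<Psi>]) (auto simp: jf)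
    fix z C \<phi> D \<psi>
    assume z: "z \<in> pts (prod_mfd N X)" and c: "(C, \<phi>) \<in> atlas X" "jet_src (case z of (p, x) \<Rightarrow> jet X 1 x (T p)) \<in> C"
      and d: "(D, \<psi>) \<in> atlas X" "jet_tgt (case z of (p, x) \<Rightarrow> jet X 1 x (T p)) \<in> D"
    obtain p0 x0 where z0: "z = (p0, x0)" "p0 \<in> pts N" "x0 \<in> pts X" using z by auto
    obtain E \<epsilon> where e: "(E, \<epsilon>) \<in> atlas N" "p0 \<in> E" using z0(2) by (rule pts_chart)
    note cm = atlas_max_atlas[OF X c(1)] and dm = atlas_max_atlas[OF X d(1)]
    note pm = atlas_max_atlas[OF ok prod_atlasI[OF e(1) c(1)]]
    define U where "U = {z \<in> pts (prod_mfd N X). (case z of (p, x) \<Rightarrow> \<Psi> p x) \<in> D}"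
    have hs: "smooth_on (prod_mfd N X) U (\<lambda>z. \<psi> (case z of (p, x) \<Rightarrow> \<Psi> p x) j)" for j
      unfolding U_def by (rule smooth_map_max_chart[OF ok X \<Psi> dm])
    let ?W = "(E \<times> C) \<inter> U"
    have "smooth_on (prod_mfd N X) ?W (\<lambda>z. jd (C, \<phi>) (D, \<psi>) (case z of (p, x) \<Rightarrow> jet X 1 x (T p)) i j)"
      if ij: "i \<in> idx X" "j \<in> idx X" for i j
    proof (rule smooth_on_cong[OF ok smooth_on_dpart[OF ok pm hs[of j]]])
      show "Inr i \<in> idx (prod_mfd N X)" using ij by (auto simp: prod_mfd_sel)
      fix w assume "w \<in> ?W"
      then obtain p x where w: "w = (p, x)" "p \<in> E" "x \<in> C" "(p, x) \<in> U" "p \<in> pts N" "x \<in> pts X" "\<Psi> p x \<in> D"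
        by (auto simp: U_def)
      note s1 = smooth_map_max_chart[OF X X slice[OF w(5)] dm]
      have "jd (C, \<phi>) (D, \<psi>) (jet X 1 x (T p)) i j = jder (C, \<phi>) (D, \<psi>) (T p) x i j"
        by (rule jd_jet[OF X T[OF w(5)] _ c(1) _ d(1) _ ij]) (use w in \<open>auto simp: T_def\<close>)
      also have "\<dots> = dpart (C, \<phi>) i (\<lambda>x. \<psi> (\<Psi> p x) j) x"
        unfolding jder_def snd_conv
        by (rule dpart_cong[OF X cm w(3) ij(1) s1]) (use w in \<open>auto simp: T_def\<close>)
      also have "\<dots> = dpart (E \<times> C, prod_chart \<epsilon> \<phi>) (Inr i) (\<lambda>z. \<psi> (case z of (p, x) \<Rightarrow> \<Psi> p x) j) (p, x)"
        using dpart_prod_right[OF N X e(1) w(2) c(1) w(3) ij(1) hs[of j] w(4), of "{q \<in> pts X. \<Psi> p q \<in> D}"] s1 w by simp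
      finally show "dpart (E \<times> C, prod_chart \<epsilon> \<phi>) (Inr i) (\<lambda>z. \<psi> (case z of (p, x) \<Rightarrow> \<Psi> p x) j) w =
          jd (C, \<phi>) (D, \<psi>) (case w of (p, x) \<Rightarrow> jet X 1 x (T p)) i j" by (simp add: w(1))
    qed
    moreover have "z \<in> ?W" using z0 c d e jf by (auto simp: U_def)
    moreover have "openin (mtop (prod_mfd N X)) ?W"
      by (rule openin_Int[OF max_chartD(5)[OF ok pm] smooth_on_openin[OF hs]])
    ultimately show "\<exists>U. openin (mtop (prod_mfd N X)) U \<and> z \<in> U \<and>
        (\<forall>i\<in>idx X. \<forall>j\<in>idx X. smooth_on (prod_mfd N X) U (\<lambda>z. jd (C, \<phi>) (D, \<psi>) (case z of (p, x) \<Rightarrow> jet X 1 x (T p)) i j))"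
      by blast
  qed
qed

section \<open>Pseudogroups containing a Lie group\<close>

lemma lie_group_smooth:
  assumes G: "lie_group G GM" and N: "atlas_ok N" and k: "smooth_map N GM k"
  shows lie_group_smooth_mult: "smooth_map N GM l \<Longrightarrow> smooth_map N GM (\<lambda>q. k q \<otimes>\<^bsub>G\<^esub> l q)"
    and lie_group_smooth_inv: "smooth_map N GM (\<lambda>q. inv\<^bsub>G\<^esub> k q)"
proof -
  have ok: "atlas_ok GM" using G by (simp add: lie_group_def manifold_atlas_ok)
  show "smooth_map N GM (\<lambda>q. k q \<otimes>\<^bsub>G\<^esub> l q)" if l: "smooth_map N GM l"
    using smooth_map_compose[OF N atlas_ok_prod[OF ok ok] ok smooth_map_pair[OF N ok ok k l], of "\<lambda>(k, l). k \<otimes>\<^bsub>G\<^esub> l"]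
      G by (simp add: lie_group_def)
  show "smooth_map N GM (\<lambda>q. inv\<^bsub>G\<^esub> k q)"
    using smooth_map_compose[OF N ok ok k, of "\<lambda>k. inv\<^bsub>G\<^esub> k"] G by (simp add: lie_group_def)
qed

locale pseudogroup_with_group =
  fixes X :: "('a, 'i::finite) mfd" and \<Gamma> :: "('a \<rightharpoonup> 'a) set" and K :: "'k monoid" and KM :: "('k, 'm) mfd"
    and act :: "'k \<Rightarrow> 'a \<Rightarrow> 'a" and x\<^sub>0 :: 'a
  assumes manifold_X: "manifold X" and lie_\<Gamma>: "lie_pseudogroup X \<Gamma>" and lie_K: "lie_group K KM"
    and action: "smooth_action K KM X act" and free: "free_action K X act" and trans: "transitive_action K X act"
    and contains: "contains_lie_group X \<Gamma> K act" and x\<^sub>0: "x\<^sub>0 \<in> pts X"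

sublocale pseudogroup_with_group \<subseteq> K: Group.group K
  using lie_K by (simp add: lie_group_def)

context pseudogroup_with_group
begin

lemma X_ok: "atlas_ok X" and K_ok: "atlas_ok KM"
  using manifold_X lie_K by (auto simp: lie_group_def manifold_atlas_ok)

lemma carrier_K: "pts KM = carrier K"
  using lie_K by (simp add: lie_group_def)

lemma smooth_map_in: "smooth_map N KM k \<Longrightarrow> q \<in> pts N \<Longrightarrow> k q \<in> carrier K"
  using smooth_mapD(1) carrier_K by metis

lemma act_pts [simp]: "k \<in> carrier K \<Longrightarrow> x \<in> pts X \<Longrightarrow> act k x \<in> pts X"
  using smooth_mapD(1)[of "prod_mfd KM X" X "\<lambda>(k, x). act k x" "(k, x)"] action
  by (simp add: smooth_action_def carrier_K)

lemma act_one [simp]: "x \<in> pts X \<Longrightarrow> act \<one>\<^bsub>K\<^esub> x = x"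
  and act_act [simp]: "k \<in> carrier K \<Longrightarrow> l \<in> carrier K \<Longrightarrow> x \<in> pts X \<Longrightarrow> act k (act l x) = act (k \<otimes>\<^bsub>K\<^esub> l) x"
  using action by (auto simp: smooth_action_def)

lemma smooth_act:
  assumes N: "atlas_ok N" and k: "smooth_map N KM k" and x: "smooth_map N X x"
  shows "smooth_map N X (\<lambda>q. act (k q) (x q))"
  using smooth_map_compose[OF N atlas_ok_prod[OF K_ok X_ok] X_ok smooth_map_pair[OF N K_ok X_ok k x], of "\<lambda>(k, x). act k x"]
    action by (simp add: smooth_action_def)

lemmas smooth_K_mult = lie_group_smooth_mult[OF lie_K] and smooth_K_inv = lie_group_smooth_inv[OF lie_K]

lemma act_cancel:
  assumes "k \<in> carrier K" "l \<in> carrier K" "x \<in> pts X" "act k x = act l x"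
  shows "k = l"
proof -
  have "act (inv\<^bsub>K\<^esub> l \<otimes>\<^bsub>K\<^esub> k) x = act (inv\<^bsub>K\<^esub> l \<otimes>\<^bsub>K\<^esub> l) x"
    using assms(1-3) assms(4) act_act[of "inv\<^bsub>K\<^esub> l" k x] act_act[of "inv\<^bsub>K\<^esub> l" l x] by (metis K.inv_closed)
  then have "act (inv\<^bsub>K\<^esub> l \<otimes>\<^bsub>K\<^esub> k) x = x" using assms by simp
  moreover have "inv\<^bsub>K\<^esub> l \<otimes>\<^bsub>K\<^esub> k \<in> carrier K" using assms by simp
  ultimately have "inv\<^bsub>K\<^esub> l \<otimes>\<^bsub>K\<^esub> k = \<one>\<^bsub>K\<^esub>" using free assms(3) unfolding free_action_def by blast
  then show ?thesis using assms(1,2) by (metis K.inv_closed K.inv_equality K.inv_inv)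
qed

section \<open>The inverse of the orbit map\<close>

definition h :: "'a \<Rightarrow> 'k" where
  "h = inv_into (pts KM) (\<lambda>k. act k x\<^sub>0)"

lemma orbit_bij: "bij_betw (\<lambda>k. act k x\<^sub>0) (pts KM) (pts X)"
  unfolding bij_betw_def
proof
  show "inj_on (\<lambda>k. act k x\<^sub>0) (pts KM)" using act_cancel x\<^sub>0 by (auto simp: inj_on_def carrier_K)
  show "(\<lambda>k. act k x\<^sub>0) ` pts KM = pts X"
  proof (intro equalityI subsetI)
    fix y assume "y \<in> pts X"
    then obtain k where "k \<in> carrier K" "act k x\<^sub>0 = y" using trans x\<^sub>0 unfolding transitive_action_def by blast
    then show "y \<in> (\<lambda>k. act k x\<^sub>0) ` pts KM" by (auto simp: carrier_K)
  qed (use x\<^sub>0 in \<open>auto simp: carrier_K\<close>)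
qed

lemma h [simp]: "x \<in> pts X \<Longrightarrow> h x \<in> carrier K" "x \<in> pts X \<Longrightarrow> act (h x) x\<^sub>0 = x"
  and h_act: "k \<in> carrier K \<Longrightarrow> h (act k x\<^sub>0) = k"
  using orbit_bij inv_into_into[of x "\<lambda>k. act k x\<^sub>0" "pts KM"] f_inv_into_f[of x "\<lambda>k. act k x\<^sub>0" "pts KM"]
    inv_into_f_f[of "\<lambda>k. act k x\<^sub>0" "pts KM" k]
  by (simp_all add: h_def bij_betw_def carrier_K)

text \<open>Both sides carry the base point to \<open>act k x\<close>, and such an element is
  unique. Under \<open>h\<close> the action becomes left multiplication.\<close>

lemma h_act_mult: "k \<in> carrier K \<Longrightarrow> x \<in> pts X \<Longrightarrow> h (act k x) = k \<otimes>\<^bsub>K\<^esub> h x"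
  using h_act[of "k \<otimes>\<^bsub>K\<^esub> h x"] act_act[of k "h x" x\<^sub>0] x\<^sub>0 by simp

lemma h_x0 [simp]: "h x\<^sub>0 = \<one>\<^bsub>K\<^esub>"
  using h_act[of "\<one>\<^bsub>K\<^esub>"] x\<^sub>0 by simp

lemma act_inv_h [simp]: "x \<in> pts X \<Longrightarrow> act (inv\<^bsub>K\<^esub> (h x)) x = x\<^sub>0"
  using act_act[of "inv\<^bsub>K\<^esub> (h x)" "h x" x\<^sub>0] x\<^sub>0 by simp

lemma smooth_h: "smooth_map X KM h"
  unfolding h_def
proof (rule homogeneous_bijection_inverse_smooth[OF _ manifold_X _ orbit_bij])
  show "manifold KM" using lie_K by (simp add: lie_group_def)
  note c = smooth_map_const[OF K_ok X_ok x\<^sub>0] and id = smooth_map_ident[OF K_ok]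
  show "smooth_map KM X (\<lambda>k. act k x\<^sub>0)" by (rule smooth_act[OF K_ok id c])
  fix p q assume pq: "p \<in> pts KM" "q \<in> pts KM"
  then have pq': "p \<in> carrier K" "q \<in> carrier K" by (auto simp: carrier_K)
  \<comment> \<open>Left translation by this element takes \<open>p\<close> to \<open>q\<close> in
    \<open>K\<close>, and acting with its inverse undoes the effect on orbit points; this pair
    witnesses homogeneity of the orbit map.\<close>
  let ?l = "q \<otimes>\<^bsub>K\<^esub> inv\<^bsub>K\<^esub> p"
  have l: "?l \<in> pts KM" "inv\<^bsub>K\<^esub> ?l \<in> pts KM" using pq' by (auto simp: carrier_K)
  show "\<exists>a b. smooth_map KM KM a \<and> smooth_map X X b \<and> a p = q \<and> (\<forall>x\<in>pts KM. b (act (a x) x\<^sub>0) = act x x\<^sub>0)"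
  proof (intro exI conjI ballI)
    show "smooth_map KM KM (\<lambda>k. ?l \<otimes>\<^bsub>K\<^esub> k)" by (rule smooth_K_mult[OF K_ok smooth_map_const[OF K_ok K_ok l(1)] id])
    show "smooth_map X X (act (inv\<^bsub>K\<^esub> ?l))"
      by (rule smooth_act[OF X_ok smooth_map_const[OF X_ok K_ok l(2)] smooth_map_ident[OF X_ok]])
    show "?l \<otimes>\<^bsub>K\<^esub> p = q" using pq' by (simp add: K.m_assoc)
    fix k assume "k \<in> pts KM"
    then have k: "k \<in> carrier K" by (simp add: carrier_K)
    define l where "l = ?l"
    have "l \<in> carrier K" using pq' by (simp add: l_def)
    then show "act (inv\<^bsub>K\<^esub> ?l) (act (?l \<otimes>\<^bsub>K\<^esub> k) x\<^sub>0) = act k x\<^sub>0"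
      using k x\<^sub>0 unfolding l_def[symmetric] by (simp add: K.m_assoc[symmetric])
  qed
qed

lemma smooth_h': "atlas_ok N \<Longrightarrow> smooth_map N X x \<Longrightarrow> smooth_map N KM (\<lambda>q. h (x q))"
  by (rule smooth_map_compose[OF _ X_ok K_ok _ smooth_h])

section \<open>Jets of the pseudogroup as arrows\<close>

abbreviation E :: "'a jet set" where "E \<equiv> jets X 1 \<Gamma>"

abbreviation M :: "('a jet, 'i + ('i multiset \<times> 'i)) mfd" where "M \<equiv> jets_mfd X 1 \<Gamma>"

abbreviation jprod :: "'a jet \<Rightarrow> 'a jet \<Rightarrow> 'a jet" (infixr "\<bullet>\<^sub>j" 70) where
  "b \<bullet>\<^sub>j a \<equiv> jet_mult X 1 b a"

lemma \<Gamma>_smooth: "f \<in> \<Gamma> \<Longrightarrow> f \<in> local_smooth_maps X"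
proof -
  assume "f \<in> \<Gamma>"
  then have "f \<in> local_embeddings X" using lie_\<Gamma> by (auto simp: lie_pseudogroup_def pseudogroup_def)
  then show ?thesis
    by (simp add: local_embeddings_def local_smooth_maps_def smooth_embedding_def immersion_def)
qed

lemma J_ok: "atlas_ok (jet_mfd X 1)"
  by (rule atlas_ok_jet[OF X_ok])

lemma E_embedded: "embedded_submanifold (jet_mfd X 1) E"
  using lie_\<Gamma> by (simp add: lie_pseudogroup_def)

lemma manifold_M: "manifold M"
  unfolding jets_mfd_def by (rule manifold_submfd[OF manifold_jet[OF manifold_X] E_embedded])

lemma M_ok: "atlas_ok M"
  by (rule manifold_atlas_ok[OF manifold_M])

lemma pts_M: "pts M = E"
  unfolding jets_mfd_def by (rule pts_submfd[OF J_ok E_embedded])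

lemma E_jets: "a \<in> E \<Longrightarrow> a \<in> jets1 X"
  using \<Gamma>_smooth by (auto simp: jets_def)

lemma smooth_into_M:
  "atlas_ok N \<Longrightarrow> smooth_map N (jet_mfd X 1) a \<Longrightarrow> (\<And>q. q \<in> pts N \<Longrightarrow> a q \<in> E) \<Longrightarrow> smooth_map N M a"
  unfolding jets_mfd_def by (rule smooth_map_into_submfd[OF J_ok E_embedded])

lemma smooth_from_M: "atlas_ok N \<Longrightarrow> smooth_map N M a \<Longrightarrow> smooth_map N (jet_mfd X 1) a"
  using smooth_map_compose[OF _ M_ok J_ok, of N a "\<lambda>p. p"] smooth_map_inclusion[OF J_ok E_embedded]
  by (simp add: jets_mfd_def)

lemma smooth_in_E: "smooth_map N M a \<Longrightarrow> q \<in> pts N \<Longrightarrow> a q \<in> E"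
  using smooth_mapD(1) pts_M by metis

lemma smooth_M_src: "atlas_ok N \<Longrightarrow> smooth_map N M a \<Longrightarrow> smooth_map N X (\<lambda>q. jet_src (a q))"
  and smooth_M_tgt: "atlas_ok N \<Longrightarrow> smooth_map N M a \<Longrightarrow> smooth_map N X (\<lambda>q. jet_tgt (a q))"
  using jet_mapD(2,3)[OF _ X_ok smooth_from_M] by auto

lemma E_pts [simp]: "a \<in> E \<Longrightarrow> jet_src a \<in> pts X" "a \<in> E \<Longrightarrow> jet_tgt a \<in> pts X"
  using jets1D(4,5)[OF X_ok E_jets] by auto

text \<open>\<open>jet_rep\<close> need not return a member of \<open>\<Gamma>\<close>. Closure
  under composition is therefore applied to representatives taken from \<open>\<Gamma>\<close>,
  which give the same product by \<open>jet_mult_jet\<close>.\<close>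

lemma E_mult [simp]:
  assumes "b \<in> E" "a \<in> E" "jet_src b = jet_tgt a"
  shows "b \<bullet>\<^sub>j a \<in> E" "jet_src (b \<bullet>\<^sub>j a) = jet_src a" "jet_tgt (b \<bullet>\<^sub>j a) = jet_tgt b"
proof -
  obtain x f where f: "a = jet X 1 x f" "f \<in> \<Gamma>" "x \<in> dom f" using assms(2) by (auto simp: jets_def)
  obtain y g where g: "b = jet X 1 y g" "g \<in> \<Gamma>" "y \<in> dom g" using assms(1) by (auto simp: jets_def)
  note jf = jet_facts[OF X_ok \<Gamma>_smooth[OF f(2)] f(3)] and jg = jet_facts[OF X_ok \<Gamma>_smooth[OF g(2)] g(3)]
  have y: "y = the (f x)" using assms(3) jf jg f(1) g(1) by simp
  have "b \<bullet>\<^sub>j a = jet X 1 x (g \<circ>\<^sub>m f)"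
    unfolding f(1) g(1) y
    by (rule jet_mult_jet[OF X_ok \<Gamma>_smooth[OF f(2)] f(3) \<Gamma>_smooth[OF g(2)]]) (use g(3) y in simp)
  moreover have "g \<circ>\<^sub>m f \<in> \<Gamma>" using f g lie_\<Gamma> by (auto simp: lie_pseudogroup_def pseudogroup_def)
  moreover have "x \<in> dom (g \<circ>\<^sub>m f)" using f(3) g(3) y by (auto simp: map_comp_def)
  ultimately show "b \<bullet>\<^sub>j a \<in> E" by (auto simp: jets_def)
  show "jet_src (b \<bullet>\<^sub>j a) = jet_src a" "jet_tgt (b \<bullet>\<^sub>j a) = jet_tgt b"
    using jet_mult_src[OF X_ok E_jets[OF assms(1)] E_jets[OF assms(2)] assms(3)]
      jet_mult_tgt[OF X_ok E_jets[OF assms(1)] E_jets[OF assms(2)] assms(3)] by auto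
qed

lemma E_assoc [simp]:
  "c \<in> E \<Longrightarrow> b \<in> E \<Longrightarrow> a \<in> E \<Longrightarrow> jet_src c = jet_tgt b \<Longrightarrow> jet_src b = jet_tgt a \<Longrightarrow> (c \<bullet>\<^sub>j b) \<bullet>\<^sub>j a = c \<bullet>\<^sub>j (b \<bullet>\<^sub>j a)"
  using jet_mult_assoc[OF X_ok E_jets E_jets E_jets] by simp

lemma smooth_M_mult:
  assumes N: "atlas_ok N" and b: "smooth_map N M b" and a: "smooth_map N M a"
    and st: "\<And>q. q \<in> pts N \<Longrightarrow> jet_src (b q) = jet_tgt (a q)"
  shows "smooth_map N M (\<lambda>q. b q \<bullet>\<^sub>j a q)"
proof (rule smooth_into_M[OF N smooth_jet_mult[OF N X_ok smooth_from_M[OF N b] smooth_from_M[OF N a] st]])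
  show "b q \<bullet>\<^sub>j a q \<in> E" if "q \<in> pts N" for q
    by (rule E_mult(1)[OF smooth_in_E[OF b that] smooth_in_E[OF a that] st[OF that]])
qed

definition T :: "'k \<Rightarrow> 'a \<rightharpoonup> 'a" where
  "T k = (\<lambda>x. if x \<in> pts X then Some (act k x) else None)"

definition Tj :: "'k \<Rightarrow> 'a \<Rightarrow> 'a jet" where
  "Tj k x = jet X 1 x (T k)"

lemma T_in: "k \<in> carrier K \<Longrightarrow> T k \<in> \<Gamma>"
  using contains by (simp add: contains_lie_group_def T_def)

lemma Tj [simp]:
  assumes "k \<in> carrier K" "x \<in> pts X"
  shows "Tj k x \<in> E" "jet_src (Tj k x) = x" "jet_tgt (Tj k x) = act k x"
proof -
  have x: "x \<in> dom (T k)" using assms by (simp add: T_def dom_def)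
  then show "Tj k x \<in> E" using T_in[OF assms(1)] by (auto simp: Tj_def jets_def)
  show "jet_src (Tj k x) = x" "jet_tgt (Tj k x) = act k x"
    using jet_facts[OF X_ok \<Gamma>_smooth[OF T_in[OF assms(1)]] x] assms by (auto simp: Tj_def T_def)
qed

lemma Tj_mult [simp]:
  assumes "k \<in> carrier K" "l \<in> carrier K" "x \<in> pts X" "y = act k x"
  shows "Tj l y \<bullet>\<^sub>j Tj k x = Tj (l \<otimes>\<^bsub>K\<^esub> k) x"
proof -
  have "T l \<circ>\<^sub>m T k = T (l \<otimes>\<^bsub>K\<^esub> k)" using assms by (auto simp: T_def map_comp_def fun_eq_iff)
  moreover have "jet_mult X 1 (jet X 1 (the (T k x)) (T l)) (jet X 1 x (T k)) = jet X 1 x (T l \<circ>\<^sub>m T k)"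
    using assms T_in \<Gamma>_smooth by (intro jet_mult_jet[OF X_ok]) (auto simp: T_def)
  ultimately show ?thesis using assms by (simp add: Tj_def T_def)
qed

lemma Tj_one: "Tj \<one>\<^bsub>K\<^esub> x = jet_unit X x"
proof -
  have "T \<one>\<^bsub>K\<^esub> = partial_id X" by (auto simp: T_def partial_id_eq fun_eq_iff)
  then show ?thesis by (simp add: Tj_def jet_unit_def)
qed

lemma Tj_unit [simp]:
  "a \<in> E \<Longrightarrow> x = jet_src a \<Longrightarrow> a \<bullet>\<^sub>j Tj \<one>\<^bsub>K\<^esub> x = a" "a \<in> E \<Longrightarrow> x = jet_tgt a \<Longrightarrow> Tj \<one>\<^bsub>K\<^esub> x \<bullet>\<^sub>j a = a"
  using jet_mult_unit[OF X_ok E_jets] by (auto simp: Tj_one)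

lemma Tj_mult_assoc [simp]:
  assumes "k \<in> carrier K" "l \<in> carrier K" "x \<in> pts X" "y = act k x" "a \<in> E" "jet_tgt a = x"
  shows "Tj l y \<bullet>\<^sub>j (Tj k x \<bullet>\<^sub>j a) = Tj (l \<otimes>\<^bsub>K\<^esub> k) x \<bullet>\<^sub>j a"
  using E_assoc[of "Tj l y" "Tj k x" a] Tj_mult[OF assms(1-4)] assms by simp

lemma smooth_Tj:
  assumes N: "atlas_ok N" and k: "smooth_map N KM k" and x: "smooth_map N X x"
  shows "smooth_map N M (\<lambda>q. Tj (k q) (x q))"
proof (rule smooth_into_M[OF N])
  have "smooth_map (prod_mfd KM X) X (\<lambda>(k, x). act k x)" using action by (simp add: smooth_action_def)
  from smooth_jet_family(2)[OF K_ok X_ok this]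
  have "smooth_map (prod_mfd KM X) (jet_mfd X 1) (\<lambda>(k, x). Tj k x)" by (simp add: Tj_def T_def)
  from smooth_map_compose[OF N atlas_ok_prod[OF K_ok X_ok] J_ok smooth_map_pair[OF N K_ok X_ok k x] this]
  show "smooth_map N (jet_mfd X 1) (\<lambda>q. Tj (k q) (x q))" by simp
  show "Tj (k q) (x q) \<in> E" if "q \<in> pts N" for q
    using smooth_map_in[OF k that] smooth_mapD(1)[OF x that] by simp
qed

text \<open>A representative in \<open>\<Gamma>\<close> is an embedding, hence injective on its
  whole domain, and its inverse represents the inverse jet. The composites are identities on open
  sets only, so \<open>jet_cong_open\<close> is what compares them with the unit.\<close>

lemma jet_inverse_exists:
  assumes a: "a \<in> E"
  shows "\<exists>b\<in>E. jet_src b = jet_tgt a \<and> jet_tgt b = jet_src a \<and> b \<bullet>\<^sub>j a = Tj \<one>\<^bsub>K\<^esub> (jet_src a) \<and> a \<bullet>\<^sub>j b = Tj \<one>\<^bsub>K\<^esub> (jet_tgt a)"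
proof -
  obtain x f where f: "a = jet X 1 x f" "f \<in> \<Gamma>" "x \<in> dom f" using a by (auto simp: jets_def)
  define y where "y = the (f x)"
  note fs = \<Gamma>_smooth[OF f(2)]
  note fd = local_smoothD[OF X_ok fs]
  have "f \<in> local_embeddings X" using lie_\<Gamma> f(2) by (auto simp: lie_pseudogroup_def pseudogroup_def)
  then have "embedding_map (mtop (open_submfd X (dom f))) (mtop X) (\<lambda>x. the (f x))"
    by (simp add: local_embeddings_def smooth_embedding_def)
  then have "inj_on (\<lambda>x. the (f x)) (topspace (mtop (open_submfd X (dom f))))"
    unfolding embedding_map_def by (rule homeomorphic_imp_injective_map)
  then have inj: "inj_on (\<lambda>x. the (f x)) (dom f)" by (simp add: topspace_mtop pts_open_submfd[OF X_ok fd(1)])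
  define g where "g = map_inverse f"
  have g: "g \<in> \<Gamma>" using lie_\<Gamma> f(2) by (auto simp: g_def lie_pseudogroup_def pseudogroup_def)
  note gs = \<Gamma>_smooth[OF g]
  \<comment> \<open>\<open>map_inverse\<close> picks a preimage by choice; injectivity leaves only
    \<open>z\<close>.\<close>
  have gf: "g (the (f z)) = Some z" if z: "z \<in> dom f" for z
  proof -
    have "f z = Some (the (f z))" using z by auto
    then have "the (f z) \<in> ran f" by (metis ranI)
    moreover have "(SOME x. f x = Some (the (f z))) = z"
    proof (rule some_equality)
      show "f z = Some (the (f z))" by fact
      show "w = z" if w: "f w = Some (the (f z))" for w
      proof (rule inj_onD[OF inj _ _ z])
        show "the (f w) = the (f z)" using w by simp
        show "w \<in> dom f" using w by blast
      qed
    qed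
    ultimately show ?thesis by (simp add: g_def map_inverse_def)
  qed
  have domg: "z \<in> dom f \<and> the (f z) = w" if "g w = Some z" for w z
  proof -
    have "w \<in> ran f" using that by (auto simp: g_def map_inverse_def split: if_splits)
    then obtain v where "f v = Some w" by (auto simp: ran_def)
    then have "v \<in> dom f" "the (f v) = w" by auto
    then show ?thesis using gf[of v] that by auto
  qed
  have yg: "y \<in> dom g" "the (g y) = x" using gf[OF f(3)] by (auto simp: y_def)
  have xf: "the (f (the (g y))) = y" "the (g y) \<in> dom f" using yg f(3) by (auto simp: y_def)
  have ident: "partial_id X z = Some z" if "z \<in> pts X" for z using that by (simp add: partial_id_eq)
  define b where "b = jet X 1 y g"
  note jf = jet_facts[OF X_ok fs f(3)] and jg = jet_facts[OF X_ok gs yg(1)]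
  have ja: "jet_src a = x" "jet_tgt a = y" using jf f(1) by (auto simp: y_def)
  have jb: "b \<in> E" "jet_src b = y" "jet_tgt b = x" using jg g yg by (auto simp: b_def jets_def)
  have "b \<bullet>\<^sub>j a = jet X 1 x (g \<circ>\<^sub>m f)"
    unfolding b_def f(1) y_def by (rule jet_mult_jet[OF X_ok fs f(3) gs]) (use yg y_def in simp)
  also have "\<dots> = jet X 1 x (partial_id X)"
  proof (rule jet_cong_open[OF X_ok local_smooth_compose[OF X_ok fs gs] partial_id_smooth[OF X_ok] fd(1) f(3)])
    have gfz: "(g \<circ>\<^sub>m f) z = Some z" if z: "z \<in> dom f" for z
    proof -
      obtain w where w: "f z = Some w" using z by blast
      then show ?thesis using gf[OF z] by (simp add: map_comp_def)
    qed
    then show "dom f \<subseteq> dom (g \<circ>\<^sub>m f)" by (meson domI subsetI)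
    show "(g \<circ>\<^sub>m f) z = partial_id X z" if "z \<in> dom f" for z
      using gfz[OF that] ident[OF fd(2)[OF that]] by simp
  qed
  finally have 1: "b \<bullet>\<^sub>j a = Tj \<one>\<^bsub>K\<^esub> x" by (simp add: Tj_one jet_unit_def)
  have "a \<bullet>\<^sub>j b = jet X 1 y (f \<circ>\<^sub>m g)"
    using jet_mult_jet[OF X_ok gs yg(1) fs] xf yg by (simp add: b_def f(1))
  also have "\<dots> = jet X 1 y (partial_id X)"
  proof (rule jet_cong_open[OF X_ok local_smooth_compose[OF X_ok gs fs] partial_id_smooth[OF X_ok] local_smoothD(1)[OF X_ok gs] yg(1)])
    have fg: "(f \<circ>\<^sub>m g) w = Some w" if w: "w \<in> dom g" for w
    proof -
      obtain z where z: "g w = Some z" using w by blast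
      then have "f z = Some w" using domg[OF z] by auto
      then show ?thesis using z by (simp add: map_comp_def)
    qed
    then show "dom g \<subseteq> dom (f \<circ>\<^sub>m g)" by (meson domI subsetI)
    show "(f \<circ>\<^sub>m g) w = partial_id X w" if "w \<in> dom g" for w
      using fg[OF that] ident local_smoothD(2)[OF X_ok gs that] by simp
  qed
  finally have "a \<bullet>\<^sub>j b = Tj \<one>\<^bsub>K\<^esub> y" by (simp add: Tj_one jet_unit_def)
  then show ?thesis using 1 ja jb by auto
qed

definition jinv :: "'a jet \<Rightarrow> 'a jet" where
  "jinv a = (SOME b. b \<in> E \<and> jet_src b = jet_tgt a \<and> jet_tgt b = jet_src a \<and>
    b \<bullet>\<^sub>j a = Tj \<one>\<^bsub>K\<^esub> (jet_src a) \<and> a \<bullet>\<^sub>j b = Tj \<one>\<^bsub>K\<^esub> (jet_tgt a))"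

lemma jinv [simp]:
  assumes "a \<in> E"
  shows "jinv a \<in> E" "jet_src (jinv a) = jet_tgt a" "jet_tgt (jinv a) = jet_src a"
    "jinv a \<bullet>\<^sub>j a = Tj \<one>\<^bsub>K\<^esub> (jet_src a)" "a \<bullet>\<^sub>j jinv a = Tj \<one>\<^bsub>K\<^esub> (jet_tgt a)"
proof -
  have "\<exists>b. b \<in> E \<and> jet_src b = jet_tgt a \<and> jet_tgt b = jet_src a \<and>
    b \<bullet>\<^sub>j a = Tj \<one>\<^bsub>K\<^esub> (jet_src a) \<and> a \<bullet>\<^sub>j b = Tj \<one>\<^bsub>K\<^esub> (jet_tgt a)"
    using jet_inverse_exists[OF assms] by blast
  from someI_ex[OF this] show "jinv a \<in> E" "jet_src (jinv a) = jet_tgt a" "jet_tgt (jinv a) = jet_src a"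
    "jinv a \<bullet>\<^sub>j a = Tj \<one>\<^bsub>K\<^esub> (jet_src a)" "a \<bullet>\<^sub>j jinv a = Tj \<one>\<^bsub>K\<^esub> (jet_tgt a)"
    unfolding jinv_def by auto
qed

lemma smooth_jinv:
  assumes N: "atlas_ok N" and a: "smooth_map N M a" shows "smooth_map N M (\<lambda>q. jinv (a q))"
proof (rule smooth_into_M[OF N smooth_jet_inverse[OF N X_ok smooth_from_M[OF N a]]])
  fix q assume "q \<in> pts N"
  then have "a q \<in> E" by (rule smooth_in_E[OF a])
  then show "jinv (a q) \<in> jets1 X \<and> jet_src (jinv (a q)) = jet_tgt (a q) \<and> jet_tgt (jinv (a q)) = jet_src (a q) \<and>
      jinv (a q) \<bullet>\<^sub>j a q = jet_unit X (jet_src (a q))" "jinv (a q) \<in> E"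
    using E_jets by (auto simp: Tj_one)
qed

section \<open>The isotropy group as a Lie group\<close>

abbreviation J1 :: "('a, 'i, 'a jet, 'i + ('i multiset \<times> 'i)) gpd" where "J1 \<equiv> jet_groupoid X 1 \<Gamma>"

abbreviation G :: "'a jet monoid" where "G \<equiv> isotropy_group J1 x\<^sub>0"

abbreviation GM :: "('a jet, 'i + ('i multiset \<times> 'i)) mfd" where "GM \<equiv> isotropy_mfd J1 x\<^sub>0"

lemma J1_sel [simp]: "objs J1 = X" "arrows J1 = M" "src J1 = jet_src" "tgt J1 = jet_tgt" "mul J1 b a = b \<bullet>\<^sub>j a"
  by (simp_all add: jet_groupoid_def)

lemma K_cancel: "k \<in> carrier K \<Longrightarrow> l \<in> carrier K \<Longrightarrow> inv\<^bsub>K\<^esub> k \<otimes>\<^bsub>K\<^esub> (k \<otimes>\<^bsub>K\<^esub> l) = l"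
  "k \<in> carrier K \<Longrightarrow> l \<in> carrier K \<Longrightarrow> k \<otimes>\<^bsub>K\<^esub> (inv\<^bsub>K\<^esub> k \<otimes>\<^bsub>K\<^esub> l) = l"
  by (simp_all add: K.m_assoc[symmetric])

lemma act_mult_h [simp]: "k \<in> carrier K \<Longrightarrow> x \<in> pts X \<Longrightarrow> act (k \<otimes>\<^bsub>K\<^esub> h x) x\<^sub>0 = act k x"
  using act_act[of k "h x" x\<^sub>0] x\<^sub>0 by simp

lemmas K_simps = K.m_assoc K.inv_mult_group K_cancel h_act_mult

lemma isotropy_J1: "isotropy J1 x\<^sub>0 = {a \<in> pts M. (jet_src a, jet_tgt a) = (x\<^sub>0, x\<^sub>0)}"
  by (auto simp: isotropy_def)

lemma isotropy_iff: "a \<in> isotropy J1 x\<^sub>0 \<longleftrightarrow> a \<in> E \<and> jet_src a = x\<^sub>0 \<and> jet_tgt a = x\<^sub>0"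
  by (auto simp: isotropy_def pts_M)

lemma XX_ok: "atlas_ok (prod_mfd X X)"
  by (rule atlas_ok_prod[OF X_ok X_ok])

text \<open>A level set of source and target taken together. Moving both ends of an isotropy element
  by jets of elements of \<open>K\<close> extends it to a section over all pairs of points, so no
  rank has to be computed.\<close>

lemma isotropy_embedded: "embedded_submanifold M (isotropy J1 x\<^sub>0)"
  unfolding isotropy_J1
proof (rule embedded_level_set[OF M_ok XX_ok])
  note id = smooth_map_ident[OF M_ok]
  show "smooth_map M (prod_mfd X X) (\<lambda>a. (jet_src a, jet_tgt a))"
    by (rule smooth_map_pair[OF M_ok X_ok X_ok smooth_M_src[OF M_ok id] smooth_M_tgt[OF M_ok id]])
  fix p assume p: "p \<in> pts M" "(jet_src p, jet_tgt p) = (x\<^sub>0, x\<^sub>0)"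
  then have pE: "p \<in> E" "jet_src p = x\<^sub>0" "jet_tgt p = x\<^sub>0" by (auto simp: pts_M)
  note f = smooth_map_fst[OF X_ok X_ok] and s = smooth_map_snd[OF X_ok X_ok]
  \<comment> \<open>The two factors move source and target of \<open>p\<close> to the given points;
    at the base point both are units, because \<open>h\<close> takes the value one there.\<close>
  let ?s = "\<lambda>z. Tj (h (snd z)) x\<^sub>0 \<bullet>\<^sub>j (p \<bullet>\<^sub>j Tj (inv\<^bsub>K\<^esub> (h (fst z))) (fst z))"
  show "\<exists>\<sigma>. smooth_map (prod_mfd X X) M \<sigma> \<and> \<sigma> (x\<^sub>0, x\<^sub>0) = p \<and>
      (\<forall>y\<in>pts (prod_mfd X X). (jet_src (\<sigma> y), jet_tgt (\<sigma> y)) = y)"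
  proof (intro exI conjI ballI)
    have "smooth_map (prod_mfd X X) M (\<lambda>z. p \<bullet>\<^sub>j Tj (inv\<^bsub>K\<^esub> (h (fst z))) (fst z))"
      by (intro smooth_M_mult[OF XX_ok smooth_map_const[OF XX_ok M_ok p(1)] smooth_Tj[OF XX_ok smooth_K_inv[OF XX_ok smooth_h'[OF XX_ok f]] f]])
        (use pE in \<open>simp add: mem_Times_iff\<close>)
    then show "smooth_map (prod_mfd X X) M ?s"
      by (rule smooth_M_mult[OF XX_ok smooth_Tj[OF XX_ok smooth_h'[OF XX_ok s] smooth_map_const[OF XX_ok X_ok x\<^sub>0]]])
        (use pE x\<^sub>0 in \<open>simp add: mem_Times_iff\<close>)
    show "?s (x\<^sub>0, x\<^sub>0) = p" using pE x\<^sub>0 by simp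
    show "(jet_src (?s y), jet_tgt (?s y)) = y" if "y \<in> pts (prod_mfd X X)" for y
      using pE x\<^sub>0 that by (cases y) simp
  qed
qed

lemma GM_eq: "GM = submfd M (isotropy J1 x\<^sub>0)"
  by (simp add: isotropy_mfd_def)

lemma manifold_GM: "manifold GM"
  unfolding GM_eq by (rule manifold_submfd[OF manifold_M isotropy_embedded])

lemma GM_ok: "atlas_ok GM"
  by (rule manifold_atlas_ok[OF manifold_GM])

lemma pts_GM: "pts GM = isotropy J1 x\<^sub>0"
  unfolding GM_eq by (rule pts_submfd[OF M_ok isotropy_embedded])

lemma pts_GM_iff [simp]: "a \<in> pts GM \<longleftrightarrow> a \<in> E \<and> jet_src a = x\<^sub>0 \<and> jet_tgt a = x\<^sub>0"
  by (simp add: pts_GM isotropy_iff)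

lemma smooth_GM_M: "atlas_ok N \<Longrightarrow> smooth_map N GM g \<Longrightarrow> smooth_map N M g"
  using smooth_map_compose[OF _ GM_ok M_ok, of N g "\<lambda>p. p"] smooth_map_inclusion[OF M_ok isotropy_embedded]
  by (simp add: GM_eq)

lemma smooth_into_GM:
  assumes "atlas_ok N" "smooth_map N M g" "\<And>q. q \<in> pts N \<Longrightarrow> g q \<in> E \<and> jet_src (g q) = x\<^sub>0 \<and> jet_tgt (g q) = x\<^sub>0"
  shows "smooth_map N GM g"
  unfolding GM_eq by (rule smooth_map_into_submfd[OF M_ok isotropy_embedded assms(1,2)]) (use assms(3) isotropy_iff in blast)

lemma G_sel [simp]: "carrier G = isotropy J1 x\<^sub>0" "b \<otimes>\<^bsub>G\<^esub> a = b \<bullet>\<^sub>j a"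
  by (simp_all add: isotropy_group_def)

text \<open>The unit of \<open>isotropy_group\<close> is a definite description; the jet of the
  identity satisfies it, and two-sided units are unique.\<close>

lemma G_one: "\<one>\<^bsub>G\<^esub> = Tj \<one>\<^bsub>K\<^esub> x\<^sub>0"
proof -
  have "(THE e. e \<in> isotropy J1 x\<^sub>0 \<and> (\<forall>a\<in>isotropy J1 x\<^sub>0. e \<bullet>\<^sub>j a = a \<and> a \<bullet>\<^sub>j e = a)) = Tj \<one>\<^bsub>K\<^esub> x\<^sub>0"
  proof (rule the_equality)
    show u: "Tj \<one>\<^bsub>K\<^esub> x\<^sub>0 \<in> isotropy J1 x\<^sub>0 \<and> (\<forall>a\<in>isotropy J1 x\<^sub>0. Tj \<one>\<^bsub>K\<^esub> x\<^sub>0 \<bullet>\<^sub>j a = a \<and> a \<bullet>\<^sub>j Tj \<one>\<^bsub>K\<^esub> x\<^sub>0 = a)"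
      using x\<^sub>0 by (simp add: isotropy_iff)
    fix e assume "e \<in> isotropy J1 x\<^sub>0 \<and> (\<forall>a\<in>isotropy J1 x\<^sub>0. e \<bullet>\<^sub>j a = a \<and> a \<bullet>\<^sub>j e = a)"
    then show "e = Tj \<one>\<^bsub>K\<^esub> x\<^sub>0" using u by metis
  qed
  then show ?thesis by (simp add: isotropy_group_def)
qed

lemma group_G: "Group.group G"
proof (rule groupI)
  show "\<exists>y\<in>carrier G. y \<otimes>\<^bsub>G\<^esub> x = \<one>\<^bsub>G\<^esub>" if "x \<in> carrier G" for x
    using that by (intro bexI[of _ "jinv x"]) (auto simp: isotropy_iff G_one)
qed (use x\<^sub>0 in \<open>auto simp: isotropy_iff G_one\<close>)

lemma G_inv: "a \<in> carrier G \<Longrightarrow> inv\<^bsub>G\<^esub> a = jinv a"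
  by (rule group.inv_equality[OF group_G]) (auto simp: isotropy_iff G_one)

lemma lie_group_G: "lie_group G GM"
  unfolding lie_group_def
proof (intro conjI group_G manifold_GM)
  show "carrier G = pts GM" by (simp add: pts_GM)
  note ok = atlas_ok_prod[OF GM_ok GM_ok] and f = smooth_map_fst[OF GM_ok GM_ok] and s = smooth_map_snd[OF GM_ok GM_ok]
  have "smooth_map (prod_mfd GM GM) GM (\<lambda>z. fst z \<bullet>\<^sub>j snd z)"
    by (rule smooth_into_GM[OF ok smooth_M_mult[OF ok smooth_GM_M[OF ok f] smooth_GM_M[OF ok s]]]) auto
  then show "smooth_map (prod_mfd GM GM) GM (\<lambda>(k, l). k \<otimes>\<^bsub>G\<^esub> l)" by (simp add: case_prod_beta')
  have "smooth_map GM GM jinv"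
    by (rule smooth_into_GM[OF GM_ok smooth_jinv[OF GM_ok smooth_GM_M[OF GM_ok smooth_map_ident[OF GM_ok]]]]) auto
  then show "smooth_map GM GM (\<lambda>k. inv\<^bsub>G\<^esub> k)"
    by (rule smooth_map_cong[OF GM_ok GM_ok]) (simp add: G_inv isotropy_iff)
qed

section \<open>The product of the action groupoid with the isotropy group\<close>

abbreviation PM :: "(('k \<times> 'a) \<times> 'a jet, ('m + 'i) + ('i + ('i multiset \<times> 'i))) mfd" where
  "PM \<equiv> prod_mfd (prod_mfd KM X) GM"

abbreviation P :: "('a, 'i, ('k \<times> 'a) \<times> 'a jet, ('m + 'i) + ('i + ('i multiset \<times> 'i))) gpd" where
  "P \<equiv> action_product_groupoid K KM X act G GM"

lemma P_sel [simp]: "objs P = X" "arrows P = PM" "src P z = snd (fst z)" "tgt P z = act (fst (fst z)) (snd (fst z))"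
  "mul P b a = ((fst (fst b) \<otimes>\<^bsub>K\<^esub> fst (fst a), snd (fst a)), snd b \<bullet>\<^sub>j snd a)"
  by (simp_all add: action_product_groupoid_def case_prod_beta)

lemma KX_ok: "atlas_ok (prod_mfd KM X)" and PM_ok: "atlas_ok PM"
  by (simp_all add: atlas_ok_prod K_ok X_ok GM_ok)

lemma manifold_PM: "manifold PM"
  using lie_K by (intro manifold_prod manifold_X manifold_GM) (simp add: lie_group_def)

lemma pts_PM [simp]: "((k, x), g) \<in> pts PM \<longleftrightarrow> k \<in> carrier K \<and> x \<in> pts X \<and> g \<in> E \<and> jet_src g = x\<^sub>0 \<and> jet_tgt g = x\<^sub>0"
  by (simp add: carrier_K)

lemma smooth_PM:
  assumes N: "atlas_ok N" and p: "smooth_map N PM p"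
  shows "smooth_map N KM (\<lambda>q. fst (fst (p q)))" "smooth_map N X (\<lambda>q. snd (fst (p q)))" "smooth_map N GM (\<lambda>q. snd (p q))"
proof -
  have kx: "smooth_map N (prod_mfd KM X) (\<lambda>q. fst (p q))"
    by (rule smooth_map_compose[OF N PM_ok KX_ok p smooth_map_fst[OF KX_ok GM_ok]])
  show "smooth_map N KM (\<lambda>q. fst (fst (p q)))"
    by (rule smooth_map_compose[OF N KX_ok K_ok kx smooth_map_fst[OF K_ok X_ok]])
  show "smooth_map N X (\<lambda>q. snd (fst (p q)))"
    by (rule smooth_map_compose[OF N KX_ok X_ok kx smooth_map_snd[OF K_ok X_ok]])
  show "smooth_map N GM (\<lambda>q. snd (p q))"
    by (rule smooth_map_compose[OF N PM_ok GM_ok p smooth_map_snd[OF KX_ok GM_ok]])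
qed

lemma smooth_into_PM:
  "atlas_ok N \<Longrightarrow> smooth_map N KM k \<Longrightarrow> smooth_map N X x \<Longrightarrow> smooth_map N GM g \<Longrightarrow> smooth_map N PM (\<lambda>q. ((k q, x q), g q))"
  by (intro smooth_map_pair KX_ok K_ok X_ok GM_ok)

text \<open>This turns the set of composable pairs into a level set of a map to \<open>X\<close>.\<close>

lemma composable_level: "x \<in> pts X \<Longrightarrow> y \<in> pts X \<Longrightarrow> x = y \<longleftrightarrow> act (inv\<^bsub>K\<^esub> (h y)) x = x\<^sub>0"
proof
  assume x: "x \<in> pts X" "y \<in> pts X" "act (inv\<^bsub>K\<^esub> (h y)) x = x\<^sub>0"
  have "act (h y) (act (inv\<^bsub>K\<^esub> (h y)) x) = x" using x(1,2) by simp
  then show "x = y" using x by simp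
qed simp

lemma composable_PM_embedded: "embedded_submanifold (prod_mfd PM PM) (composable P)"
proof -
  let ?PP = "prod_mfd PM PM"
  let ?\<Phi> = "\<lambda>z. act (inv\<^bsub>K\<^esub> (h (act (fst (fst (snd z))) (snd (fst (snd z)))))) (snd (fst (fst z)))"
  note ok = atlas_ok_prod[OF PM_ok PM_ok]
  note b = smooth_PM[OF ok smooth_map_fst[OF PM_ok PM_ok]] and a = smooth_PM[OF ok smooth_map_snd[OF PM_ok PM_ok]]
  have "composable P = {z \<in> pts ?PP. ?\<Phi> z = x\<^sub>0}"
    using composable_level by (auto simp: composable_def carrier_K)
  moreover have "embedded_submanifold ?PP {z \<in> pts ?PP. ?\<Phi> z = x\<^sub>0}"
  proof (rule embedded_level_set[OF ok X_ok])
    show "smooth_map ?PP X ?\<Phi>"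
      by (intro smooth_act[OF ok] smooth_K_inv[OF ok] smooth_h'[OF ok] a b)
    fix p assume p: "p \<in> pts ?PP" "?\<Phi> p = x\<^sub>0"
    obtain k2 x2 g2 k1 x1 g1 where pp: "p = (((k2, x2), g2), ((k1, x1), g1))" by (metis surj_pair)
    have m: "((k2, x2), g2) \<in> pts PM" "((k1, x1), g1) \<in> pts PM" using p(1) unfolding pp pts_prod_mfd[of PM PM] by blast+
    define l where "l = h (act k1 x1)"
    have l: "l \<in> carrier K" using m by (simp add: l_def carrier_K)
    have x2: "x2 = act k1 x1" using p(2) m composable_level[of x2 "act k1 x1"] by (simp add: pp carrier_K)
    \<comment> \<open>Only the source point of the first arrow moves. The element \<open>l\<close>
      carries the base point to the target of the second arrow, so the level map returns
      \<open>y\<close>, and the base point gives back \<open>p\<close>.\<close>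
    let ?s = "\<lambda>y. (((k2, act l y), g2), ((k1, x1), g1))"
    note id = smooth_map_ident[OF X_ok]
    show "\<exists>\<sigma>. smooth_map X ?PP \<sigma> \<and> \<sigma> x\<^sub>0 = p \<and> (\<forall>y\<in>pts X. ?\<Phi> (\<sigma> y) = y)"
    proof (intro exI conjI ballI)
      show "smooth_map X ?PP ?s"
        using l m
        by (intro smooth_map_pair[OF X_ok PM_ok PM_ok] smooth_into_PM[OF X_ok] smooth_act[OF X_ok] id
            smooth_map_const[OF X_ok K_ok] smooth_map_const[OF X_ok PM_ok] smooth_map_const[OF X_ok GM_ok]) (auto simp: carrier_K)
      show "?s x\<^sub>0 = p" using m by (simp add: pp x2 l_def)
      show "?\<Phi> (?s y) = y" if "y \<in> pts X" for y using that l by (simp add: l_def[symmetric])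
    qed
  qed
  ultimately show ?thesis by simp
qed

lemma P_submersions: "submersion PM X (src P)" "submersion PM X (tgt P)"
proof -
  note pm = smooth_PM[OF PM_ok smooth_map_ident[OF PM_ok]] and id = smooth_map_ident[OF X_ok]
  show "submersion PM X (src P)"
  proof (rule submersionI[OF PM_ok X_ok])
    show "smooth_map PM X (src P)" using pm(2) by (simp add: fun_eq_iff[of "src P"] P_sel(3)[abs_def])
    fix p assume p: "p \<in> pts PM"
    obtain k x g where pp: "p = ((k, x), g)" by (metis surj_pair)
    have m: "k \<in> pts KM" "g \<in> pts GM" using p by (simp_all add: pp)
    show "\<exists>\<sigma>. smooth_map X PM \<sigma> \<and> \<sigma> (src P p) = p \<and> (\<forall>y\<in>pts X. src P (\<sigma> y) = y)"
      using smooth_into_PM[OF X_ok smooth_map_const[OF X_ok K_ok m(1)] id smooth_map_const[OF X_ok GM_ok m(2)]]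
      by (intro exI[of _ "\<lambda>y. ((k, y), g)"]) (simp add: pp)
  qed
  show "submersion PM X (tgt P)"
  proof (rule submersionI[OF PM_ok X_ok])
    show "smooth_map PM X (tgt P)" using smooth_act[OF PM_ok pm(1,2)] by (simp add: P_sel(4)[abs_def])
    fix p assume p: "p \<in> pts PM"
    obtain k x g where pp: "p = ((k, x), g)" by (metis surj_pair)
    have m: "k \<in> pts KM" "g \<in> pts GM" "k \<in> carrier K" "inv\<^bsub>K\<^esub> k \<in> pts KM" "x \<in> pts X"
      using p by (simp_all add: pp carrier_K)
    \<comment> \<open>With \<open>k\<close> and \<open>g\<close> kept, the source has to be the
      point that \<open>k\<close> carries to the prescribed target.\<close>
    show "\<exists>\<sigma>. smooth_map X PM \<sigma> \<and> \<sigma> (tgt P p) = p \<and> (\<forall>y\<in>pts X. tgt P (\<sigma> y) = y)"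
      using smooth_into_PM[OF X_ok smooth_map_const[OF X_ok K_ok m(1)]
          smooth_act[OF X_ok smooth_map_const[OF X_ok K_ok m(4)] id] smooth_map_const[OF X_ok GM_ok m(2)]] m(3,5)
      by (intro exI[of _ "\<lambda>y. ((k, act (inv\<^bsub>K\<^esub> k) y), g)"]) (simp add: pp)
  qed
qed

lemma P_composable: "(b, a) \<in> composable P \<longleftrightarrow> b \<in> pts PM \<and> a \<in> pts PM \<and> snd (fst b) = act (fst (fst a)) (snd (fst a))"
  by (simp add: composable_def)

lemma lie_groupoid_P: "lie_groupoid P"
proof -
  let ?PP = "prod_mfd PM PM" and ?C = "submfd (prod_mfd PM PM) (composable P)"
  note ok = atlas_ok_prod[OF PM_ok PM_ok]
  note Cok = atlas_ok_submfd[OF ok composable_PM_embedded] and inc = smooth_map_inclusion[OF ok composable_PM_embedded]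
  note b = smooth_PM[OF Cok smooth_map_compose[OF Cok ok PM_ok inc smooth_map_fst[OF PM_ok PM_ok]]]
    and a = smooth_PM[OF Cok smooth_map_compose[OF Cok ok PM_ok inc smooth_map_snd[OF PM_ok PM_ok]]]
  have "smooth_map ?C GM (\<lambda>z. snd (fst z) \<bullet>\<^sub>j snd (snd z))"
    using lie_group_smooth_mult[OF lie_group_G Cok b(3) a(3)] by simp
  then have mul: "smooth_map ?C PM (\<lambda>(b, a). mul P b a)"
    using smooth_into_PM[OF Cok smooth_K_mult[OF Cok b(1) a(1)] a(2)] by (simp add: case_prod_beta')
  note pm = smooth_PM[OF PM_ok smooth_map_ident[OF PM_ok]] and id = smooth_map_ident[OF X_ok]
  have K1: "\<one>\<^bsub>K\<^esub> \<in> pts KM" by (simp add: carrier_K)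
  have G1: "Tj \<one>\<^bsub>K\<^esub> x\<^sub>0 \<in> pts GM" using x\<^sub>0 by simp
  let ?u = "\<lambda>x. ((\<one>\<^bsub>K\<^esub>, x), Tj \<one>\<^bsub>K\<^esub> x\<^sub>0)"
  let ?i = "\<lambda>p. ((inv\<^bsub>K\<^esub> (fst (fst p)), act (fst (fst p)) (snd (fst p))), jinv (snd p))"
  have u: "smooth_map X PM ?u"
    by (rule smooth_into_PM[OF X_ok smooth_map_const[OF X_ok K_ok K1] id smooth_map_const[OF X_ok GM_ok G1]])
  have "smooth_map PM GM (\<lambda>p. jinv (snd p))"
    by (rule smooth_into_GM[OF PM_ok smooth_jinv[OF PM_ok smooth_GM_M[OF PM_ok pm(3)]]]) auto
  then have i: "smooth_map PM PM ?i"
    by (rule smooth_into_PM[OF PM_ok smooth_K_inv[OF PM_ok pm(1)] smooth_act[OF PM_ok pm(1,2)]])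
  show ?thesis
    unfolding lie_groupoid_def
  proof (intro conjI)
    show "manifold (objs P)" "manifold (arrows P)" using manifold_X manifold_PM by auto
    show "submersion (arrows P) (objs P) (src P)" "submersion (arrows P) (objs P) (tgt P)"
      using P_submersions by (simp_all del: P_sel(3,4))
    show "embedded_submanifold (prod_mfd (arrows P) (arrows P)) (composable P)" using composable_PM_embedded by simp
    show "smooth_map (submfd (prod_mfd (arrows P) (arrows P)) (composable P)) (arrows P) (\<lambda>(b, a). mul P b a)"
      using mul by (simp del: P_sel(5))
    show "\<forall>(b, a)\<in>composable P. src P (mul P b a) = src P a \<and> tgt P (mul P b a) = tgt P b"
      by (auto simp: P_composable carrier_K)
    show "\<forall>c b a. (c, b) \<in> composable P \<and> (b, a) \<in> composable P \<longrightarrow> mul P c (mul P b a) = mul P (mul P c b) a"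
      by (auto simp: P_composable carrier_K K.m_assoc)
    show "\<exists>u i. smooth_map (objs P) (arrows P) u \<and> smooth_map (arrows P) (arrows P) i \<and>
      (\<forall>x\<in>pts (objs P). src P (u x) = x \<and> tgt P (u x) = x) \<and>
      (\<forall>a\<in>pts (arrows P). mul P a (u (src P a)) = a \<and> mul P (u (tgt P a)) a = a \<and>
        src P (i a) = tgt P a \<and> tgt P (i a) = src P a \<and> mul P (i a) a = u (src P a) \<and> mul P a (i a) = u (tgt P a))"
    proof (intro exI conjI)
      show "smooth_map (objs P) (arrows P) ?u" "smooth_map (arrows P) (arrows P) ?i" using u i by simp_all
      show "\<forall>x\<in>pts (objs P). src P (?u x) = x \<and> tgt P (?u x) = x" by simp
      show "\<forall>a\<in>pts (arrows P). mul P a (?u (src P a)) = a \<and> mul P (?u (tgt P a)) a = a \<and>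
        src P (?i a) = tgt P a \<and> tgt P (?i a) = src P a \<and> mul P (?i a) a = ?u (src P a) \<and> mul P a (?i a) = ?u (tgt P a)"
        by (auto simp: carrier_K)
    qed
  qed
qed

section \<open>The groupoid of first order jets\<close>

lemma MM_ok: "atlas_ok (prod_mfd M M)"
  by (rule atlas_ok_prod[OF M_ok M_ok])

lemma J1_composable: "(b, a) \<in> composable J1 \<longleftrightarrow> b \<in> E \<and> a \<in> E \<and> jet_src b = jet_tgt a"
  by (simp add: composable_def pts_M)

lemma composable_J1_embedded: "embedded_submanifold (prod_mfd M M) (composable J1)"
proof -
  let ?\<Phi> = "\<lambda>z. act (inv\<^bsub>K\<^esub> (h (jet_tgt (snd z)))) (jet_src (fst z))"
  note f = smooth_map_fst[OF M_ok M_ok] and s = smooth_map_snd[OF M_ok M_ok]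
  have "composable J1 = {z \<in> pts (prod_mfd M M). ?\<Phi> z = x\<^sub>0}"
    using composable_level by (auto simp: J1_composable pts_M)
  moreover have "embedded_submanifold (prod_mfd M M) {z \<in> pts (prod_mfd M M). ?\<Phi> z = x\<^sub>0}"
  proof (rule embedded_level_set[OF MM_ok X_ok])
    show "smooth_map (prod_mfd M M) X ?\<Phi>"
      by (intro smooth_act[OF MM_ok] smooth_K_inv[OF MM_ok] smooth_h'[OF MM_ok] smooth_M_src[OF MM_ok f] smooth_M_tgt[OF MM_ok s])
    fix p assume p: "p \<in> pts (prod_mfd M M)" "?\<Phi> p = x\<^sub>0"
    obtain b a where pp: "p = (b, a)" by (cases p)
    have m: "b \<in> E" "a \<in> E" "b \<in> pts M" "a \<in> pts M" using p by (auto simp: pp pts_M)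
    have st: "jet_src b = jet_tgt a" using p(2) m composable_level[of "jet_src b" "jet_tgt a"] by (simp add: pp)
    define l where "l = h (jet_tgt a)"
    have l: "l \<in> carrier K" "l \<in> pts KM" "h (jet_src b) = l" "act l x\<^sub>0 = jet_src b" using m st by (auto simp: l_def carrier_K)
    note id = smooth_map_ident[OF X_ok]
    note sl = smooth_act[OF X_ok smooth_map_const[OF X_ok K_ok l(2)] id]
    \<comment> \<open>The jet of an element of \<open>K\<close> from \<open>act l y\<close> to the
      source of \<open>b\<close>, a unit for \<open>y = x\<^sub>0\<close>. Composing
      \<open>b\<close> with it moves the source of \<open>b\<close> and keeps its target.\<close>
    let ?t = "\<lambda>y. Tj (l \<otimes>\<^bsub>K\<^esub> inv\<^bsub>K\<^esub> (h (act l y))) (act l y)"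
    have t: "?t y \<in> E" "jet_src (?t y) = act l y" "jet_tgt (?t y) = jet_src b" if "y \<in> pts X" for y
      using that l(1,4) x\<^sub>0 by (simp_all add: act_act[symmetric] del: act_act)
    show "\<exists>\<sigma>. smooth_map X (prod_mfd M M) \<sigma> \<and> \<sigma> x\<^sub>0 = p \<and> (\<forall>y\<in>pts X. ?\<Phi> (\<sigma> y) = y)"
    proof (intro exI conjI ballI)
      have "smooth_map X M ?t"
        by (intro smooth_Tj[OF X_ok] smooth_K_mult[OF X_ok] smooth_K_inv[OF X_ok] smooth_h'[OF X_ok] smooth_map_const[OF X_ok K_ok l(2)] sl)
      then have "smooth_map X M (\<lambda>y. b \<bullet>\<^sub>j ?t y)"
        by (rule smooth_M_mult[OF X_ok smooth_map_const[OF X_ok M_ok m(3)]]) (simp only: t)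
      then show "smooth_map X (prod_mfd M M) (\<lambda>y. (b \<bullet>\<^sub>j ?t y, a))"
        by (rule smooth_map_pair[OF X_ok M_ok M_ok _ smooth_map_const[OF X_ok M_ok m(4)]])
      show "(b \<bullet>\<^sub>j ?t x\<^sub>0, a) = p" using m l x\<^sub>0 by (simp add: pp)
      show "?\<Phi> (b \<bullet>\<^sub>j ?t y, a) = y" if y: "y \<in> pts X" for y
      proof -
        have "jet_src (b \<bullet>\<^sub>j ?t y) = act l y" using t[OF y] m by simp
        then show ?thesis using y l(1) by (simp add: l_def[symmetric])
      qed
    qed
  qed
  ultimately show ?thesis by simp
qed

text \<open>Composition with jets of elements of \<open>K\<close> moves one end of an arrow anywhere
  while the other end stays, which gives a section over all of \<open>X\<close> through every
  arrow.\<close>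

lemma J1_submersions: "submersion M X jet_src" "submersion M X jet_tgt"
proof -
  note idM = smooth_map_ident[OF M_ok] and id = smooth_map_ident[OF X_ok]
  note hinv = smooth_K_inv[OF X_ok smooth_h'[OF X_ok id]]
  show "submersion M X jet_src"
  proof (rule submersionI[OF M_ok X_ok smooth_M_src[OF M_ok idM]])
    fix a assume a: "a \<in> pts M"
    then have aE: "a \<in> E" by (simp add: pts_M)
    have k: "h (jet_src a) \<in> pts KM" using aE by (simp add: carrier_K)
    show "\<exists>\<sigma>. smooth_map X M \<sigma> \<and> \<sigma> (jet_src a) = a \<and> (\<forall>y\<in>pts X. jet_src (\<sigma> y) = y)"
    proof (intro exI conjI ballI)
      show "smooth_map X M (\<lambda>y. a \<bullet>\<^sub>j Tj (h (jet_src a) \<otimes>\<^bsub>K\<^esub> inv\<^bsub>K\<^esub> (h y)) y)"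
        by (rule smooth_M_mult[OF X_ok smooth_map_const[OF X_ok M_ok a] smooth_Tj[OF X_ok smooth_K_mult[OF X_ok smooth_map_const[OF X_ok K_ok k] hinv] id]])
          (use aE in \<open>simp add: act_act[symmetric] del: act_act\<close>)
      show "jet_src (a \<bullet>\<^sub>j Tj (h (jet_src a) \<otimes>\<^bsub>K\<^esub> inv\<^bsub>K\<^esub> (h y)) y) = y" if "y \<in> pts X" for y
        using that aE by (simp add: act_act[symmetric] del: act_act)
    qed (use aE in simp)
  qed
  show "submersion M X jet_tgt"
  proof (rule submersionI[OF M_ok X_ok smooth_M_tgt[OF M_ok idM]])
    fix a assume a: "a \<in> pts M"
    then have aE: "a \<in> E" by (simp add: pts_M)
    have k: "inv\<^bsub>K\<^esub> (h (jet_tgt a)) \<in> pts KM" "jet_tgt a \<in> pts X" using aE by (simp_all add: carrier_K)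
    show "\<exists>\<sigma>. smooth_map X M \<sigma> \<and> \<sigma> (jet_tgt a) = a \<and> (\<forall>y\<in>pts X. jet_tgt (\<sigma> y) = y)"
    proof (intro exI conjI ballI)
      show "smooth_map X M (\<lambda>y. Tj (h y \<otimes>\<^bsub>K\<^esub> inv\<^bsub>K\<^esub> (h (jet_tgt a))) (jet_tgt a) \<bullet>\<^sub>j a)"
        by (rule smooth_M_mult[OF X_ok smooth_Tj[OF X_ok smooth_K_mult[OF X_ok smooth_h smooth_map_const[OF X_ok K_ok k(1)]]
              smooth_map_const[OF X_ok X_ok k(2)]] smooth_map_const[OF X_ok M_ok a]]) (use aE in simp)
      show "jet_tgt (Tj (h y \<otimes>\<^bsub>K\<^esub> inv\<^bsub>K\<^esub> (h (jet_tgt a))) (jet_tgt a) \<bullet>\<^sub>j a) = y" if "y \<in> pts X" for y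
        using that aE by (simp add: act_act[symmetric] del: act_act)
    qed (use aE in simp)
  qed
qed

lemma lie_groupoid_J1: "lie_groupoid J1"
proof -
  let ?C = "submfd (prod_mfd M M) (composable J1)"
  note Cok = atlas_ok_submfd[OF MM_ok composable_J1_embedded] and inc = smooth_map_inclusion[OF MM_ok composable_J1_embedded]
  have "smooth_map ?C M (\<lambda>z. fst z \<bullet>\<^sub>j snd z)"
    by (rule smooth_M_mult[OF Cok smooth_map_compose[OF Cok MM_ok M_ok inc smooth_map_fst[OF M_ok M_ok]]
          smooth_map_compose[OF Cok MM_ok M_ok inc smooth_map_snd[OF M_ok M_ok]]])
      (auto simp: pts_submfd[OF MM_ok composable_J1_embedded] J1_composable)
  then have mul: "smooth_map ?C M (\<lambda>(b, a). mul J1 b a)" by (simp add: case_prod_beta')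
  have K1: "\<one>\<^bsub>K\<^esub> \<in> pts KM" by (simp add: carrier_K)
  have u: "smooth_map X M (Tj \<one>\<^bsub>K\<^esub>)"
    using smooth_Tj[OF X_ok smooth_map_const[OF X_ok K_ok K1] smooth_map_ident[OF X_ok]] by simp
  have i: "smooth_map M M jinv" by (rule smooth_jinv[OF M_ok smooth_map_ident[OF M_ok]])
  show ?thesis
    unfolding lie_groupoid_def
  proof (intro conjI)
    show "\<exists>u i. smooth_map (objs J1) (arrows J1) u \<and> smooth_map (arrows J1) (arrows J1) i \<and>
      (\<forall>x\<in>pts (objs J1). src J1 (u x) = x \<and> tgt J1 (u x) = x) \<and>
      (\<forall>a\<in>pts (arrows J1). mul J1 a (u (src J1 a)) = a \<and> mul J1 (u (tgt J1 a)) a = a \<and>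
        src J1 (i a) = tgt J1 a \<and> tgt J1 (i a) = src J1 a \<and> mul J1 (i a) a = u (src J1 a) \<and> mul J1 a (i a) = u (tgt J1 a))"
      using u i by (intro exI[of _ "Tj \<one>\<^bsub>K\<^esub>"] exI[of _ jinv]) (simp add: pts_M)
    show "\<forall>c b a. (c, b) \<in> composable J1 \<and> (b, a) \<in> composable J1 \<longrightarrow> mul J1 c (mul J1 b a) = mul J1 (mul J1 c b) a"
      by (simp add: J1_composable)
    show "\<forall>(b, a)\<in>composable J1. src J1 (mul J1 b a) = src J1 a \<and> tgt J1 (mul J1 b a) = tgt J1 b"
      by (auto simp: J1_composable)
  qed (use manifold_X manifold_M J1_submersions composable_J1_embedded mul in \<open>simp_all del: J1_sel(5)\<close>)
qed

section \<open>The isomorphism\<close>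

definition F :: "'a jet \<Rightarrow> ('k \<times> 'a) \<times> 'a jet" where
  "F a = ((h (jet_tgt a) \<otimes>\<^bsub>K\<^esub> inv\<^bsub>K\<^esub> (h (jet_src a)), jet_src a),
    Tj (inv\<^bsub>K\<^esub> (h (jet_tgt a))) (jet_tgt a) \<bullet>\<^sub>j (a \<bullet>\<^sub>j Tj (h (jet_src a)) x\<^sub>0))"

text \<open>The equations defining \<open>F\<close> solved for the arrow: jets of elements of
  \<open>K\<close> carry the isotropy element from the base point to the ends \<open>x\<close> and
  \<open>act k x\<close>, where \<open>h (act k x)\<close> is the product of \<open>k\<close> and
  \<open>h x\<close>.\<close>

definition F' :: "('k \<times> 'a) \<times> 'a jet \<Rightarrow> 'a jet" where
  "F' p = Tj (fst (fst p) \<otimes>\<^bsub>K\<^esub> h (snd (fst p))) x\<^sub>0 \<bullet>\<^sub>j (snd p \<bullet>\<^sub>j Tj (inv\<^bsub>K\<^esub> (h (snd (fst p)))) (snd (fst p)))"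

lemma F_in: "a \<in> E \<Longrightarrow> F a \<in> pts PM"
  using x\<^sub>0 by (simp add: F_def del: pts_prod_mfd)

lemma F'_in:
  assumes "k \<in> carrier K" "x \<in> pts X" "g \<in> E" "jet_src g = x\<^sub>0" "jet_tgt g = x\<^sub>0"
  shows "F' ((k, x), g) \<in> E" "jet_src (F' ((k, x), g)) = x" "jet_tgt (F' ((k, x), g)) = act k x"
  using assms x\<^sub>0 by (simp_all add: F'_def act_act[symmetric] del: act_act)

lemma F'_F: assumes a: "a \<in> E" shows "F' (F a) = a"
  using a x\<^sub>0 by (simp add: F_def F'_def K_simps)

lemma F_F':
  assumes "k \<in> carrier K" "x \<in> pts X" "g \<in> E" "jet_src g = x\<^sub>0" "jet_tgt g = x\<^sub>0"
  shows "F (F' ((k, x), g)) = ((k, x), g)"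
proof -
  note f = F'_in[OF assms]
  have "Tj (inv\<^bsub>K\<^esub> (h (act k x))) (act k x) \<bullet>\<^sub>j (F' ((k, x), g) \<bullet>\<^sub>j Tj (h x) x\<^sub>0) = g"
    using assms x\<^sub>0 by (simp add: F'_def K_simps)
  then show ?thesis using assms x\<^sub>0 unfolding F_def f by (simp add: K_simps)
qed

lemma smooth_F: "smooth_map M PM F"
proof -
  note id = smooth_map_ident[OF M_ok]
  note s = smooth_M_src[OF M_ok id] and t = smooth_M_tgt[OF M_ok id]
  note hs = smooth_h'[OF M_ok s] and ht = smooth_K_inv[OF M_ok smooth_h'[OF M_ok t]]
  have "smooth_map M M (\<lambda>a. a \<bullet>\<^sub>j Tj (h (jet_src a)) x\<^sub>0)"
    by (rule smooth_M_mult[OF M_ok id smooth_Tj[OF M_ok hs smooth_map_const[OF M_ok X_ok x\<^sub>0]]]) (use x\<^sub>0 in \<open>simp add: pts_M\<close>)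
  then have "smooth_map M M (\<lambda>a. Tj (inv\<^bsub>K\<^esub> (h (jet_tgt a))) (jet_tgt a) \<bullet>\<^sub>j (a \<bullet>\<^sub>j Tj (h (jet_src a)) x\<^sub>0))"
    by (rule smooth_M_mult[OF M_ok smooth_Tj[OF M_ok ht t]]) (use x\<^sub>0 in \<open>simp add: pts_M\<close>)
  then have "smooth_map M GM (\<lambda>a. Tj (inv\<^bsub>K\<^esub> (h (jet_tgt a))) (jet_tgt a) \<bullet>\<^sub>j (a \<bullet>\<^sub>j Tj (h (jet_src a)) x\<^sub>0))"
    by (rule smooth_into_GM[OF M_ok]) (use x\<^sub>0 in \<open>simp add: pts_M\<close>)
  then show ?thesis
    using smooth_into_PM[OF M_ok smooth_K_mult[OF M_ok smooth_h'[OF M_ok t] smooth_K_inv[OF M_ok hs]] s]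
    by (simp add: F_def[abs_def])
qed

lemma smooth_F': "smooth_map PM M F'"
proof -
  note pm = smooth_PM[OF PM_ok smooth_map_ident[OF PM_ok]]
  note hx = smooth_h'[OF PM_ok pm(2)]
  have "smooth_map PM M (\<lambda>p. snd p \<bullet>\<^sub>j Tj (inv\<^bsub>K\<^esub> (h (snd (fst p)))) (snd (fst p)))"
    by (rule smooth_M_mult[OF PM_ok smooth_GM_M[OF PM_ok pm(3)] smooth_Tj[OF PM_ok smooth_K_inv[OF PM_ok hx] pm(2)]]) auto
  then have "smooth_map PM M (\<lambda>p. Tj (fst (fst p) \<otimes>\<^bsub>K\<^esub> h (snd (fst p))) x\<^sub>0 \<bullet>\<^sub>j (snd p \<bullet>\<^sub>j Tj (inv\<^bsub>K\<^esub> (h (snd (fst p)))) (snd (fst p))))"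
    by (rule smooth_M_mult[OF PM_ok smooth_Tj[OF PM_ok smooth_K_mult[OF PM_ok pm(1) hx] smooth_map_const[OF PM_ok X_ok x\<^sub>0]]])
      (use x\<^sub>0 in \<open>auto simp: carrier_K\<close>)
  then show ?thesis by (simp add: F'_def[abs_def])
qed

lemma F_iso: "lie_groupoid_iso J1 P F (\<lambda>x. x)"
  unfolding lie_groupoid_iso_def
proof (intro conjI lie_groupoid_J1 lie_groupoid_P)
  have PM_cases: "\<exists>k x g. p = ((k, x), g) \<and> k \<in> carrier K \<and> x \<in> pts X \<and> g \<in> E \<and> jet_src g = x\<^sub>0 \<and> jet_tgt g = x\<^sub>0"
    if "p \<in> pts PM" for p using that by (auto simp: carrier_K)
  have FF': "F (F' p) = p" "F' p \<in> pts M" if "p \<in> pts PM" for p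
    using PM_cases[OF that] F_F' F'_in(1) by (auto simp: pts_M)
  have bij: "bij_betw F (pts M) (pts PM)"
    by (rule bij_betwI[of _ _ _ F']) (use FF' F_in F'_F in \<open>auto simp: pts_M simp del: pts_prod_mfd\<close>)
  \<comment> \<open>\<open>diffeomorphism\<close> speaks about \<open>inv_into\<close>, which is
    identified with the explicit inverse on the points of the product; smoothness is insensitive to
    values elsewhere.\<close>
  have "inv_into (pts M) F p = F' p" if "p \<in> pts PM" for p
    using inv_into_f_f[OF bij_betw_imp_inj_on[OF bij] FF'(2)[OF that]] FF'(1)[OF that] by simp
  then have "smooth_map PM M (inv_into (pts M) F)"
    by (intro smooth_map_cong[OF PM_ok M_ok smooth_F']) simp
  then show "diffeomorphism (arrows J1) (arrows P) F"
    using bij smooth_F by (simp add: diffeomorphism_def del: pts_prod_mfd)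
  have "smooth_map X X (inv_into (pts X) (\<lambda>x. x))"
    by (rule smooth_map_cong[OF X_ok X_ok smooth_map_ident[OF X_ok]]) (simp add: inv_into_f_f[of "\<lambda>x. x", symmetric])
  then show "diffeomorphism (objs J1) (objs P) (\<lambda>x. x)"
    using smooth_map_ident[OF X_ok] by (simp add: diffeomorphism_def bij_betw_def)
  show "\<forall>a\<in>pts (arrows J1). src P (F a) = src J1 a \<and> tgt P (F a) = tgt J1 a"
    by (simp add: pts_M F_def act_act[symmetric] del: act_act)
  \<comment> \<open>At the common object of two composable arrows the jet inserted by one factor
    cancels against the inverse jet inserted by the other, and the elements of \<open>K\<close>
    telescope in the same way.\<close>
  show "\<forall>(b, a)\<in>composable J1. F (mul J1 b a) = mul P (F b) (F a)"
  proof clarify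
    fix b a assume "(b, a) \<in> composable J1"
    then have ba: "b \<in> E" "a \<in> E" "jet_src b = jet_tgt a" by (auto simp: J1_composable)
    then show "F (mul J1 b a) = mul P (F b) (F a)"
      using x\<^sub>0 by (simp add: F_def K_simps)
  qed
qed

end

theorem proposition4p7:
  fixes X :: "('a, 'i::finite) mfd"
    and \<Gamma> :: "('a \<rightharpoonup> 'a) set"
    and K :: "'k monoid"
    and KM :: "('k, 'm::finite) mfd"
    and act :: "'k \<Rightarrow> 'a \<Rightarrow> 'a"
    and x\<^sub>0 :: 'a
  assumes "manifold X"
    and "lie_pseudogroup X \<Gamma>"
    and "transitive_pseudogroup X \<Gamma>"
    and "lie_group K KM"
    and "smooth_action K KM X act"
    and "free_action K X act"
    and "transitive_action K X act"
    and "contains_lie_group X \<Gamma> K act"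
    and "x\<^sub>0 \<in> pts X"
  shows "let J1 = jet_groupoid X 1 \<Gamma>;
             G = isotropy_group J1 x\<^sub>0;
             GM = isotropy_mfd J1 x\<^sub>0
         in embedded_submanifold (arrows J1) (isotropy J1 x\<^sub>0) \<and>
            lie_group G GM \<and>
            (\<exists>F. lie_groupoid_iso J1 (action_product_groupoid K KM X act G GM) F (\<lambda>x. x))"
proof -
  interpret pseudogroup_with_group X \<Gamma> K KM act x\<^sub>0
    by (rule pseudogroup_with_group.intro) (use assms in auto)
  show ?thesis
    using isotropy_embedded lie_group_G F_iso by (auto simp: Let_def)
qed

end
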